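(* Let $X$ be an open manifold of dimension $n\ge3$ with tame ends $Z\times[0,\infty)$ and $h$ any Riemannian metric on $Z$. Then $Y^{cyl}_{[\bar g]}(X)\le Y^{cyl}_{[h+dt^2]}(Z\times\mathbb R)$ for any cylindrical metric $\bar g$ on $X$ with $\partial_\infty\bar g=h$. Furthermore, $Y^{h\text{-}cyl}(X)\le Y^{cyl}_{[h+dt^2]}(Z\times\mathbb R)$.
   Context: An open manifold with tame ends $Z\times[0,\infty)$ is a connected noncompact manifold $X$ without boundary having a relatively compact open submanifold $W\subset X$ with $\partial\overline W=Z=\bigsqcup_{j=1}^m Z_j$, each $Z_j$ a connected closed $(n-1)$-manifold, such that $X\setminus W\cong Z\times[0,\infty)$. A cylindrical metric on $X$ is a complete Riemannian metric $\bar g$ such that, in some coordinate system $(x,t)$ on $Z\times[0,\infty)$, $\bar g(x,t)=h(x)+dt^2$ on $Z\times[1,\infty)$ for some Riemannian metric $h$ on $Z$; one writes $\partial_\infty\bar g=h$. With $\alpha_n=\frac{4(n-1)}{n-2}$ and $L^{1,2}_{\bar g}(X)$ the Sobolev space of functions square-integrable with their first weak derivatives, $$Y^{cyl}_{[\bar g]}(X)=\inf_{u\in L^{1,2}_{\bar g}(X),\,u\not\equiv0}\frac{\int_X(\alpha_n|du|^2+R_{\bar g}u^2)\,d\sigma_{\bar g}}{\left(\int_X|u|^{\frac{2n}{n-2}}d\sigma_{\bar g}\right)^{\frac{n-2}{n}}}\in[-\infty,\infty),\qquad Y^{h\text{-}cyl}(X)=\sup_{\bar g\text{ cylindrical},\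 \partial_\infty\bar g=h}Y^{cyl}_{[\bar g]}(X).$$ $Y^{cyl}_{[h+dt^2]}(Z\times\mathbb R)$ is defined by the same infimum for the manifold $Z\times\mathbb R$ with metric $h+dt^2$. *)

theory Defs
  imports "HOL-Analysis.Analysis"
begin

section \<open>Smooth manifolds given by atlases\<close>

text \<open>
  A manifold is a whole Hausdorff, second countable type \<open>'x\<close> together with a smooth atlas.
  A chart is a pair \<open>(U, \<phi>)\<close>; only the values of \<open>\<phi>\<close> on \<open>U\<close> matter.
\<close>

type_synonym ('x, 'e) chart = "'x set \<times> ('x \<Rightarrow> 'e)"
type_synonym ('x, 'e) atlas = "('x, 'e) chart set"

abbreviation chart_dom :: "('x, 'e) chart \<Rightarrow> 'x set" where
  "chart_dom c \<equiv> fst c"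

abbreviation chart_map :: "('x, 'e) chart \<Rightarrow> 'x \<Rightarrow> 'e" where
  "chart_map c \<equiv> snd c"

abbreviation chart_img :: "('x, 'e) chart \<Rightarrow> 'e set" where
  "chart_img c \<equiv> chart_map c ` chart_dom c"

definition chart_inv :: "('x, 'e) chart \<Rightarrow> 'e \<Rightarrow> 'x" where
  "chart_inv c = inv_into (chart_dom c) (chart_map c)"

text \<open>\<open>k\<close> times continuously differentiable functions on an open set.\<close>

primrec Ck_on :: "nat \<Rightarrow> 'a::euclidean_space set \<Rightarrow> ('a \<Rightarrow> 'b::euclidean_space) \<Rightarrow> bool" where
  "Ck_on 0 S f \<longleftrightarrow> continuous_on S f"
| "Ck_on (Suc k) S f \<longleftrightarrow>
     (\<forall>x\<in>S. f differentiable (at x)) \<and> (\<forall>v. Ck_on k S (\<lambda>x. frechet_derivative f (at x) v))"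

definition smooth_on :: "'a::euclidean_space set \<Rightarrow> ('a \<Rightarrow> 'b::euclidean_space) \<Rightarrow> bool" where
  "smooth_on S f \<longleftrightarrow> (\<forall>k. Ck_on k S f)"

definition smooth_manifold ::
    "('x::{t2_space, second_countable_topology}, 'e::euclidean_space) atlas \<Rightarrow> bool" where
  "smooth_manifold A \<longleftrightarrow>
     (\<Union>c\<in>A. chart_dom c) = UNIV \<and>
     (\<forall>c\<in>A. open (chart_dom c) \<and> open (chart_img c) \<and>
             homeomorphism (chart_dom c) (chart_img c) (chart_map c) (chart_inv c)) \<and>
     (\<forall>c\<in>A. \<forall>d\<in>A. smooth_on (chart_map c ` (chart_dom c \<inter> chart_dom d))
                             (chart_map d \<circ> chart_inv c))"

definition smooth_map_open ::
    "('x::topological_space, 'e::euclidean_space) atlas \<Rightarrow> ('y::topological_space, 'f::euclidean_space) atlas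
      \<Rightarrow> 'x set \<Rightarrow> ('x \<Rightarrow> 'y) \<Rightarrow> bool" where
  "smooth_map_open A B N f \<longleftrightarrow>
     continuous_on N f \<and>
     (\<forall>c\<in>A. \<forall>d\<in>B. smooth_on (chart_map c ` {p \<in> chart_dom c \<inter> N. f p \<in> chart_dom d})
                             (chart_map d \<circ> f \<circ> chart_inv c))"

text \<open>
  A map is smooth on an arbitrary subset \<open>S\<close> of a manifold if near each point of \<open>S\<close> it is the
  restriction of a map that is smooth on an open set. On \<open>Z \<times> [0,\<infinity>)\<close> and on the complement of a domain
  with smooth boundary this is smoothness up to the boundary.
\<close>

definition smooth_map ::
    "('x::topological_space, 'e::euclidean_space) atlas \<Rightarrow> ('y::topological_space, 'f::euclidean_space) atlas
      \<Rightarrow> 'x set \<Rightarrow> ('x \<Rightarrow> 'y) \<Rightarrow> bool" where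
  "smooth_map A B S f \<longleftrightarrow>
     (\<forall>p\<in>S. \<exists>N F. open N \<and> p \<in> N \<and> smooth_map_open A B N F \<and> (\<forall>q\<in>N \<inter> S. F q = f q))"

definition diffeo ::
    "('x::topological_space, 'e::euclidean_space) atlas \<Rightarrow> ('y::topological_space, 'f::euclidean_space) atlas
      \<Rightarrow> 'x set \<Rightarrow> 'y set \<Rightarrow> ('x \<Rightarrow> 'y) \<Rightarrow> bool" where
  "diffeo A B S T f \<longleftrightarrow>
     bij_betw f S T \<and> smooth_map A B S f \<and> smooth_map B A T (inv_into S f)"

section \<open>The cylinder over a manifold\<close>

text \<open>
  \<open>\<real>\<^sup>m \<times> \<real>\<close> is identified with \<open>real ^ ('m option)\<close>, the index \<open>None\<close> being the \<open>t\<close> direction, so that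
  determinants and matrix inverses are available for the product metric.
\<close>

definition cylinder_chart ::
    "('z, real^'m) chart \<Rightarrow> ('z \<times> real, real^('m::finite option)) chart" where
  "cylinder_chart c =
     (chart_dom c \<times> UNIV,
      \<lambda>(z, t). \<chi> i. case i of None \<Rightarrow> t | Some j \<Rightarrow> chart_map c z $ j)"

definition cylinder_atlas ::
    "('z, real^'m) atlas \<Rightarrow> ('z \<times> real, real^('m::finite option)) atlas" where
  "cylinder_atlas B = cylinder_chart ` B"

section \<open>Riemannian metrics\<close>

text \<open>
  A tensor is given by its components in every chart of the atlas, as functions of the coordinates,
  subject to the transformation law. Here \<open>g c y\<close> is the Gram matrix \<open>(g\<^sub>i\<^sub>j(y))\<close> in the chart \<open>c\<close>.
  The components for charts outside the atlas, and outside the image of the chart, are irrelevant.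
\<close>

type_synonym ('x, 'n) metric = "('x, real^'n) chart \<Rightarrow> real^'n \<Rightarrow> real^'n^'n"

definition jacobian :: "(real^'n \<Rightarrow> real^'k) \<Rightarrow> real^'n \<Rightarrow> real^'n^'k" where
  "jacobian F y = matrix (frechet_derivative F (at y))"

definition riemannian_metric ::
    "('x::topological_space, real^'n) atlas \<Rightarrow> ('x, 'n::finite) metric \<Rightarrow> bool" where
  "riemannian_metric A g \<longleftrightarrow>
     (\<forall>c\<in>A. \<forall>i j. smooth_on (chart_img c) (\<lambda>y. g c y $ i $ j)) \<and>
     (\<forall>c\<in>A. \<forall>y\<in>chart_img c. transpose (g c y) = g c y \<and>
        (\<forall>v. v \<noteq> 0 \<longrightarrow> 0 < v \<bullet> (g c y *v v))) \<and>
     (\<forall>c\<in>A. \<forall>d\<in>A. \<forall>p\<in>chart_dom c \<inter> chart_dom d.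
        let J = jacobian (chart_map d \<circ> chart_inv c) (chart_map c p)
        in g c (chart_map c p) = transpose J ** g d (chart_map d p) ** J)"

definition chart_at :: "('x, 'e) atlas \<Rightarrow> 'x \<Rightarrow> ('x, 'e) chart" where
  "chart_at A p = (SOME c. c \<in> A \<and> p \<in> chart_dom c)"

text \<open>
  Length, distance and completeness. Restricting the infimum to smooth curves does not change the
  Riemannian distance. The line is a manifold with the single chart \<open>(UNIV, id)\<close>.
\<close>

definition curve_length ::
    "('x::topological_space, real^'n) atlas \<Rightarrow> ('x, 'n::finite) metric \<Rightarrow> (real \<Rightarrow> 'x) \<Rightarrow> real" where
  "curve_length A g \<gamma> = integral {0..1} (\<lambda>t.
     let c = chart_at A (\<gamma> t);
         v = vector_derivative (chart_map c \<circ> \<gamma>) (at t within {0..1})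
     in sqrt (v \<bullet> (g c (chart_map c (\<gamma> t)) *v v)))"

definition riemannian_dist ::
    "('x::topological_space, real^'n) atlas \<Rightarrow> ('x, 'n::finite) metric \<Rightarrow> 'x \<Rightarrow> 'x \<Rightarrow> real" where
  "riemannian_dist A g p q =
     Inf {curve_length A g \<gamma> |\<gamma>. smooth_map {(UNIV, id)} A {0..1} \<gamma> \<and> \<gamma> 0 = p \<and> \<gamma> 1 = q}"

definition complete_metric ::
    "('x::topological_space, real^'n) atlas \<Rightarrow> ('x, 'n::finite) metric \<Rightarrow> bool" where
  "complete_metric A g \<longleftrightarrow>
     (\<forall>s :: nat \<Rightarrow> 'x.
        (\<forall>e>0. \<exists>N. \<forall>m\<ge>N. \<forall>k\<ge>N. riemannian_dist A g (s m) (s k) < e) \<longrightarrow> (\<exists>p. s \<longlonglongrightarrow> p))"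

text \<open>
  The metric \<open>h + dt\<^sup>2\<close> on \<open>Z \<times> \<real>\<close>; \<open>cylinder_chart\<close> is injective, so \<open>inv cylinder_chart C\<close> is the
  chart of \<open>Z\<close> from which \<open>C\<close> was built.
\<close>

definition cylinder_metric ::
    "('z, 'm::finite) metric \<Rightarrow> ('z \<times> real, 'm option) metric" where
  "cylinder_metric h C y = (\<chi> i j.
     case (i, j) of
       (Some a, Some b) \<Rightarrow> h (inv cylinder_chart C) (\<chi> k. y $ Some k) $ a $ b
     | (None, None) \<Rightarrow> 1
     | _ \<Rightarrow> 0)"

text \<open>\<open>(f\<^sup>*g)(p) = k(p)\<close>, for \<open>f\<close> smooth near \<open>p\<close>.\<close>

definition pullback_eq_at ::
    "('y::topological_space, real^'k) atlas \<Rightarrow> ('y, 'k::finite) metric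
      \<Rightarrow> ('x::topological_space, real^'n) atlas \<Rightarrow> ('x, 'n::finite) metric
      \<Rightarrow> ('y \<Rightarrow> 'x) \<Rightarrow> 'y \<Rightarrow> bool" where
  "pullback_eq_at B k A g f p \<longleftrightarrow>
     (\<forall>c\<in>B. \<forall>d\<in>A. p \<in> chart_dom c \<and> f p \<in> chart_dom d \<longrightarrow>
        (let J = jacobian (chart_map d \<circ> f \<circ> chart_inv c) (chart_map c p)
         in transpose J ** g d (chart_map d (f p)) ** J = k c (chart_map c p)))"

section \<open>Tame ends and cylindrical metrics\<close>

text \<open>
  \<open>Z\<close> is a closed manifold; being compact, it is the disjoint union of finitely many connected closed
  manifolds, its components. Since \<open>X - W\<close> is diffeomorphic to \<open>Z \<times> [0,\<infinity>)\<close> with \<open>Z \<times> {0}\<close> going to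
  the frontier, the closure of \<open>W\<close> is a compact smooth domain whose boundary is a copy of \<open>Z\<close>.
\<close>

definition open_manifold_with_tame_ends ::
    "('x::{t2_space, second_countable_topology}, real^'n) atlas \<Rightarrow> 'x set
      \<Rightarrow> ('z::{t2_space, second_countable_topology}, real^'m::finite) atlas \<Rightarrow> bool" where
  "open_manifold_with_tame_ends A W B \<longleftrightarrow>
     smooth_manifold A \<and> connected (UNIV :: 'x set) \<and> \<not> compact (UNIV :: 'x set) \<and>
     smooth_manifold B \<and> compact (UNIV :: 'z set) \<and>
     open W \<and> compact (closure W) \<and>
     (\<exists>\<Phi>. diffeo (cylinder_atlas B) A (UNIV \<times> {0..}) (- W) \<Phi> \<and>
          frontier (closure W) = \<Phi> ` (UNIV \<times> {0}))"

text \<open>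
  \<open>cylindrical_metric A W B g h\<close>: the metric \<open>g\<close> on \<open>X\<close> is cylindrical with \<open>\<partial>\<^sub>\<infinity> g = h\<close>. A coordinate
  system \<open>(x,t)\<close> on the end \<open>X - W\<close> is any diffeomorphism from \<open>Z \<times> [0,\<infinity>)\<close> onto it.
\<close>

definition cylindrical_metric ::
    "('x::{t2_space, second_countable_topology}, real^'n) atlas \<Rightarrow> 'x set
      \<Rightarrow> ('z::{t2_space, second_countable_topology}, real^'m) atlas
      \<Rightarrow> ('x, 'n::finite) metric \<Rightarrow> ('z, 'm::finite) metric \<Rightarrow> bool" where
  "cylindrical_metric A W B g h \<longleftrightarrow>
     riemannian_metric A g \<and> complete_metric A g \<and> riemannian_metric B h \<and>
     (\<exists>\<Psi>. diffeo (cylinder_atlas B) A (UNIV \<times> {0..}) (- W) \<Psi> \<and>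
          (\<forall>p\<in>UNIV \<times> {1..}. pullback_eq_at (cylinder_atlas B) (cylinder_metric h) A g \<Psi> p))"

section \<open>Scalar curvature and volume\<close>

definition partial_deriv :: "'n \<Rightarrow> (real^'n::finite \<Rightarrow> real) \<Rightarrow> real^'n \<Rightarrow> real" where
  "partial_deriv i f y = frechet_derivative f (at y) (axis i 1)"

text \<open>\<open>christoffel G k i j\<close> is \<open>\<Gamma>\<^sup>k\<^sub>i\<^sub>j\<close>. The sign conventions make round spheres positively curved.\<close>

definition christoffel ::
    "(real^'n \<Rightarrow> real^'n^'n) \<Rightarrow> 'n::finite \<Rightarrow> 'n \<Rightarrow> 'n \<Rightarrow> real^'n \<Rightarrow> real" where
  "christoffel G k i j y =
     (1/2) * (\<Sum>l\<in>UNIV. matrix_inv (G y) $ k $ l *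
        (partial_deriv i (\<lambda>x. G x $ j $ l) y + partial_deriv j (\<lambda>x. G x $ i $ l) y
          - partial_deriv l (\<lambda>x. G x $ i $ j) y))"

definition ricci ::
    "(real^'n \<Rightarrow> real^'n^'n) \<Rightarrow> 'n::finite \<Rightarrow> 'n \<Rightarrow> real^'n \<Rightarrow> real" where
  "ricci G i j y =
     (\<Sum>k\<in>UNIV. partial_deriv k (christoffel G k i j) y - partial_deriv j (christoffel G k i k) y)
     + (\<Sum>k\<in>UNIV. \<Sum>l\<in>UNIV. christoffel G k k l y * christoffel G l i j y
                             - christoffel G k j l y * christoffel G l i k y)"

definition local_scalar_curvature :: "(real^'n \<Rightarrow> real^'n^'n) \<Rightarrow> real^'n::finite \<Rightarrow> real" where
  "local_scalar_curvature G y = (\<Sum>i\<in>UNIV. \<Sum>j\<in>UNIV. matrix_inv (G y) $ i $ j * ricci G i j y)"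

definition scalar_curvature ::
    "('x::topological_space, real^'n) atlas \<Rightarrow> ('x, 'n::finite) metric \<Rightarrow> 'x \<Rightarrow> real" where
  "scalar_curvature A g p =
     (let c = chart_at A p in local_scalar_curvature (g c) (chart_map c p))"

text \<open>
  The Riemannian measure \<open>d\<sigma>\<^sub>g\<close>: the unique Borel measure given by \<open>sqrt (det g\<^sub>i\<^sub>j) dy\<close> in each chart.
\<close>

definition riemannian_measure ::
    "('x::topological_space, real^'n) atlas \<Rightarrow> ('x, 'n::finite) metric \<Rightarrow> 'x measure" where
  "riemannian_measure A g =
     (THE \<mu>. sets \<mu> = sets borel \<and>
        (\<forall>c\<in>A. \<forall>E\<in>sets borel. E \<subseteq> chart_dom c \<longrightarrow>
           emeasure \<mu> E = (\<integral>\<^sup>+y\<in>chart_map c ` E. ennreal (sqrt (det (g c y))) \<partial>lborel)))"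

section \<open>Sobolev functions and the Yamabe constant\<close>

text \<open>
  A \<open>1\<close>-form is a family of component vectors obeying the transformation law at every point (not just
  almost everywhere, as there may be uncountably many charts), so its pointwise norm is well defined.
\<close>

type_synonym ('x, 'n) oneform = "('x, real^'n) chart \<Rightarrow> real^'n \<Rightarrow> real^'n"

definition oneform :: "('x::topological_space, real^'n) atlas \<Rightarrow> ('x, 'n::finite) oneform \<Rightarrow> bool" where
  "oneform A \<omega> \<longleftrightarrow>
     (\<forall>c\<in>A. \<forall>d\<in>A. \<forall>p\<in>chart_dom c \<inter> chart_dom d.
        \<omega> c (chart_map c p) =
          transpose (jacobian (chart_map d \<circ> chart_inv c) (chart_map c p)) *v \<omega> d (chart_map d p))"

definition norm2_oneform ::
    "('x::topological_space, real^'n) atlas \<Rightarrow> ('x, 'n::finite) metric \<Rightarrow> ('x, 'n) oneform \<Rightarrow> 'x \<Rightarrow> real" where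
  "norm2_oneform A g \<omega> p =
     (let c = chart_at A p; y = chart_map c p in \<omega> c y \<bullet> (matrix_inv (g c y) *v \<omega> c y))"

definition test_function :: "(real^'n::finite) set \<Rightarrow> (real^'n \<Rightarrow> real) \<Rightarrow> bool" where
  "test_function S \<phi> \<longleftrightarrow>
     smooth_on UNIV \<phi> \<and> (\<exists>K. compact K \<and> K \<subseteq> S \<and> (\<forall>y. y \<notin> K \<longrightarrow> \<phi> y = 0))"

text \<open>
  \<open>\<omega>\<close> represents the weak differential \<open>du\<close>: in each chart, \<open>u\<close> and the components of \<open>\<omega>\<close> are locally
  integrable and the latter are the weak partial derivatives. Then \<open>\<omega>\<close> is unique almost everywhere.
\<close>

definition weak_differential ::
    "('x::topological_space, real^'n) atlas \<Rightarrow> ('x \<Rightarrow> real) \<Rightarrow> ('x, 'n::finite) oneform \<Rightarrow> bool" where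
  "weak_differential A u \<omega> \<longleftrightarrow>
     oneform A \<omega> \<and>
     (\<forall>c\<in>A.
        (\<forall>K. compact K \<and> K \<subseteq> chart_img c \<longrightarrow>
           set_integrable lborel K (u \<circ> chart_inv c) \<and> set_integrable lborel K (\<omega> c)) \<and>
        (\<forall>\<phi> i. test_function (chart_img c) \<phi> \<longrightarrow>
           (LINT y:chart_img c|lborel. u (chart_inv c y) * partial_deriv i \<phi> y) =
           - (LINT y:chart_img c|lborel. \<omega> c y $ i * \<phi> y)))"

text \<open>\<open>u \<in> L\<^sup>1\<^sup>,\<^sup>2\<^sub>g(X)\<close> with \<open>du = \<omega>\<close>.\<close>

definition sobolev_L12 ::
    "('x::topological_space, real^'n) atlas \<Rightarrow> ('x, 'n::finite) metric
      \<Rightarrow> ('x \<Rightarrow> real) \<Rightarrow> ('x, 'n) oneform \<Rightarrow> bool" where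
  "sobolev_L12 A g u \<omega> \<longleftrightarrow>
     u \<in> borel_measurable borel \<and> weak_differential A u \<omega> \<and>
     integrable (riemannian_measure A g) (\<lambda>p. (u p)\<^sup>2) \<and>
     integrable (riemannian_measure A g) (norm2_oneform A g \<omega>)"

text \<open>
  For cylindrical metrics, and for \<open>h + dt\<^sup>2\<close> on \<open>Z \<times> \<real>\<close> with \<open>Z\<close> compact, the scalar curvature is bounded,
  so the integral in the numerator exists, and the Sobolev embedding makes the one in the denominator
  finite. (In any case a divergent denominator gives the quotient \<open>0\<close>.)
\<close>

definition yamabe_quotient ::
    "('x::topological_space, real^'n) atlas \<Rightarrow> ('x, 'n::finite) metric
      \<Rightarrow> ('x \<Rightarrow> real) \<Rightarrow> ('x, 'n) oneform \<Rightarrow> real" where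
  "yamabe_quotient A g u \<omega> =
     (let n = real CARD('n); \<sigma> = riemannian_measure A g; \<alpha> = 4 * (n - 1) / (n - 2)
      in (LINT p|\<sigma>. \<alpha> * norm2_oneform A g \<omega> p + scalar_curvature A g p * (u p)\<^sup>2)
         / (LINT p|\<sigma>. \<bar>u p\<bar> powr (2 * n / (n - 2))) powr ((n - 2) / n))"

definition yamabe_cyl ::
    "('x::topological_space, real^'n) atlas \<Rightarrow> ('x, 'n::finite) metric \<Rightarrow> ereal" where
  "yamabe_cyl A g =
     Inf {ereal (yamabe_quotient A g u \<omega>) |u \<omega>.
            sobolev_L12 A g u \<omega> \<and> \<not> (AE p in riemannian_measure A g. u p = 0)}"

definition yamabe_hcyl ::
    "('x::{t2_space, second_countable_topology}, real^'n::finite) atlas \<Rightarrow> 'x set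
      \<Rightarrow> ('z::{t2_space, second_countable_topology}, real^'m) atlas
      \<Rightarrow> ('z, 'm::finite) metric \<Rightarrow> ereal" where
  "yamabe_hcyl A W B h = Sup {yamabe_cyl A g |g. cylindrical_metric A W B g h}"

end

theory Submission
  imports Defs
begin

text \<open>A competitor \<open>u\<close> on the cylinder \<open>Z \<times> \<real>\<close> is cut off in the direction of \<open>t\<close>, which changes
  numerator and denominator of its quotient by as little as we like. The result has compact support,
  and translating it along the cylinder, an isometry, moves the support into \<open>t > 1\<close>. There the
  cylinder is isometric to the end of \<open>X\<close>, so the function can be transported to \<open>X\<close> and extended by
  zero without changing the quotient. Scalar curvature is preserved because the Christoffel
  symbols obey the usual transformation law; weak derivatives under changes of charts, products and
  truncations are reduced to the smooth case by mollification.\<close>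

section \<open>Calculus of smooth functions\<close>

text \<open>The infimum for X is bounded above by each quotient found on the cylinder, and the bound
  is the same for all \<open>g\<close>, so the statement on the supremum comes for free. Competitors
  are merely measurable with weak derivatives: weak gradients are therefore characterised as limits,
  in L1 on compact sets, of C1 functions and their gradients, and each rule of calculus is read off
  from the approximating sequences. Compactness of Z enters twice: it bounds the scalar curvature of
  the cylinder, which gives dominating functions when the cutoff is removed, and it makes supports
  of cut-off functions compact, so that their images are closed in X and extension by zero is weakly
  differentiable. Only the open part t > 1 of the end is used: there smoothness up to the boundary
  is ordinary smoothness and the metric is a product. The integral of a non-integrable function is 0
  by convention, so a competitor whose denominator diverges has quotient 0; for it one needs
  \<open>yamabe_cyl A g\<close> to be at most 0, which comes from bounded truncations of the
  competitor.\<close>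

lemma frechet_derivative_eqI:
  "(f has_derivative f') (at x) \<Longrightarrow> frechet_derivative f (at x) = f'"
  using frechet_derivative_at by metis

lemma has_derivative_frechet:
  "f differentiable (at x) \<Longrightarrow> (f has_derivative frechet_derivative f (at x)) (at x)"
  using frechet_derivative_works by blast

lemma differentiable_cong_open:
  assumes "open S" "x \<in> S" "\<And>y. y \<in> S \<Longrightarrow> f y = g y" "f differentiable (at x)"
  shows "g differentiable (at x)" "frechet_derivative g (at x) = frechet_derivative f (at x)"
proof -
  have d: "(g has_derivative frechet_derivative f (at x)) (at x)"
    by (rule has_derivative_transform_within_open[OF has_derivative_frechet[OF assms(4)] assms(1,2)])
       (use assms in auto)
  show "g differentiable (at x)" using d by (auto simp: differentiable_def)
  show "frechet_derivative g (at x) = frechet_derivative f (at x)" using frechet_derivative_eqI[OF d] .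
qed

text \<open>Openness matters because \<open>Ck_on\<close> uses derivatives in the full space:
  functions that agree on an open set have the same derivatives there, so the argument can be
  repeated for the derivatives.\<close>

lemma Ck_on_cong:
  assumes "open S" "\<And>y. y \<in> S \<Longrightarrow> f y = g y" "Ck_on k S f"
  shows "Ck_on k S g"
  using assms(2,3)
proof (induction k arbitrary: f g)
  case 0 then show ?case using continuous_on_cong by force
next
  case (Suc k)
  have "\<forall>x\<in>S. g differentiable (at x)"
    using differentiable_cong_open(1)[OF assms(1)] Suc.prems by (metis Ck_on.simps(2))
  moreover have "Ck_on k S (\<lambda>x. frechet_derivative g (at x) v)" for v
  proof (rule Suc.IH)
    show "Ck_on k S (\<lambda>x. frechet_derivative f (at x) v)" using Suc.prems by simp
    show "frechet_derivative f (at y) v = frechet_derivative g (at y) v" if "y \<in> S" for y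
      using differentiable_cong_open(2)[OF assms(1) that, of f g] Suc.prems that by simp
  qed
  ultimately show ?case by simp
qed

lemma Ck_on_subset: "Ck_on k S f \<Longrightarrow> T \<subseteq> S \<Longrightarrow> Ck_on k T f"
proof (induction k arbitrary: f)
  case 0 then show ?case using continuous_on_subset by auto
qed auto

lemma Ck_on_SucD: "Ck_on (Suc k) S f \<Longrightarrow> Ck_on k S f"
proof (induction k arbitrary: f)
  case 0
  then show ?case
    by (auto intro!: continuous_at_imp_continuous_on differentiable_imp_continuous_within)
qed auto

lemma Ck_on_const: "Ck_on k S (\<lambda>x. c)"
  by (induction k arbitrary: c) auto

lemma Ck_on_linear: "bounded_linear L \<Longrightarrow> Ck_on k S L"
proof (cases k)
  case (Suc j)
  assume L: "bounded_linear L"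
  have "frechet_derivative L (at x) = L" for x
    using frechet_derivative_eqI bounded_linear_imp_has_derivative[OF L] by blast
  then show ?thesis using Suc L Ck_on_const bounded_linear_imp_differentiable by auto
qed (auto simp: linear_continuous_on)

lemma Ck_on_post:
  assumes "open S" "bounded_linear L" "Ck_on k S f"
  shows "Ck_on k S (\<lambda>x. L (f x))"
  using assms(3)
proof (induction k arbitrary: f)
  case 0 then show ?case
    using bounded_linear.continuous_on[OF assms(2)] by auto
next
  case (Suc k)
  have d: "((\<lambda>x. L (f x)) has_derivative (\<lambda>v. L (frechet_derivative f (at x) v))) (at x)" if "x \<in> S" for x
    using bounded_linear.has_derivative[OF assms(2) has_derivative_frechet] Suc.prems that by auto
  have "Ck_on k S (\<lambda>x. frechet_derivative (\<lambda>x. L (f x)) (at x) v)" for v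
    by (rule Ck_on_cong[OF assms(1) _ Suc.IH[of "\<lambda>x. frechet_derivative f (at x) v"]])
       (use Suc.prems frechet_derivative_eqI[OF d] in auto)
  then show ?case using d by (auto simp: differentiable_def)
qed

text \<open>An affine substitution turns the derivative in direction \<open>v\<close> into the one
  in the fixed direction \<open>L v\<close>, so the induction runs over single directional
  derivatives. It covers the reflected translates of mollifiers and the projection in the cylinder
  charts.\<close>

lemma Ck_on_pre:
  fixes L :: "'c::euclidean_space \<Rightarrow> 'a::euclidean_space"
  assumes "open T" "bounded_linear L" "\<And>x. x \<in> T \<Longrightarrow> L x + a \<in> S" "Ck_on k S f"
  shows "Ck_on k T (\<lambda>x. f (L x + a))"
  using assms(4)
proof (induction k arbitrary: f)
  case 0
  have "continuous_on T (\<lambda>x. L x + a)"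
    by (intro continuous_intros linear_continuous_on assms)
  then show ?case using 0 continuous_on_compose2 assms(3) by (metis Ck_on.simps(1) image_subsetI)
next
  case (Suc k)
  have d: "((\<lambda>x. f (L x + a)) has_derivative (\<lambda>v. frechet_derivative f (at (L x + a)) (L v))) (at x)"
    if "x \<in> T" for x
  proof -
    have 1: "((\<lambda>x. L x + a) has_derivative L) (at x)"
      using has_derivative_add[OF bounded_linear_imp_has_derivative[OF assms(2)] has_derivative_const] by simp
    have "f differentiable (at (L x + a))" using Suc.prems assms(3) that by auto
    then show ?thesis using diff_chain_at[OF 1 has_derivative_frechet] by (simp add: o_def)
  qed
  have "Ck_on k T (\<lambda>x. frechet_derivative (\<lambda>x. f (L x + a)) (at x) v)" for v
    by (rule Ck_on_cong[OF assms(1) _ Suc.IH[of "\<lambda>x. frechet_derivative f (at x) (L v)"]])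
       (use Suc.prems frechet_derivative_eqI[OF d] in auto)
  then show ?case using d by (auto simp: differentiable_def)
qed

lemma Ck_on_add:
  assumes "open S" "Ck_on k S f" "Ck_on k S g"
  shows "Ck_on k S (\<lambda>x. f x + g x)"
  using assms(2,3)
proof (induction k arbitrary: f g)
  case 0 then show ?case by (auto intro: continuous_intros)
next
  case (Suc k)
  have d: "((\<lambda>x. f x + g x) has_derivative (\<lambda>v. frechet_derivative f (at x) v + frechet_derivative g (at x) v)) (at x)"
    if "x \<in> S" for x
    using Suc.prems that by (auto intro!: derivative_eq_intros has_derivative_frechet)
  have "Ck_on k S (\<lambda>x. frechet_derivative (\<lambda>x. f x + g x) (at x) v)" for v
    by (rule Ck_on_cong[OF assms(1) _ Suc.IH[of "\<lambda>x. frechet_derivative f (at x) v" "\<lambda>x. frechet_derivative g (at x) v"]])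
       (use Suc.prems frechet_derivative_eqI[OF d] in auto)
  then show ?case using d by (auto simp: differentiable_def)
qed

lemma Ck_on_mult:
  fixes f g :: "'a::euclidean_space \<Rightarrow> real"
  assumes "open S" "Ck_on k S f" "Ck_on k S g"
  shows "Ck_on k S (\<lambda>x. f x * g x)"
  using assms(2,3)
proof (induction k arbitrary: f g)
  case 0 then show ?case by (auto intro: continuous_intros)
next
  case (Suc k)
  have d: "((\<lambda>x. f x * g x) has_derivative (\<lambda>v. f x * frechet_derivative g (at x) v + frechet_derivative f (at x) v * g x)) (at x)"
    if "x \<in> S" for x
    using Suc.prems that by (auto intro!: derivative_eq_intros has_derivative_frechet)
  have "Ck_on k S (\<lambda>x. frechet_derivative (\<lambda>x. f x * g x) (at x) v)" for v
    by (rule Ck_on_cong[OF assms(1) _ Ck_on_add[OF assms(1)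
          Suc.IH[of f "\<lambda>x. frechet_derivative g (at x) v"]
          Suc.IH[of "\<lambda>x. frechet_derivative f (at x) v" g]]])
       (use Suc.prems frechet_derivative_eqI[OF d] Ck_on_SucD[of k S f] Ck_on_SucD[of k S g] in auto)
  then show ?case using d by (auto simp: differentiable_def)
qed

text \<open>The derivative of the reciprocal is a product of reciprocals and a derivative of
  \<open>f\<close>, so the induction feeds on itself: order \<open>k\<close> for the reciprocal
  yields order \<open>Suc k\<close>.\<close>

lemma Ck_on_inverse:
  fixes f :: "'a::euclidean_space \<Rightarrow> real"
  assumes "open S" "Ck_on k S f" "\<And>x. x \<in> S \<Longrightarrow> f x \<noteq> 0"
  shows "Ck_on k S (\<lambda>x. inverse (f x))"
  using assms(2)
proof (induction k)
  case 0 then show ?case using assms(3) by (auto intro: continuous_intros)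
next
  case (Suc k)
  have d: "((\<lambda>x. inverse (f x)) has_derivative (\<lambda>v. (-1) * (inverse (f x) * frechet_derivative f (at x) v * inverse (f x)))) (at x)"
    if "x \<in> S" for x
    using Suc.prems that assms(3) by (auto intro!: derivative_eq_intros has_derivative_frechet)
  have I: "Ck_on k S (\<lambda>x. inverse (f x))" using Suc Ck_on_SucD by blast
  have "Ck_on k S (\<lambda>x. frechet_derivative (\<lambda>x. inverse (f x)) (at x) v)" for v
    by (rule Ck_on_cong[OF assms(1) _ Ck_on_mult[OF assms(1) Ck_on_const[of _ _ "-1"]
          Ck_on_mult[OF assms(1) Ck_on_mult[OF assms(1) I, of "\<lambda>x. frechet_derivative f (at x) v"] I]]])
       (use Suc.prems frechet_derivative_eqI[OF d] in auto)
  then show ?case using d by (auto simp: differentiable_def)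
qed

lemma Ck_on_local:
  assumes "\<And>x. x \<in> S \<Longrightarrow> \<exists>T. open T \<and> x \<in> T \<and> Ck_on k T f"
  shows "Ck_on k S f"
  using assms
proof (induction k arbitrary: f)
  case 0 
  have "isCont f x" if "x \<in> S" for x
    using 0[OF that] continuous_on_eq_continuous_at by auto
  then show ?case by (simp add: continuous_at_imp_continuous_on)
next
  case (Suc k)
  have "Ck_on k S (\<lambda>x. frechet_derivative f (at x) v)" for v
    using Suc.prems by (intro Suc.IH) (metis Ck_on.simps(2))
  then show ?case using Suc.prems by auto
qed

lemma smooth_on_Suc:
  "smooth_on S f \<longleftrightarrow> (\<forall>x\<in>S. f differentiable (at x)) \<and> (\<forall>v. smooth_on S (\<lambda>x. frechet_derivative f (at x) v))"
  unfolding smooth_on_def by (metis Ck_on.simps(2) Ck_on_SucD)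

lemma smooth_on_differentiable: "smooth_on S f \<Longrightarrow> x \<in> S \<Longrightarrow> f differentiable (at x)"
  using smooth_on_Suc by blast

lemma smooth_on_frechet: "smooth_on S f \<Longrightarrow> smooth_on S (\<lambda>x. frechet_derivative f (at x) v)"
  using smooth_on_Suc by blast

lemma smooth_on_continuous: "smooth_on S f \<Longrightarrow> continuous_on S f"
  unfolding smooth_on_def by (metis Ck_on.simps(1))

lemma smooth_on_cong: "open S \<Longrightarrow> (\<And>y. y \<in> S \<Longrightarrow> f y = g y) \<Longrightarrow> smooth_on S f \<Longrightarrow> smooth_on S g"
  unfolding smooth_on_def using Ck_on_cong by blast

lemma smooth_on_subset: "smooth_on S f \<Longrightarrow> T \<subseteq> S \<Longrightarrow> smooth_on T f"
  unfolding smooth_on_def using Ck_on_subset by blast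

lemma smooth_on_const: "smooth_on S (\<lambda>x. c)"
  unfolding smooth_on_def using Ck_on_const by blast

lemma smooth_on_linear: "bounded_linear L \<Longrightarrow> smooth_on S L"
  unfolding smooth_on_def using Ck_on_linear by blast

lemma smooth_on_post: "open S \<Longrightarrow> bounded_linear L \<Longrightarrow> smooth_on S f \<Longrightarrow> smooth_on S (\<lambda>x. L (f x))"
  unfolding smooth_on_def using Ck_on_post by blast

lemma smooth_on_pre:
  fixes L :: "'c::euclidean_space \<Rightarrow> 'a::euclidean_space"
  shows "open T \<Longrightarrow> bounded_linear L \<Longrightarrow> (\<And>x. x \<in> T \<Longrightarrow> L x + a \<in> S) \<Longrightarrow> smooth_on S f
    \<Longrightarrow> smooth_on T (\<lambda>x. f (L x + a))"
  unfolding smooth_on_def using Ck_on_pre by blast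

lemma smooth_on_add: "open S \<Longrightarrow> smooth_on S f \<Longrightarrow> smooth_on S g \<Longrightarrow> smooth_on S (\<lambda>x. f x + g x)"
  unfolding smooth_on_def using Ck_on_add by blast

lemma smooth_on_mult:
  fixes f g :: "'a::euclidean_space \<Rightarrow> real"
  shows "open S \<Longrightarrow> smooth_on S f \<Longrightarrow> smooth_on S g \<Longrightarrow> smooth_on S (\<lambda>x. f x * g x)"
  unfolding smooth_on_def using Ck_on_mult by blast

lemma smooth_on_inverse:
  fixes f :: "'a::euclidean_space \<Rightarrow> real"
  shows "open S \<Longrightarrow> smooth_on S f \<Longrightarrow> (\<And>x. x \<in> S \<Longrightarrow> f x \<noteq> 0) \<Longrightarrow> smooth_on S (\<lambda>x. inverse (f x))"
  unfolding smooth_on_def using Ck_on_inverse by blast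

lemma smooth_on_local:
  "(\<And>x. x \<in> S \<Longrightarrow> \<exists>T. open T \<and> x \<in> T \<and> smooth_on T f) \<Longrightarrow> smooth_on S f"
  unfolding smooth_on_def using Ck_on_local by metis

lemma smooth_on_diff:
  fixes f g :: "'a::euclidean_space \<Rightarrow> real"
  assumes "open S" "smooth_on S f" "smooth_on S g"
  shows "smooth_on S (\<lambda>x. f x - g x)"
  using smooth_on_add[OF assms(1,2) smooth_on_post[OF assms(1) bounded_linear_minus[OF bounded_linear_ident] assms(3)]]
  by simp

lemma smooth_on_sum:
  assumes "open S" "\<And>i. i \<in> I \<Longrightarrow> smooth_on S (f i)"
  shows "smooth_on S (\<lambda>x. \<Sum>i\<in>I. f i x)"
  using assms(2)
proof (induction I rule: infinite_finite_induct)
  case (insert a F)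
  then show ?case using smooth_on_add[OF assms(1), of "f a"] by simp
qed (simp_all add: smooth_on_const)

lemma smooth_on_prod:
  fixes f :: "'i \<Rightarrow> 'a::euclidean_space \<Rightarrow> real"
  assumes "open S" "\<And>i. i \<in> I \<Longrightarrow> smooth_on S (f i)"
  shows "smooth_on S (\<lambda>x. \<Prod>i\<in>I. f i x)"
  using assms(2)
proof (induction I rule: infinite_finite_induct)
  case (insert a F)
  then show ?case using smooth_on_mult[OF assms(1), of "f a"] by simp
qed (simp_all add: smooth_on_const)

lemma smooth_on_partial_deriv: "smooth_on S f \<Longrightarrow> smooth_on S (partial_deriv i f)"
  unfolding partial_deriv_def[abs_def] using smooth_on_frechet by blast

lemma smooth_on_nth:
  fixes F :: "'a::euclidean_space \<Rightarrow> real^'k::finite"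
  shows "open S \<Longrightarrow> smooth_on S F \<Longrightarrow> smooth_on S (\<lambda>y. F y $ a)"
  by (rule smooth_on_post) (auto intro: bounded_linear_vec_nth)

lemma smooth_on_det:
  fixes G :: "'a::euclidean_space \<Rightarrow> real^'n::finite^'n"
  assumes "open S" "\<And>i j. smooth_on S (\<lambda>y. G y $ i $ j)"
  shows "smooth_on S (\<lambda>y. det (G y))"
  unfolding det_def
  by (intro smooth_on_sum smooth_on_mult smooth_on_prod smooth_on_const assms)

section \<open>Inverse matrices\<close>

lemma matrix_inv_right:
  fixes A :: "real^'n::finite^'n" assumes "det A \<noteq> 0"
  shows "A ** matrix_inv A = mat 1" "matrix_inv A ** A = mat 1"
proof -
  obtain A' where "A ** A' = mat 1 \<and> A' ** A = mat 1"
    using assms invertible_det_nz invertible_def by metis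
  then have "A ** matrix_inv A = mat 1 \<and> matrix_inv A ** A = mat 1"
    unfolding matrix_inv_def by (rule someI)
  then show "A ** matrix_inv A = mat 1" "matrix_inv A ** A = mat 1" by auto
qed

text \<open>Cramer's rule exhibits every entry of the inverse as a quotient of polynomials in the
  entries of \<open>A\<close>, which is what makes the inverse metric smooth in the
  coordinates.\<close>

lemma matrix_inv_cramer:
  fixes A :: "real^'n::finite^'n" assumes "det A \<noteq> 0"
  shows "matrix_inv A $ k $ l = det (\<chi> i j. if j = k then axis l 1 $ i else A $ i $ j) * inverse (det A)"
proof -
  have "A *v (matrix_inv A *v axis l 1) = axis l 1"
    using matrix_inv_right[OF assms] by (simp add: matrix_vector_mul_assoc)
  then have "matrix_inv A *v axis l 1 = (\<chi> k. det (\<chi> i j. if j=k then axis l 1 $ i else A$i$j) / det A)"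
    using cramer[OF assms] by blast
  then have "(matrix_inv A *v axis l 1) $ k = det (\<chi> i j. if j=k then axis l 1 $ i else A$i$j) / det A" by simp
  then show ?thesis by (simp add: matrix_vector_mult_basis column_def field_simps)
qed

lemma smooth_on_matrix_inv:
  fixes G :: "'a::euclidean_space \<Rightarrow> real^'n::finite^'n"
  assumes "open S" "\<And>i j. smooth_on S (\<lambda>y. G y $ i $ j)" "\<And>y. y \<in> S \<Longrightarrow> det (G y) \<noteq> 0"
  shows "smooth_on S (\<lambda>y. matrix_inv (G y) $ k $ l)"
proof (rule smooth_on_cong[OF assms(1)])
  have "smooth_on S (\<lambda>y. if j = k then axis l 1 $ i else G y $ i $ j)" for i j
    using assms by (cases "j = k") (auto simp: smooth_on_const)
  then show "smooth_on S (\<lambda>y. det (\<chi> i j. if j = k then axis l 1 $ i else G y $ i $ j) * inverse (det (G y)))"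
    by (intro smooth_on_mult smooth_on_inverse smooth_on_det assms) auto
qed (simp add: matrix_inv_cramer assms)

section \<open>Partial derivatives and symmetry of second derivatives\<close>

lemma frechet_derivative_partial:
  fixes f :: "real^'n::finite \<Rightarrow> real"
  assumes "f differentiable (at y)"
  shows "frechet_derivative f (at y) v = (\<Sum>i\<in>UNIV. v $ i * partial_deriv i f y)"
proof -
  have L: "linear (frechet_derivative f (at y))"
    using assms linear_frechet_derivative by blast
  have "frechet_derivative f (at y) v = frechet_derivative f (at y) (\<Sum>i\<in>UNIV. v $ i *\<^sub>R axis i 1)"
    using basis_expansion[of v] by (simp add: scalar_mult_eq_scaleR)
  then show ?thesis
    by (simp add: linear_sum[OF L] linear_cmul[OF L] partial_deriv_def)
qed

text \<open>The mean value theorem is applied once along \<open>u\<close> to the increment in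
  direction \<open>v\<close>, and once along \<open>v\<close> to the derivative in direction
  \<open>u\<close>. The second difference is symmetric in \<open>u\<close> and \<open>v\<close>, so
  exchanging them gives the other mixed derivative at another point of the same
  parallelogram.\<close>

lemma second_difference_mvt:
  fixes f :: "'a::euclidean_space \<Rightarrow> real"
  assumes S: "\<And>s r. 0 \<le> s \<Longrightarrow> s \<le> t \<Longrightarrow> 0 \<le> r \<Longrightarrow> r \<le> t \<Longrightarrow> x + s *\<^sub>R u + r *\<^sub>R v \<in> S"
    and f: "smooth_on S f" and t: "t > 0"
  shows "\<exists>s r. 0 \<le> s \<and> s \<le> t \<and> 0 \<le> r \<and> r \<le> t \<and>
     f (x + t *\<^sub>R u + t *\<^sub>R v) - f (x + t *\<^sub>R u) - f (x + t *\<^sub>R v) + f x =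
     t^2 * frechet_derivative (\<lambda>z. frechet_derivative f (at z) u) (at (x + s *\<^sub>R u + r *\<^sub>R v)) v"
proof -
  have der: "((\<lambda>s. g (a + s *\<^sub>R w)) has_real_derivative frechet_derivative g (at (a + s *\<^sub>R w)) w) (at s)"
    if "smooth_on S g" "a + s *\<^sub>R w \<in> S" for g :: "'a \<Rightarrow> real" and a w s
  proof -
    have "g differentiable (at (a + s *\<^sub>R w))" using smooth_on_differentiable that by blast
    note d = has_derivative_frechet[OF this]
    have "((\<lambda>s. a + s *\<^sub>R w) has_derivative (\<lambda>h. h *\<^sub>R w)) (at s)"
      by (auto intro!: derivative_eq_intros)
    from diff_chain_at[OF this d]
    have "((\<lambda>s. g (a + s *\<^sub>R w)) has_derivative (\<lambda>h. frechet_derivative g (at (a + s *\<^sub>R w)) (h *\<^sub>R w))) (at s)"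
      by (simp add: o_def)
    moreover have "frechet_derivative g (at (a + s *\<^sub>R w)) (h *\<^sub>R w) = frechet_derivative g (at (a + s *\<^sub>R w)) w * h" for h
      using linear_cmul[OF has_derivative_linear[OF d]] by simp
    ultimately show ?thesis by (simp add: has_field_derivative_def)
  qed
  let ?phi = "\<lambda>s. f (x + t *\<^sub>R v + s *\<^sub>R u) - f (x + s *\<^sub>R u)"
  let ?phi' = "\<lambda>s. frechet_derivative f (at (x + t *\<^sub>R v + s *\<^sub>R u)) u - frechet_derivative f (at (x + s *\<^sub>R u)) u"
  have "\<exists>s. 0 < s \<and> s < t \<and> ?phi t - ?phi 0 = (t - 0) * ?phi' s"
  proof (rule MVT2[OF t])
    fix s assume s: "0 \<le> s" "s \<le> t"
    have "x + t *\<^sub>R v + s *\<^sub>R u \<in> S" "x + s *\<^sub>R u \<in> S" 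
      using S[of s t] S[of s 0] s t by (auto simp: algebra_simps)
    then show "(?phi has_real_derivative ?phi' s) (at s)"
      by (intro DERIV_diff der f) 
  qed
  then obtain s where s: "0 < s" "s < t" "?phi t - ?phi 0 = t * ?phi' s" by auto
  let ?F = "\<lambda>z. frechet_derivative f (at z) u"
  have "\<exists>r. 0 < r \<and> r < t \<and> ?F (x + s *\<^sub>R u + t *\<^sub>R v) - ?F (x + s *\<^sub>R u + 0 *\<^sub>R v)
       = (t - 0) * frechet_derivative ?F (at (x + s *\<^sub>R u + r *\<^sub>R v)) v"
  proof (rule MVT2[OF t])
    fix r assume r: "0 \<le> r" "r \<le> t"
    have "x + s *\<^sub>R u + r *\<^sub>R v \<in> S" using S[of s r] s r by auto
    then show "((\<lambda>r. ?F (x + s *\<^sub>R u + r *\<^sub>R v)) has_real_derivative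
       frechet_derivative ?F (at (x + s *\<^sub>R u + r *\<^sub>R v)) v) (at r)"
      using der[OF smooth_on_frechet[OF f, of u], of "x + s *\<^sub>R u" r v] by simp
  qed
  then obtain r where r: "0 < r" "r < t"
    "?F (x + s *\<^sub>R u + t *\<^sub>R v) - ?F (x + s *\<^sub>R u) = t * frechet_derivative ?F (at (x + s *\<^sub>R u + r *\<^sub>R v)) v"
    by auto
  have "?phi' s = ?F (x + s *\<^sub>R u + t *\<^sub>R v) - ?F (x + s *\<^sub>R u)" by (simp add: algebra_simps)
  then show ?thesis using s r
    by (intro exI[of _ s] exI[of _ r]) (auto simp: power2_eq_square algebra_simps)
qed

text \<open>If the mixed derivatives differed at \<open>x\<close>, continuity would keep them apart
  on a small parallelogram, whereas the second difference expresses one value of each by the same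
  number.\<close>

lemma symmetric_second_derivative:
  fixes f :: "'a::euclidean_space \<Rightarrow> real"
  assumes "open S" "x \<in> S" "smooth_on S f"
  shows "frechet_derivative (\<lambda>z. frechet_derivative f (at z) u) (at x) v =
         frechet_derivative (\<lambda>z. frechet_derivative f (at z) v) (at x) u"
proof (rule ccontr)
  define D where "D u v z = frechet_derivative (\<lambda>z. frechet_derivative f (at z) u) (at z) v" for u v z
  assume "\<not> ?thesis"
  then have ne: "\<bar>D u v x - D v u x\<bar> / 2 > 0" (is "?e > 0") by (simp add: D_def)
  have c: "continuous_on S (D u v)" for u v
    unfolding D_def using assms by (intro smooth_on_continuous smooth_on_frechet)
  then have "isCont (D u v) x" "isCont (D v u) x"
    using assms continuous_on_eq_continuous_at by blast+
  then obtain d1 d2 where d: "d1 > 0" "\<And>z. dist z x < d1 \<Longrightarrow> dist (D u v z) (D u v x) < ?e"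
    "d2 > 0" "\<And>z. dist z x < d2 \<Longrightarrow> dist (D v u z) (D v u x) < ?e"
    using ne unfolding continuous_at_eps_delta by (metis dist_commute)
  obtain d3 where d3: "d3 > 0" "ball x d3 \<subseteq> S" using assms openE by blast
  define d where "d = min d1 (min d2 d3)"
  have dp: "d > 0" using d d3 by (auto simp: d_def)
  \<comment> \<open>Small enough that the whole parallelogram spanned by the multiples of
    \<open>u\<close> and \<open>v\<close> lies within \<open>d\<close> of \<open>x\<close>; the
    summand 1 covers the case that both vectors vanish.\<close>
  define t where "t = d / (2 * (norm u + norm v + 1))"
  have tp: "t > 0" using dp unfolding t_def by (intro divide_pos_pos) (auto intro: add_nonneg_pos)
  have near: "dist (x + s *\<^sub>R a + r *\<^sub>R b) x < d"
    if "0 \<le> s" "s \<le> t" "0 \<le> r" "r \<le> t" "(a = u \<and> b = v) \<or> (a = v \<and> b = u)" for s r a b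
  proof -
    have "dist (x + s *\<^sub>R a + r *\<^sub>R b) x = norm (s *\<^sub>R a + r *\<^sub>R b)" by (simp add: dist_norm algebra_simps)
    also have "\<dots> \<le> s * norm a + r * norm b" using that by (metis norm_triangle_ineq norm_scaleR abs_of_nonneg)
    also have "\<dots> \<le> t * norm a + t * norm b" using that by (intro add_mono mult_right_mono) auto
    also have "\<dots> \<le> t * (norm u + norm v + 1)" using that tp by (auto simp: algebra_simps)
    also have "\<dots> = d / 2"
    proof -
      have "norm u + norm v + 1 > 0" by (simp add: add_nonneg_pos)
      then show ?thesis unfolding t_def by (simp add: divide_simps del: add_pos_nonneg)
    qed
    also have "\<dots> < d" using dp by simp
    finally show ?thesis .
  qed
  have inS: "x + s *\<^sub>R a + r *\<^sub>R b \<in> S"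
    if "0 \<le> s" "s \<le> t" "0 \<le> r" "r \<le> t" "(a = u \<and> b = v) \<or> (a = v \<and> b = u)" for s r a b
    using near[OF that] d3 by (auto simp: d_def dist_commute subset_eq)
  obtain s r where 1: "0 \<le> s" "s \<le> t" "0 \<le> r" "r \<le> t"
    "f (x + t *\<^sub>R u + t *\<^sub>R v) - f (x + t *\<^sub>R u) - f (x + t *\<^sub>R v) + f x = t^2 * D u v (x + s *\<^sub>R u + r *\<^sub>R v)"
    using second_difference_mvt[of t x u v S f] inS assms tp unfolding D_def by blast
  obtain s' r' where 2: "0 \<le> s'" "s' \<le> t" "0 \<le> r'" "r' \<le> t"
    "f (x + t *\<^sub>R v + t *\<^sub>R u) - f (x + t *\<^sub>R v) - f (x + t *\<^sub>R u) + f x = t^2 * D v u (x + s' *\<^sub>R v + r' *\<^sub>R u)"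
    using second_difference_mvt[of t x v u S f] inS assms tp unfolding D_def by blast
  have "t^2 * D u v (x + s *\<^sub>R u + r *\<^sub>R v) = t^2 * D v u (x + s' *\<^sub>R v + r' *\<^sub>R u)"
    using 1(5) 2(5) by (simp add: algebra_simps)
  then have eq: "D u v (x + s *\<^sub>R u + r *\<^sub>R v) = D v u (x + s' *\<^sub>R v + r' *\<^sub>R u)" using tp by simp
  have "dist (D u v (x + s *\<^sub>R u + r *\<^sub>R v)) (D u v x) < ?e"
    using d near[of s r u v] 1 by (auto simp: d_def)
  moreover have "dist (D v u (x + s' *\<^sub>R v + r' *\<^sub>R u)) (D v u x) < ?e"
    using d near[of s' r' v u] 2 by (auto simp: d_def)
  ultimately show False using eq abs_triangle_ineq4[of "D u v (x + s *\<^sub>R u + r *\<^sub>R v) - D v u x" "D u v (x + s *\<^sub>R u + r *\<^sub>R v) - D u v x"]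
    by (simp add: dist_real_def)
qed

section \<open>Change of variables\<close>

text \<open>The image under \<open>f\<close> is the preimage under the continuous inverse
  \<open>g\<close>, and preimages preserve Borel sets.\<close>

lemma homeomorphism_image_borel:
  assumes "homeomorphism U V f g" "U \<in> sets borel" "V \<in> sets borel" "E \<in> sets borel" "E \<subseteq> U"
  shows "f ` E \<in> sets borel"
proof -
  have "g \<in> borel_measurable (restrict_space borel V)"
    using assms(1) by (intro borel_measurable_continuous_on_restrict) (simp add: homeomorphism_def)
  then have "g -` E \<inter> space (restrict_space borel V) \<in> sets (restrict_space borel V)"
    using assms(4) by (rule measurable_sets)
  then have "g -` E \<inter> V \<in> sets borel"
    using assms(3) by (simp add: sets_restrict_space_iff space_restrict_space)
  moreover have "f ` E = g -` E \<inter> V"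
    using assms(1,5) unfolding homeomorphism_def by force
  ultimately show ?thesis by simp
qed

text \<open>\<open>has_measure_differentiable_image\<close> equates finiteness of the measure of the
  image with existence of the integral. The statement in extended reals follows by cases: a finite
  integral gives the measure, and an infinite one excludes a finite measure, since that would make
  the integral finite.\<close>

lemma emeasure_image_wellorder:
  fixes F :: "real^'n::{finite,wellorder} \<Rightarrow> real^'n::_"
  assumes U: "open U" and der: "\<And>x. x \<in> U \<Longrightarrow> (F has_derivative F' x) (at x)"
    and cont: "continuous_on U (\<lambda>x. det (matrix (F' x)))"
    and inj: "inj_on F U" and E: "E \<in> sets borel" "E \<subseteq> U"
  shows "emeasure lborel (F ` E) = (\<integral>\<^sup>+x\<in>E. ennreal \<bar>det (matrix (F' x))\<bar> \<partial>lborel)"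
proof -
  let ?d = "\<lambda>x. \<bar>det (matrix (F' x))\<bar>"
  have cF: "continuous_on U F" using der has_derivative_continuous continuous_at_imp_continuous_on by blast
  obtain g where g: "homeomorphism U (F ` U) F g"
    using invariance_of_domain_homeomorphism[OF U cF _ inj] by auto
  have "open (F ` U)" using invariance_of_domain[OF cF U inj] .
  then have FE: "F ` E \<in> sets borel" using homeomorphism_image_borel[OF g _ _ E] U by auto
  have meas: "(\<lambda>x. indicator E x * ?d x) \<in> borel_measurable borel"
  proof -
    have "(\<lambda>x. if x \<in> U then ?d x else 0) \<in> borel_measurable borel"
      using U by (intro borel_measurable_continuous_on_if continuous_intros cont) auto
    then have "(\<lambda>x. indicator E x * (if x \<in> U then ?d x else 0)) \<in> borel_measurable borel"
      using E by measurable
    moreover have "(\<lambda>x. indicator E x * (if x \<in> U then ?d x else 0)) = (\<lambda>x. indicator E x * ?d x)"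
      by (rule ext) (use E in \<open>auto simp: indicator_def\<close>)
    ultimately show ?thesis by simp
  qed
  have cv: "F ` E \<in> lmeasurable \<and> measure lebesgue (F ` E) = m \<longleftrightarrow> (?d has_integral m) E" for m
  proof (rule has_measure_differentiable_image)
    show "E \<in> sets lebesgue" using E by auto
    show "(F has_derivative F' x) (at x within E)" if "x \<in> E" for x
      using der E that has_derivative_at_withinI by blast
    show "inj_on F E" using inj E inj_on_subset by blast
  qed
  have hi: "(?d has_integral m) E \<longleftrightarrow> ((\<lambda>x. indicator E x * ?d x) has_integral m) UNIV" for m
  proof -
    have "(\<lambda>x. indicator E x * ?d x) = (\<lambda>x. if x \<in> E then ?d x else 0)" by auto
    then show ?thesis by (simp add: has_integral_restrict_UNIV)
  qed
  let ?I = "\<integral>\<^sup>+x. ennreal (indicator E x * ?d x) \<partial>lborel"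
  have I: "?I = (\<integral>\<^sup>+x\<in>E. ennreal (?d x) \<partial>lborel)"
    by (intro nn_integral_cong) (auto simp: indicator_def)
  have em: "emeasure lborel (F ` E) = emeasure lebesgue (F ` E)" using FE by simp
  show ?thesis
  proof (cases "?I = \<infinity>")
    case False
    then obtain m where m: "?I = ennreal m" "m \<ge> 0" by (cases ?I rule: ennreal_cases) auto
    then have "(?d has_integral m) E" unfolding hi by (intro nn_integral_has_integral meas) auto
    then have l: "F ` E \<in> lmeasurable" "measure lebesgue (F ` E) = m" using cv by auto
    have "emeasure lebesgue (F ` E) = ennreal m"
      using emeasure_eq_measure2[OF l(1)] l(2) by simp
    then show ?thesis unfolding em I[symmetric] m(1) .
  next
    case True
    have "emeasure lborel (F ` E) = \<infinity>"
    proof (rule ccontr)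
      assume "emeasure lborel (F ` E) \<noteq> \<infinity>"
      then have "emeasure lebesgue (F ` E) < \<infinity>" unfolding em by (simp only: less_top infinity_ennreal_def)
      moreover have "F ` E \<in> sets lebesgue" using FE by auto
      ultimately have "F ` E \<in> lmeasurable" by (intro fmeasurableI)
      then have "(?d has_integral (measure lebesgue (F ` E))) E" using cv by blast
      then have "((\<lambda>x. indicator E x * ?d x) has_integral (measure lebesgue (F ` E))) UNIV" using hi by blast
      then have "?I = ennreal (measure lebesgue (F ` E))"
        by (intro nn_integral_has_integral_lborel meas) auto
      then show False using True by simp
    qed
    then show ?thesis using True I by simp
  qed
qed

text \<open>The library's change of variables theorem needs a well-ordered index type, so we pass to a copy
  of the finite index type carrying an arbitrary enumeration order.\<close>

typedef 'a enumerated = "UNIV :: 'a set" by auto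

lemma bij_Rep_enumerated: "bij (Rep_enumerated :: 'a enumerated \<Rightarrow> 'a)"
  by (metis Abs_enumerated_inverse Rep_enumerated_inverse UNIV_I bijI')

instance enumerated :: (finite) finite
proof
  show "finite (UNIV :: 'a enumerated set)"
    using bij_betw_finite[OF bij_Rep_enumerated[where ?'a='a]] by simp
qed

definition enumeration :: "'a::finite enumerated \<Rightarrow> nat" where
  "enumeration = (SOME f. inj f)"

lemma inj_enumeration: "inj (enumeration :: 'a::finite enumerated \<Rightarrow> nat)"
proof -
  obtain f :: "'a::finite enumerated \<Rightarrow> nat" where "inj f"
    using finite_imp_inj_to_nat_seg[OF finite_class.finite_UNIV] by blast
  then show ?thesis unfolding enumeration_def by (rule someI[of inj])
qed

instantiation enumerated :: (finite) wellorder
begin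
definition "less_eq_enumerated (x :: 'a enumerated) (y :: 'a enumerated) \<longleftrightarrow> enumeration x \<le> enumeration y"
definition "less_enumerated (x :: 'a enumerated) (y :: 'a enumerated) \<longleftrightarrow> enumeration x < enumeration y"
instance
proof
  fix x y z :: "'a enumerated"
  show "(x < y) = (x \<le> y \<and> \<not> y \<le> x)" unfolding less_eq_enumerated_def less_enumerated_def by auto
  show "x \<le> x" unfolding less_eq_enumerated_def by simp
  show "x \<le> z" if "x \<le> y" "y \<le> z" using that unfolding less_eq_enumerated_def by simp
  show "x = y" if "x \<le> y" "y \<le> x"
    by (rule injD[OF inj_enumeration]) (use that in \<open>simp add: less_eq_enumerated_def\<close>)
  show "x \<le> y \<or> y \<le> x" unfolding less_eq_enumerated_def by auto
next
  fix P :: "'a enumerated \<Rightarrow> bool" and a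
  assume step: "\<And>x. (\<And>y. y < x \<Longrightarrow> P y) \<Longrightarrow> P x"
  show "P a"
  proof (induction "enumeration a" arbitrary: a rule: less_induct)
    case less
    then show ?case using step unfolding less_enumerated_def by blast
  qed
qed
end

text \<open>Conjugation by \<open>f\<close> is a bijection between the permutations of the two index
  types that preserves signs, so the two Leibniz expansions agree term by term.\<close>

lemma det_reindex:
  fixes A :: "real^'n::finite^'n" and f :: "'m::finite \<Rightarrow> 'n"
  assumes "bij f"
  shows "det (\<chi> i j. A $ f i $ f j :: real^'m^'m) = det A"
proof -
  have f: "inj f" "f ` UNIV = UNIV" using assms by (auto simp: bij_def)
  have bij: "bij_betw (map_permutation UNIV f) {p. p permutes UNIV} {p. p permutes UNIV}"
  proof -
    have "map_permutation UNIV f = (\<lambda>\<pi> x. if x \<in> UNIV then f (\<pi> (inv_into UNIV f x)) else x)"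
      by (auto simp: map_permutation_def restrict_id_def f fun_eq_iff)
    then show ?thesis using bij_betw_permutations[of f UNIV UNIV] assms by simp
  qed
  have "det A = (\<Sum>p | p permutes (UNIV::'m set). of_int (sign (map_permutation UNIV f p)) *
      (\<Prod>i\<in>UNIV. A $ i $ map_permutation UNIV f p i))"
    unfolding det_def by (rule sum.reindex_bij_betw[OF bij, symmetric])
  also have "\<dots> = (\<Sum>p | p permutes (UNIV::'m set). of_int (sign p) * (\<Prod>i\<in>UNIV. A $ f i $ f (p i)))"
  proof (intro sum.cong refl)
    fix p assume p: "p \<in> {p. p permutes (UNIV::'m set)}"
    have "(\<Prod>i\<in>UNIV. A $ i $ map_permutation UNIV f p i) = (\<Prod>i\<in>UNIV. A $ f i $ map_permutation UNIV f p (f i))"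
      by (rule prod.reindex_bij_betw[OF assms, symmetric])
    also have "\<dots> = (\<Prod>i\<in>UNIV. A $ f i $ f (p i))"
      using f by (simp add: map_permutation_apply)
    finally show "of_int (sign (map_permutation UNIV f p)) * (\<Prod>i\<in>UNIV. A $ i $ map_permutation UNIV f p i)
       = of_int (sign p) * (\<Prod>i\<in>UNIV. A $ f i $ f (p i))"
      using sign_map_permutation[of f UNIV p] f p by simp
  qed
  finally show ?thesis by (simp add: det_def)
qed

section \<open>Relabelling of coordinates\<close>

definition reindex :: "('m \<Rightarrow> 'n) \<Rightarrow> real^'n \<Rightarrow> real^'m" where
  "reindex f x = (\<chi> i. x $ f i)"

lemma reindex_nth: "reindex f x $ i = x $ f i"
  by (simp add: reindex_def)

lemma linear_reindex: "linear (reindex f :: real^'n::finite \<Rightarrow> real^'m::finite)"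
  by (auto simp: linear_iff reindex_def vec_eq_iff)

lemma reindex_inverse:
  assumes "bij f"
  shows "reindex (inv f) (reindex f x) = x" "reindex f (reindex (inv f) y) = y"
  using assms by (auto simp: reindex_def vec_eq_iff bij_def surj_f_inv_f)

text \<open>Lebesgue measure is determined by its values on boxes, and relabelling coordinates sends
  a box to a box with the same edge lengths in another order.\<close>

lemma emeasure_reindex:
  fixes f :: "'m::finite \<Rightarrow> 'n::finite"
  assumes "bij f" and E: "E \<in> sets borel"
  shows "emeasure lborel (reindex f ` E) = emeasure lborel E"
proof -
  let ?r = "reindex (inv f) :: real^'m \<Rightarrow> real^'n"
  have meas: "?r \<in> borel_measurable borel"
    by (intro borel_measurable_continuous_onI linear_continuous_on linear_linear[THEN iffD2] linear_reindex)
  have "lborel = distr lborel borel ?r"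
  proof (rule lborel_eqI)
    fix l u :: "real^'n" assume le: "\<And>b. b \<in> Basis \<Longrightarrow> l \<bullet> b \<le> u \<bullet> b"
    have v: "?r -` box l u = box (reindex f l) (reindex f u)"
    proof (intro set_eqI)
      fix x :: "real^'m"
      have "(\<forall>i. l $ i < x $ inv f i \<and> x $ inv f i < u $ i) \<longleftrightarrow> (\<forall>i. l $ f i < x $ i \<and> x $ i < u $ f i)"
        using assms(1) by (metis bij_inv_eq_iff)
      then show "x \<in> ?r -` box l u \<longleftrightarrow> x \<in> box (reindex f l) (reindex f u)"
        by (simp add: mem_box_cart reindex_def)
    qed
    have P: "(\<Prod>b\<in>Basis. w \<bullet> b) = (\<Prod>i\<in>UNIV. w $ i)" for w :: "real^'k::finite"
    proof -
      have B: "Basis = range (\<lambda>i::'k. axis i (1::real))" by (auto simp: Basis_vec_def)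
      show ?thesis unfolding B by (subst prod.reindex) (auto simp: inj_on_def axis_eq_axis inner_axis)
    qed
    have le': "l $ i \<le> u $ i" for i using le[of "axis i 1"] by (auto simp: Basis_vec_def inner_axis)
    have "emeasure (distr lborel borel ?r) (box l u) = emeasure lborel (box (reindex f l) (reindex f u))"
      using meas by (simp add: emeasure_distr v)
    also have "\<dots> = (\<Prod>b\<in>Basis. (reindex f u - reindex f l) \<bullet> b)"
      by (rule emeasure_lborel_box) (auto simp: Basis_vec_def inner_axis reindex_def le')
    also have "\<dots> = (\<Prod>i\<in>UNIV. (u - l) $ f i)" unfolding P by (simp add: reindex_def)
    also have "\<dots> = (\<Prod>i\<in>UNIV. (u - l) $ i)" 
      by (rule arg_cong[where f = ennreal]) (rule prod.reindex_bij_betw[OF assms(1)])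
    finally show "emeasure (distr lborel borel ?r) (box l u) = (\<Prod>b\<in>Basis. (u - l) \<bullet> b)" unfolding P .
  qed simp
  then have "emeasure lborel E = emeasure (distr lborel borel ?r) E" by simp
  also have "\<dots> = emeasure lborel (?r -` E)" using meas E by (simp add: emeasure_distr)
  also have "?r -` E = reindex f ` E"
    using reindex_inverse[OF assms(1)] by (auto simp: image_iff) (metis)
  finally show ?thesis by simp
qed

lemma reindex_has_derivative: "(reindex f has_derivative reindex f) (at x)"
  for f :: "'m::finite \<Rightarrow> 'n::finite"
  by (intro bounded_linear_imp_has_derivative linear_linear[THEN iffD2] linear_reindex)

text \<open>Conjugating \<open>F\<close> by the relabelling to \<open>'n enumerated\<close> changes
  neither Lebesgue measure nor the Jacobian determinant, so the result for the ordered index type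
  carries over.\<close>

lemma emeasure_image:
  fixes F :: "real^'n::finite \<Rightarrow> real^'n"
  assumes U: "open U" and der: "\<And>x. x \<in> U \<Longrightarrow> F differentiable (at x)"
    and cont: "continuous_on U (\<lambda>x. det (jacobian F x))"
    and inj: "inj_on F U" and E: "E \<in> sets borel" "E \<subseteq> U"
  shows "emeasure lborel (F ` E) = (\<integral>\<^sup>+x\<in>E. ennreal \<bar>det (jacobian F x)\<bar> \<partial>lborel)"
proof -
  let ?e = "Rep_enumerated :: 'n enumerated \<Rightarrow> 'n"
  let ?r = "reindex ?e" and ?s = "reindex (inv ?e)"
  note b = bij_Rep_enumerated[where ?'a='n]
  note [simp] = reindex_inverse[OF b]
  have cl: "continuous_on S ?s" "continuous_on T ?r" for S T
    by (intro linear_continuous_on linear_linear[THEN iffD2] linear_reindex)+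
  have rU: "?r ` S = ?s -` S" for S
    by (auto simp: image_iff) (metis reindex_inverse(2)[OF b])
  have sr: "?s ` ?r ` S = S" for S by (force simp: image_iff)
  let ?F = "\<lambda>y. ?r (F (?s y))" and ?F' = "\<lambda>y h. ?r (frechet_derivative F (at (?s y)) (?s h))"
  have dF: "(?F has_derivative ?F' y) (at y)" if "y \<in> ?r ` U" for y
  proof -
    have "?s y \<in> U" using that rU by auto
    then have "((\<lambda>y. F (?s y)) has_derivative (\<lambda>h. frechet_derivative F (at (?s y)) (?s h))) (at y)"
      using diff_chain_at[OF reindex_has_derivative has_derivative_frechet[OF der]] by (simp add: o_def)
    from diff_chain_at[OF this reindex_has_derivative] show ?thesis by (simp add: o_def)
  qed
  have detF: "det (matrix (?F' y)) = det (jacobian F (?s y))" for y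
  proof -
    have s: "?s (axis j 1) = axis (?e j) 1" for j
    proof -
      have "inv ?e i = j \<longleftrightarrow> i = ?e j" for i using b by (metis bij_inv_eq_iff)
      then show ?thesis by (auto simp: reindex_def vec_eq_iff axis_def)
    qed
    have "matrix (?F' y) = (\<chi> i j. jacobian F (?s y) $ ?e i $ ?e j)"
      by (simp add: matrix_def jacobian_def s vec_eq_iff reindex_nth)
    then show ?thesis using det_reindex[OF b] by simp
  qed
  have cE: "?r ` S \<in> sets borel" if "S \<in> sets borel" for S
  proof -
    have "homeomorphism UNIV UNIV ?r ?s"
      by (auto simp: homeomorphism_def cl image_iff) (metis reindex_inverse[OF b])+
    from homeomorphism_image_borel[OF this _ _ that] show ?thesis by simp
  qed
  have "continuous_on U F" using der differentiable_imp_continuous_within continuous_at_imp_continuous_on by blast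
  then obtain g where g: "homeomorphism U (F ` U) F g" and op: "open (F ` U)"
    using invariance_of_domain_homeomorphism[OF U _ _ inj] invariance_of_domain[OF _ U inj] by auto
  have FE: "F ` E \<in> sets borel" using homeomorphism_image_borel[OF g _ _ E] U op by auto
  have [measurable]: "(\<lambda>x. indicator E x * ennreal \<bar>det (jacobian F x)\<bar>) \<in> borel_measurable borel"
  proof -
    have "(\<lambda>x. if x \<in> U then \<bar>det (jacobian F x)\<bar> else 0) \<in> borel_measurable borel"
      using U by (intro borel_measurable_continuous_on_if continuous_intros cont) auto
    then have "(\<lambda>x. indicator E x * ennreal (if x \<in> U then \<bar>det (jacobian F x)\<bar> else 0)) \<in> borel_measurable borel"
      using E by measurable
    moreover have "(\<lambda>x. indicator E x * ennreal (if x \<in> U then \<bar>det (jacobian F x)\<bar> else 0)) = (\<lambda>x. indicator E x * ennreal \<bar>det (jacobian F x)\<bar>)"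
      by (rule ext) (use E in \<open>auto simp: indicator_def\<close>)
    ultimately show ?thesis by simp
  qed
  have "emeasure lborel (F ` E) = emeasure lborel (?r ` F ` E)" using emeasure_reindex[OF b FE] by simp
  also have "?r ` F ` E = ?F ` (?r ` E)" by (simp add: image_image)
  also have "emeasure lborel \<dots> = (\<integral>\<^sup>+y\<in>?r ` E. ennreal \<bar>det (matrix (?F' y))\<bar> \<partial>lborel)"
  proof (rule emeasure_image_wellorder[of "?r ` U"])
    show "open (?r ` U)" unfolding rU using U cl(1)[of UNIV] by (simp add: open_vimage)
    show "continuous_on (?r ` U) (\<lambda>x. det (matrix (?F' x)))"
      unfolding detF by (rule continuous_on_compose2[OF cont cl(1)]) (simp add: sr)
    show "inj_on ?F (?r ` U)"
    proof (rule inj_onI)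
      fix x y assume xy: "x \<in> ?r ` U" "y \<in> ?r ` U" "?F x = ?F y"
      then have "F (?s x) = F (?s y)" by (metis reindex_inverse(1)[OF b])
      then have "?s x = ?s y" using xy inj rU by (metis inj_onD vimageD)
      then show "x = y" by (metis reindex_inverse(2)[OF b])
    qed
    show "?r ` E \<in> sets borel" using cE E by blast
  qed (use dF E in auto)
  also have "\<dots> = (\<integral>\<^sup>+y. indicator E (?s y) * ennreal \<bar>det (jacobian F (?s y))\<bar> \<partial>lborel)"
    by (intro nn_integral_cong) (auto simp: detF rU indicator_def mult.commute)
  also have "\<dots> = (\<integral>\<^sup>+x. indicator E x * ennreal \<bar>det (jacobian F x)\<bar> \<partial>(distr lborel borel ?s))"
    by (subst nn_integral_distr) (auto intro: borel_measurable_continuous_onI cl)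
  also have "distr lborel borel ?s = lborel"
  proof (rule measure_eqI)
    fix A assume "A \<in> sets (distr lborel borel ?s)"
    then have A: "A \<in> sets borel" by simp
    have "emeasure (distr lborel borel ?s) A = emeasure lborel (?s -` A)"
      using A by (subst emeasure_distr) (auto intro: borel_measurable_continuous_onI cl)
    then show "emeasure (distr lborel borel ?s) A = emeasure lborel A"
      using emeasure_reindex[OF b A] by (simp add: rU)
  qed simp
  finally show ?thesis by (simp add: mult.commute)
qed

text \<open>By the measure formula, Lebesgue measure on the image of \<open>U\<close> is the
  push-forward under \<open>F\<close> of the measure whose density is the absolute Jacobian
  determinant; integrals of arbitrary measurable functions then follow from the rules for
  push-forwards and densities.\<close>

lemma nn_integral_change_of_variables:
  fixes F :: "real^'n::finite \<Rightarrow> real^'n" and f :: "real^'n \<Rightarrow> ennreal"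
  assumes U: "open U" and der: "\<And>x. x \<in> U \<Longrightarrow> F differentiable (at x)"
    and cont: "continuous_on U (\<lambda>x. det (jacobian F x))" and inj: "inj_on F U"
    and f: "f \<in> borel_measurable (restrict_space borel (F ` U))"
  shows "(\<integral>\<^sup>+y\<in>F ` U. f y \<partial>lborel) = (\<integral>\<^sup>+x\<in>U. ennreal \<bar>det (jacobian F x)\<bar> * f (F x) \<partial>lborel)"
proof -
  have cF: "continuous_on U F" using der differentiable_imp_continuous_within continuous_at_imp_continuous_on by blast
  have op: "open (F ` U)" using invariance_of_domain[OF cF U inj] .
  obtain g where g: "homeomorphism U (F ` U) F g"
    using invariance_of_domain_homeomorphism[OF U cF _ inj] by auto
  have Fm [measurable]: "F \<in> restrict_space borel U \<rightarrow>\<^sub>M restrict_space borel (F ` U)"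
    by (intro measurable_restrict_space2 borel_measurable_continuous_on_restrict cF) (auto simp: space_restrict_space)
  have dm: "(\<lambda>x. ennreal \<bar>det (jacobian F x)\<bar>) \<in> borel_measurable (restrict_space borel U)"
    by (intro measurable_ennreal[THEN measurable_compose_rev] borel_measurable_continuous_on_restrict continuous_intros cont)
  let ?L = "restrict_space lborel U" and ?M = "restrict_space lborel (F ` U)"
  have dm': "(\<lambda>x. ennreal \<bar>det (jacobian F x)\<bar>) \<in> borel_measurable ?L"
    using dm by (simp cong: measurable_cong_sets add: sets_restrict_space_cong[OF sets_lborel])
  have Fm': "F \<in> ?L \<rightarrow>\<^sub>M ?M"
    using Fm by (simp cong: measurable_cong_sets add: sets_restrict_space_cong[OF sets_lborel])
  have f': "f \<in> borel_measurable ?M"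
    using f by (simp cong: measurable_cong_sets add: sets_restrict_space_cong[OF sets_lborel])
  have eq: "?M = distr (density ?L (\<lambda>x. ennreal \<bar>det (jacobian F x)\<bar>)) ?M F"
  proof (rule measure_eqI)
    fix A assume A: "A \<in> sets ?M"
    then have AU: "A \<subseteq> F ` U" "A \<in> sets borel" using op by (auto simp: sets_restrict_space_iff)
    let ?E = "F -` A \<inter> U"
    have "?E \<in> sets ?L" using measurable_sets[OF Fm' A] by (simp add: space_restrict_space)
    then have E: "?E \<in> sets borel" using U by (auto simp: sets_restrict_space_iff)
    have "F ` ?E = A" using AU by auto
    then have "emeasure lborel A = (\<integral>\<^sup>+x\<in>?E. ennreal \<bar>det (jacobian F x)\<bar> \<partial>lborel)"
      using emeasure_image[OF U der cont inj E] by simp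
    also have "\<dots> = emeasure (density ?L (\<lambda>x. ennreal \<bar>det (jacobian F x)\<bar>)) ?E"
      using \<open>?E \<in> sets ?L\<close> U
      by (subst emeasure_density[OF dm'], simp, subst nn_integral_restrict_space)
         (auto intro!: nn_integral_cong simp: indicator_def)
    also have "\<dots> = emeasure (distr (density ?L (\<lambda>x. ennreal \<bar>det (jacobian F x)\<bar>)) ?M F) A"
      using Fm' A by (subst emeasure_distr) (auto simp: space_restrict_space)
    finally show "emeasure ?M A = emeasure (distr (density ?L (\<lambda>x. ennreal \<bar>det (jacobian F x)\<bar>)) ?M F) A"
      using AU op by (simp add: emeasure_restrict_space)
  qed simp
  have "(\<integral>\<^sup>+y\<in>F ` U. f y \<partial>lborel) = integral\<^sup>N ?M f"
    using op by (simp add: nn_integral_restrict_space)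
  also have "\<dots> = integral\<^sup>N (density ?L (\<lambda>x. ennreal \<bar>det (jacobian F x)\<bar>)) (\<lambda>x. f (F x))"
    by (subst eq) (rule nn_integral_distr, use Fm' f' in auto)
  also have "\<dots> = (\<integral>\<^sup>+x. ennreal \<bar>det (jacobian F x)\<bar> * f (F x) \<partial>?L)"
    by (intro nn_integral_density dm' measurable_compose[OF Fm' f'])
  also have "\<dots> = (\<integral>\<^sup>+x\<in>U. ennreal \<bar>det (jacobian F x)\<bar> * f (F x) \<partial>lborel)"
    using U by (simp add: nn_integral_restrict_space)
  finally show ?thesis .
qed

section \<open>Coordinate invariance of the scalar curvature\<close>

lemma matrix_vector_mult_cancel:
  fixes A :: "real^'n::finite^'n"
  assumes "det A \<noteq> 0" "A *v x = A *v y"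
  shows "x = y"
proof -
  have "matrix_inv A *v (A *v z) = z" for z
    by (simp add: matrix_vector_mul_assoc matrix_inv_right[OF assms(1)])
  then show ?thesis using assms(2) by metis
qed

text \<open>The bilinear map with values \<open>\<Gamma> b c\<close> on basis vectors. Index sums
  are turned into it so that transformation laws can be handled by additivity and symmetry instead
  of by reordering sums.\<close>

definition contract :: "('n::finite \<Rightarrow> 'n \<Rightarrow> 'b::real_vector) \<Rightarrow> real^'n \<Rightarrow> real^'n \<Rightarrow> 'b" where
  "contract \<Gamma> u v = (\<Sum>b\<in>UNIV. \<Sum>c\<in>UNIV. (u $ b * v $ c) *\<^sub>R \<Gamma> b c)"

lemma contract_add:
  "contract \<Gamma> (u + u') v = contract \<Gamma> u v + contract \<Gamma> u' v"
  "contract \<Gamma> u (v + v') = contract \<Gamma> u v + contract \<Gamma> u v'"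
  by (simp_all add: contract_def sum.distrib algebra_simps)

lemma contract_sum_right:
  "contract \<Gamma> u (\<Sum>k\<in>I. s k *\<^sub>R v k) = (\<Sum>k\<in>I. s k *\<^sub>R contract \<Gamma> u (v k))"
proof (induction I rule: infinite_finite_induct)
  case (insert a I)
  have "contract \<Gamma> u (s a *\<^sub>R v a) = s a *\<^sub>R contract \<Gamma> u (v a)"
    by (simp add: contract_def scaleR_sum_right mult_ac)
  then show ?case using insert by (simp add: contract_add)
qed (simp_all add: contract_def)

lemma contract_commute:
  "(\<And>b c. \<Gamma> b c = \<Gamma> c b) \<Longrightarrow> contract \<Gamma> u v = contract \<Gamma> v u"
  unfolding contract_def by (subst sum.swap) (simp add: mult_ac)

lemma contract_has_derivative:
  fixes \<Gamma> :: "real^'m \<Rightarrow> 'n::finite \<Rightarrow> 'n \<Rightarrow> 'b::real_normed_vector"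
  assumes "\<And>b c. ((\<lambda>z. \<Gamma> z b c) has_derivative \<Gamma>' b c) (at y)"
    and "(u has_derivative u') (at y)" "(v has_derivative v') (at y)"
  shows "((\<lambda>z. contract (\<Gamma> z) (u z) (v z)) has_derivative
     (\<lambda>h. contract (\<lambda>b c. \<Gamma>' b c h) (u y) (v y) + contract (\<Gamma> y) (u' h) (v y) + contract (\<Gamma> y) (u y) (v' h))) (at y)"
proof -
  have n: "((\<lambda>z. w z $ k) has_derivative (\<lambda>h. w' h $ k)) (at y)"
    if "(w has_derivative w') (at y)" for w :: "real^'m \<Rightarrow> real^'n" and w' k
    using bounded_linear.has_derivative[OF bounded_linear_vec_nth that] .
  have "((\<lambda>z. contract (\<Gamma> z) (u z) (v z)) has_derivative
     (\<lambda>h. \<Sum>b\<in>UNIV. \<Sum>c\<in>UNIV. (u y $ b * v y $ c) *\<^sub>R \<Gamma>' b c h + (u y $ b * v' h $ c + u' h $ b * v y $ c) *\<^sub>R \<Gamma> y b c)) (at y)"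
    unfolding contract_def
    by (intro has_derivative_sum has_derivative_scaleR has_derivative_mult n assms)
  then show ?thesis
    by (rule has_derivative_eq_rhs) (auto simp: contract_def sum.distrib algebra_simps)
qed

text \<open>As a vector this is the covariant derivative of the coordinate field with index
  \<open>j\<close> along the one with index \<open>i\<close>.\<close>

definition christoffel_vec :: "(real^'n \<Rightarrow> real^'n^'n) \<Rightarrow> real^'n \<Rightarrow> 'n::finite \<Rightarrow> 'n \<Rightarrow> real^'n" where
  "christoffel_vec G y i j = (\<chi> k. christoffel G k i j y)"

text \<open>The commutator of the covariant derivatives along the coordinate fields \<open>l\<close>
  and \<open>j\<close>, applied to the field \<open>i\<close>. Its trace over \<open>l\<close> is
  the Ricci curvature.\<close>

definition riemann_vec :: "(real^'n \<Rightarrow> real^'n^'n) \<Rightarrow> real^'n \<Rightarrow> 'n::finite \<Rightarrow> 'n \<Rightarrow> 'n \<Rightarrow> real^'n" where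
  "riemann_vec G y i l j =
     frechet_derivative (\<lambda>z. christoffel_vec G z i j) (at y) (axis l 1)
     - frechet_derivative (\<lambda>z. christoffel_vec G z i l) (at y) (axis j 1)
     + (\<Sum>m\<in>UNIV. christoffel_vec G y i j $ m *\<^sub>R christoffel_vec G y l m)
     - (\<Sum>m\<in>UNIV. christoffel_vec G y i l $ m *\<^sub>R christoffel_vec G y j m)"

locale local_metric =
  fixes V :: "(real^'n::finite) set" and G :: "real^'n \<Rightarrow> real^'n^'n"
  assumes V: "open V" and G_smooth: "\<And>i j. smooth_on V (\<lambda>y. G y $ i $ j)"
    and G_sym: "\<And>y i j. y \<in> V \<Longrightarrow> G y $ i $ j = G y $ j $ i"
    and G_det: "\<And>y. y \<in> V \<Longrightarrow> det (G y) \<noteq> 0"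
begin

lemma christoffel_smooth: "smooth_on V (christoffel G k i j)"
  unfolding christoffel_def[abs_def]
  by (intro smooth_on_mult smooth_on_sum smooth_on_add smooth_on_diff smooth_on_const
      smooth_on_matrix_inv smooth_on_partial_deriv V G_smooth G_det)

lemma local_scalar_curvature_smooth: "smooth_on V (local_scalar_curvature G)"
  unfolding local_scalar_curvature_def[abs_def] ricci_def
  by (intro smooth_on_mult smooth_on_sum smooth_on_add smooth_on_diff smooth_on_const
      smooth_on_matrix_inv smooth_on_partial_deriv V G_smooth G_det christoffel_smooth)

lemma partial_G_sym: "y \<in> V \<Longrightarrow> partial_deriv l (\<lambda>x. G x $ i $ j) y = partial_deriv l (\<lambda>x. G x $ j $ i) y"
  unfolding partial_deriv_def
  using differentiable_cong_open(2)[OF V, of y "\<lambda>x. G x $ j $ i" "\<lambda>x. G x $ i $ j"] G_sym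
    smooth_on_differentiable[OF G_smooth] by simp

lemma christoffel_vec_sym: "y \<in> V \<Longrightarrow> christoffel_vec G y i j = christoffel_vec G y j i"
  using partial_G_sym[of y _ i j] by (simp add: christoffel_vec_def christoffel_def vec_eq_iff algebra_simps)

lemma christoffel_vec_has_derivative:
  assumes "y \<in> V"
  shows "((\<lambda>z. christoffel_vec G z i j) has_derivative
           (\<lambda>v. \<chi> k. frechet_derivative (christoffel G k i j) (at y) v)) (at y)"
proof -
  have "((\<lambda>z. \<Sum>k\<in>UNIV. christoffel G k i j z *\<^sub>R axis k (1::real)) has_derivative
     (\<lambda>v. \<Sum>k\<in>UNIV. frechet_derivative (christoffel G k i j) (at y) v *\<^sub>R axis k 1)) (at y)"
    by (intro has_derivative_sum has_derivative_scaleR_left has_derivative_frechet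
        smooth_on_differentiable[OF christoffel_smooth assms])
  moreover have "(\<Sum>k\<in>UNIV. f k *\<^sub>R axis k (1::real)) = (\<chi> k. f k)" for f :: "'n \<Rightarrow> real"
    using basis_expansion[of "\<chi> k. f k"] by (simp add: scalar_mult_eq_scaleR)
  ultimately show ?thesis by (simp add: christoffel_vec_def)
qed

lemma riemann_vec_nth:
  assumes "y \<in> V"
  shows "riemann_vec G y i l j $ k = partial_deriv l (christoffel G k i j) y - partial_deriv j (christoffel G k i l) y
    + (\<Sum>m\<in>UNIV. christoffel G k l m y * christoffel G m i j y) - (\<Sum>m\<in>UNIV. christoffel G k j m y * christoffel G m i l y)"
  unfolding riemann_vec_def frechet_derivative_eqI[OF christoffel_vec_has_derivative[OF assms]]
  by (simp add: partial_deriv_def christoffel_vec_def mult.commute)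

lemma ricci_eq: "y \<in> V \<Longrightarrow> ricci G i j y = (\<Sum>k\<in>UNIV. riemann_vec G y i k j $ k)"
  by (simp add: riemann_vec_nth ricci_def sum.distrib sum_subtractf)

text \<open>Lowering the index removes the inverse matrix from the definition. In this form, linear
  in the derivatives of the metric, the symbols of two coordinate systems can be compared.\<close>

lemma metric_christoffel:
  assumes "y \<in> V"
  shows "(G y *v christoffel_vec G y i j) $ l = (1/2) * (partial_deriv i (\<lambda>x. G x $ j $ l) y +
     partial_deriv j (\<lambda>x. G x $ i $ l) y - partial_deriv l (\<lambda>x. G x $ i $ j) y)"
proof -
  define w where "w = (\<chi> l. (1/2) * (partial_deriv i (\<lambda>x. G x $ j $ l) y +
     partial_deriv j (\<lambda>x. G x $ i $ l) y - partial_deriv l (\<lambda>x. G x $ i $ j) y))"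
  have "christoffel_vec G y i j = matrix_inv (G y) *v w"
    by (simp add: vec_eq_iff christoffel_vec_def christoffel_def matrix_vector_mult_def w_def sum_distrib_left mult_ac)
  then have "G y *v christoffel_vec G y i j = w"
    using matrix_inv_right[OF G_det[OF assms]] by (simp add: matrix_vector_mul_assoc)
  then show ?thesis by (simp add: w_def)
qed

end

text \<open>\<open>F\<close> may be a transition map of one metric or the coordinate expression of
  an isometry between two manifolds; chart independence and isometry invariance of the curvature
  thus come from one computation.\<close>

locale local_isometry = S: local_metric U G' + T: local_metric V G for U G' V G +
  fixes F :: "real^'n::finite \<Rightarrow> real^'n"
  assumes FU: "F ` U \<subseteq> V" and F_smooth: "smooth_on U F"
    and pull: "\<And>y. y \<in> U \<Longrightarrow> G' y = transpose (jacobian F y) ** G (F y) ** jacobian F y"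
begin

text \<open>First and second derivatives of \<open>F\<close> along coordinate directions, as
  vectors. In \<open>HF y i j\<close> the outer derivative is the one in direction
  \<open>i\<close>.\<close>

definition "DF y i = frechet_derivative F (at y) (axis i 1)"
definition "HF y i j = frechet_derivative (\<lambda>z. DF z j) (at y) (axis i 1)"
abbreviation "CH y \<equiv> christoffel_vec G (F y)"
abbreviation "CH' y \<equiv> christoffel_vec G' y"

lemma FV: "y \<in> U \<Longrightarrow> F y \<in> V" using FU by blast

lemma DF_smooth: "smooth_on U (\<lambda>y. DF y i)"
  unfolding DF_def using F_smooth smooth_on_frechet by blast

lemma HF_smooth: "smooth_on U (\<lambda>y. HF y i j)"
  unfolding HF_def using DF_smooth smooth_on_frechet by blast

lemma frechet_nth:
  fixes f :: "real^'n \<Rightarrow> real^'n"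
  assumes "f differentiable (at y)"
  shows "frechet_derivative f (at y) v $ a = frechet_derivative (\<lambda>z. f z $ a) (at y) v"
  using frechet_derivative_eqI[OF bounded_linear.has_derivative[OF bounded_linear_vec_nth has_derivative_frechet[OF assms]]]
  by metis

lemma schwarz_vec:
  fixes f :: "real^'n \<Rightarrow> real^'n"
  assumes "smooth_on U f" "y \<in> U"
  shows "frechet_derivative (\<lambda>z. frechet_derivative f (at z) u) (at y) v =
         frechet_derivative (\<lambda>z. frechet_derivative f (at z) v) (at y) u"
proof -
  have 1: "frechet_derivative (\<lambda>z. frechet_derivative f (at z) u) (at y) v $ a =
    frechet_derivative (\<lambda>z. frechet_derivative (\<lambda>z. f z $ a) (at z) u) (at y) v" for u v a
  proof -
    have s: "smooth_on U (\<lambda>z. frechet_derivative f (at z) u)" by (intro smooth_on_frechet assms)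
    have "frechet_derivative (\<lambda>z. frechet_derivative f (at z) u) (at y) v $ a =
      frechet_derivative (\<lambda>z. frechet_derivative f (at z) u $ a) (at y) v"
      using frechet_nth[OF smooth_on_differentiable[OF s assms(2)]] .
    also have "frechet_derivative (\<lambda>z. frechet_derivative f (at z) u $ a) (at y)
        = frechet_derivative (\<lambda>z. frechet_derivative (\<lambda>z. f z $ a) (at z) u) (at y)"
    proof (rule differentiable_cong_open(2)[OF S.V assms(2)])
      show "frechet_derivative (\<lambda>z. f z $ a) (at z) u = frechet_derivative f (at z) u $ a" if "z \<in> U" for z
        using frechet_nth[OF smooth_on_differentiable[OF assms(1) that]] by metis
      show "(\<lambda>z. frechet_derivative (\<lambda>z. f z $ a) (at z) u) differentiable at y"
        by (rule smooth_on_differentiable[OF smooth_on_frechet[OF smooth_on_nth[OF S.V assms(1)]] assms(2)])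
    qed
    finally show ?thesis .
  qed
  show ?thesis
    using symmetric_second_derivative[OF S.V assms(2) smooth_on_nth[OF S.V assms(1)]] by (simp add: vec_eq_iff 1)
qed

lemma HF_sym: "y \<in> U \<Longrightarrow> HF y i j = HF y j i"
  unfolding HF_def DF_def by (rule schwarz_vec[OF F_smooth])

text \<open>The two inner indices are exchanged by \<open>HF_sym\<close> and the two outer ones by
  symmetry of second derivatives of \<open>DF\<close>; together they permute all three. By this
  symmetry the third derivatives of \<open>F\<close> cancel in the curvature.\<close>

lemma third_sym:
  assumes "y \<in> U"
  shows "frechet_derivative (\<lambda>z. HF z i j) (at y) (axis l 1) = frechet_derivative (\<lambda>z. HF z i l) (at y) (axis j 1)"
proof -
  have sw: "frechet_derivative (\<lambda>z. HF z i j) (at y) = frechet_derivative (\<lambda>z. HF z j i) (at y)" for i j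
    using differentiable_cong_open(2)[OF S.V assms, of "\<lambda>z. HF z j i" "\<lambda>z. HF z i j"]
      HF_sym smooth_on_differentiable[OF HF_smooth assms] by blast
  have "frechet_derivative (\<lambda>z. HF z j i) (at y) (axis l 1) = frechet_derivative (\<lambda>z. HF z l i) (at y) (axis j 1)"
    unfolding HF_def by (rule schwarz_vec[OF DF_smooth assms])
  then show ?thesis by (metis sw)
qed

lemma DF_has_derivative: "y \<in> U \<Longrightarrow> ((\<lambda>z. DF z i) has_derivative frechet_derivative (\<lambda>z. DF z i) (at y)) (at y)"
  by (intro has_derivative_frechet smooth_on_differentiable[OF DF_smooth])

lemma jacobian_nth: "jacobian F y $ a $ i = DF y i $ a"
  by (simp add: jacobian_def matrix_def DF_def)

lemma jacobian_mult: "y \<in> U \<Longrightarrow> jacobian F y *v x = (\<Sum>k\<in>UNIV. x $ k *\<^sub>R DF y k)"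
  by (simp add: vec_eq_iff matrix_vector_mult_def jacobian_nth mult_ac)

lemma det_jacobian: "y \<in> U \<Longrightarrow> det (jacobian F y) \<noteq> 0"
  using pull[of y] S.G_det[of y] by (auto simp: det_mul)

lemma pull_contract: "y \<in> U \<Longrightarrow> G' y $ i $ j = contract (\<lambda>a b. G (F y) $ a $ b) (DF y i) (DF y j)"
proof -
  assume "y \<in> U"
  then have "G' y $ i $ j = (\<Sum>b\<in>UNIV. \<Sum>a\<in>UNIV. DF y i $ a * G (F y) $ a $ b * DF y j $ b)"
    by (simp add: pull matrix_matrix_mult_def transpose_def jacobian_nth sum_distrib_right)
  also have "\<dots> = contract (\<lambda>a b. G (F y) $ a $ b) (DF y i) (DF y j)"
    unfolding contract_def by (subst sum.swap) (simp add: mult_ac)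
  finally show ?thesis .
qed

lemma has_derivative_compF:
  assumes "y \<in> U" "(f has_derivative f') (at (F y))"
  shows "((\<lambda>z. f (F z)) has_derivative (\<lambda>v. f' (frechet_derivative F (at y) v))) (at y)"
  using diff_chain_at[OF has_derivative_frechet[OF smooth_on_differentiable[OF F_smooth assms(1)]] assms(2)]
  by (simp add: o_def)

definition "TG y u v w = contract (\<lambda>a b. frechet_derivative (\<lambda>x. G x $ a $ b) (at (F y)) w) u v"

lemma partial_pull:
  assumes "y \<in> U"
  shows "partial_deriv i (\<lambda>x. G' x $ j $ l) y = TG y (DF y j) (DF y l) (DF y i)
      + contract (\<lambda>a b. G (F y) $ a $ b) (HF y i j) (DF y l)
      + contract (\<lambda>a b. G (F y) $ a $ b) (DF y j) (HF y i l)"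
proof -
  have d: "((\<lambda>z. contract (\<lambda>a b. G (F z) $ a $ b) (DF z j) (DF z l)) has_derivative
     (\<lambda>h. contract (\<lambda>a b. frechet_derivative (\<lambda>x. G x $ a $ b) (at (F y)) (frechet_derivative F (at y) h)) (DF y j) (DF y l)
       + contract (\<lambda>a b. G (F y) $ a $ b) (frechet_derivative (\<lambda>z. DF z j) (at y) h) (DF y l)
       + contract (\<lambda>a b. G (F y) $ a $ b) (DF y j) (frechet_derivative (\<lambda>z. DF z l) (at y) h))) (at y)"
    by (intro contract_has_derivative DF_has_derivative has_derivative_compF has_derivative_frechet
        smooth_on_differentiable[OF T.G_smooth] FV assms)
  have "frechet_derivative (\<lambda>x. G' x $ j $ l) (at y) = frechet_derivative (\<lambda>z. contract (\<lambda>a b. G (F z) $ a $ b) (DF z j) (DF z l)) (at y)"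
    by (rule differentiable_cong_open(2)[OF S.V assms]) (use d pull_contract in \<open>auto simp: differentiable_def\<close>)
  then show ?thesis
    unfolding partial_deriv_def frechet_derivative_eqI[OF d] by (simp add: TG_def HF_def DF_def)
qed

lemma TG_expand:
  "y \<in> U \<Longrightarrow> TG y u v w = (\<Sum>a\<in>UNIV. \<Sum>b\<in>UNIV. \<Sum>c\<in>UNIV. u $ a * v $ b * w $ c * partial_deriv c (\<lambda>x. G x $ a $ b) (F y))"
  by (simp add: TG_def contract_def frechet_derivative_partial[OF smooth_on_differentiable[OF T.G_smooth FV]]
      sum_distrib_left mult_ac)

text \<open>The Koszul formula for vectors with constant coefficients, obtained by contracting
  \<open>metric_christoffel\<close> with three vectors. The rest is bookkeeping: three triple sums
  are matched with \<open>TG\<close> by permuting their indices.\<close>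

lemma christoffel_pair:
  assumes "y \<in> U"
  shows "contract (\<lambda>a b. G (F y) $ a $ b) w (contract (CH y) u v) = (1/2) * (TG y v w u + TG y u w v - TG y u v w)"
proof -
  let ?d = "\<lambda>c a b. partial_deriv c (\<lambda>x. G x $ a $ b) (F y)"
  have "contract (\<lambda>a b. G (F y) $ a $ b) w z = (\<Sum>a\<in>UNIV. w $ a * (G (F y) *v z) $ a)" for z
    by (simp add: contract_def matrix_vector_mult_def sum_distrib_left mult_ac)
  then have "contract (\<lambda>a b. G (F y) $ a $ b) w (contract (CH y) u v)
    = (\<Sum>a\<in>UNIV. w $ a * (G (F y) *v (contract (CH y) u v)) $ a)" .
  also have "G (F y) *v (contract (CH y) u v) = contract (\<lambda>b c. G (F y) *v CH y b c) u v"
    unfolding contract_def by (simp add: linear_sum[OF matrix_vector_mul_linear] linear_cmul[OF matrix_vector_mul_linear])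
  also have "(\<Sum>a\<in>UNIV. w $ a * (contract (\<lambda>b c. G (F y) *v CH y b c) u v) $ a) =
    (\<Sum>a\<in>UNIV. \<Sum>b\<in>UNIV. \<Sum>c\<in>UNIV. (w $ a * u $ b * v $ c) * ((1/2) * (?d b c a + ?d c b a - ?d a b c)))"
    by (simp add: contract_def T.metric_christoffel[OF FV[OF assms]] sum_distrib_left mult_ac del: times_divide_eq_left times_divide_eq_right)
  also have "\<dots> = (1/2) * ((\<Sum>a\<in>UNIV. \<Sum>b\<in>UNIV. \<Sum>c\<in>UNIV. (w $ a * u $ b * v $ c) * ?d b c a) 
     + (\<Sum>a\<in>UNIV. \<Sum>b\<in>UNIV. \<Sum>c\<in>UNIV. (w $ a * u $ b * v $ c) * ?d c b a) 
     - (\<Sum>a\<in>UNIV. \<Sum>b\<in>UNIV. \<Sum>c\<in>UNIV. (w $ a * u $ b * v $ c) * ?d a b c))"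
    unfolding sum_distrib_left sum.distrib[symmetric] sum_subtractf[symmetric]
    by (intro sum.cong refl) (simp add: field_simps)
  also have "(\<Sum>a\<in>UNIV. \<Sum>b\<in>UNIV. \<Sum>c\<in>UNIV. (w $ a * u $ b * v $ c) * ?d b c a) = TG y v w u"
  proof -
    have "TG y v w u = (\<Sum>b\<in>UNIV. \<Sum>a\<in>UNIV. \<Sum>c\<in>UNIV. v $ a * w $ b * u $ c * ?d c a b)"
      unfolding TG_expand[OF assms] by (rule sum.swap)
    also have "\<dots> = (\<Sum>b\<in>UNIV. \<Sum>c\<in>UNIV. \<Sum>a\<in>UNIV. v $ a * w $ b * u $ c * ?d c a b)"
      by (rule sum.cong[OF refl]) (rule sum.swap)
    finally show ?thesis by (simp add: mult_ac)
  qed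
  also have "(\<Sum>a\<in>UNIV. \<Sum>b\<in>UNIV. \<Sum>c\<in>UNIV. (w $ a * u $ b * v $ c) * ?d c b a) = TG y u w v"
  proof -
    have "TG y u w v = (\<Sum>b\<in>UNIV. \<Sum>a\<in>UNIV. \<Sum>c\<in>UNIV. u $ a * w $ b * v $ c * ?d c a b)"
      unfolding TG_expand[OF assms] by (rule sum.swap)
    then show ?thesis by (simp add: mult_ac)
  qed
  also have "(\<Sum>a\<in>UNIV. \<Sum>b\<in>UNIV. \<Sum>c\<in>UNIV. (w $ a * u $ b * v $ c) * ?d a b c) = TG y u v w"
  proof -
    have "TG y u v w = (\<Sum>b\<in>UNIV. \<Sum>c\<in>UNIV. \<Sum>a\<in>UNIV. u $ b * v $ c * w $ a * ?d a b c)"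
      unfolding TG_expand[OF assms] ..
    also have "\<dots> = (\<Sum>b\<in>UNIV. \<Sum>a\<in>UNIV. \<Sum>c\<in>UNIV. u $ b * v $ c * w $ a * ?d a b c)"
      by (rule sum.cong[OF refl]) (rule sum.swap)
    also have "\<dots> = (\<Sum>a\<in>UNIV. \<Sum>b\<in>UNIV. \<Sum>c\<in>UNIV. u $ b * v $ c * w $ a * ?d a b c)"
      by (rule sum.swap)
    finally show ?thesis by (simp add: mult_ac)
  qed
  finally show ?thesis .
qed

text \<open>Both sides are paired with the vectors \<open>DF y l\<close> through the metric, that
  is, multiplied by an invertible matrix that is cancelled at the end. After pairing, the symbols of
  \<open>G'\<close> become derivatives of the pulled-back metric, which split into derivatives of
  \<open>G\<close> and terms with second derivatives of \<open>F\<close>.\<close>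

lemma christoffel_transform:
  assumes "y \<in> U"
  shows "(\<Sum>k\<in>UNIV. CH' y i j $ k *\<^sub>R DF y k) = HF y i j + contract (CH y) (DF y i) (DF y j)"
proof -
  let ?g = "contract (\<lambda>a b. G (F y) $ a $ b)" and ?J = "jacobian F y"
  have gs: "?g u v = ?g v u" for u v by (rule contract_commute) (rule T.G_sym[OF FV[OF assms]])
  have *: "((transpose ?J ** G (F y)) *v z) $ l = ?g (DF y l) z" for z l
  proof -
    have "((transpose ?J ** G (F y)) *v z) $ l = (\<Sum>b\<in>UNIV. \<Sum>a\<in>UNIV. (DF y l $ a * z $ b) * G (F y) $ a $ b)"
      by (simp add: matrix_vector_mult_def matrix_matrix_mult_def transpose_def jacobian_nth sum_distrib_left sum_distrib_right mult_ac)
    then show ?thesis unfolding contract_def by (subst sum.swap) simp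
  qed
  have "(transpose ?J ** G (F y)) *v (?J *v CH' y i j) = (transpose ?J ** G (F y)) *v (HF y i j + contract (CH y) (DF y i) (DF y j))"
  proof (subst vec_eq_iff, rule allI)
    fix l
    have "((transpose ?J ** G (F y)) *v (?J *v CH' y i j)) $ l = (G' y *v CH' y i j) $ l"
      by (simp add: pull[OF assms] matrix_vector_mul_assoc)
    also have "\<dots> = (1/2) * (partial_deriv i (\<lambda>x. G' x $ j $ l) y + partial_deriv j (\<lambda>x. G' x $ i $ l) y
        - partial_deriv l (\<lambda>x. G' x $ i $ j) y)" by (rule S.metric_christoffel[OF assms])
    also have "\<dots> = ?g (DF y l) (HF y i j) + (1/2) * (TG y (DF y j) (DF y l) (DF y i) + TG y (DF y i) (DF y l) (DF y j)
        - TG y (DF y i) (DF y j) (DF y l))"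
    proof -
      \<comment> \<open>Of the six pairings with second derivatives of \<open>F\<close> that arise
        from the three metric derivatives, the two of \<open>HF y i j\<close> with
        \<open>DF y l\<close> coincide and add up; the other four cancel in pairs.\<close>
      have e: "?g (HF y i j) (DF y l) = ?g (DF y l) (HF y i j)" "?g (HF y j i) (DF y l) = ?g (DF y l) (HF y i j)"
        "?g (DF y j) (HF y i l) = ?g (HF y l i) (DF y j)" "?g (DF y i) (HF y j l) = ?g (DF y i) (HF y l j)"
        using gs HF_sym[OF assms] by metis+
      have cancel: "(1/2) * (t1 + p + q + (t2 + p + r) - (t3 + q + r)) = p + (1/2) * (t1 + t2 - t3)"
        for t1 t2 t3 p q r :: real by (simp add: field_simps)
      show ?thesis unfolding partial_pull[OF assms] e by (rule cancel)
    qed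
    also have "\<dots> = ?g (DF y l) (HF y i j) + ?g (DF y l) (contract (CH y) (DF y i) (DF y j))"
      by (simp add: christoffel_pair[OF assms])
    also have "\<dots> = ((transpose ?J ** G (F y)) *v (HF y i j + contract (CH y) (DF y i) (DF y j))) $ l"
      by (simp only: * contract_add)
    finally show "((transpose ?J ** G (F y)) *v (?J *v CH' y i j)) $ l
       = ((transpose ?J ** G (F y)) *v (HF y i j + contract (CH y) (DF y i) (DF y j))) $ l" .
  qed
  moreover have "det (transpose ?J ** G (F y)) \<noteq> 0"
    using det_jacobian[OF assms] T.G_det[OF FV[OF assms]] by (simp add: det_mul)
  ultimately have "?J *v CH' y i j = HF y i j + contract (CH y) (DF y i) (DF y j)"
    by (rule matrix_vector_mult_cancel[rotated])
  then show ?thesis by (simp add: jacobian_mult[OF assms])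
qed

definition "DCH y b c v = frechet_derivative (\<lambda>x. christoffel_vec G x b c) (at (F y)) v"

text \<open>The transformation law holds on the open set \<open>U\<close>, so both sides may be
  differentiated along the coordinate \<open>l\<close> by the product rule.\<close>

lemma christoffel_transform_deriv:
  assumes "y \<in> U"
  shows "(\<Sum>k\<in>UNIV. frechet_derivative (\<lambda>z. CH' z i j) (at y) (axis l 1) $ k *\<^sub>R DF y k)
      + (\<Sum>k\<in>UNIV. CH' y i j $ k *\<^sub>R HF y l k) =
    frechet_derivative (\<lambda>z. HF z i j) (at y) (axis l 1)
    + contract (\<lambda>b c. DCH y b c (DF y l)) (DF y i) (DF y j)
    + contract (CH y) (HF y l i) (DF y j) + contract (CH y) (DF y i) (HF y l j)"
proof -
  have c: "((\<lambda>z. CH' z i j) has_derivative frechet_derivative (\<lambda>z. CH' z i j) (at y)) (at y)"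
    using S.christoffel_vec_has_derivative[OF assms] frechet_derivative_eqI by metis
  have c2: "((\<lambda>x. christoffel_vec G x b c) has_derivative DCH y b c) (at (F y))" for b c
    unfolding DCH_def using T.christoffel_vec_has_derivative[OF FV[OF assms]] frechet_derivative_eqI by metis
  have 1: "((\<lambda>z. \<Sum>k\<in>UNIV. CH' z i j $ k *\<^sub>R DF z k) has_derivative
     (\<lambda>h. \<Sum>k\<in>UNIV. CH' y i j $ k *\<^sub>R frechet_derivative (\<lambda>z. DF z k) (at y) h
        + frechet_derivative (\<lambda>z. CH' z i j) (at y) h $ k *\<^sub>R DF y k)) (at y)"
    by (intro has_derivative_sum has_derivative_scaleR DF_has_derivative[OF assms]
        bounded_linear.has_derivative[OF bounded_linear_vec_nth c])
  have 2: "((\<lambda>z. HF z i j + contract (CH z) (DF z i) (DF z j)) has_derivative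
     (\<lambda>h. frechet_derivative (\<lambda>z. HF z i j) (at y) h +
       (contract (\<lambda>b c. DCH y b c (frechet_derivative F (at y) h)) (DF y i) (DF y j)
      + contract (CH y) (frechet_derivative (\<lambda>z. DF z i) (at y) h) (DF y j)
      + contract (CH y) (DF y i) (frechet_derivative (\<lambda>z. DF z j) (at y) h)))) (at y)"
    by (intro has_derivative_add contract_has_derivative DF_has_derivative assms has_derivative_frechet
        smooth_on_differentiable[OF HF_smooth assms] has_derivative_compF c2)
  have "frechet_derivative (\<lambda>z. \<Sum>k\<in>UNIV. CH' z i j $ k *\<^sub>R DF z k) (at y)
     = frechet_derivative (\<lambda>z. HF z i j + contract (CH z) (DF z i) (DF z j)) (at y)"
    by (rule differentiable_cong_open(2)[OF S.V assms])
       (use 2 christoffel_transform in \<open>auto simp: differentiable_def\<close>)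
  then have "frechet_derivative (\<lambda>z. \<Sum>k\<in>UNIV. CH' z i j $ k *\<^sub>R DF z k) (at y) (axis l 1)
     = frechet_derivative (\<lambda>z. HF z i j + contract (CH z) (DF z i) (DF z j)) (at y) (axis l 1)" by simp
  then show ?thesis
    unfolding frechet_derivative_eqI[OF 1] frechet_derivative_eqI[OF 2] DF_def[symmetric] HF_def[symmetric]
    by (simp add: sum.distrib algebra_simps)
qed

text \<open>Second covariant derivatives are moved to the target and antisymmetrised in
  \<open>l\<close> and \<open>j\<close>. Third derivatives of \<open>F\<close> cancel by
  \<open>third_sym\<close>, the terms with one second derivative by symmetry of the Christoffel
  symbols, and only first derivatives remain: the curvature is a tensor.\<close>

lemma riemann_transform:
  assumes "y \<in> U"
  shows "jacobian F y *v riemann_vec G' y i l j =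
    (\<Sum>d\<in>UNIV. DF y l $ d *\<^sub>R contract (\<lambda>b c. riemann_vec G (F y) b d c) (DF y i) (DF y j))"
proof -
  let ?D = "\<lambda>i j l. frechet_derivative (\<lambda>z. CH' z i j) (at y) (axis l 1)"
  let ?T = "\<lambda>l i j. frechet_derivative (\<lambda>z. HF z i j) (at y) (axis l 1)"
  let ?B = "contract (CH y)"
  \<comment> \<open>\<open>Q l i j\<close> is the Jacobian applied to the second covariant
    derivative of the coordinate field \<open>i\<close>, taken first along \<open>j\<close> and then
    along \<open>l\<close>. Its difference under exchange of \<open>l\<close> and \<open>j\<close>
    is the curvature.\<close>
  define Q where "Q l i j = (\<Sum>k\<in>UNIV. ?D i j l $ k *\<^sub>R DF y k)
     + (\<Sum>m\<in>UNIV. CH' y i j $ m *\<^sub>R (\<Sum>k\<in>UNIV. CH' y l m $ k *\<^sub>R DF y k))" for l i j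
  have Q: "Q l i j = ?T l i j + contract (\<lambda>b c. DCH y b c (DF y l)) (DF y i) (DF y j)
    + ?B (HF y l i) (DF y j) + ?B (DF y i) (HF y l j) + ?B (DF y l) (HF y i j)
    + ?B (DF y l) (?B (DF y i) (DF y j))" for l i j
  proof -
    have "(\<Sum>m\<in>UNIV. CH' y i j $ m *\<^sub>R (\<Sum>k\<in>UNIV. CH' y l m $ k *\<^sub>R DF y k))
      = (\<Sum>m\<in>UNIV. CH' y i j $ m *\<^sub>R HF y l m) + ?B (DF y l) (\<Sum>m\<in>UNIV. CH' y i j $ m *\<^sub>R DF y m)"
      unfolding contract_sum_right
      unfolding christoffel_transform[OF assms]
      by (simp add: scaleR_add_right sum.distrib)
    also have "(\<Sum>m\<in>UNIV. CH' y i j $ m *\<^sub>R DF y m) = HF y i j + ?B (DF y i) (DF y j)"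
      by (rule christoffel_transform[OF assms])
    finally show ?thesis
      unfolding Q_def using christoffel_transform_deriv[OF assms, of i j l]
      by (simp add: contract_add algebra_simps)
  qed
  have CHs: "?B u v = ?B v u" for u v
    by (rule contract_commute) (rule T.christoffel_vec_sym[OF FV[OF assms]])
  have "jacobian F y *v riemann_vec G' y i l j = Q l i j - Q j i l"
  proof -
    have "jacobian F y *v riemann_vec G' y i l j = jacobian F y *v ?D i j l - jacobian F y *v ?D i l j
      + (\<Sum>m\<in>UNIV. CH' y i j $ m *\<^sub>R (jacobian F y *v CH' y l m))
      - (\<Sum>m\<in>UNIV. CH' y i l $ m *\<^sub>R (jacobian F y *v CH' y j m))"
      unfolding riemann_vec_def
      by (simp add: matrix_vector_mult_diff_distrib matrix_vector_right_distrib
         linear_sum[OF matrix_vector_mul_linear] linear_cmul[OF matrix_vector_mul_linear])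
    then show ?thesis by (simp add: Q_def jacobian_mult[OF assms] algebra_simps)
  qed
  also have "\<dots> = contract (\<lambda>b c. DCH y b c (DF y l)) (DF y i) (DF y j)
      - contract (\<lambda>b c. DCH y b c (DF y j)) (DF y i) (DF y l)
      + ?B (DF y l) (?B (DF y i) (DF y j)) - ?B (DF y j) (?B (DF y i) (DF y l))"
  proof -
    have e: "?B (HF y j i) (DF y l) = ?B (DF y l) (HF y i j)" "?B (DF y i) (HF y j l) = ?B (DF y i) (HF y l j)"
      "?B (DF y j) (HF y i l) = ?B (HF y l i) (DF y j)" "?T l i j = ?T j i l"
      using CHs HF_sym[OF assms] third_sym[OF assms] by metis+
    have cancel: "t + a + p + q + r + s - (t + a' + r + q + p + s') = a - a' + s - s'"
      for t a p q r s a' s' :: "real^'n" by simp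
    show ?thesis unfolding Q[of l i j] Q[of j i l] e by (rule cancel)
  qed
  also have "\<dots> = (\<Sum>d\<in>UNIV. DF y l $ d *\<^sub>R contract (\<lambda>b c. riemann_vec G (F y) b d c) (DF y i) (DF y j))"
  proof -
    \<comment> \<open>All four remaining terms are brought to one outer sum over the components
      \<open>d\<close> of \<open>DF y l\<close>. In the two subtracted terms this vector sits in the
      second slot of the contraction, so the facts 2 and 4 exchange the roles of \<open>c\<close>
      and \<open>d\<close>.\<close>
    have dl: "DCH y b c v = (\<Sum>d\<in>UNIV. v $ d *\<^sub>R DCH y b c (axis d 1))" for b c v
    proof -
      have L: "linear (DCH y b c)"
        unfolding DCH_def[abs_def] frechet_derivative_eqI[OF T.christoffel_vec_has_derivative[OF FV[OF assms]]]
        by (rule has_derivative_linear[OF T.christoffel_vec_has_derivative[OF FV[OF assms]]])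
      have "DCH y b c v = DCH y b c (\<Sum>i\<in>UNIV. v $ i *\<^sub>R axis i 1)"
        using basis_expansion[of v] by (simp add: scalar_mult_eq_scaleR)
      then show ?thesis by (simp add: linear_sum[OF L] linear_cmul[OF L])
    qed
    have 1: "contract (\<lambda>b c. DCH y b c w) u v = (\<Sum>d\<in>UNIV. w $ d *\<^sub>R contract (\<lambda>b c. DCH y b c (axis d 1)) u v)" for u v w
    proof -
      have "contract (\<lambda>b c. DCH y b c w) u v = (\<Sum>b\<in>UNIV. \<Sum>c\<in>UNIV. \<Sum>d\<in>UNIV. (u $ b * v $ c * w $ d) *\<^sub>R DCH y b c (axis d 1))"
        unfolding contract_def by (subst dl) (simp add: scaleR_sum_right)
      also have "\<dots> = (\<Sum>b\<in>UNIV. \<Sum>d\<in>UNIV. \<Sum>c\<in>UNIV. (u $ b * v $ c * w $ d) *\<^sub>R DCH y b c (axis d 1))"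
        by (rule sum.cong[OF refl]) (rule sum.swap)
      also have "\<dots> = (\<Sum>d\<in>UNIV. \<Sum>b\<in>UNIV. \<Sum>c\<in>UNIV. (u $ b * v $ c * w $ d) *\<^sub>R DCH y b c (axis d 1))"
        by (rule sum.swap)
      finally show ?thesis by (simp add: contract_def scaleR_sum_right mult_ac)
    qed
    have 2: "contract (\<lambda>b c. DCH y b c w) u v = (\<Sum>d\<in>UNIV. v $ d *\<^sub>R contract (\<lambda>b c. DCH y b d (axis c 1)) u w)" for u v w
    proof -
      have "contract (\<lambda>b c. DCH y b c w) u v = (\<Sum>b\<in>UNIV. \<Sum>d\<in>UNIV. \<Sum>c\<in>UNIV. (u $ b * v $ d * w $ c) *\<^sub>R DCH y b d (axis c 1))"
        unfolding contract_def by (subst dl) (simp add: scaleR_sum_right)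
      also have "\<dots> = (\<Sum>d\<in>UNIV. \<Sum>b\<in>UNIV. \<Sum>c\<in>UNIV. (u $ b * v $ d * w $ c) *\<^sub>R DCH y b d (axis c 1))"
        by (rule sum.swap)
      finally show ?thesis by (simp add: contract_def scaleR_sum_right mult_ac)
    qed
    have 3: "?B w (?B u v) = (\<Sum>d\<in>UNIV. w $ d *\<^sub>R contract (\<lambda>b c. \<Sum>m\<in>UNIV. CH y b c $ m *\<^sub>R CH y d m) u v)" for u v w
    proof -
      have "?B w z = (\<Sum>d\<in>UNIV. w $ d *\<^sub>R (\<Sum>m\<in>UNIV. z $ m *\<^sub>R CH y d m))" for z
        by (simp add: contract_def scaleR_sum_right)
      moreover have "(\<Sum>m\<in>UNIV. (?B u v) $ m *\<^sub>R CH y d m) = contract (\<lambda>b c. \<Sum>m\<in>UNIV. CH y b c $ m *\<^sub>R CH y d m) u v" for d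
      proof -
        have "(\<Sum>m\<in>UNIV. (?B u v) $ m *\<^sub>R CH y d m) = (\<Sum>m\<in>UNIV. \<Sum>b\<in>UNIV. \<Sum>c\<in>UNIV. (u $ b * v $ c * CH y b c $ m) *\<^sub>R CH y d m)"
          by (simp add: contract_def scaleR_sum_left)
        also have "\<dots> = (\<Sum>b\<in>UNIV. \<Sum>m\<in>UNIV. \<Sum>c\<in>UNIV. (u $ b * v $ c * CH y b c $ m) *\<^sub>R CH y d m)"
          by (rule sum.swap)
        also have "\<dots> = (\<Sum>b\<in>UNIV. \<Sum>c\<in>UNIV. \<Sum>m\<in>UNIV. (u $ b * v $ c * CH y b c $ m) *\<^sub>R CH y d m)"
          by (rule sum.cong[OF refl]) (rule sum.swap)
        finally show ?thesis by (simp add: contract_def scaleR_sum_right)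
      qed
      ultimately show ?thesis by simp
    qed
    have 4: "?B w (?B u v) = (\<Sum>d\<in>UNIV. v $ d *\<^sub>R contract (\<lambda>b c. \<Sum>m\<in>UNIV. CH y b d $ m *\<^sub>R CH y c m) u w)" for u v w
    proof -
      have "?B w (?B u v) = (\<Sum>c\<in>UNIV. \<Sum>b\<in>UNIV. \<Sum>d\<in>UNIV. (w $ c * u $ b * v $ d) *\<^sub>R (\<Sum>m\<in>UNIV. CH y b d $ m *\<^sub>R CH y c m))"
        unfolding 3 by (simp add: contract_def scaleR_sum_right mult_ac)
      also have "\<dots> = (\<Sum>c\<in>UNIV. \<Sum>d\<in>UNIV. \<Sum>b\<in>UNIV. (w $ c * u $ b * v $ d) *\<^sub>R (\<Sum>m\<in>UNIV. CH y b d $ m *\<^sub>R CH y c m))"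
        by (rule sum.cong[OF refl]) (rule sum.swap)
      also have "\<dots> = (\<Sum>d\<in>UNIV. \<Sum>c\<in>UNIV. \<Sum>b\<in>UNIV. (w $ c * u $ b * v $ d) *\<^sub>R (\<Sum>m\<in>UNIV. CH y b d $ m *\<^sub>R CH y c m))"
        by (rule sum.swap)
      also have "\<dots> = (\<Sum>d\<in>UNIV. \<Sum>b\<in>UNIV. \<Sum>c\<in>UNIV. (w $ c * u $ b * v $ d) *\<^sub>R (\<Sum>m\<in>UNIV. CH y b d $ m *\<^sub>R CH y c m))"
        by (rule sum.cong[OF refl]) (rule sum.swap)
      finally show ?thesis by (simp add: contract_def scaleR_sum_right mult_ac)
    qed
    have 5: "contract (\<lambda>b c. riemann_vec G (F y) b d c) u v = contract (\<lambda>b c. DCH y b c (axis d 1)) u v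
       - contract (\<lambda>b c. DCH y b d (axis c 1)) u v + contract (\<lambda>b c. \<Sum>m\<in>UNIV. CH y b c $ m *\<^sub>R CH y d m) u v
       - contract (\<lambda>b c. \<Sum>m\<in>UNIV. CH y b d $ m *\<^sub>R CH y c m) u v" for d u v
      by (simp add: contract_def riemann_vec_def DCH_def scaleR_diff_right scaleR_add_right sum.distrib sum_subtractf)
    show ?thesis
      unfolding 5 1[of "DF y l" "DF y i" "DF y j"] 2[of "DF y j" "DF y i" "DF y l"]
        3[of "DF y l" "DF y i" "DF y j"] 4[of "DF y j" "DF y i" "DF y l"]
      by (simp add: scaleR_diff_right scaleR_add_right sum.distrib sum_subtractf)
  qed
  finally show ?thesis .
qed

text \<open>Ricci curvature is the trace of the endomorphism sending the field \<open>k\<close> to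
  \<open>riemann_vec\<close> with indices \<open>i\<close>, \<open>k\<close>, \<open>j\<close>. By
  the curvature law the Jacobian conjugates it into its counterpart at the image point, and traces
  are invariant under conjugation.\<close>

lemma ricci_transform:
  assumes "y \<in> U"
  shows "ricci G' i j y = contract (\<lambda>b c. ricci G b c (F y)) (DF y i) (DF y j)"
proof -
  let ?J = "jacobian F y" and ?K = "matrix_inv (jacobian F y)"
  let ?R = "\<lambda>d. contract (\<lambda>b c. riemann_vec G (F y) b d c) (DF y i) (DF y j)"
  define M' where "M' = (\<chi> a k. riemann_vec G' y i k j $ a)"
  define M where "M = (\<chi> a d. ?R d $ a)"
  have "?J ** M' = M ** ?J"
  proof -
    have "(?J ** M') $ a $ k = (?J *v riemann_vec G' y i k j) $ a" for a k
      by (simp add: matrix_matrix_mult_def matrix_vector_mult_def M'_def)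
    then have "(?J ** M') $ a $ k = (M ** ?J) $ a $ k" for a k
      unfolding riemann_transform[OF assms]
      by (simp add: matrix_matrix_mult_def M_def jacobian_nth mult_ac)
    then show ?thesis by (simp add: vec_eq_iff)
  qed
  then have "M' = ?K ** (M ** ?J)"
    using matrix_inv_right(2)[OF det_jacobian[OF assms]]
    by (metis matrix_mul_assoc matrix_mul_lid)
  then have "trace M' = trace (?K ** (M ** ?J))" by (rule arg_cong)
  also have "\<dots> = trace ((M ** ?J) ** ?K)" by (rule trace_mul_sym)
  also have "(M ** ?J) ** ?K = M"
    using matrix_inv_right(1)[OF det_jacobian[OF assms]] by (metis matrix_mul_assoc matrix_mul_rid)
  finally have t: "trace M' = trace M" .
  have "trace M = (\<Sum>d\<in>UNIV. \<Sum>b\<in>UNIV. \<Sum>c\<in>UNIV. (DF y i $ b * DF y j $ c) * riemann_vec G (F y) b d c $ d)"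
    by (simp add: trace_def M_def contract_def)
  also have "\<dots> = (\<Sum>b\<in>UNIV. \<Sum>d\<in>UNIV. \<Sum>c\<in>UNIV. (DF y i $ b * DF y j $ c) * riemann_vec G (F y) b d c $ d)"
    by (rule sum.swap)
  also have "\<dots> = (\<Sum>b\<in>UNIV. \<Sum>c\<in>UNIV. \<Sum>d\<in>UNIV. (DF y i $ b * DF y j $ c) * riemann_vec G (F y) b d c $ d)"
    by (rule sum.cong[OF refl]) (rule sum.swap)
  also have "\<dots> = contract (\<lambda>b c. ricci G b c (F y)) (DF y i) (DF y j)"
    by (simp add: contract_def T.ricci_eq[OF FV[OF assms]] sum_distrib_left)
  finally show ?thesis using t by (simp add: S.ricci_eq[OF assms] trace_def M'_def)
qed

lemma matrix_inv_pull:
  assumes "y \<in> U"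
  shows "jacobian F y ** matrix_inv (G' y) ** transpose (jacobian F y) = matrix_inv (G (F y))"
proof -
  let ?J = "jacobian F y" and ?g = "G (F y)"
  have 1: "matrix_inv (G' y) ** (transpose ?J ** ?g ** ?J) = mat 1"
    using matrix_inv_right(2)[OF S.G_det[OF assms]] pull[OF assms] by simp
  have "?J ** (matrix_inv (G' y) ** (transpose ?J ** ?g ** ?J)) ** matrix_inv ?J ** matrix_inv ?g
     = (?J ** matrix_inv (G' y) ** transpose ?J) ** ?g ** (?J ** matrix_inv ?J) ** matrix_inv ?g"
    by (simp add: matrix_mul_assoc)
  also have "\<dots> = (?J ** matrix_inv (G' y) ** transpose ?J) ** (?g ** matrix_inv ?g)"
    by (simp add: matrix_inv_right[OF det_jacobian[OF assms]] matrix_mul_assoc)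
  also have "\<dots> = ?J ** matrix_inv (G' y) ** transpose ?J"
    by (simp add: matrix_inv_right[OF T.G_det[OF FV[OF assms]]])
  finally show ?thesis unfolding 1 by (simp add: matrix_inv_right[OF det_jacobian[OF assms]])
qed

text \<open>Written as the trace of the inverse metric times Ricci, the scalar curvature allows the
  Jacobians in \<open>R'\<close> to be moved cyclically until they turn the inverse of
  \<open>G'\<close> into that of \<open>G\<close>.\<close>

lemma scalar_curvature_transform:
  assumes "y \<in> U"
  shows "local_scalar_curvature G' y = local_scalar_curvature G (F y)"
proof -
  let ?J = "jacobian F y"
  define R where "R = (\<chi> i j. ricci G i j (F y))"
  define R' where "R' = (\<chi> i j. ricci G' i j y)"
  have tr: "trace (A ** transpose B) = (\<Sum>i\<in>UNIV. \<Sum>j\<in>UNIV. A $ i $ j * B $ i $ j)" for A B :: "real^'n^'n"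
    by (simp add: trace_def matrix_matrix_mult_def transpose_def)
  have R': "R' = transpose ?J ** R ** ?J"
  proof -
    have "R' $ i $ j = (\<Sum>c\<in>UNIV. \<Sum>b\<in>UNIV. (DF y i $ b * DF y j $ c) * R $ b $ c)" for i j
      unfolding R'_def R_def by (subst sum.swap) (simp add: ricci_transform[OF assms] contract_def)
    then show ?thesis
      by (simp add: vec_eq_iff matrix_matrix_mult_def transpose_def jacobian_nth sum_distrib_left mult_ac)
  qed
  have "local_scalar_curvature G' y = trace (matrix_inv (G' y) ** transpose R')"
    by (simp add: tr R'_def local_scalar_curvature_def)
  also have "\<dots> = trace ((matrix_inv (G' y) ** transpose ?J ** transpose R) ** ?J)"
    by (simp add: R' matrix_transpose_mul matrix_mul_assoc)
  also have "\<dots> = trace (?J ** matrix_inv (G' y) ** transpose ?J ** transpose R)"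
    by (subst trace_mul_sym) (simp add: matrix_mul_assoc)
  also have "\<dots> = local_scalar_curvature G (F y)"
    by (simp add: matrix_inv_pull[OF assms] tr R_def local_scalar_curvature_def)
  finally show ?thesis .
qed

end

section \<open>Mollification\<close>

text \<open>The polynomial is a parameter because the family is closed under differentiation:
  smoothness, including flatness at 0, is then one induction over all polynomials at once.\<close>

definition flat_exp :: "real poly \<Rightarrow> real \<Rightarrow> real" where
  "flat_exp P t = (if t > 0 then poly P (1 / t) * exp (- (1 / t)) else 0)"

lemma poly_times_exp_tendsto_0: "((\<lambda>s::real. poly P s * exp (- s)) \<longlongrightarrow> 0) at_top"
proof -
  have "((\<lambda>s. \<Sum>i\<le>degree P. coeff P i * (s ^ i / exp s)) \<longlongrightarrow> (\<Sum>i\<le>degree P. coeff P i * 0)) at_top"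
    by (intro tendsto_intros tendsto_power_div_exp_0)
  then show ?thesis by (simp add: poly_altdef exp_minus divide_inverse sum_distrib_right mult.assoc)
qed

text \<open>With s = 1/t one has ds/dt = -s^2, so P(s) exp(-s) has derivative s^2 (P(s) - P'(s))
  exp(-s); \<open>[:0, 0, 1:]\<close> is the monomial of degree 2.\<close>

lemma flat_exp_has_derivative:
  "(flat_exp P has_real_derivative flat_exp ([:0, 0, 1:] * (P - pderiv P)) t) (at t)"
proof -
  consider "t > 0" | "t < 0" | "t = 0" by linarith
  then show ?thesis
  proof cases
    case 1
    have "((\<lambda>t. poly P (1 / t) * exp (- (1 / t))) has_real_derivative
        flat_exp ([:0, 0, 1:] * (P - pderiv P)) t) (at t)"
      using 1 by (auto intro!: derivative_eq_intros simp: flat_exp_def field_simps power2_eq_square)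
    then show ?thesis
      by (rule has_field_derivative_transform_within_open[where S = "{0<..}"]) (use 1 in \<open>auto simp: flat_exp_def\<close>)
  next
    case 2
    have "((\<lambda>t. 0) has_real_derivative flat_exp ([:0, 0, 1:] * (P - pderiv P)) t) (at t)"
      using 2 by (simp add: flat_exp_def)
    then show ?thesis
      by (rule has_field_derivative_transform_within_open[where S = "{..<0}"]) (use 2 in \<open>auto simp: flat_exp_def\<close>)
  next
    case 3
    have r: "((\<lambda>h. (flat_exp P h - flat_exp P 0) / h) \<longlongrightarrow> 0) (at_right 0)"
    proof -
      \<comment> \<open>The difference quotient at 0 carries an extra factor 1/h, which
        \<open>pCons 0 P\<close> absorbs as multiplication by the variable.\<close>
      have "((\<lambda>h. poly (pCons 0 P) (inverse h) * exp (- inverse h)) \<longlongrightarrow> 0) (at_right 0)"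
        by (rule filterlim_compose[OF poly_times_exp_tendsto_0 filterlim_inverse_at_top_right])
      moreover have "\<forall>\<^sub>F h in at_right 0. poly (pCons 0 P) (inverse h) * exp (- inverse h) = (flat_exp P h - flat_exp P 0) / h"
        by (rule eventually_at_rightI[of 0 1]) (auto simp: flat_exp_def divide_inverse)
      ultimately show ?thesis by (rule Lim_transform_eventually)
    qed
    have l: "((\<lambda>h. (flat_exp P h - flat_exp P 0) / h) \<longlongrightarrow> 0) (at_left 0)"
    proof (rule Lim_transform_eventually[OF tendsto_const])
      show "\<forall>\<^sub>F h in at_left 0. 0 = (flat_exp P h - flat_exp P 0) / h"
        by (rule eventually_at_leftI[of "-1" 0]) (auto simp: flat_exp_def)
    qed
    have "((\<lambda>h. (flat_exp P h - flat_exp P 0) / h) \<longlongrightarrow> 0) (at 0)"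
      using l r by (simp add: filterlim_at_split)
    then show ?thesis using 3 by (simp add: has_field_derivative_iff flat_exp_def)
  qed
qed

lemma smooth_on_flat_exp:
  assumes "open S" "smooth_on S q"
  shows "smooth_on S (\<lambda>x. flat_exp P (q x))"
proof -
  have "Ck_on k S (\<lambda>x. flat_exp P (q x))" for k
  proof (induction k arbitrary: P)
    case 0
    have c: "continuous_on UNIV (flat_exp P)"
      using flat_exp_has_derivative DERIV_isCont continuous_at_imp_continuous_on by blast
    show ?case using continuous_on_compose2[OF c smooth_on_continuous[OF assms(2)]] by simp
  next
    case (Suc k)
    let ?Q = "[:0, 0, 1:] * (P - pderiv P)"
    have d: "((\<lambda>x. flat_exp P (q x)) has_derivative (\<lambda>v. flat_exp ?Q (q x) * frechet_derivative q (at x) v)) (at x)"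
      if "x \<in> S" for x
      using diff_chain_at[OF has_derivative_frechet[OF smooth_on_differentiable[OF assms(2) that]]
          flat_exp_has_derivative[of P "q x", unfolded has_field_derivative_def]]
      by (simp add: o_def)
    have "Ck_on k S (\<lambda>x. frechet_derivative (\<lambda>x. flat_exp P (q x)) (at x) v)" for v
      by (rule Ck_on_cong[OF assms(1) _ Ck_on_mult[OF assms(1) Suc.IH[of ?Q], of "\<lambda>x. frechet_derivative q (at x) v"]])
         (use frechet_derivative_eqI[OF d] smooth_on_frechet[OF assms(2)] in \<open>auto simp: smooth_on_def\<close>)
    then show ?case using d by (auto simp: differentiable_def)
  qed
  then show ?thesis by (simp add: smooth_on_def)
qed

section \<open>Mollifiers\<close>

lemma integrable_continuous_compact_support:
  fixes f :: "'a::euclidean_space \<Rightarrow> 'b::{banach, second_countable_topology}"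
  assumes "continuous_on UNIV f" "compact K" "\<And>x. x \<notin> K \<Longrightarrow> f x = 0"
  shows "integrable lborel f"
proof -
  have "integrable lborel (\<lambda>x. indicator K x *\<^sub>R f x)"
    by (rule borel_integrable_compact[OF assms(2) continuous_on_subset[OF assms(1)]]) simp
  moreover have "(\<lambda>x. indicator K x *\<^sub>R f x) = f" using assms(3) by (auto simp: indicator_def)
  ultimately show ?thesis by simp
qed

text \<open>The function exp(-1/q) with q = e^2 - |y|^2, extended by zero and divided by its
  integral. The squared norm is written as a sum of squares of coordinates, whose smoothness is
  immediate.\<close>

lemma mollifier_exists:
  assumes "e > 0"
  obtains \<eta> :: "real^'n::finite \<Rightarrow> real" where "smooth_on UNIV \<eta>" "\<And>y. \<eta> y \<ge> 0"
    "\<And>y. norm y \<ge> e \<Longrightarrow> \<eta> y = 0" "integrable lborel \<eta>" "integral\<^sup>L lborel \<eta> = 1"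
proof -
  define f where "f = (\<lambda>y::real^'n. flat_exp 1 (e\<^sup>2 - (\<Sum>i\<in>UNIV. y $ i * y $ i)))"
  have n2: "(\<Sum>i\<in>UNIV. y $ i * y $ i) = (norm y)\<^sup>2" for y :: "real^'n"
    by (simp add: power2_norm_eq_inner inner_vec_def)
  have fs: "smooth_on UNIV f"
    unfolding f_def
    by (intro smooth_on_flat_exp smooth_on_diff smooth_on_const smooth_on_sum smooth_on_mult
        smooth_on_linear bounded_linear_vec_nth open_UNIV)
  have f0: "f y \<ge> 0" for y by (simp add: f_def flat_exp_def)
  have fz: "f y = 0 \<longleftrightarrow> norm y \<ge> e" for y
  proof -
    have "(norm y)\<^sup>2 < e\<^sup>2 \<longleftrightarrow> norm y < e"
      using assms power2_less_imp_less[of "norm y" e] power_strict_mono[of "norm y" e 2] by auto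
    then show ?thesis by (auto simp: f_def flat_exp_def n2 not_less)
  qed
  have int: "integrable lborel f"
    by (rule integrable_continuous_compact_support[OF smooth_on_continuous[OF fs] compact_cball[of 0 e]]) (auto simp: fz)
  \<comment> \<open>A nonnegative function with vanishing integral is zero almost everywhere, which
    would make the open ball of radius \<open>e\<close> a null set.\<close>
  have pos: "integral\<^sup>L lborel f > 0"
  proof (rule ccontr)
    assume "\<not> integral\<^sup>L lborel f > 0"
    then have "integral\<^sup>L lborel f = 0" using integral_nonneg_AE[of f lborel] f0 by (simp add: order.antisym)
    then have "AE x in lborel. f x = 0" using integral_nonneg_eq_0_iff_AE[OF int] f0 by simp
    then have "AE x in lborel. x \<notin> ball (0::real^'n) e" unfolding fz by (simp add: not_less)
    then have "ball (0::real^'n) e \<in> null_sets lborel"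
      by (subst (asm) AE_iff_null_sets[symmetric]) auto
    then have "negligible (ball (0::real^'n) e)" by (simp add: negligible_iff_null_sets null_sets_completionI)
    then show False using open_not_negligible[of "ball 0 e"] assms by auto
  qed
  define c where "c = integral\<^sup>L lborel f"
  show ?thesis
  proof
    show "smooth_on UNIV (\<lambda>y. inverse c * f y)" by (intro smooth_on_mult smooth_on_const fs open_UNIV)
  qed (use f0 fz int pos in \<open>auto simp: c_def\<close>)
qed

text \<open>The radius is enlarged by 1 so that two points at distance below 1 either both lie in
  the compact ball, where uniform continuity is available, or both lie where \<open>f\<close>
  vanishes.\<close>

lemma uniformly_continuous_compact_support:
  fixes f :: "'a::euclidean_space \<Rightarrow> 'b::real_normed_vector"
  assumes "continuous_on UNIV f" "\<And>x. norm x \<ge> R \<Longrightarrow> f x = 0"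
  shows "uniformly_continuous_on UNIV f"
proof -
  have u: "uniformly_continuous_on (cball 0 (R + 1)) f"
    by (intro compact_uniformly_continuous continuous_on_subset[OF assms(1)]) auto
  show ?thesis unfolding uniformly_continuous_on_def
  proof (intro allI impI)
    fix e :: real assume "e > 0"
    then obtain d where d: "d > 0" "\<And>x y. x \<in> cball 0 (R+1) \<Longrightarrow> y \<in> cball 0 (R+1) \<Longrightarrow> dist y x < d \<Longrightarrow> dist (f y) (f x) < e"
      using u unfolding uniformly_continuous_on_def by metis
    have "dist (f y) (f x) < e" if xy: "dist y x < min d 1" for x y
    proof (cases "norm x \<le> R + 1 \<and> norm y \<le> R + 1")
      case True then show ?thesis using d xy by auto
    next
      case False
      then have "norm x \<ge> R" "norm y \<ge> R"
        using xy norm_triangle_ineq2[of x y] norm_triangle_ineq2[of y x] by (auto simp: dist_norm norm_minus_commute)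
      then show ?thesis using assms(2) \<open>e > 0\<close> by simp
    qed
    then show "\<exists>d>0. \<forall>x\<in>UNIV. \<forall>y\<in>UNIV. dist y x < d \<longrightarrow> dist (f y) (f x) < e"
      using d(1) by (intro exI[of _ "min d 1"]) auto
  qed
qed

section \<open>Translations and continuity in L1\<close>

lemma lborel_distr_translate: "distr lborel borel (\<lambda>x. x - h) = (lborel :: 'a::euclidean_space measure)"
proof -
  have "(+) (- h) = (\<lambda>x. x - h)" by auto
  then show ?thesis using lborel_distr_plus[of "- h"] by simp
qed

lemma lborel_integral_translate:
  fixes f :: "'a::euclidean_space \<Rightarrow> 'b::{banach, second_countable_topology}"
  shows "integrable lborel (\<lambda>x. f (x - h)) \<longleftrightarrow> integrable lborel f"
    "(\<integral>x. f (x - h) \<partial>lborel) = (\<integral>x. f x \<partial>lborel)"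
proof -
  have imp: "integrable lborel (\<lambda>x. g (x - k))" if "integrable lborel g" for g :: "'a \<Rightarrow> 'b" and k
  proof -
    have "integrable (distr lborel borel (\<lambda>x. x - k)) g" using that by (simp add: lborel_distr_translate)
    then show ?thesis using that by (subst (asm) integrable_distr_eq) (auto dest: borel_measurable_integrable)
  qed
  show i: "integrable lborel (\<lambda>x. f (x - h)) \<longleftrightarrow> integrable lborel f"
    using imp[of f h] imp[of "\<lambda>x. f (x - h)" "- h"] by auto
  show "(\<integral>x. f (x - h) \<partial>lborel) = (\<integral>x. f x \<partial>lborel)"
  proof (cases "integrable lborel f")
    case True
    then have "(\<integral>x. f x \<partial>lborel) = (\<integral>x. f x \<partial>(distr lborel borel (\<lambda>x. x - h)))" by (simp add: lborel_distr_translate)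
    also have "\<dots> = (\<integral>x. f (x - h) \<partial>lborel)" using True by (subst integral_distr) auto
    finally show ?thesis by simp
  qed (simp add: i not_integrable_integral_eq)
qed

lemma lborel_emeasure_translate:
  fixes A :: "'a::euclidean_space set"
  assumes "A \<in> sets borel"
  shows "emeasure lborel {x. x - h \<in> A} = emeasure lborel A"
proof -
  have "emeasure lborel A = emeasure (distr lborel borel (\<lambda>x. x - h)) A"
    by (simp add: lborel_distr_translate)
  also have "\<dots> = emeasure lborel {x. x - h \<in> A}"
    using assms by (subst emeasure_distr) (auto intro!: arg_cong[where f="emeasure lborel"])
  finally show ?thesis by simp
qed

text \<open>Inner regularity is available for finite measures, so it is applied to the measure whose
  density is the indicator of \<open>A\<close>, which is finite and agrees with Lebesgue measure on
  subsets of \<open>A\<close>.\<close>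

lemma compact_inner_approx:
  fixes A :: "'a::euclidean_space set"
  assumes A: "A \<in> sets borel" "emeasure lborel A < \<infinity>" and e: "e > (0::real)"
  obtains K where "compact K" "K \<subseteq> A" "emeasure lborel (A - K) < ennreal e"
proof -
  let ?M = "density lborel (indicator A)"
  have em: "emeasure ?M B = emeasure lborel (A \<inter> B)" if "B \<in> sets borel" for B
    using A that by (subst emeasure_density) (auto simp flip: indicator_inter_arith)
  interpret M: finite_measure ?M
    by (rule finite_measureI) (use em[of UNIV] A in \<open>auto simp: less_top\<close>)
  have "emeasure ?M A = (SUP K\<in>{K. K \<subseteq> A \<and> compact K}. emeasure ?M K)"
    by (rule inner_regular) (use A em[of UNIV] in auto)
  moreover have "emeasure ?M A = emeasure lborel A" using em A by simp
  ultimately have s: "emeasure lborel A = (SUP K\<in>{K. K \<subseteq> A \<and> compact K}. emeasure ?M K)" by simp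
  have "\<exists>K. K \<subseteq> A \<and> compact K \<and> emeasure lborel A < emeasure lborel K + ennreal e"
  proof -
    have "(SUP K\<in>{K. K \<subseteq> A \<and> compact K}. emeasure ?M K) < (SUP K\<in>{K. K \<subseteq> A \<and> compact K}. emeasure ?M K) + ennreal e"
      using A(2) e unfolding s[symmetric] by (cases "emeasure lborel A") (auto simp flip: ennreal_plus intro: ennreal_lessI)
    then have "emeasure lborel A < (SUP K\<in>{K. K \<subseteq> A \<and> compact K}. emeasure ?M K + ennreal e)"
      unfolding s by (subst ennreal_SUP_add_left) auto
    then obtain K where K: "K \<subseteq> A" "compact K" "emeasure lborel A < emeasure ?M K + ennreal e"
      unfolding less_SUP_iff by auto
    moreover have "emeasure ?M K = emeasure lborel K"
      using em[of K] K by (auto simp: Int_absorb1 compact_imp_closed)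
    ultimately show ?thesis by auto
  qed
  then obtain K where K: "K \<subseteq> A" "compact K" "emeasure lborel A < emeasure lborel K + ennreal e" by blast
  have Kb: "K \<in> sets borel" using K compact_imp_closed borel_closed by blast
  have "emeasure lborel A = emeasure lborel K + emeasure lborel (A - K)"
    using K(1) A Kb by (subst plus_emeasure) (auto simp: Un_absorb1)
  then have "emeasure lborel (A - K) < ennreal e"
    using K(3) by (metis ennreal_add_left_cancel_less)
  then show ?thesis using that K by blast
qed

text \<open>Squeeze \<open>A\<close> between a compact and an open set whose difference is small. A
  translation shorter than the distance from the compact set to the complement of the open one
  changes the indicator only on that difference and on its translate.\<close>

lemma L1_translation_indicator:
  fixes A :: "'a::euclidean_space set"
  assumes A: "A \<in> sets borel" "emeasure lborel A < \<infinity>" and e: "e > 0"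
  shows "\<exists>d>0. \<forall>h. norm h < d \<longrightarrow> (\<integral>x. \<bar>indicator A (x - h) - indicator A x\<bar> \<partial>lborel) < (e::real)"
proof -
  obtain K where K: "compact K" "K \<subseteq> A" "emeasure lborel (A - K) < ennreal (e/4)"
    using compact_inner_approx[OF A, of "e/4"] e by auto
  obtain U where U: "open U" "A \<subseteq> U" "emeasure lborel (U - A) < ennreal (e/4)"
    using outer_regular_lborel[OF A(1), of "e/4"] e by auto
  obtain d where d: "d > 0" "\<And>x. x \<in> K \<Longrightarrow> ball x d \<subseteq> U"
    using Heine_Borel_lemma[OF K(1), of "{U}"] K U by auto
  have Kb: "K \<in> sets borel" using K compact_imp_closed borel_closed by blast
  have UK: "emeasure lborel (U - K) < ennreal (e/2)"
  proof -
    have "U - K = (U - A) \<union> (A - K)" using K U by auto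
    then have "emeasure lborel (U - K) \<le> emeasure lborel (U - A) + emeasure lborel (A - K)"
      using emeasure_subadditive[of "U - A" lborel "A - K"] A U Kb by simp
    also have "\<dots> < ennreal (e/4) + ennreal (e/4)" using K U by (intro add_strict_mono) auto
    also have "\<dots> = ennreal (e/2)" using e by (simp flip: ennreal_plus)
    finally show ?thesis .
  qed
  have "(\<integral>x. \<bar>indicator A (x - h) - indicator A x\<bar> \<partial>lborel) < e" if h: "norm h < d" for h
  proof -
    let ?f = "\<lambda>x. \<bar>indicator A (x - h) - indicator A x\<bar> :: real"
    have [measurable]: "A \<in> sets borel" "U \<in> sets borel" "K \<in> sets borel" using A U Kb by auto
    have pt: "ennreal (?f x) \<le> indicator (U - K) x + indicator {x. x - h \<in> U - K} x" for x
    proof -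
      have "x \<in> U" if "x - h \<in> K" using d(2)[OF that] h by (auto simp: dist_norm subset_eq)
      moreover have "x - h \<in> U" if "x \<in> K" using d(2)[OF that] h by (auto simp: dist_norm subset_eq)
      ultimately show ?thesis using K U by (auto simp: indicator_def)
    qed
    have "(\<integral>\<^sup>+x. ennreal (?f x) \<partial>lborel) \<le> (\<integral>\<^sup>+x. indicator (U - K) x + indicator {x. x - h \<in> U - K} x \<partial>lborel)"
      by (intro nn_integral_mono pt)
    also have "\<dots> = emeasure lborel (U - K) + emeasure lborel {x. x - h \<in> U - K}"
      by (subst nn_integral_add) auto
    also have "\<dots> = emeasure lborel (U - K) + emeasure lborel (U - K)" by (subst lborel_emeasure_translate) auto
    also have "\<dots> < ennreal (e/2) + ennreal (e/2)" using UK by (intro add_strict_mono) auto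
    also have "\<dots> = ennreal e" using e by (simp flip: ennreal_plus)
    finally have l: "(\<integral>\<^sup>+x. ennreal (?f x) \<partial>lborel) < ennreal e" .
    have "(\<integral>x. ?f x \<partial>lborel) = enn2real (\<integral>\<^sup>+x. ennreal (?f x) \<partial>lborel)"
      by (intro integral_eq_nn_integral) auto
    also have "\<dots> < e" using l e by (metis enn2real_less_iff enn2real_nonneg ennreal_less_top less_trans less_top)
    finally show ?thesis .
  qed
  then show ?thesis using d(1) by blast
qed

lemma L1_translation:
  fixes f :: "'a::euclidean_space \<Rightarrow> 'b::{banach, second_countable_topology}"
  assumes "integrable lborel f" "e > 0"
  shows "\<exists>d>0. \<forall>h. norm h < d \<longrightarrow> (\<integral>x. norm (f (x - h) - f x) \<partial>lborel) < e"
  using assms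
proof (induction f arbitrary: e rule: integrable_induct)
  case (base A c)
  \<comment> \<open>The summand 1 covers \<open>c = 0\<close>.\<close>
  have "e / (norm c + 1) > 0" using base by (simp add: add_nonneg_pos)
  then obtain d where d: "d > 0" "\<And>h. norm h < d \<Longrightarrow> (\<integral>x. \<bar>indicator A (x - h) - indicator A x\<bar> \<partial>lborel) < e / (norm c + 1)"
    using L1_translation_indicator[of A "e / (norm c + 1)"] base by auto
  have "(\<integral>x. norm (indicator A (x - h) *\<^sub>R c - indicator A x *\<^sub>R c) \<partial>lborel) < e" if "norm h < d" for h
  proof -
    have "(\<integral>x. norm (indicator A (x - h) *\<^sub>R c - indicator A x *\<^sub>R c) \<partial>lborel) = (\<integral>x. \<bar>indicator A (x - h) - indicator A x\<bar> * norm c \<partial>lborel)"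
      by (simp flip: scaleR_diff_left)
    also have "\<dots> = (\<integral>x. \<bar>indicator A (x - h) - indicator A x\<bar> \<partial>lborel) * norm c" by simp
    also have "\<dots> \<le> e / (norm c + 1) * norm c" using d(2)[OF that] by (intro mult_right_mono) auto
    also have "\<dots> < e" using base(3) by (simp add: divide_simps add_nonneg_pos add_nonneg_eq_0_iff)
    finally show ?thesis .
  qed
  then show ?case using d(1) by blast
next
  case (add f g)
  obtain d1 where d1: "d1 > 0" "\<And>h. norm h < d1 \<Longrightarrow> (\<integral>x. norm (f (x - h) - f x) \<partial>lborel) < e/2"
    using add.IH(1)[of "e/2"] add.prems by auto
  obtain d2 where d2: "d2 > 0" "\<And>h. norm h < d2 \<Longrightarrow> (\<integral>x. norm (g (x - h) - g x) \<partial>lborel) < e/2"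
    using add.IH(2)[of "e/2"] add.prems by auto
  have "(\<integral>x. norm (f (x - h) + g (x - h) - (f x + g x)) \<partial>lborel) < e" if h: "norm h < min d1 d2" for h
  proof -
    have i: "integrable lborel (\<lambda>x. f (x - h))" "integrable lborel (\<lambda>x. g (x - h))"
      using add.hyps by (simp_all add: lborel_integral_translate)
    have "(\<integral>x. norm (f (x - h) + g (x - h) - (f x + g x)) \<partial>lborel)
      \<le> (\<integral>x. norm (f (x - h) - f x) + norm (g (x - h) - g x) \<partial>lborel)"
      using i add.hyps norm_triangle_ineq[of "f (_ - h) - f _" "g (_ - h) - g _"]
      by (intro integral_mono) (auto simp: add_diff_add intro!: norm_triangle_ineq)
    also have "\<dots> = (\<integral>x. norm (f (x - h) - f x) \<partial>lborel) + (\<integral>x. norm (g (x - h) - g x) \<partial>lborel)"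
      using i add.hyps by (intro Bochner_Integration.integral_add) auto
    also have "\<dots> < e" using d1(2)[of h] d2(2)[of h] h by auto
    finally show ?thesis .
  qed
  then show ?case using d1(1) d2(1) by (intro exI[of _ "min d1 d2"]) auto
next
  case (lim f s)
  \<comment> \<open>The induction principle supplies approximations bounded by twice the norm of
    \<open>f\<close>, hence the factor 3 in the dominating function.\<close>
  have "(\<lambda>i. \<integral>x. norm (s i x - f x) \<partial>lborel) \<longlonglongrightarrow> (\<integral>x. norm (f x - f x) \<partial>lborel)"
  proof (rule integral_dominated_convergence[where w = "\<lambda>x. 3 * norm (f x)"])
    show "AE x in lborel. (\<lambda>i. norm (s i x - f x)) \<longlonglongrightarrow> norm (f x - f x)"
    proof (intro AE_I2)
      fix x :: 'a
      show "(\<lambda>i. norm (s i x - f x)) \<longlonglongrightarrow> norm (f x - f x)"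
        by (intro tendsto_intros lim.hyps(2)) auto
    qed
    show "AE x in lborel. norm (norm (s i x - f x)) \<le> 3 * norm (f x)" for i
    proof (intro AE_I2)
      fix x :: 'a
      show "norm (norm (s i x - f x)) \<le> 3 * norm (f x)"
        using lim.hyps(3)[of x i] norm_triangle_ineq4[of "s i x" "f x"] by simp
    qed
  qed (use lim in auto)
  then have "(\<lambda>i. \<integral>x. norm (s i x - f x) \<partial>lborel) \<longlonglongrightarrow> 0" by simp
  then obtain i where i: "(\<integral>x. norm (s i x - f x) \<partial>lborel) < e/3"
    using lim.prems eventually_happens'[OF _ order_tendstoD(2)[of _ 0 sequentially "e/3"]] by fastforce
  obtain d where d: "d > 0" "\<And>h. norm h < d \<Longrightarrow> (\<integral>x. norm (s i (x - h) - s i x) \<partial>lborel) < e/3"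
    using lim.IH[of "e/3" i] lim.prems by auto
  have "(\<integral>x. norm (f (x - h) - f x) \<partial>lborel) < e" if h: "norm h < d" for h
  proof -
    have I: "integrable lborel (\<lambda>x. f (x - h))" "integrable lborel (\<lambda>x. s i (x - h))" "integrable lborel f" "integrable lborel (s i)"
      using lim by (simp_all add: lborel_integral_translate)
    have "(\<integral>x. norm (f (x - h) - f x) \<partial>lborel)
      \<le> (\<integral>x. norm (s i (x - h) - f (x - h)) + norm (s i (x - h) - s i x) + norm (s i x - f x) \<partial>lborel)"
    proof (intro integral_mono)
      fix x
      have "f (x - h) - f x = - (s i (x - h) - f (x - h)) + (s i (x - h) - s i x) + (s i x - f x)" by simp
      then show "norm (f (x - h) - f x) \<le> norm (s i (x - h) - f (x - h)) + norm (s i (x - h) - s i x) + norm (s i x - f x)"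
        by (metis norm_minus_cancel norm_triangle_le norm_triangle_ineq add_right_mono)
    qed (use I in auto)
    also have "\<dots> = (\<integral>x. norm (s i (x - h) - f (x - h)) \<partial>lborel) + (\<integral>x. norm (s i (x - h) - s i x) \<partial>lborel)
         + (\<integral>x. norm (s i x - f x) \<partial>lborel)" using I by simp
    also have "(\<integral>x. norm (s i (x - h) - f (x - h)) \<partial>lborel) = (\<integral>x. norm (s i x - f x) \<partial>lborel)"
      by (rule lborel_integral_translate(2)[of "\<lambda>x. norm (s i x - f x)"])
    also have "(\<integral>x. norm (s i x - f x) \<partial>lborel) + (\<integral>x. norm (s i (x - h) - s i x) \<partial>lborel)
         + (\<integral>x. norm (s i x - f x) \<partial>lborel) < e" using i d(2)[OF h] by simp
    finally show ?thesis .
  qed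
  then show ?case using d(1) by blast
qed

section \<open>Convolution\<close>

lemma lborel_distr_reflect: "distr lborel borel (\<lambda>z. x - z) = (lborel :: 'a::euclidean_space measure)"
proof -
  have "(lborel :: 'a measure) = density (distr lborel borel (\<lambda>z. x + (-1) *\<^sub>R z)) (\<lambda>_. ennreal (\<bar>-1\<bar> ^ DIM('a)))"
    by (rule lborel_affine) simp
  then show ?thesis by (simp add: density_1)
qed

lemma lborel_integral_reflect:
  fixes f :: "'a::euclidean_space \<Rightarrow> 'b::{banach, second_countable_topology}"
  assumes "f \<in> borel_measurable borel"
  shows "(\<integral>z. f (x - z) \<partial>lborel) = (\<integral>z. f z \<partial>lborel)"
proof -
  have "(\<integral>z. f z \<partial>lborel) = (\<integral>z. f z \<partial>(distr lborel borel (\<lambda>z. x - z)))" by (simp add: lborel_distr_reflect)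
  also have "\<dots> = (\<integral>z. f (x - z) \<partial>lborel)" using assms by (subst integral_distr) auto
  finally show ?thesis by simp
qed

lemma continuous_compact_support_bounded:
  fixes g :: "'a::euclidean_space \<Rightarrow> 'b::real_normed_vector"
  assumes "continuous_on UNIV g" "\<And>x. norm x \<ge> R \<Longrightarrow> g x = 0"
  obtains B where "B > 0" "\<And>z. norm (g z) \<le> B"
proof -
  have "compact (g ` cball 0 R)" by (intro compact_continuous_image continuous_on_subset[OF assms(1)]) auto
  then obtain B where B: "\<And>z. z \<in> cball 0 R \<Longrightarrow> norm (g z) \<le> B"
    using compact_imp_bounded bounded_iff by (metis imageI)
  have "norm (g z) \<le> max B 1" for z using B[of z] assms(2)[of z] by (cases "norm z \<le> R") auto
  then show ?thesis using that[of "max B 1"] by auto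
qed

lemma integrable_convolution_kernel:
  fixes v :: "'a::euclidean_space \<Rightarrow> real" and g :: "'a \<Rightarrow> 'b::{banach, second_countable_topology}"
  assumes v: "integrable lborel v" and g: "continuous_on UNIV g" "\<And>x. norm x \<ge> R \<Longrightarrow> g x = 0"
  shows "integrable lborel (\<lambda>y. v y *\<^sub>R g (x - y))"
proof -
  obtain B where B: "B > 0" "\<And>z. norm (g z) \<le> B" using continuous_compact_support_bounded[OF g] by blast
  have [measurable]: "g \<in> borel_measurable borel" using g(1) by (rule borel_measurable_continuous_onI)
  have [measurable]: "v \<in> borel_measurable borel" using v by auto
  show ?thesis
  proof (rule Bochner_Integration.integrable_bound)
    show "integrable lborel (\<lambda>y. B * v y)" using v by simp
    show "AE y in lborel. norm (v y *\<^sub>R g (x - y)) \<le> norm (B * v y)"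
    proof (intro AE_I2)
      fix y
      show "norm (v y *\<^sub>R g (x - y)) \<le> norm (B * v y)"
        using mult_left_mono[OF B(2)[of "x - y"], of "\<bar>v y\<bar>"] B(1) by (simp add: abs_mult mult.commute)
    qed
  qed measurable
qed

text \<open>The convention that a non-integrable function has integral 0 makes the bound hold for
  every \<open>f\<close>.\<close>

lemma integral_norm_bound_nn: "ennreal (norm (integral\<^sup>L M f)) \<le> (\<integral>\<^sup>+x. norm (f x) \<partial>M)"
  by (cases "integrable M f") (simp_all add: integral_norm_bound_ennreal not_integrable_integral_eq)

definition gradient :: "(real^'n::finite \<Rightarrow> real) \<Rightarrow> real^'n \<Rightarrow> real^'n" where
  "gradient f y = (\<chi> i. partial_deriv i f y)"

lemma gradient_has_derivative:
  assumes "f differentiable (at y)"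
  shows "(f has_derivative (\<lambda>h. gradient f y \<bullet> h)) (at y)"
proof -
  have "frechet_derivative f (at y) = (\<lambda>h. gradient f y \<bullet> h)"
    by (rule ext) (simp add: frechet_derivative_partial[OF assms] gradient_def inner_vec_def mult.commute)
  then show ?thesis using has_derivative_frechet[OF assms] by simp
qed

lemma gradient_eqI:
  assumes "(f has_derivative (\<lambda>h. g \<bullet> h)) (at y)" shows "gradient f y = g"
  using frechet_derivative_eqI[OF assms]
  by (simp add: gradient_def partial_deriv_def vec_eq_iff inner_axis)

text \<open>The gradient is carried as a separate argument so that functions and gradients can
  converge to a pair of different nature, a function and its weak gradient.\<close>

definition C1_on :: "(real^'n::finite) set \<Rightarrow> (real^'n \<Rightarrow> real) \<Rightarrow> (real^'n \<Rightarrow> real^'n) \<Rightarrow> bool" where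
  "C1_on S f g \<longleftrightarrow> (\<forall>x\<in>S. (f has_derivative (\<lambda>h. g x \<bullet> h)) (at x)) \<and> continuous_on S g"

lemma C1_on_subset: "C1_on S f g \<Longrightarrow> T \<subseteq> S \<Longrightarrow> C1_on T f g"
  unfolding C1_on_def using continuous_on_subset by blast

lemma C1_on_continuous: "C1_on S f g \<Longrightarrow> continuous_on S f"
  unfolding C1_on_def using has_derivative_continuous continuous_at_imp_continuous_on by blast

lemma smooth_on_C1_on: "smooth_on S f \<Longrightarrow> C1_on S f (gradient f)"
  unfolding C1_on_def
proof (intro conjI ballI)
  assume f: "smooth_on S f"
  show "(f has_derivative (\<lambda>h. gradient f x \<bullet> h)) (at x)" if "x \<in> S" for x
    using gradient_has_derivative smooth_on_differentiable f that by blast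
  have "continuous_on S (\<lambda>x. \<chi> i. partial_deriv i f x)"
    using f by (intro continuous_on_vec_lambda smooth_on_continuous smooth_on_partial_deriv)
  then show "continuous_on S (gradient f)" by (simp add: gradient_def[abs_def])
qed

lemma gradient_zero:
  assumes "open S" "y \<in> S" "\<And>x. x \<in> S \<Longrightarrow> f x = 0"
  shows "gradient f y = 0"
proof (rule gradient_eqI)
  show "(f has_derivative (\<lambda>h. 0 \<bullet> h)) (at y)"
    by (rule has_derivative_transform_within_open[of "\<lambda>x. 0", OF _ assms(1,2)]) (use assms(3) in auto)
qed

text \<open>The gradient of the mollifier is uniformly continuous, so the error of its linearisation
  at \<open>x - y\<close> is small relative to the increment, uniformly in \<open>y\<close>.
  Integration against \<open>v\<close> multiplies this error by at most the L1 norm of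
  \<open>v\<close>.\<close>

lemma convolution_C1:
  fixes v :: "real^'n::finite \<Rightarrow> real"
  assumes v: "integrable lborel v" and \<eta>: "smooth_on UNIV \<eta>" "\<And>y. norm y \<ge> e \<Longrightarrow> \<eta> y = 0"
  shows "C1_on UNIV (\<lambda>x. \<integral>y. v y *\<^sub>R \<eta> (x - y) \<partial>lborel) (\<lambda>x. \<integral>y. v y *\<^sub>R gradient \<eta> (x - y) \<partial>lborel)"
proof -
  let ?g = "gradient \<eta>"
  have C: "C1_on UNIV \<eta> ?g" using smooth_on_C1_on[OF \<eta>(1)] .
  have gc: "continuous_on UNIV ?g" and gd: "\<And>z. (\<eta> has_derivative (\<lambda>h. ?g z \<bullet> h)) (at z)"
    using C by (auto simp: C1_on_def)
  have g0: "?g z = 0" if "norm z \<ge> e + 1" for z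
  proof (rule gradient_zero)
    show "open {z. e < norm z}" by (intro open_Collect_less continuous_intros)
  qed (use that \<eta> in auto)
  have uc: "uniformly_continuous_on UNIV ?g" by (rule uniformly_continuous_compact_support[OF gc g0])
  let ?G = "\<lambda>x. \<integral>y. v y *\<^sub>R ?g (x - y) \<partial>lborel"
  have iG: "integrable lborel (\<lambda>y. v y *\<^sub>R ?g (x - y))" for x
    by (rule integrable_convolution_kernel[OF v gc g0])
  have i\<eta>: "integrable lborel (\<lambda>y. v y *\<^sub>R \<eta> (x - y))" for x
    by (rule integrable_convolution_kernel[OF v C1_on_continuous[OF C] \<eta>(2)])
  define N where "N = (\<integral>y. norm (v y) \<partial>lborel)"
  have N0: "N \<ge> 0" by (simp add: N_def)
  \<comment> \<open>The tolerance is divided by the L1 norm \<open>N\<close> of \<open>v\<close>,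
    with 1 added in case \<open>N = 0\<close>.\<close>
  have ucd: "\<exists>d>0. \<forall>z z'. norm (z' - z) < d \<longrightarrow> norm (?g z' - ?g z) \<le> r / (N + 1)" if "r > 0" for r
  proof -
    have "r / (N + 1) > 0" using that N0 by simp
    then obtain d where "d > 0" "\<And>z z'. dist z' z < d \<Longrightarrow> dist (?g z') (?g z) < r / (N + 1)"
      using uc unfolding uniformly_continuous_on_def by (metis UNIV_I)
    then show ?thesis by (intro exI[of _ d]) (auto simp: dist_norm less_imp_le)
  qed
  have small: "r / (N + 1) * N \<le> r" if "r > 0" for r
    using that N0 by (simp add: field_simps)
  have 1: "((\<lambda>x. \<integral>y. v y *\<^sub>R \<eta> (x - y) \<partial>lborel) has_derivative (\<lambda>h. ?G x \<bullet> h)) (at x)" for x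
    unfolding has_derivative_at_alt
  proof (intro conjI allI impI)
    show "bounded_linear ((\<bullet>) (?G x))" by (rule bounded_linear_inner_right)
    fix r :: real assume r: "r > 0"
    obtain d where d: "d > 0" "\<And>z z'. norm (z' - z) < d \<Longrightarrow> norm (?g z' - ?g z) \<le> r / (N + 1)" using ucd[OF r] by blast
    have "norm ((\<integral>y. v y *\<^sub>R \<eta> (x' - y) \<partial>lborel) - (\<integral>y. v y *\<^sub>R \<eta> (x - y) \<partial>lborel) - ?G x \<bullet> (x' - x)) \<le> r * norm (x' - x)"
      if x': "norm (x' - x) < d" for x'
    proof -
      have pt: "\<bar>\<eta> (x' - y) - \<eta> (x - y) - ?g (x - y) \<bullet> (x' - x)\<bar> \<le> norm (x' - x) * (r / (N + 1))" for y
      proof -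
        have "norm (\<eta> (x' - y) - \<eta> (x - y) - ?g (x - y) \<bullet> ((x' - y) - (x - y))) \<le> norm ((x' - y) - (x - y)) * (r / (N + 1))"
        proof (rule differentiable_bound_linearization[where S = "ball (x - y) d" and f' = "\<lambda>z h. ?g z \<bullet> h"])
          fix t :: real assume t: "t \<in> {0..1}"
          have "norm (t *\<^sub>R (x' - x)) \<le> norm (x' - x)" using t by (simp add: mult_left_le_one_le)
          then show "x - y + t *\<^sub>R (x' - y - (x - y)) \<in> ball (x - y) d" using x' by (simp add: dist_norm)
        next
          fix z assume "z \<in> ball (x - y) d"
          then have "norm (?g z - ?g (x - y)) \<le> r / (N + 1)" by (intro d(2)) (simp add: dist_norm norm_minus_commute)
          then have "\<bar>(?g z - ?g (x - y)) \<bullet> i\<bar> \<le> r / (N + 1) * norm i" for i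
            using Cauchy_Schwarz_ineq2[of "?g z - ?g (x - y)" i] mult_right_mono[of "norm (?g z - ?g (x - y))" "r / (N + 1)" "norm i"]
            by simp
          then show "onorm ((\<bullet>) (?g z) - (\<bullet>) (?g (x - y))) \<le> r / (N + 1)"
            by (intro onorm_le) (simp add: inner_diff_left)
        qed (use gd d in \<open>auto intro: has_derivative_at_withinI\<close>)
        then show ?thesis by simp
      qed
      have E: "(\<integral>y. v y *\<^sub>R \<eta> (x' - y) \<partial>lborel) - (\<integral>y. v y *\<^sub>R \<eta> (x - y) \<partial>lborel) - ?G x \<bullet> (x' - x)
        = (\<integral>y. v y *\<^sub>R (\<eta> (x' - y) - \<eta> (x - y) - ?g (x - y) \<bullet> (x' - x)) \<partial>lborel)"
      proof -
        have e1: "?G x \<bullet> (x' - x) = (\<integral>y. (v y *\<^sub>R ?g (x - y)) \<bullet> (x' - x) \<partial>lborel)"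
          by (rule integral_inner_left[OF iG, symmetric])
        have j: "integrable lborel (\<lambda>y. (v y *\<^sub>R ?g (x - y)) \<bullet> (x' - x))" using iG by (rule integrable_inner_left)
        note e2 = Bochner_Integration.integral_diff[OF i\<eta>[of x'] i\<eta>[of x]]
        note e3 = Bochner_Integration.integral_diff[OF Bochner_Integration.integrable_diff[OF i\<eta>[of x'] i\<eta>[of x]] j]
        have e4: "v y *\<^sub>R (\<eta> (x' - y) - \<eta> (x - y) - ?g (x - y) \<bullet> (x' - x))
          = v y *\<^sub>R \<eta> (x' - y) - v y *\<^sub>R \<eta> (x - y) - (v y *\<^sub>R ?g (x - y)) \<bullet> (x' - x)" for y
          by (simp add: algebra_simps)
        show ?thesis unfolding e4 e3 e2 e1 ..
      qed
      have "norm ((\<integral>y. v y *\<^sub>R \<eta> (x' - y) \<partial>lborel) - (\<integral>y. v y *\<^sub>R \<eta> (x - y) \<partial>lborel) - ?G x \<bullet> (x' - x))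
        \<le> (\<integral>y. norm (v y *\<^sub>R (\<eta> (x' - y) - \<eta> (x - y) - ?g (x - y) \<bullet> (x' - x))) \<partial>lborel)"
        unfolding E by (rule integral_norm_bound)
      also have "\<dots> \<le> (\<integral>y. norm (v y) * (norm (x' - x) * (r / (N + 1))) \<partial>lborel)"
      proof (rule integral_mono')
        show "integrable lborel (\<lambda>y. norm (v y) * (norm (x' - x) * (r / (N + 1))))" using v by simp
        show "norm (v y *\<^sub>R (\<eta> (x' - y) - \<eta> (x - y) - ?g (x - y) \<bullet> (x' - x))) \<le> norm (v y) * (norm (x' - x) * (r / (N + 1)))" for y
          unfolding norm_scaleR real_norm_def[of "_ - _ - _"] by (simp only: real_norm_def) (rule mult_left_mono[OF pt], simp)
        show "0 \<le> norm (v y) * (norm (x' - x) * (r / (N + 1)))" for y using r N0 by simp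
      qed
      also have "\<dots> = norm (x' - x) * (r / (N + 1) * N)" by (simp add: N_def)
      also have "\<dots> \<le> r * norm (x' - x)" using small[OF r] by (metis mult.commute mult_right_mono norm_ge_zero)
      finally show ?thesis .
    qed
    then show "\<exists>d>0. \<forall>y. norm (y - x) < d \<longrightarrow> norm ((\<integral>ya. v ya *\<^sub>R \<eta> (y - ya) \<partial>lborel) - (\<integral>y. v y *\<^sub>R \<eta> (x - y) \<partial>lborel) - ?G x \<bullet> (y - x)) \<le> r * norm (y - x)"
      using d(1) by blast
  qed
  have 2: "continuous_on UNIV ?G"
    unfolding continuous_on_iff
  proof (intro ballI allI impI)
    fix x and r :: real assume r: "r > 0"
    obtain d where d: "d > 0" "\<And>z z'. norm (z' - z) < d \<Longrightarrow> norm (?g z' - ?g z) \<le> (r/2) / (N + 1)" using ucd[of "r/2"] r by auto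
    have "dist (?G x') (?G x) < r" if x': "dist x' x < d" for x'
    proof -
      have E: "?G x' - ?G x = (\<integral>y. v y *\<^sub>R (?g (x' - y) - ?g (x - y)) \<partial>lborel)"
        unfolding scaleR_diff_right by (rule Bochner_Integration.integral_diff[OF iG iG, symmetric])
      have "norm (?G x' - ?G x) \<le> (\<integral>y. norm (v y *\<^sub>R (?g (x' - y) - ?g (x - y))) \<partial>lborel)"
        unfolding E by (rule integral_norm_bound)
      also have "\<dots> \<le> (\<integral>y. norm (v y) * ((r/2) / (N + 1)) \<partial>lborel)"
      proof (rule integral_mono')
        show "integrable lborel (\<lambda>y. norm (v y) * ((r/2) / (N + 1)))" using v by simp
        show "norm (v y *\<^sub>R (?g (x' - y) - ?g (x - y))) \<le> norm (v y) * ((r/2) / (N + 1))" for y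
          unfolding norm_scaleR real_norm_def by (intro mult_left_mono d(2)) (use x' in \<open>auto simp: dist_norm\<close>)
        show "0 \<le> norm (v y) * ((r/2) / (N + 1))" for y using r N0 by simp
      qed
      also have "\<dots> = (r/2) / (N + 1) * N" by (simp add: N_def)
      also have "\<dots> \<le> r/2" using small[of "r/2"] r by simp
      also have "\<dots> < r" using r by simp
      finally show ?thesis by (simp add: dist_norm)
    qed
    then show "\<exists>d>0. \<forall>x'\<in>UNIV. dist x' x < d \<longrightarrow> dist (?G x') (?G x) < r" using d(1) by blast
  qed
  show ?thesis using 1 2 by (simp add: C1_on_def)
qed

text \<open>Since the mollifier has integral 1, the difference is an average over \<open>z\<close>
  of V(x - z) - V(x). By Tonelli its L1 norm is at most the same average of the L1 norms of these
  translation differences, each at most \<delta> on the support of the mollifier.\<close>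

lemma convolution_L1_close:
  fixes V :: "'a::euclidean_space \<Rightarrow> 'b::{banach, second_countable_topology}"
  assumes V: "integrable lborel V"
    and \<eta>: "continuous_on UNIV \<eta>" "\<And>y. \<eta> y \<ge> (0::real)" "\<And>y. norm y \<ge> e \<Longrightarrow> \<eta> y = 0" "integral\<^sup>L lborel \<eta> = 1"
    and close: "\<And>h. norm h < e \<Longrightarrow> (\<integral>x. norm (V (x - h) - V x) \<partial>lborel) \<le> \<delta>"
    and \<delta>: "\<delta> \<ge> 0"
  shows "integrable lborel (\<lambda>x. (\<integral>y. \<eta> (x - y) *\<^sub>R V y \<partial>lborel) - V x)"
    "(\<integral>x. norm ((\<integral>y. \<eta> (x - y) *\<^sub>R V y \<partial>lborel) - V x) \<partial>lborel) \<le> \<delta>"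
proof -
  have [measurable]: "\<eta> \<in> borel_measurable borel" using \<eta>(1) by (rule borel_measurable_continuous_onI)
  have [measurable]: "V \<in> borel_measurable borel" using V by auto
  have i\<eta>: "integrable lborel \<eta>" using \<eta>(4) not_integrable_integral_eq by fastforce
  obtain B where B: "B > 0" "\<And>z. norm (\<eta> z) \<le> B" using continuous_compact_support_bounded[OF \<eta>(1,3)] by blast
  let ?D = "\<lambda>x. (\<integral>y. \<eta> (x - y) *\<^sub>R V y \<partial>lborel) - V x"
  have D: "?D x = (\<integral>z. \<eta> z *\<^sub>R (V (x - z) - V x) \<partial>lborel)" for x
  proof -
    have "(\<integral>y. \<eta> (x - y) *\<^sub>R V y \<partial>lborel) = (\<integral>z. \<eta> (x - (x - z)) *\<^sub>R V (x - z) \<partial>lborel)"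
      by (rule lborel_integral_reflect[symmetric]) measurable
    moreover have "integrable lborel (\<lambda>z. \<eta> z *\<^sub>R V (x - z))"
    proof -
      have "integrable (distr lborel borel (\<lambda>z. x - z)) (\<lambda>y. \<eta> (x - y) *\<^sub>R V y)"
        unfolding lborel_distr_reflect
      proof (rule Bochner_Integration.integrable_bound)
        show "integrable lborel (\<lambda>y. B *\<^sub>R V y)" using V by simp
        show "AE y in lborel. norm (\<eta> (x - y) *\<^sub>R V y) \<le> norm (B *\<^sub>R V y)"
          using B by (intro AE_I2) (simp add: mult_right_mono)
      qed measurable
      then show ?thesis by (subst (asm) integrable_distr_eq) auto
    qed
    ultimately show ?thesis using i\<eta> \<eta>(4) by (simp add: scaleR_diff_right)
  qed
  have "(\<integral>\<^sup>+x. ennreal (norm (?D x)) \<partial>lborel) \<le> (\<integral>\<^sup>+x. (\<integral>\<^sup>+z. ennreal (norm (\<eta> z *\<^sub>R (V (x - z) - V x))) \<partial>lborel) \<partial>lborel)"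
    unfolding D by (intro nn_integral_mono integral_norm_bound_nn)
  also have "\<dots> = (\<integral>\<^sup>+z. (\<integral>\<^sup>+x. ennreal (norm (\<eta> z *\<^sub>R (V (x - z) - V x))) \<partial>lborel) \<partial>lborel)"
    by (rule lborel_pair.Fubini') measurable
  also have "\<dots> \<le> (\<integral>\<^sup>+z. ennreal (\<eta> z * \<delta>) \<partial>lborel)"
  proof (intro nn_integral_mono)
    fix z :: 'a
    show "(\<integral>\<^sup>+x. ennreal (norm (\<eta> z *\<^sub>R (V (x - z) - V x))) \<partial>lborel) \<le> ennreal (\<eta> z * \<delta>)"
    proof (cases "norm z < e")
      case True
      have i: "integrable lborel (\<lambda>x. norm (V (x - z) - V x))" using V by (simp add: lborel_integral_translate)
      have "(\<integral>\<^sup>+x. ennreal (norm (\<eta> z *\<^sub>R (V (x - z) - V x))) \<partial>lborel) = (\<integral>\<^sup>+x. ennreal (\<eta> z * norm (V (x - z) - V x)) \<partial>lborel)"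
        using \<eta>(2) by simp
      also have "\<dots> = ennreal (\<integral>x. \<eta> z * norm (V (x - z) - V x) \<partial>lborel)"
        using i \<eta>(2) by (intro nn_integral_eq_integral) auto
      also have "\<dots> \<le> ennreal (\<eta> z * \<delta>)"
        using close[OF True] \<eta>(2)[of z] by (intro ennreal_leI) (simp add: mult_left_mono)
      finally show ?thesis .
    qed (use \<eta>(3) in simp)
  qed
  also have "\<dots> = ennreal \<delta>"
    using i\<eta> \<eta>(2,4) \<delta> by (subst nn_integral_eq_integral) auto
  finally have le: "(\<integral>\<^sup>+x. ennreal (norm (?D x)) \<partial>lborel) \<le> ennreal \<delta>" .
  have [measurable]: "?D \<in> borel_measurable borel" by measurable
  show int: "integrable lborel ?D"
    by (rule integrableI_bounded) (use le in \<open>auto intro: le_less_trans\<close>)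
  have "ennreal (\<integral>x. norm (?D x) \<partial>lborel) \<le> ennreal \<delta>"
    using le by (subst nn_integral_eq_integral[symmetric]) (use int in auto)
  then show "(\<integral>x. norm (?D x) \<partial>lborel) \<le> \<delta>" using \<delta> by simp
qed

section \<open>Weak gradients\<close>

text \<open>Integrability is part of the definition: otherwise the integral of the difference could
  be 0 by convention, and the limit would carry no information.\<close>

definition L1_lim ::
    "'a::euclidean_space set \<Rightarrow> (nat \<Rightarrow> 'a \<Rightarrow> 'b::{banach, second_countable_topology}) \<Rightarrow> ('a \<Rightarrow> 'b) \<Rightarrow> bool" where
  "L1_lim K f F \<longleftrightarrow> (\<forall>n. set_integrable lborel K (f n)) \<and> set_integrable lborel K F \<and>
     (\<lambda>n. LINT x:K|lborel. norm (f n x - F x)) \<longlonglongrightarrow> 0"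

lemma set_integrable_norm_bound:
  fixes f :: "'a \<Rightarrow> 'b::{banach, second_countable_topology}" and g :: "'a \<Rightarrow> 'c::{banach, second_countable_topology}"
  assumes "set_integrable M K f" "set_borel_measurable M K g" "\<And>x. x \<in> K \<Longrightarrow> norm (g x) \<le> C * norm (f x)"
  shows "set_integrable M K g"
  unfolding set_integrable_def
proof (rule Bochner_Integration.integrable_bound)
  show "integrable M (\<lambda>x. C *\<^sub>R (indicator K x *\<^sub>R f x))"
    by (intro integrable_scaleR_right) (use assms(1) in \<open>simp add: set_integrable_def\<close>)
  show "AE x in M. norm (indicator K x *\<^sub>R g x) \<le> norm (C *\<^sub>R (indicator K x *\<^sub>R f x))"
    using assms(3) by (auto simp: indicator_def intro!: AE_I2 intro: order.trans[OF _ mult_right_mono[OF abs_ge_self]])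
qed (use assms(2) in \<open>simp add: set_borel_measurable_def\<close>)

lemma set_integrable_norm_diff:
  fixes f g :: "'a \<Rightarrow> 'b::{banach, second_countable_topology}"
  shows "set_integrable M K f \<Longrightarrow> set_integrable M K g \<Longrightarrow> set_integrable M K (\<lambda>x. norm (f x - g x))"
  by (rule set_integrable_norm) (rule set_integral_diff(1))

text \<open>Meant for operations applied pointwise: a Lipschitz operation that fixes 0 satisfies the
  three bounds, so it preserves convergence in L1.\<close>

lemma L1_lim_dominated:
  fixes f :: "nat \<Rightarrow> 'a::euclidean_space \<Rightarrow> 'b::{banach, second_countable_topology}"
    and g :: "nat \<Rightarrow> 'a \<Rightarrow> 'c::{banach, second_countable_topology}"
  assumes "L1_lim K f F" and m: "\<And>n. set_borel_measurable lborel K (g n)" "set_borel_measurable lborel K G"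
    and b: "\<And>n x. x \<in> K \<Longrightarrow> norm (g n x) \<le> C * norm (f n x)" "\<And>x. x \<in> K \<Longrightarrow> norm (G x) \<le> C * norm (F x)"
    and d: "\<And>n x. x \<in> K \<Longrightarrow> norm (g n x - G x) \<le> C * norm (f n x - F x)"
  shows "L1_lim K g G"
proof -
  have i: "set_integrable lborel K (f n)" "set_integrable lborel K F" for n using assms(1) by (auto simp: L1_lim_def)
  have j: "set_integrable lborel K (g n)" for n
    by (rule set_integrable_norm_bound[OF i(1)[of n] m(1) b(1)])
  have J: "set_integrable lborel K G" 
    by (rule set_integrable_norm_bound[OF i(2) m(2) b(2)])
  have "(\<lambda>n. LINT x:K|lborel. norm (g n x - G x)) \<longlonglongrightarrow> 0"
  proof (rule tendsto_sandwich[OF _ _ tendsto_const])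
    have "(\<lambda>n. C * (LINT x:K|lborel. norm (f n x - F x))) \<longlonglongrightarrow> C * 0"
      using assms(1) by (intro tendsto_intros) (auto simp: L1_lim_def)
    then show "(\<lambda>n. C * (LINT x:K|lborel. norm (f n x - F x))) \<longlonglongrightarrow> 0" by simp
    show "\<forall>\<^sub>F n in sequentially. (LINT x:K|lborel. norm (g n x - G x)) \<le> C * (LINT x:K|lborel. norm (f n x - F x))"
    proof (intro always_eventually allI)
      fix n
      have "(LINT x:K|lborel. norm (g n x - G x)) \<le> (LINT x:K|lborel. C * norm (f n x - F x))"
        by (intro set_integral_mono set_integrable_norm_diff j J set_integrable_mult_right i d)
      then show "(LINT x:K|lborel. norm (g n x - G x)) \<le> C * (LINT x:K|lborel. norm (f n x - F x))" by simp
    qed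
    show "\<forall>\<^sub>F n in sequentially. 0 \<le> (LINT x:K|lborel. norm (g n x - G x))"
      by (intro always_eventually allI) (auto simp: set_lebesgue_integral_def)
  qed
  then show ?thesis using j J by (simp add: L1_lim_def)
qed

lemma L1_lim_add:
  assumes "L1_lim K f F" "L1_lim K g G"
  shows "L1_lim K (\<lambda>n x. f n x + g n x) (\<lambda>x. F x + G x)"
proof -
  have i: "set_integrable lborel K (f n)" "set_integrable lborel K F" "set_integrable lborel K (g n)" "set_integrable lborel K G" for n
    using assms by (auto simp: L1_lim_def)
  have "(\<lambda>n. LINT x:K|lborel. norm (f n x + g n x - (F x + G x))) \<longlonglongrightarrow> 0"
  proof (rule tendsto_sandwich[OF _ _ tendsto_const])
    have "(\<lambda>n. (LINT x:K|lborel. norm (f n x - F x)) + (LINT x:K|lborel. norm (g n x - G x))) \<longlonglongrightarrow> 0 + 0"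
      using assms by (intro tendsto_intros) (auto simp: L1_lim_def)
    then show "(\<lambda>n. (LINT x:K|lborel. norm (f n x - F x)) + (LINT x:K|lborel. norm (g n x - G x))) \<longlonglongrightarrow> 0" by simp
    show "\<forall>\<^sub>F n in sequentially. (LINT x:K|lborel. norm (f n x + g n x - (F x + G x)))
        \<le> (LINT x:K|lborel. norm (f n x - F x)) + (LINT x:K|lborel. norm (g n x - G x))"
    proof (intro always_eventually allI)
      fix n
      have "(LINT x:K|lborel. norm (f n x + g n x - (F x + G x))) \<le> (LINT x:K|lborel. norm (f n x - F x) + norm (g n x - G x))"
        by (intro set_integral_mono set_integrable_norm_diff set_integral_add(1) i) (simp add: add_diff_add norm_triangle_ineq)
      also have "\<dots> = (LINT x:K|lborel. norm (f n x - F x)) + (LINT x:K|lborel. norm (g n x - G x))"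
        by (intro set_integral_add(2) set_integrable_norm_diff i)
      finally show "(LINT x:K|lborel. norm (f n x + g n x - (F x + G x)))
        \<le> (LINT x:K|lborel. norm (f n x - F x)) + (LINT x:K|lborel. norm (g n x - G x))" .
    qed
    show "\<forall>\<^sub>F n in sequentially. 0 \<le> (LINT x:K|lborel. norm (f n x + g n x - (F x + G x)))"
      by (intro always_eventually allI) (auto simp: set_lebesgue_integral_def)
  qed
  then show ?thesis using i by (simp add: L1_lim_def set_integral_add(1))
qed

text \<open>A continuous coefficient is bounded on the compact set, so multiplication by it is a
  Lipschitz operation. For measurability both factors are first multiplied by the indicator, since
  only the restricted functions are known to be measurable.\<close>

lemma L1_lim_bilinear:
  fixes P :: "'c::{real_normed_vector, second_countable_topology} \<Rightarrow> 'b::{banach, second_countable_topology} \<Rightarrow> 'd::{banach, second_countable_topology}"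
  assumes P: "bounded_bilinear P" and K: "compact K" and a: "continuous_on K a" and f: "L1_lim K f F"
  shows "L1_lim K (\<lambda>n x. P (a x) (f n x)) (\<lambda>x. P (a x) (F x))"
proof -
  interpret P: bounded_bilinear P by fact
  obtain c where c: "c > 0" "\<And>x y. norm (P x y) \<le> norm x * norm y * c" using P.pos_bounded by blast
  have "compact (a ` K)" using a K by (rule compact_continuous_image)
  then obtain B where B: "\<And>x. x \<in> K \<Longrightarrow> norm (a x) \<le> B" using compact_imp_bounded bounded_iff by (metis imageI)
  have Kb: "K \<in> sets borel" using K compact_imp_closed borel_closed by blast
  have am: "(\<lambda>x. indicator K x *\<^sub>R a x) \<in> borel_measurable borel"
    by (rule borel_measurable_continuous_on_indicator[OF Kb a])
  have m: "set_borel_measurable lborel K (\<lambda>x. P (a x) (h x))" if "set_integrable lborel K h" for h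
  proof -
    have "(\<lambda>x. indicator K x *\<^sub>R h x) \<in> borel_measurable borel"
      using that by (auto simp: set_integrable_def dest: borel_measurable_integrable)
    then have "(\<lambda>x. P (indicator K x *\<^sub>R a x) (indicator K x *\<^sub>R h x)) \<in> borel_measurable borel"
      by (rule borel_measurable_continuous_Pair[OF am])
         (rule P.continuous_on[OF continuous_on_fst[OF continuous_on_id] continuous_on_snd[OF continuous_on_id]])
    moreover have "(\<lambda>x. P (indicator K x *\<^sub>R a x) (indicator K x *\<^sub>R h x)) = (\<lambda>x. indicator K x *\<^sub>R P (a x) (h x))"
      by (auto simp: indicator_def P.zero_left P.zero_right)
    ultimately show ?thesis by (simp add: set_borel_measurable_def)
  qed
  have b: "norm (P (a x) y) \<le> (B * c) * norm y" if "x \<in> K" for x y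
  proof -
    have "norm (P (a x) y) \<le> norm (a x) * norm y * c" by (rule c(2))
    also have "\<dots> \<le> B * norm y * c" using B[OF that] c(1) by (intro mult_right_mono) auto
    finally show ?thesis by (simp add: mult_ac)
  qed
  show ?thesis
    by (rule L1_lim_dominated[OF f, where C = "B * c"])
       (use f b m in \<open>auto simp: L1_lim_def P.diff_right[symmetric]\<close>)
qed

lemma L1_lim_integral:
  assumes "L1_lim K f F"
  shows "(\<lambda>n. LINT x:K|lborel. f n x) \<longlonglongrightarrow> (LINT x:K|lborel. F x)"
proof -
  have i: "set_integrable lborel K (f n)" "set_integrable lborel K F" for n
    using assms by (auto simp: L1_lim_def)
  have "(\<lambda>n. (LINT x:K|lborel. f n x) - (LINT x:K|lborel. F x)) \<longlonglongrightarrow> 0"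
  proof (rule Lim_null_comparison)
    show "(\<lambda>n. LINT x:K|lborel. norm (f n x - F x)) \<longlonglongrightarrow> 0" using assms by (simp add: L1_lim_def)
    show "\<forall>\<^sub>F n in sequentially. norm ((LINT x:K|lborel. f n x) - (LINT x:K|lborel. F x)) \<le> (LINT x:K|lborel. norm (f n x - F x))"
    proof (intro always_eventually allI)
      fix n
      show "norm ((LINT x:K|lborel. f n x) - (LINT x:K|lborel. F x)) \<le> (LINT x:K|lborel. norm (f n x - F x))"
        unfolding set_integral_diff(2)[OF i(1) i(2), symmetric]
        by (rule set_integral_norm_bound[OF set_integral_diff(1)[OF i(1) i(2)]])
    qed
  qed
  then show ?thesis by (rule LIM_zero_cancel)
qed

lemma set_integrable_continuous_compact:
  fixes f :: "'a::euclidean_space \<Rightarrow> 'b::{banach, second_countable_topology}"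
  assumes "compact K" "continuous_on K f" shows "set_integrable lborel K f"
  unfolding set_integrable_def by (rule borel_integrable_compact[OF assms])

section \<open>Approximation of weak gradients by C1 functions\<close>

definition weak_parts :: "(real^'n::finite) set \<Rightarrow> (real^'n \<Rightarrow> real) \<Rightarrow> (real^'n \<Rightarrow> real^'n) \<Rightarrow> bool" where
  "weak_parts S v w \<longleftrightarrow> (\<forall>\<phi> i. test_function S \<phi> \<longrightarrow>
     (LINT y:S|lborel. v y * partial_deriv i \<phi> y) = - (LINT y:S|lborel. w y $ i * \<phi> y))"

definition locally_L1 :: "'a::euclidean_space set \<Rightarrow> ('a \<Rightarrow> 'b::{banach, second_countable_topology}) \<Rightarrow> bool" where
  "locally_L1 S v \<longleftrightarrow> (\<forall>K. compact K \<and> K \<subseteq> S \<longrightarrow> set_integrable lborel K v)"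

definition weak_gradient :: "(real^'n::finite) set \<Rightarrow> (real^'n \<Rightarrow> real) \<Rightarrow> (real^'n \<Rightarrow> real^'n) \<Rightarrow> bool" where
  "weak_gradient S v w \<longleftrightarrow> locally_L1 S v \<and> locally_L1 S w \<and> weak_parts S v w"

lemma weak_differential_iff:
  "weak_differential A u \<omega> \<longleftrightarrow> oneform A \<omega> \<and> (\<forall>c\<in>A. weak_gradient (chart_img c) (\<lambda>y. u (chart_inv c y)) (\<omega> c))"
  unfolding weak_differential_def weak_gradient_def locally_L1_def weak_parts_def o_def by blast

text \<open>Mollify \<open>v\<close> after cutting it off outside a neighbourhood \<open>K'\<close>
  of \<open>K\<close>. For \<open>x\<close> in \<open>K\<close> the kernel centred at
  \<open>x\<close> is a test function supported where the weak identity holds, so the gradient of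
  the mollified \<open>v\<close> is the mollified \<open>w\<close>. As the kernels are small, the
  local form \<open>loc\<close> of the identity suffices; the local nature of weak gradients rests
  on this.\<close>

lemma approx_step:
  fixes v :: "real^'n::finite \<Rightarrow> real" and w :: "real^'n \<Rightarrow> real^'n"
  assumes S: "open S" and v: "locally_L1 S v" "locally_L1 S w"
    and loc: "\<And>x. x \<in> S \<Longrightarrow> \<exists>N. open N \<and> x \<in> N \<and> N \<subseteq> S \<and> weak_parts N v w"
    and K: "compact K" "K \<subseteq> S" and \<delta>: "\<delta> > 0"
  shows "\<exists>f g. C1_on UNIV f g \<and> (LINT x:K|lborel. norm (f x - v x)) \<le> \<delta> \<and> (LINT x:K|lborel. norm (g x - w x)) \<le> \<delta>"
proof -
  let ?N = "{N. open N \<and> N \<subseteq> S \<and> weak_parts N v w}"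
  \<comment> \<open>A Lebesgue number: every ball of this radius centred in \<open>K\<close> lies in
    one of the sets on which the weak identity is known.\<close>
  obtain \<epsilon> where \<epsilon>: "\<epsilon> > 0" "\<And>x. x \<in> K \<Longrightarrow> \<exists>N\<in>?N. ball x \<epsilon> \<subseteq> N"
  proof (rule Heine_Borel_lemma[OF K(1), of ?N])
    show "K \<subseteq> \<Union>?N" using loc K by blast
  qed auto
  define r where "r = \<epsilon> / 2"
  have r: "r > 0" "r < \<epsilon>" using \<epsilon> by (auto simp: r_def)
  define K' where "K' = {x + y |x y. x \<in> K \<and> y \<in> cball 0 r}"
  have K'c: "compact K'" unfolding K'_def by (rule compact_sums[OF K(1) compact_cball])
  have K'i: "y \<in> K'" if "x \<in> K" "norm (y - x) \<le> r" for x y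
    unfolding K'_def using that by (intro CollectI exI[of _ x] exI[of _ "y - x"]) auto
  have K'S: "K' \<subseteq> S"
  proof
    fix y assume "y \<in> K'"
    then obtain x z where "x \<in> K" "y = x + z" "norm z \<le> r" by (auto simp: K'_def)
    then show "y \<in> S" using \<epsilon>(2)[of x] r by (force simp: dist_norm subset_eq)
  qed
  have KK': "K \<subseteq> K'" using K'i r by force
  define V where "V = (\<lambda>x. indicator K' x *\<^sub>R v x)"
  define W where "W = (\<lambda>x. indicator K' x *\<^sub>R w x)"
  have V: "integrable lborel V" and W: "integrable lborel W"
    using v K'c K'S by (auto simp: V_def W_def locally_L1_def set_integrable_def)
  obtain d1 where d1: "d1 > 0" "\<And>h. norm h < d1 \<Longrightarrow> (\<integral>x. norm (V (x - h) - V x) \<partial>lborel) < \<delta>" using L1_translation[OF V \<delta>] by blast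
  obtain d2 where d2: "d2 > 0" "\<And>h. norm h < d2 \<Longrightarrow> (\<integral>x. norm (W (x - h) - W x) \<partial>lborel) < \<delta>" using L1_translation[OF W \<delta>] by blast
  \<comment> \<open>Three demands on the kernel: its translates centred in \<open>K\<close> stay
    inside \<open>K'\<close>, and translations by less than \<open>e\<close> move both
    \<open>V\<close> and \<open>W\<close> by less than \<delta> in L1.\<close>
  define e where "e = min r (min d1 d2)"
  have e: "e > 0" "e \<le> r" "e \<le> d1" "e \<le> d2" using r d1 d2 by (auto simp: e_def)
  obtain \<eta> :: "real^'n \<Rightarrow> real" where \<eta>: "smooth_on UNIV \<eta>" "\<And>y. \<eta> y \<ge> 0" "\<And>y. norm y \<ge> e \<Longrightarrow> \<eta> y = 0"
     "integrable lborel \<eta>" "integral\<^sup>L lborel \<eta> = 1" using mollifier_exists[OF e(1)] by blast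
  let ?f = "\<lambda>x. \<integral>y. V y *\<^sub>R \<eta> (x - y) \<partial>lborel" and ?g = "\<lambda>x. \<integral>y. V y *\<^sub>R gradient \<eta> (x - y) \<partial>lborel"
  have C1: "C1_on UNIV ?f ?g" by (rule convolution_C1[OF V \<eta>(1,3)])
  have Vc: "(\<integral>x. norm (V (x - h) - V x) \<partial>lborel) \<le> \<delta>" if "norm h < e" for h
    using d1(2)[of h] that e by simp
  have fV: "integrable lborel (\<lambda>x. (\<integral>y. \<eta> (x - y) *\<^sub>R V y \<partial>lborel) - V x)"
      "(\<integral>x. norm ((\<integral>y. \<eta> (x - y) *\<^sub>R V y \<partial>lborel) - V x) \<partial>lborel) \<le> \<delta>"
    using convolution_L1_close[OF V smooth_on_continuous[OF \<eta>(1)] \<eta>(2,3,5) Vc less_imp_le[OF \<delta>]] by auto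
  have Wc: "(\<integral>x. norm (W (x - h) - W x) \<partial>lborel) \<le> \<delta>" if "norm h < e" for h
    using d2(2)[of h] that e by simp
  have gW: "integrable lborel (\<lambda>x. (\<integral>y. \<eta> (x - y) *\<^sub>R W y \<partial>lborel) - W x)"
      "(\<integral>x. norm ((\<integral>y. \<eta> (x - y) *\<^sub>R W y \<partial>lborel) - W x) \<partial>lborel) \<le> \<delta>"
    using convolution_L1_close[OF W smooth_on_continuous[OF \<eta>(1)] \<eta>(2,3,5) Wc less_imp_le[OF \<delta>]] by auto
  have g0: "gradient \<eta> z = 0" if "norm z > e" for z
  proof (rule gradient_zero)
    show "open {z :: real^'n. e < norm z}" by (intro open_Collect_less continuous_intros)
  qed (use that \<eta> in auto)
  have gc: "continuous_on UNIV (gradient \<eta>)" using smooth_on_C1_on[OF \<eta>(1)] by (simp add: C1_on_def)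
  \<comment> \<open>As a function of \<open>y\<close>, the kernel \<eta>(x - y) has a gradient of
    the opposite sign; this sign and the one in \<open>weak_parts\<close> cancel.\<close>
  have geq: "?g x = (\<integral>y. \<eta> (x - y) *\<^sub>R W y \<partial>lborel)" if x: "x \<in> K" for x
  proof -
    obtain N where N: "open N" "N \<subseteq> S" "weak_parts N v w" "ball x \<epsilon> \<subseteq> N" using \<epsilon>(2)[OF x] by blast
    let ?\<phi> = "\<lambda>y. \<eta> (x - y)"
    have \<phi>s: "smooth_on UNIV ?\<phi>"
      using smooth_on_pre[OF open_UNIV bounded_linear_minus[OF bounded_linear_ident] _ \<eta>(1), of x] by simp
    have t: "test_function N ?\<phi>"
      unfolding test_function_def
    proof (intro conjI exI[of _ "cball x e"] allI impI)
      show "cball x e \<subseteq> N" using N e r by (auto simp: subset_eq)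
      show "\<eta> (x - y) = 0" if "y \<notin> cball x e" for y using \<eta>(3)[of "x - y"] that by (simp add: dist_norm)
    qed (use \<phi>s in auto)
    have pd: "partial_deriv i ?\<phi> y = - (gradient \<eta> (x - y) $ i)" for i y
    proof -
      have "(\<eta> has_derivative (\<lambda>h. gradient \<eta> (x - y) \<bullet> h)) (at (x - y))"
        using smooth_on_C1_on[OF \<eta>(1)] by (simp add: C1_on_def)
      moreover have "((\<lambda>y. x - y) has_derivative (\<lambda>h. - h)) (at y)" by (auto intro!: derivative_eq_intros)
      ultimately have "(?\<phi> has_derivative (\<lambda>h. gradient \<eta> (x - y) \<bullet> (- h))) (at y)"
        using diff_chain_at[of "\<lambda>y. x - y"] by (force simp: o_def)
      then show ?thesis by (simp add: partial_deriv_def frechet_derivative_eqI inner_axis)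
    qed
    have inN: "y \<in> N \<and> y \<in> K'" if "norm (x - y) \<le> e" for y
      using that N(4) e r K'i[OF x, of y] by (auto simp: subset_eq dist_norm norm_minus_commute)
    have "?g x $ i = (\<integral>y. \<eta> (x - y) *\<^sub>R W y \<partial>lborel) $ i" for i
    proof -
      have iv: "integrable lborel (\<lambda>y. V y *\<^sub>R gradient \<eta> (x - y))"
        by (rule integrable_convolution_kernel[OF V gc, of "e + 1"]) (use g0 in auto)
      have iw: "integrable lborel (\<lambda>y. \<eta> (x - y) *\<^sub>R W y)"
      proof -
        obtain B where B: "B > 0" "\<And>z. norm (\<eta> z) \<le> B" using continuous_compact_support_bounded[OF smooth_on_continuous[OF \<eta>(1)] \<eta>(3)] by blast
        have [measurable]: "\<eta> \<in> borel_measurable borel" by (rule borel_measurable_continuous_onI[OF smooth_on_continuous[OF \<eta>(1)]])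
        have [measurable]: "W \<in> borel_measurable borel" using W by auto
        show ?thesis
        proof (rule Bochner_Integration.integrable_bound)
          show "integrable lborel (\<lambda>y. B *\<^sub>R W y)" using W by simp
          show "AE y in lborel. norm (\<eta> (x - y) *\<^sub>R W y) \<le> norm (B *\<^sub>R W y)"
            using B by (intro AE_I2) (simp add: mult_right_mono)
        qed measurable
      qed
      have "?g x $ i = (\<integral>y. V y * gradient \<eta> (x - y) $ i \<partial>lborel)"
        using integral_bounded_linear[OF bounded_linear_vec_nth iv, of i] by simp
      also have "\<dots> = - (LINT y:N|lborel. v y * partial_deriv i ?\<phi> y)"
        unfolding set_lebesgue_integral_def pd Bochner_Integration.integral_minus[symmetric]
        by (intro Bochner_Integration.integral_cong refl)
           (use inN g0 in \<open>force simp: V_def indicator_def not_le\<close>)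
      also have "\<dots> = (LINT y:N|lborel. w y $ i * ?\<phi> y)" using N(3) t by (simp add: weak_parts_def)
      also have "\<dots> = (\<integral>y. (\<eta> (x - y) *\<^sub>R W y) $ i \<partial>lborel)"
        unfolding set_lebesgue_integral_def
        by (intro Bochner_Integration.integral_cong refl)
           (use inN \<eta>(3) in \<open>force simp: W_def indicator_def not_le\<close>)
      also have "\<dots> = (\<integral>y. \<eta> (x - y) *\<^sub>R W y \<partial>lborel) $ i"
        using integral_bounded_linear[OF bounded_linear_vec_nth iw, of i] by simp
      finally show ?thesis .
    qed
    then show ?thesis by (simp add: vec_eq_iff)
  qed
  have Kb: "K \<in> sets borel" using K compact_imp_closed borel_closed by blast
  have le: "(LINT x:K|lborel. norm (D x)) \<le> (\<integral>x. norm (D x) \<partial>lborel)" if "integrable lborel D" for D :: "real^'n \<Rightarrow> 'b::{banach, second_countable_topology}"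
    unfolding set_lebesgue_integral_def
    by (rule integral_mono') (use that in \<open>auto simp: indicator_def\<close>)
  show ?thesis
  proof (intro exI conjI)
    show "C1_on UNIV ?f ?g" by fact
    have "(LINT x:K|lborel. norm (?f x - v x)) = (LINT x:K|lborel. norm ((\<integral>y. \<eta> (x - y) *\<^sub>R V y \<partial>lborel) - V x))"
      using Kb KK' by (intro set_lebesgue_integral_cong) (auto simp: V_def mult.commute)
    also have "\<dots> \<le> \<delta>" using le[OF fV(1)] fV(2) by linarith
    finally show "(LINT x:K|lborel. norm (?f x - v x)) \<le> \<delta>" .
    have "(LINT x:K|lborel. norm (?g x - w x)) = (LINT x:K|lborel. norm ((\<integral>y. \<eta> (x - y) *\<^sub>R W y \<partial>lborel) - W x))"
      using Kb KK' geq by (intro set_lebesgue_integral_cong) (auto simp: W_def)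
    also have "\<dots> \<le> \<delta>" using le[OF gW(1)] gW(2) by linarith
    finally show "(LINT x:K|lborel. norm (?g x - w x)) \<le> \<delta>" .
  qed
qed

lemma weak_gradient_approx_local:
  fixes v :: "real^'n::finite \<Rightarrow> real"
  assumes S: "open S" and v: "locally_L1 S v" "locally_L1 S w"
    and loc: "\<And>x. x \<in> S \<Longrightarrow> \<exists>N. open N \<and> x \<in> N \<and> N \<subseteq> S \<and> weak_parts N v w"
    and K: "compact K" "K \<subseteq> S"
  obtains f g where "\<And>n. C1_on UNIV (f n) (g n)" "L1_lim K f v" "L1_lim K g w"
proof -
  have "\<exists>f g. C1_on UNIV f g \<and> (LINT x:K|lborel. norm (f x - v x)) \<le> 1 / Suc n \<and> (LINT x:K|lborel. norm (g x - w x)) \<le> 1 / Suc n" for n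
    by (rule approx_step[OF S v loc K]) auto
  then have "\<forall>n. \<exists>p. C1_on UNIV (fst p) (snd p) \<and> (LINT x:K|lborel. norm (fst p x - v x)) \<le> 1 / Suc n
      \<and> (LINT x:K|lborel. norm (snd p x - w x)) \<le> 1 / Suc n" by simp
  from choice[OF this] obtain p where p: "\<And>n. C1_on UNIV (fst (p n)) (snd (p n)) \<and> (LINT x:K|lborel. norm (fst (p n) x - v x)) \<le> 1 / Suc n
      \<and> (LINT x:K|lborel. norm (snd (p n) x - w x)) \<le> 1 / Suc n" by blast
  define f where "f n = fst (p n)" for n
  define g where "g n = snd (p n)" for n
  have fg: "\<And>n. C1_on UNIV (f n) (g n)" "\<And>n. (LINT x:K|lborel. norm (f n x - v x)) \<le> 1 / Suc n"
      "\<And>n. (LINT x:K|lborel. norm (g n x - w x)) \<le> 1 / Suc n" using p by (simp_all add: f_def g_def)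
  have z: "h \<longlonglongrightarrow> 0" if "\<And>n. h n \<le> 1 / Suc n" "\<And>n. 0 \<le> h n" for h :: "nat \<Rightarrow> real"
    by (rule tendsto_sandwich[OF _ _ tendsto_const LIMSEQ_inverse_real_of_nat])
       (use that in \<open>auto simp: inverse_eq_divide\<close>)
  have c: "set_integrable lborel K (f n)" "set_integrable lborel K (g n)" for n
  proof -
    have C: "C1_on K (f n) (g n)" using C1_on_subset[OF fg(1)] by blast
    show "set_integrable lborel K (f n)" "set_integrable lborel K (g n)"
      using C C1_on_continuous[OF C] by (auto intro!: set_integrable_continuous_compact[OF K(1)] simp: C1_on_def)
  qed
  show ?thesis
  proof
    have nn: "0 \<le> (LINT x:K|lborel. norm (h x))" for h :: "real^'n \<Rightarrow> 'c::{banach, second_countable_topology}"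
      by (auto simp: set_lebesgue_integral_def)
    show "L1_lim K f v" unfolding L1_lim_def
      by (intro conjI allI c z[OF fg(2)] nn) (use v K in \<open>simp add: locally_L1_def\<close>)
    show "L1_lim K g w" unfolding L1_lim_def
      by (intro conjI allI c z[OF fg(3)] nn) (use v K in \<open>simp add: locally_L1_def\<close>)
  qed (rule fg(1))
qed

text \<open>Difference quotients in a coordinate direction have integral 0 by translation
  invariance. They converge to the partial derivative, dominated by a bound on the gradient times
  the indicator of a large ball.\<close>

lemma integral_partial_deriv_zero:
  fixes f :: "real^'n::finite \<Rightarrow> real"
  assumes C: "C1_on UNIV f g" and K: "compact K" "\<And>x. x \<notin> K \<Longrightarrow> f x = 0"
  shows "(\<integral>x. g x $ i \<partial>lborel) = 0"
proof -
  obtain R where R: "\<And>x. x \<in> K \<Longrightarrow> norm x \<le> R" using K(1) compact_imp_bounded bounded_iff by metis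
  define R' where "R' = max R 0 + 1"
  have f0: "f x = 0" if "norm x \<ge> R'" for x using R[of x] K(2)[of x] that
    by (cases "x \<in> K") (auto simp: R'_def max_def split: if_splits)
  have gc: "continuous_on UNIV g" and fd: "\<And>x. (f has_derivative (\<lambda>h. g x \<bullet> h)) (at x)" using C by (auto simp: C1_on_def)
  have g0: "g x = 0" if "norm x \<ge> R' + 1" for x
  proof -
    have "gradient f x = 0"
      by (rule gradient_zero[of "{z. R' < norm z}"]) (use that f0 in \<open>auto intro!: open_Collect_less continuous_intros\<close>)
    then show ?thesis using gradient_eqI[OF fd] by simp
  qed
  let ?e = "axis i 1 :: real^'n"
  let ?h = "\<lambda>n. 1 / real (Suc n)"
  let ?q = "\<lambda>n x. (f (x + ?h n *\<^sub>R ?e) - f x) / ?h n"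
  obtain B where B: "B > 0" "\<And>z. norm (g z) \<le> B" using continuous_compact_support_bounded[OF gc g0] by blast
  have fi: "integrable lborel f"
    by (rule integrable_continuous_compact_support[OF C1_on_continuous[OF C] compact_cball[of 0 R']]) (use f0 in auto)
  have [measurable]: "f \<in> borel_measurable borel" using fi by auto
  have [measurable]: "g \<in> borel_measurable borel" by (rule borel_measurable_continuous_onI[OF gc])
  have q0: "(\<integral>x. ?q n x \<partial>lborel) = 0" for n
  proof -
    have i: "integrable lborel (\<lambda>x. f (x + ?h n *\<^sub>R ?e))" "(\<integral>x. f (x + ?h n *\<^sub>R ?e) \<partial>lborel) = (\<integral>x. f x \<partial>lborel)"
      using lborel_integral_translate[of f "- (?h n *\<^sub>R ?e)"] fi by simp_all
    have "(\<integral>x. ?q n x \<partial>lborel) = ((\<integral>x. f (x + ?h n *\<^sub>R ?e) \<partial>lborel) - (\<integral>x. f x \<partial>lborel)) / ?h n"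
      using i fi by simp
    then show ?thesis using i by simp
  qed
  have "(\<lambda>n. \<integral>x. ?q n x \<partial>lborel) \<longlonglongrightarrow> (\<integral>x. g x $ i \<partial>lborel)"
  \<comment> \<open>The steps have length at most 1, so all difference quotients vanish outside
    radius \<open>R' + 1\<close>.\<close>
  proof (rule integral_dominated_convergence[where w = "\<lambda>x. B * indicator (cball 0 (R' + 1)) x"])
    show "(\<lambda>x. g x $ i) \<in> borel_measurable lborel" unfolding cart_eq_inner_axis by measurable
    show "?q n \<in> borel_measurable lborel" for n by measurable
    show "integrable lborel (\<lambda>x. B * indicator (cball (0::real^'n) (R' + 1)) x)"
      by (intro integrable_mult_right integrable_real_indicator) (use emeasure_bounded_finite[OF bounded_cball] in auto)
    show "AE x in lborel. (\<lambda>n. ?q n x) \<longlonglongrightarrow> g x $ i"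
    proof (intro AE_I2)
      fix x :: "real^'n"
      have "((\<lambda>t. x + t *\<^sub>R ?e) has_derivative (\<lambda>t. t *\<^sub>R ?e)) (at 0)" by (auto intro!: derivative_eq_intros)
      moreover have "(f has_derivative (\<lambda>h. g x \<bullet> h)) (at (x + 0 *\<^sub>R ?e))" using fd by simp
      ultimately have "((\<lambda>t. f (x + t *\<^sub>R ?e)) has_derivative (\<lambda>t. g x \<bullet> (t *\<^sub>R ?e))) (at 0)"
        using diff_chain_at[of "\<lambda>t. x + t *\<^sub>R ?e"] by (force simp: o_def)
      then have "((\<lambda>t. f (x + t *\<^sub>R ?e)) has_field_derivative (g x $ i)) (at 0)"
        by (simp add: has_field_derivative_def inner_axis mult.commute[of _ "g x $ i"] cong: )
      then have "((\<lambda>t. (f (x + t *\<^sub>R ?e) - f x) / t) \<longlongrightarrow> g x $ i) (at 0)"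
        by (simp add: has_field_derivative_iff)
      moreover have "filterlim ?h (at 0) sequentially"
        by (rule filterlim_atI) (use LIMSEQ_inverse_real_of_nat in \<open>auto simp: inverse_eq_divide\<close>)
      ultimately show "(\<lambda>n. ?q n x) \<longlonglongrightarrow> g x $ i" by (rule filterlim_compose)
    qed
    show "AE x in lborel. norm (?q n x) \<le> B * indicator (cball 0 (R' + 1)) x" for n
    proof (intro AE_I2)
      fix x :: "real^'n"
      have hn: "norm (?h n *\<^sub>R ?e) \<le> 1" "?h n > 0" by simp_all
      show "norm (?q n x) \<le> B * indicator (cball 0 (R' + 1)) x"
      proof (cases "norm x \<le> R' + 1")
        case True
        have "norm (f (x + ?h n *\<^sub>R ?e) - f x) \<le> B * norm ((x + ?h n *\<^sub>R ?e) - x)"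
        proof (rule differentiable_bound[of UNIV f "\<lambda>x h. g x \<bullet> h"])
          show "onorm ((\<bullet>) (g z)) \<le> B" for z
            using B by (intro onorm_le) (metis Cauchy_Schwarz_ineq2 mult_right_mono norm_ge_zero order_trans real_norm_def)
        qed (use fd in auto)
        moreover have "norm ((x + ?h n *\<^sub>R ?e) - x) = ?h n" by simp
        ultimately have "norm (f (x + ?h n *\<^sub>R ?e) - f x) \<le> B * ?h n" by simp
        moreover have "norm (?q n x) = norm (f (x + ?h n *\<^sub>R ?e) - f x) / ?h n"
          using abs_div_pos[OF hn(2)] by (simp only: real_norm_def)
        ultimately have "norm (?q n x) \<le> B" using hn(2) by (simp only: pos_divide_le_eq)
        then show ?thesis using True by simp
      next
        case False
        then have "norm x \<ge> R'" "norm (x + ?h n *\<^sub>R ?e) \<ge> R'"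
          using norm_diff_ineq[of x "?h n *\<^sub>R ?e"] hn(1) by linarith+
        then show ?thesis using f0 by (simp add: B(1) less_imp_le)
      qed
    qed
  qed
  then have "(\<lambda>n. 0::real) \<longlonglongrightarrow> (\<integral>x. g x $ i \<partial>lborel)" using q0 by simp
  then show ?thesis using LIMSEQ_unique tendsto_const by blast
qed

text \<open>The product of \<open>f\<close> with the test function, extended by zero outside
  \<open>K\<close>, is C1 on the whole space, so each of its partial derivatives has integral
  0.\<close>

lemma integration_by_parts:
  assumes S: "open S" and f: "C1_on S f g" and \<phi>: "smooth_on UNIV \<phi>" "compact K" "K \<subseteq> S" "\<And>y. y \<notin> K \<Longrightarrow> \<phi> y = 0"
  shows "(LINT y:K|lborel. f y * partial_deriv i \<phi> y) = - (LINT y:K|lborel. g y $ i * \<phi> y)"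
proof -
  let ?F = "\<lambda>x. if x \<in> K then f x * \<phi> x else 0"
  let ?G = "\<lambda>x. if x \<in> K then \<phi> x *\<^sub>R g x + f x *\<^sub>R gradient \<phi> x else 0"
  have C\<phi>: "C1_on UNIV \<phi> (gradient \<phi>)" by (rule smooth_on_C1_on[OF \<phi>(1)])
  have oK: "open (- K)" using compact_imp_closed[OF \<phi>(2)] by (simp add: open_Compl)
  have \<phi>g0: "gradient \<phi> x = 0" if "x \<notin> K" for x by (rule gradient_zero[OF oK]) (use that \<phi>(4) in auto)
  have eqS: "?G x = \<phi> x *\<^sub>R g x + f x *\<^sub>R gradient \<phi> x" "?F x = f x * \<phi> x" for x
    using \<phi>(4) \<phi>g0 by auto
  have "C1_on UNIV ?F ?G"
    unfolding C1_on_def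
  proof (intro conjI ballI)
    fix x
    show "(?F has_derivative (\<lambda>h. ?G x \<bullet> h)) (at x)"
    proof (cases "x \<in> S")
      case True
      have "((\<lambda>x. f x * \<phi> x) has_derivative (\<lambda>h. f x * (gradient \<phi> x \<bullet> h) + g x \<bullet> h * \<phi> x)) (at x)"
        using f C\<phi> True by (auto intro!: has_derivative_mult simp: C1_on_def)
      then have "(?F has_derivative (\<lambda>h. f x * (gradient \<phi> x \<bullet> h) + g x \<bullet> h * \<phi> x)) (at x)"
        unfolding eqS .
      then show ?thesis unfolding eqS by (rule has_derivative_eq_rhs) (auto simp: inner_add_left algebra_simps)
    next
      case False
      then have "x \<in> - K" using \<phi>(3) by auto
      have "(?F has_derivative (\<lambda>h. 0)) (at x)"
        by (rule has_derivative_transform_within_open[of "\<lambda>x. 0", OF _ oK \<open>x \<in> - K\<close>]) auto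
      then show ?thesis using \<open>x \<in> - K\<close> by simp
    qed
  next
    \<comment> \<open>Continuity is checked on the two open sets \<open>S\<close> and
      \<open>- K\<close>, which cover the space. On \<open>S\<close> the case distinction
      disappears, because the test function and its gradient vanish off \<open>K\<close>.\<close>
    have US: "S \<union> - K = UNIV" using \<phi>(3) by auto
    have "continuous_on S ?G" unfolding eqS
      using C1_on_continuous[OF f] C1_on_continuous[OF C\<phi>] f C\<phi>
      by (intro continuous_intros) (auto simp: C1_on_def intro: continuous_on_subset)
    moreover have "continuous_on (- K) ?G" by (rule continuous_on_eq[of _ "\<lambda>x. 0"]) auto
    ultimately have "continuous_on (S \<union> - K) ?G" by (intro continuous_on_open_Un S oK)
    then show "continuous_on UNIV ?G" unfolding US .
  qed
  then have "(\<integral>x. ?G x $ i \<partial>lborel) = 0" by (rule integral_partial_deriv_zero[OF _ \<phi>(2)]) auto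
  moreover have "(\<integral>x. ?G x $ i \<partial>lborel) = (LINT y:K|lborel. g y $ i * \<phi> y + f y * partial_deriv i \<phi> y)"
    unfolding set_lebesgue_integral_def
    by (intro Bochner_Integration.integral_cong refl) (auto simp: gradient_def)
  moreover have "(LINT y:K|lborel. g y $ i * \<phi> y + f y * partial_deriv i \<phi> y)
     = (LINT y:K|lborel. g y $ i * \<phi> y) + (LINT y:K|lborel. f y * partial_deriv i \<phi> y)"
  proof (rule set_integral_add(2))
    have c: "continuous_on K g" "continuous_on K f" "continuous_on K \<phi>" "continuous_on K (partial_deriv i \<phi>)"
      using f C1_on_continuous[OF f] \<phi> smooth_on_continuous[OF \<phi>(1)] smooth_on_continuous[OF smooth_on_partial_deriv[OF \<phi>(1)]]
      by (auto simp: C1_on_def intro: continuous_on_subset)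
    show "set_integrable lborel K (\<lambda>x. g x $ i * \<phi> x)" "set_integrable lborel K (\<lambda>y. f y * partial_deriv i \<phi> y)"
      by (intro set_integrable_continuous_compact \<phi>(2) continuous_intros c)+
  qed
  ultimately show ?thesis by linarith
qed

text \<open>Integration by parts holds for the approximating C1 functions and passes to the limit in
  L1 on the support of the test function. Together with \<open>weak_gradient_approx\<close> this
  characterises weak gradients by approximation, so that calculus rules can be checked on the
  sequences.\<close>

lemma weak_gradientI:
  fixes v :: "real^'n::finite \<Rightarrow> real"
  assumes S: "open S" and approx: "\<And>K. compact K \<Longrightarrow> K \<subseteq> S \<Longrightarrow>
    \<exists>f g. (\<forall>n. C1_on S (f n) (g n)) \<and> L1_lim K f v \<and> L1_lim K g w"
  shows "weak_gradient S v w"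
proof -
  have "locally_L1 S v" "locally_L1 S w" unfolding locally_L1_def L1_lim_def
    using approx unfolding L1_lim_def by blast+
  moreover have "weak_parts S v w"
    unfolding weak_parts_def
  proof (intro allI impI)
    fix \<phi> and i :: 'n assume t: "test_function S \<phi>"
    then obtain K where \<phi>: "smooth_on UNIV \<phi>" and K: "compact K" "K \<subseteq> S" "\<And>y. y \<notin> K \<Longrightarrow> \<phi> y = 0"
      by (auto simp: test_function_def)
    obtain f g where fg: "\<And>n. C1_on S (f n) (g n)" "L1_lim K f v" "L1_lim K g w" using approx[OF K(1,2)] by blast
    have oK: "open (- K)" using compact_imp_closed[OF K(1)] by (simp add: open_Compl)
    have \<phi>g0: "partial_deriv i \<phi> x = 0" if "x \<notin> K" for x
      using gradient_zero[OF oK, of x \<phi>] that K(3) by (auto simp: gradient_def vec_eq_iff)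
    have c: "continuous_on K \<phi>" "continuous_on K (partial_deriv i \<phi>)"
      using smooth_on_continuous[OF \<phi>] smooth_on_continuous[OF smooth_on_partial_deriv[OF \<phi>]] by (auto intro: continuous_on_subset)
    have l1: "L1_lim K (\<lambda>n y. f n y * partial_deriv i \<phi> y) (\<lambda>y. v y * partial_deriv i \<phi> y)"
      using L1_lim_bilinear[OF bounded_bilinear_mult K(1) c(2) fg(2)] by (simp add: mult.commute)
    have "bounded_bilinear (\<lambda>a (x::real^'n). a * x $ i)"
      by (rule bounded_bilinear.comp[OF bounded_bilinear_mult bounded_linear_ident bounded_linear_vec_nth])
    from L1_lim_bilinear[OF this K(1) c(1) fg(3)]
    have l2: "L1_lim K (\<lambda>n y. g n y $ i * \<phi> y) (\<lambda>y. w y $ i * \<phi> y)"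
      by (simp add: mult.commute)
    have "(LINT y:K|lborel. f n y * partial_deriv i \<phi> y) = - (LINT y:K|lborel. g n y $ i * \<phi> y)" for n
      by (rule integration_by_parts[OF S fg(1) \<phi> K])
    then have "(LINT y:K|lborel. v y * partial_deriv i \<phi> y) = - (LINT y:K|lborel. w y $ i * \<phi> y)"
      using L1_lim_integral[OF l1] tendsto_minus[OF L1_lim_integral[OF l2]] by (simp add: LIMSEQ_unique)
    moreover have "(LINT y:S|lborel. v y * partial_deriv i \<phi> y) = (LINT y:K|lborel. v y * partial_deriv i \<phi> y)"
      unfolding set_lebesgue_integral_def
      by (intro Bochner_Integration.integral_cong refl) (use K(2) \<phi>g0 in \<open>auto simp: indicator_def\<close>)
    moreover have "(LINT y:S|lborel. w y $ i * \<phi> y) = (LINT y:K|lborel. w y $ i * \<phi> y)"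
      unfolding set_lebesgue_integral_def
      by (intro Bochner_Integration.integral_cong refl) (use K(2,3) in \<open>auto simp: indicator_def\<close>)
    ultimately show "(LINT y:S|lborel. v y * partial_deriv i \<phi> y) = - (LINT y:S|lborel. w y $ i * \<phi> y)" by simp
  qed
  ultimately show ?thesis by (simp add: weak_gradient_def)
qed

lemma weak_gradient_approx:
  assumes "open S" "weak_gradient S v w" "compact K" "K \<subseteq> S"
  obtains f g where "\<And>n. C1_on UNIV (f n) (g n)" "L1_lim K f v" "L1_lim K g w"
proof -
  have "locally_L1 S v" "locally_L1 S w" "weak_parts S v w" using assms(2) by (auto simp: weak_gradient_def)
  then show ?thesis using weak_gradient_approx_local[OF assms(1) _ _ _ assms(3,4), of v w] that assms(1) by blast
qed

text \<open>A compact set is a finite union of its intersections with small closed balls, and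
  integrability on each of these compact pieces is known.\<close>

lemma locally_L1_local:
  fixes v :: "'a::euclidean_space \<Rightarrow> 'b::{banach, second_countable_topology}"
  assumes "\<And>x. x \<in> S \<Longrightarrow> \<exists>N. open N \<and> x \<in> N \<and> locally_L1 N v"
  shows "locally_L1 S v"
  unfolding locally_L1_def
proof (intro allI impI)
  fix K assume K: "compact K \<and> K \<subseteq> S"
  have "\<exists>r>0. set_integrable lborel (K \<inter> cball x r) v" if x: "x \<in> K" for x
  proof -
    obtain N where N: "open N" "x \<in> N" "locally_L1 N v" using assms[of x] x K by blast
    then obtain r where r: "r > 0" "cball x r \<subseteq> N" using open_contains_cball by blast
    have "compact (K \<inter> cball x r)" using K by (simp add: compact_Int)
    then show ?thesis using N(3) r unfolding locally_L1_def by blast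
  qed
  then obtain r where r: "\<And>x. x \<in> K \<Longrightarrow> r x > 0 \<and> set_integrable lborel (K \<inter> cball x (r x)) v" by metis
  obtain T where T: "T \<subseteq> K" "finite T" "K \<subseteq> (\<Union>x\<in>T. ball x (r x))"
    by (rule compactE_image[of K K "\<lambda>x. ball x (r x)"]) (use K r in auto)
  have "set_integrable lborel (\<Union>x\<in>T. K \<inter> cball x (r x)) v"
  proof (rule set_integrable_UN[OF T(2)])
    show "set_integrable lborel (K \<inter> cball x (r x)) v" if "x \<in> T" for x using r T that by blast
    show "K \<inter> cball x (r x) \<in> sets lborel" for x
      using K compact_imp_closed borel_closed by (auto intro!: borel_closed closed_Int)
  qed
  moreover have "(\<Union>x\<in>T. K \<inter> cball x (r x)) = K"
  proof -
    have "x \<in> (\<Union>x\<in>T. K \<inter> cball x (r x))" if x: "x \<in> K" for x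
    proof -
      obtain y where "y \<in> T" "x \<in> ball y (r y)" using T(3) x by blast
      then show ?thesis using x by (auto intro!: bexI[of _ y] simp: less_imp_le)
    qed
    then show ?thesis by auto
  qed
  ultimately show "set_integrable lborel K v" by simp
qed

text \<open>The construction of approximations uses the weak identity only near each point, while
  limits of C1 functions satisfy it against every test function on \<open>S\<close>.\<close>

lemma weak_gradient_local:
  assumes S: "open S" and loc: "\<And>x. x \<in> S \<Longrightarrow> \<exists>N. open N \<and> x \<in> N \<and> N \<subseteq> S \<and> weak_gradient N v w"
  shows "weak_gradient S v w"
proof (rule weak_gradientI[OF S])
  have l: "locally_L1 S v" "locally_L1 S w"
    by (rule locally_L1_local; use loc in \<open>force simp: weak_gradient_def\<close>)+
  fix K assume K: "compact K" "K \<subseteq> S"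
  have "\<exists>N. open N \<and> x \<in> N \<and> N \<subseteq> S \<and> weak_parts N v w" if "x \<in> S" for x
    using loc[OF that] by (auto simp: weak_gradient_def)
  from weak_gradient_approx_local[OF S l this K]
  obtain f g where "\<And>n. C1_on UNIV (f n) (g n)" "L1_lim K f v" "L1_lim K g w" by blast
  then show "\<exists>f g. (\<forall>n. C1_on S (f n) (g n)) \<and> L1_lim K f v \<and> L1_lim K g w"
    using C1_on_subset by blast
qed

section \<open>Product rule, chain rule and change of coordinates\<close>

lemma L1_lim_sum:
  assumes "finite I" "compact K" "\<And>i. i \<in> I \<Longrightarrow> L1_lim K (f i) (F i)"
  shows "L1_lim K (\<lambda>n x. \<Sum>i\<in>I. f i n x) (\<lambda>x. \<Sum>i\<in>I. F i x)"
  using assms(1,3)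
proof (induction I rule: finite_induct)
  case empty
  have "set_integrable lborel K (\<lambda>x. 0)" by (simp add: set_integrable_def)
  then show ?case by (simp add: L1_lim_def set_lebesgue_integral_def)
next
  case (insert i I)
  then show ?case using L1_lim_add[of K "f i" "F i" "\<lambda>n x. \<Sum>i\<in>I. f i n x" "\<lambda>x. \<Sum>i\<in>I. F i x"] by simp
qed

text \<open>The approximating functions obey the classical product rule, and both of its terms
  converge because \<kappa> and its gradient are continuous on compact subsets of
  \<open>S\<close>.\<close>

lemma weak_gradient_mult:
  assumes S: "open S" and v: "weak_gradient S v w" and \<kappa>: "C1_on S \<kappa> \<kappa>'"
  shows "weak_gradient S (\<lambda>x. \<kappa> x * v x) (\<lambda>x. \<kappa> x *\<^sub>R w x + v x *\<^sub>R \<kappa>' x)"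
proof (rule weak_gradientI[OF S])
  fix K assume K: "compact K" "K \<subseteq> S"
  obtain f g where fg: "\<And>n. C1_on UNIV (f n) (g n)" "L1_lim K f v" "L1_lim K g w"
    using weak_gradient_approx[OF S v K] by blast
  have \<kappa>K: "continuous_on K \<kappa>" "continuous_on K \<kappa>'"
    using C1_on_continuous[OF \<kappa>] \<kappa> K(2) by (auto simp: C1_on_def intro: continuous_on_subset)
  have "C1_on S (\<lambda>x. \<kappa> x * f n x) (\<lambda>x. \<kappa> x *\<^sub>R g n x + f n x *\<^sub>R \<kappa>' x)" for n
    unfolding C1_on_def
  proof (intro conjI ballI)
    have Cn: "C1_on S (f n) (g n)" using C1_on_subset[OF fg(1)] by blast
    fix x assume x: "x \<in> S"
    have "((\<lambda>x. \<kappa> x * f n x) has_derivative (\<lambda>h. \<kappa> x * (g n x \<bullet> h) + \<kappa>' x \<bullet> h * f n x)) (at x)"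
      using Cn \<kappa> x by (auto intro!: has_derivative_mult simp: C1_on_def)
    then show "((\<lambda>x. \<kappa> x * f n x) has_derivative (\<lambda>h. (\<kappa> x *\<^sub>R g n x + f n x *\<^sub>R \<kappa>' x) \<bullet> h)) (at x)"
      by (rule has_derivative_eq_rhs) (auto simp: inner_add_left algebra_simps)
  next
    have Cn: "C1_on S (f n) (g n)" using C1_on_subset[OF fg(1)] by blast
    show "continuous_on S (\<lambda>x. \<kappa> x *\<^sub>R g n x + f n x *\<^sub>R \<kappa>' x)"
      using C1_on_continuous[OF \<kappa>] C1_on_continuous[OF Cn] \<kappa> Cn by (intro continuous_intros) (auto simp: C1_on_def)
  qed
  moreover have "L1_lim K (\<lambda>n x. \<kappa> x * f n x) (\<lambda>x. \<kappa> x * v x)"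
    by (rule L1_lim_bilinear[OF bounded_bilinear_mult K(1) \<kappa>K(1) fg(2)])
  moreover have "L1_lim K (\<lambda>n x. \<kappa> x *\<^sub>R g n x + f n x *\<^sub>R \<kappa>' x) (\<lambda>x. \<kappa> x *\<^sub>R w x + v x *\<^sub>R \<kappa>' x)"
    by (rule L1_lim_add[OF L1_lim_bilinear[OF bounded_bilinear_scaleR K(1) \<kappa>K(1) fg(3)]
          L1_lim_bilinear[OF bounded_bilinear.flip[OF bounded_bilinear_scaleR] K(1) \<kappa>K(2) fg(2)]])
  ultimately show "\<exists>f g. (\<forall>n. C1_on S (f n) (g n)) \<and> L1_lim K f (\<lambda>x. \<kappa> x * v x) \<and> L1_lim K g (\<lambda>x. \<kappa> x *\<^sub>R w x + v x *\<^sub>R \<kappa>' x)"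
    by (intro exI[of _ "\<lambda>n x. \<kappa> x * f n x"] exI[of _ "\<lambda>n x. \<kappa> x *\<^sub>R g n x + f n x *\<^sub>R \<kappa>' x"]) blast
qed

lemma L1_lim_subseq:
  assumes "L1_lim K f F" "strict_mono r" shows "L1_lim K (\<lambda>n. f (r n)) F"
  using assms LIMSEQ_subseq_LIMSEQ[OF _ assms(2), of "\<lambda>n. LINT x:K|lborel. norm (f n x - F x)" 0]
  by (auto simp: L1_lim_def o_def)

lemma L1_lim_AE_subseq:
  assumes "L1_lim K f F"
  obtains r where "strict_mono r" "AE x in lborel. x \<in> K \<longrightarrow> (\<lambda>n. f (r n) x) \<longlonglongrightarrow> F x"
proof -
  let ?u = "\<lambda>n x. indicator K x *\<^sub>R (f n x - F x)"
  have "\<exists>r::nat \<Rightarrow> nat. strict_mono r \<and> (AE x in lborel. (\<lambda>n. ?u (r n) x) \<longlonglongrightarrow> 0)"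
  proof (rule tendsto_L1_AE_subseq)
    show "integrable lborel (?u n)" for n
      using assms set_integral_diff(1)[of lborel K "f n" F] by (auto simp: L1_lim_def set_integrable_def)
    have "(\<integral>x. norm (?u n x) \<partial>lborel) = (LINT x:K|lborel. norm (f n x - F x))" for n
      by (auto simp: set_lebesgue_integral_def)
    then show "(\<lambda>n. \<integral>x. norm (?u n x) \<partial>lborel) \<longlonglongrightarrow> 0" using assms by (simp add: L1_lim_def)
  qed
  then obtain r :: "nat \<Rightarrow> nat" where r: "strict_mono r" "AE x in lborel. (\<lambda>n. ?u (r n) x) \<longlonglongrightarrow> 0" by blast
  from r(2) have "AE x in lborel. x \<in> K \<longrightarrow> (\<lambda>n. f (r n) x) \<longlonglongrightarrow> F x"
    by (rule AE_mp) (auto intro!: AE_I2 simp: LIM_zero_iff)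
  then show ?thesis using that r(1) by blast
qed

lemma set_integrable_borel_measurable: "set_integrable M K f \<Longrightarrow> set_borel_measurable M K f"
  unfolding set_integrable_def set_borel_measurable_def by (rule borel_measurable_integrable)

lemma set_borel_measurable_comp:
  fixes \<psi> :: "real \<Rightarrow> real"
  assumes \<psi>: "continuous_on UNIV \<psi>" and K: "K \<in> sets borel" and v: "set_borel_measurable lborel K v"
  shows "set_borel_measurable lborel K (\<lambda>x. \<psi> (v x))"
proof -
  have [measurable]: "\<psi> \<in> borel_measurable borel" using \<psi> by (rule borel_measurable_continuous_onI)
  have [measurable]: "(\<lambda>x. indicator K x *\<^sub>R v x) \<in> borel_measurable borel" using v by (simp add: set_borel_measurable_def)
  have "(\<lambda>x. indicator K x *\<^sub>R \<psi> (indicator K x *\<^sub>R v x)) \<in> borel_measurable borel" using K by measurable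
  moreover have "(\<lambda>x. indicator K x *\<^sub>R \<psi> (indicator K x *\<^sub>R v x)) = (\<lambda>x. indicator K x *\<^sub>R \<psi> (v x))"
    by (auto simp: indicator_def)
  ultimately show ?thesis by (simp add: set_borel_measurable_def)
qed

lemma set_borel_measurable_scaleR':
  fixes w :: "'a::euclidean_space \<Rightarrow> 'b::{banach, second_countable_topology}"
  assumes "set_borel_measurable lborel K a" "set_borel_measurable lborel K w"
  shows "set_borel_measurable lborel K (\<lambda>x. a x *\<^sub>R w x)"
proof -
  have [measurable]: "(\<lambda>x. indicator K x *\<^sub>R a x) \<in> borel_measurable borel" "(\<lambda>x. indicator K x *\<^sub>R w x) \<in> borel_measurable borel"
    using assms by (simp_all add: set_borel_measurable_def)
  have "(\<lambda>x. (indicator K x *\<^sub>R a x) *\<^sub>R (indicator K x *\<^sub>R w x)) \<in> borel_measurable borel" by measurable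
  moreover have "(\<lambda>x. (indicator K x *\<^sub>R a x) *\<^sub>R (indicator K x *\<^sub>R w x)) = (\<lambda>x. indicator K x *\<^sub>R (a x *\<^sub>R w x))"
    by (auto simp: indicator_def)
  ultimately show ?thesis by (simp add: set_borel_measurable_def)
qed

text \<open>Split \<psi>'(f) g - \<psi>'(v) w into \<psi>'(f)(g - w), controlled by the bound
  \<open>M\<close>, and (\<psi>'(f) - \<psi>'(v)) w, which tends to 0 by dominated convergence along
  a subsequence converging almost everywhere. The condition \<psi>(0) = 0 bounds \<psi>(v) by
  \<open>M\<close> times the absolute value of v, hence makes it locally integrable.\<close>

lemma weak_gradient_chain:
  assumes S: "open S" and v: "weak_gradient S v w"
    and \<psi>: "\<And>s. (\<psi> has_real_derivative \<psi>' s) (at s)" "continuous_on UNIV \<psi>'" "\<And>s. \<bar>\<psi>' s\<bar> \<le> M" "\<psi> 0 = 0"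
  shows "weak_gradient S (\<lambda>x. \<psi> (v x)) (\<lambda>x. \<psi>' (v x) *\<^sub>R w x)"
proof (rule weak_gradientI[OF S])
  fix K assume K: "compact K" "K \<subseteq> S"
  have Kb: "K \<in> sets borel" using compact_imp_closed[OF K(1)] borel_closed by blast
  obtain f0 g0 where fg0: "\<And>n. C1_on UNIV (f0 n) (g0 n)" "L1_lim K f0 v" "L1_lim K g0 w"
    using weak_gradient_approx[OF S v K] by blast
  obtain r where r: "strict_mono r" "AE x in lborel. x \<in> K \<longrightarrow> (\<lambda>n. f0 (r n) x) \<longlonglongrightarrow> v x"
    using L1_lim_AE_subseq[OF fg0(2)] by blast
  define f where "f n = f0 (r n)" for n
  define g where "g n = g0 (r n)" for n
  have fg: "C1_on S (f n) (g n)" "L1_lim K f v" "L1_lim K g w" for n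
    using C1_on_subset[OF fg0(1)] L1_lim_subseq[OF fg0(2) r(1)] L1_lim_subseq[OF fg0(3) r(1)] by (auto simp: f_def[abs_def] g_def[abs_def])
  have ae: "AE x in lborel. x \<in> K \<longrightarrow> (\<lambda>n. f n x) \<longlonglongrightarrow> v x" using r(2) by (simp add: f_def)
  have \<psi>c: "continuous_on UNIV \<psi>" using \<psi>(1) DERIV_isCont continuous_at_imp_continuous_on by blast
  have lip: "\<bar>\<psi> a - \<psi> b\<bar> \<le> M * \<bar>a - b\<bar>" for a b
    using field_differentiable_bound[of UNIV \<psi> \<psi>' M a b] \<psi>(1,3) by auto
  have C: "C1_on S (\<lambda>x. \<psi> (f n x)) (\<lambda>x. \<psi>' (f n x) *\<^sub>R g n x)" for n
    unfolding C1_on_def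
  proof (intro conjI ballI)
    fix x assume x: "x \<in> S"
    have "(f n has_derivative (\<lambda>h. g n x \<bullet> h)) (at x)" using fg(1) x by (simp add: C1_on_def)
    from diff_chain_at[OF this \<psi>(1)[unfolded has_field_derivative_def]]
    show "((\<lambda>x. \<psi> (f n x)) has_derivative (\<lambda>h. (\<psi>' (f n x) *\<^sub>R g n x) \<bullet> h)) (at x)" by (simp add: o_def)
  next
    show "continuous_on S (\<lambda>x. \<psi>' (f n x) *\<^sub>R g n x)"
      using C1_on_continuous[OF fg(1)] fg(1)
      by (intro continuous_intros continuous_on_compose2[OF \<psi>(2)]) (auto simp: C1_on_def)
  qed
  have m: "set_borel_measurable lborel K (f n)" "set_borel_measurable lborel K v"
    "set_borel_measurable lborel K (g n)" "set_borel_measurable lborel K w" for n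
    using fg(2,3) by (auto simp: L1_lim_def intro!: set_integrable_borel_measurable)
  have 1: "L1_lim K (\<lambda>n x. \<psi> (f n x)) (\<lambda>x. \<psi> (v x))"
  proof (rule L1_lim_dominated[OF fg(2), where C = M])
    show "norm (\<psi> (f n x)) \<le> M * norm (f n x)" for n x using lip[of "f n x" 0] \<psi>(4) by simp
    show "norm (\<psi> (v x)) \<le> M * norm (v x)" for x using lip[of "v x" 0] \<psi>(4) by simp
    show "norm (\<psi> (f n x) - \<psi> (v x)) \<le> M * norm (f n x - v x)" for n x using lip by simp
    show "set_borel_measurable lborel K (\<lambda>x. \<psi> (f n x))" for n by (rule set_borel_measurable_comp[OF \<psi>c Kb m(1)])
    show "set_borel_measurable lborel K (\<lambda>x. \<psi> (v x))" by (rule set_borel_measurable_comp[OF \<psi>c Kb m(2)])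
  qed
  have z: "set_borel_measurable lborel K (\<lambda>x. 0 :: real^'a)" by (simp add: set_borel_measurable_def)
  have i: "set_integrable lborel K w" "set_integrable lborel K (g n)" for n using fg(3) by (auto simp: L1_lim_def)
  have gw: "L1_lim K (\<lambda>n x. g n x - w x) (\<lambda>x. 0)"
    unfolding L1_lim_def
    by (intro conjI allI set_integral_diff(1)[OF i(2) i(1)])
       (use fg(3) in \<open>auto simp: L1_lim_def set_integrable_def\<close>)
  have a: "L1_lim K (\<lambda>n x. \<psi>' (f n x) *\<^sub>R (g n x - w x)) (\<lambda>x. 0)"
  proof (rule L1_lim_dominated[OF gw, where C = M])
    show "set_borel_measurable lborel K (\<lambda>x. \<psi>' (f n x) *\<^sub>R (g n x - w x))" for n
      by (rule set_borel_measurable_scaleR'[OF set_borel_measurable_comp[OF \<psi>(2) Kb m(1)]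
            set_integrable_borel_measurable[OF set_integral_diff(1)[OF i(2) i(1)]]])
    show "norm (\<psi>' (f n x) *\<^sub>R (g n x - w x)) \<le> M * norm (g n x - w x)" for n x
      using \<psi>(3) by (simp add: mult_right_mono)
    then show "norm (\<psi>' (f n x) *\<^sub>R (g n x - w x) - 0) \<le> M * norm (g n x - w x - 0)" for n x by simp
  qed (use z in auto)
  have b: "L1_lim K (\<lambda>n x. \<psi>' (f n x) *\<^sub>R w x) (\<lambda>x. \<psi>' (v x) *\<^sub>R w x)"
  proof -
    have bi: "set_integrable lborel K (\<lambda>x. \<psi>' (h x) *\<^sub>R w x)" if "set_borel_measurable lborel K h" for h
    proof (rule set_integrable_norm_bound[OF i(1), where C = M])
      show "norm (\<psi>' (h x) *\<^sub>R w x) \<le> M * norm (w x)" for x using \<psi>(3) by (simp add: mult_right_mono)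
    qed (rule set_borel_measurable_scaleR'[OF set_borel_measurable_comp[OF \<psi>(2) Kb that] m(4)])
    have "(\<lambda>n. \<integral>x. indicator K x *\<^sub>R norm (\<psi>' (f n x) *\<^sub>R w x - \<psi>' (v x) *\<^sub>R w x) \<partial>lborel) \<longlonglongrightarrow> (\<integral>x. (0::real) \<partial>(lborel :: (real^'a) measure))"
    proof (rule integral_dominated_convergence[where w = "\<lambda>x. indicator K x *\<^sub>R (2 * M * norm (w x))"])
      show "integrable lborel (\<lambda>x. indicator K x *\<^sub>R (2 * M * norm (w x)))"
        using set_integrable_mult_right[of "2 * M" lborel K "\<lambda>x. norm (w x)"] set_integrable_norm[OF i(1)]
        by (simp add: set_integrable_def)
      show "(\<lambda>x. indicator K x *\<^sub>R norm (\<psi>' (f n x) *\<^sub>R w x - \<psi>' (v x) *\<^sub>R w x)) \<in> borel_measurable lborel" for n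
        using set_integrable_norm_diff[OF bi[OF m(1)[of n]] bi[OF m(2)]] by (auto simp: set_integrable_def)
      show "AE x in lborel. (\<lambda>n. indicator K x *\<^sub>R norm (\<psi>' (f n x) *\<^sub>R w x - \<psi>' (v x) *\<^sub>R w x)) \<longlonglongrightarrow> 0"
      proof (rule AE_mp[OF ae], intro AE_I2 impI)
        fix x assume h: "x \<in> K \<longrightarrow> (\<lambda>n. f n x) \<longlonglongrightarrow> v x"
        show "(\<lambda>n. indicator K x *\<^sub>R norm (\<psi>' (f n x) *\<^sub>R w x - \<psi>' (v x) *\<^sub>R w x)) \<longlonglongrightarrow> 0"
        proof (cases "x \<in> K")
          case True
          then have "(\<lambda>n. \<psi>' (f n x)) \<longlonglongrightarrow> \<psi>' (v x)"
            using h \<psi>(2) by (intro isCont_tendsto_compose[of "v x" \<psi>']) (auto simp: continuous_on_eq_continuous_at)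
          then have "(\<lambda>n. norm (\<psi>' (f n x) *\<^sub>R w x - \<psi>' (v x) *\<^sub>R w x)) \<longlonglongrightarrow> norm (\<psi>' (v x) *\<^sub>R w x - \<psi>' (v x) *\<^sub>R w x)"
            by (intro tendsto_intros)
          then show ?thesis using True by simp
        qed simp
      qed
      show "AE x in lborel. norm (indicator K x *\<^sub>R norm (\<psi>' (f n x) *\<^sub>R w x - \<psi>' (v x) *\<^sub>R w x)) \<le> indicator K x *\<^sub>R (2 * M * norm (w x))" for n
      proof (intro AE_I2)
        fix x
        have "norm (\<psi>' (f n x) *\<^sub>R w x - \<psi>' (v x) *\<^sub>R w x) = \<bar>\<psi>' (f n x) - \<psi>' (v x)\<bar> * norm (w x)"
          by (simp flip: scaleR_diff_left)
        also have "\<dots> \<le> (2 * M) * norm (w x)"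
          using \<psi>(3)[of "f n x"] \<psi>(3)[of "v x"] by (intro mult_right_mono) auto
        finally show "norm (indicator K x *\<^sub>R norm (\<psi>' (f n x) *\<^sub>R w x - \<psi>' (v x) *\<^sub>R w x)) \<le> indicator K x *\<^sub>R (2 * M * norm (w x))"
          by (auto simp: indicator_def)
      qed
    qed simp
    then show ?thesis using bi m by (simp add: L1_lim_def set_lebesgue_integral_def)
  qed
  have 2: "L1_lim K (\<lambda>n x. \<psi>' (f n x) *\<^sub>R g n x) (\<lambda>x. \<psi>' (v x) *\<^sub>R w x)"
    using L1_lim_add[OF a b] by (simp add: scaleR_diff_right)
  show "\<exists>f g. (\<forall>n. C1_on S (f n) (g n)) \<and> L1_lim K f (\<lambda>x. \<psi> (v x)) \<and> L1_lim K g (\<lambda>x. \<psi>' (v x) *\<^sub>R w x)"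
    by (intro exI conjI allI) (rule C, rule 1, rule 2)
qed

text \<open>On the compact set \<open>K\<close> the reciprocal of the Jacobian determinant is
  bounded, so the density in the change of variables formula can be inserted at the cost of a
  constant factor that is the same for all \<open>h\<close>.\<close>

lemma change_of_variables_L1:
  fixes F :: "real^'n::finite \<Rightarrow> real^'n" and h :: "real^'n \<Rightarrow> 'b::{banach, second_countable_topology}"
  assumes U: "open U" and F: "smooth_on U F" "inj_on F U" "\<forall>x\<in>U. det (jacobian F x) \<noteq> 0"
    and K: "compact K" "K \<subseteq> U"
  obtains C where "C \<ge> 0" "\<And>h :: real^'n \<Rightarrow> 'b::{banach, second_countable_topology}. set_integrable lborel (F ` K) h \<Longrightarrow>
    set_integrable lborel K (\<lambda>x. h (F x)) \<and> (LINT x:K|lborel. norm (h (F x))) \<le> C * (LINT y:F ` K|lborel. norm (h y))"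
proof -
  have dc: "continuous_on U (\<lambda>x. det (jacobian F x))"
  proof (rule smooth_on_continuous[OF smooth_on_det[OF U]])
    have "jacobian F x $ i $ j = frechet_derivative F (at x) (axis j 1) $ i" for x i j
      by (simp add: jacobian_def matrix_def)
    then show "smooth_on U (\<lambda>y. jacobian F y $ i $ j)" for i j
      using smooth_on_nth[OF U smooth_on_frechet[OF F(1)]] by simp
  qed
  have cF: "continuous_on K F" using smooth_on_continuous[OF F(1)] K(2) continuous_on_subset by blast
  have Kb: "K \<in> sets borel" using compact_imp_closed[OF K(1)] borel_closed by blast
  have FKb: "F ` K \<in> sets borel" using compact_imp_closed[OF compact_continuous_image[OF cF K(1)]] borel_closed by blast
  have "compact ((\<lambda>x. inverse \<bar>det (jacobian F x)\<bar>) ` K)"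
    by (intro compact_continuous_image K continuous_intros continuous_on_subset[OF dc]) (use F(3) K in auto)
  then obtain C0 where C0: "\<And>x. x \<in> K \<Longrightarrow> inverse \<bar>det (jacobian F x)\<bar> \<le> C0"
    using compact_imp_bounded bounded_iff by (metis abs_le_D1 imageI real_norm_def)
  \<comment> \<open>The maximum with 0 keeps the constant nonnegative when \<open>K\<close> is
    empty.\<close>
  define C where "C = max C0 0"
  have C: "C \<ge> 0" "1 \<le> C * \<bar>det (jacobian F x)\<bar>" if "x \<in> K" for x
  proof -
    have p: "\<bar>det (jacobian F x)\<bar> > 0" using F(3) K that by auto
    then have "1 = inverse \<bar>det (jacobian F x)\<bar> * \<bar>det (jacobian F x)\<bar>" by simp
    also have "\<dots> \<le> C * \<bar>det (jacobian F x)\<bar>" using C0[OF that] p by (intro mult_right_mono) (auto simp: C_def)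
    finally show "1 \<le> C * \<bar>det (jacobian F x)\<bar>" .
  qed (simp add: C_def)
  show ?thesis
  proof
    show "C \<ge> 0" by (simp add: C_def)
    fix h :: "real^'n \<Rightarrow> 'b::{banach, second_countable_topology}"
    assume h: "set_integrable lborel (F ` K) h"
    let ?H = "\<lambda>y. indicator (F ` K) y *\<^sub>R h y"
    have Hm: "?H \<in> borel_measurable borel" using h by (auto simp: set_integrable_def)
    have HF: "?H (F x) = indicator K x *\<^sub>R h (F x)" if "x \<in> U" for x
      using that F(2) K(2) by (auto simp: indicator_def inj_on_def)
    have m: "set_borel_measurable lborel K (\<lambda>x. h (F x))"
    proof -
      have "F \<in> borel_measurable (restrict_space borel K)" by (rule borel_measurable_continuous_on_restrict[OF cF])
      then have "(\<lambda>x. ?H (F x)) \<in> borel_measurable (restrict_space borel K)" using Hm by (rule measurable_compose)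
      then have "(\<lambda>x. indicator K x *\<^sub>R ?H (F x)) \<in> borel_measurable borel"
        using Kb by (subst (asm) borel_measurable_restrict_space_iff) auto
      moreover have "(\<lambda>x. indicator K x *\<^sub>R ?H (F x)) = (\<lambda>x. indicator K x *\<^sub>R h (F x))"
        by (rule ext) (use HF K(2) in \<open>auto simp: indicator_def\<close>)
      ultimately show ?thesis by (simp add: set_borel_measurable_def)
    qed
    have "(\<integral>\<^sup>+x. ennreal (norm (indicator K x *\<^sub>R h (F x))) \<partial>lborel) \<le> (\<integral>\<^sup>+x. ennreal C * (ennreal \<bar>det (jacobian F x)\<bar> * ennreal (norm (?H (F x))) * indicator U x) \<partial>lborel)"
    proof (intro nn_integral_mono)
      fix x
      show "ennreal (norm (indicator K x *\<^sub>R h (F x))) \<le> ennreal C * (ennreal \<bar>det (jacobian F x)\<bar> * ennreal (norm (?H (F x))) * indicator U x)"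
      proof (cases "x \<in> K")
        case True
        then have "x \<in> U" using K by auto
        have "norm (h (F x)) \<le> (C * \<bar>det (jacobian F x)\<bar>) * norm (h (F x))"
          using mult_right_mono[OF C(2)[OF True], of "norm (h (F x))"] by simp
        then have "ennreal (norm (h (F x))) \<le> ennreal (C * (\<bar>det (jacobian F x)\<bar> * norm (h (F x))))"
          by (intro ennreal_leI) (simp add: mult_ac)
        then show ?thesis using True \<open>x \<in> U\<close> C(1)[OF True] by (simp add: ennreal_mult)
      qed simp
    qed
    also have "\<dots> = ennreal C * (\<integral>\<^sup>+x\<in>U. ennreal \<bar>det (jacobian F x)\<bar> * ennreal (norm (?H (F x))) \<partial>lborel)"
    proof (rule nn_integral_cmult)
      have "(\<lambda>x. ennreal \<bar>det (jacobian F x)\<bar> * ennreal (norm (?H (F x)))) \<in> borel_measurable (restrict_space borel U)"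
      proof -
        have [measurable]: "F \<in> borel_measurable (restrict_space borel U)" "(\<lambda>x. det (jacobian F x)) \<in> borel_measurable (restrict_space borel U)"
          by (intro borel_measurable_continuous_on_restrict smooth_on_continuous[OF F(1)] dc)+
        have [measurable]: "(\<lambda>x. norm (?H (F x))) \<in> borel_measurable (restrict_space borel U)"
          using measurable_compose[OF _ Hm] by measurable
        show ?thesis by measurable
      qed
      then show "(\<lambda>x. ennreal \<bar>det (jacobian F x)\<bar> * ennreal (norm (?H (F x))) * indicator U x) \<in> borel_measurable lborel"
        using U by (subst (asm) borel_measurable_restrict_space_iff_ennreal) auto
    qed
    also have "(\<integral>\<^sup>+x\<in>U. ennreal \<bar>det (jacobian F x)\<bar> * ennreal (norm (?H (F x))) \<partial>lborel) = (\<integral>\<^sup>+y\<in>F ` U. ennreal (norm (?H y)) \<partial>lborel)"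
    proof (rule nn_integral_change_of_variables[OF U smooth_on_differentiable[OF F(1)] dc F(2), symmetric])
      show "(\<lambda>y. ennreal (norm (?H y))) \<in> borel_measurable (restrict_space borel (F ` U))"
        by (rule measurable_restrict_space1, rule measurable_compose[OF Hm]) measurable
    qed
    also have "\<dots> = (\<integral>\<^sup>+y. ennreal (norm (?H y)) \<partial>lborel)"
      using K(2) by (intro nn_integral_cong) (auto simp: indicator_def)
    also have "\<dots> = ennreal (\<integral>y. norm (?H y) \<partial>lborel)"
      by (intro nn_integral_eq_integral integrable_norm[OF h[unfolded set_integrable_def]]) simp
    also have "(\<integral>y. norm (?H y) \<partial>lborel) = (LINT y:F ` K|lborel. norm (h y))" by (simp add: set_lebesgue_integral_def)
    also have "ennreal C * ennreal \<dots> = ennreal (C * (LINT y:F ` K|lborel. norm (h y)))" by (simp add: ennreal_mult' C_def)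
    finally have le: "(\<integral>\<^sup>+x. ennreal (norm (indicator K x *\<^sub>R h (F x))) \<partial>lborel) \<le> ennreal (C * (LINT y:F ` K|lborel. norm (h y)))" .
    have int: "set_integrable lborel K (\<lambda>x. h (F x))"
      unfolding set_integrable_def
      by (rule integrableI_bounded) (use m le in \<open>auto simp: set_borel_measurable_def intro: le_less_trans\<close>)
    have "ennreal (LINT x:K|lborel. norm (h (F x))) = (\<integral>\<^sup>+x. ennreal (norm (indicator K x *\<^sub>R h (F x))) \<partial>lborel)"
      using nn_integral_eq_integral[OF integrable_norm[OF int[unfolded set_integrable_def]]]
      by (simp add: set_lebesgue_integral_def)
    with le have "ennreal (LINT x:K|lborel. norm (h (F x))) \<le> ennreal (C * (LINT y:F ` K|lborel. norm (h y)))" by simp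
    moreover have "0 \<le> C * (LINT y:F ` K|lborel. norm (h y))" by (auto simp: C_def set_lebesgue_integral_def)
    ultimately show "set_integrable lborel K (\<lambda>x. h (F x)) \<and> (LINT x:K|lborel. norm (h (F x))) \<le> C * (LINT y:F ` K|lborel. norm (h y))"
      using int by simp
  qed
qed

lemma L1_lim_change_of_variables:
  fixes F :: "real^'n::finite \<Rightarrow> real^'n" and h :: "real^'n \<Rightarrow> 'b::{banach, second_countable_topology}"
  assumes U: "open U" and F: "smooth_on U F" "inj_on F U" "\<forall>x\<in>U. det (jacobian F x) \<noteq> 0"
    and K: "compact K" "K \<subseteq> U" and l: "L1_lim (F ` K) f h"
  shows "L1_lim K (\<lambda>n x. f n (F x)) (\<lambda>x. h (F x))"
proof -
  obtain C where C: "C \<ge> 0" "\<And>h :: real^'n \<Rightarrow> 'b. set_integrable lborel (F ` K) h \<Longrightarrow>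
    set_integrable lborel K (\<lambda>x. h (F x)) \<and> (LINT x:K|lborel. norm (h (F x))) \<le> C * (LINT y:F ` K|lborel. norm (h y))"
    using change_of_variables_L1[OF U F K, where ?'b = 'b] by blast
  have i: "set_integrable lborel (F ` K) (f n)" "set_integrable lborel (F ` K) h" for n using l by (auto simp: L1_lim_def)
  have "(\<lambda>n. LINT x:K|lborel. norm (f n (F x) - h (F x))) \<longlonglongrightarrow> 0"
  proof (rule tendsto_sandwich[OF _ _ tendsto_const])
    have "(\<lambda>n. C * (LINT y:F ` K|lborel. norm (f n y - h y))) \<longlonglongrightarrow> C * 0"
      using l by (intro tendsto_intros) (auto simp: L1_lim_def)
    then show "(\<lambda>n. C * (LINT y:F ` K|lborel. norm (f n y - h y))) \<longlonglongrightarrow> 0" by simp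
    show "\<forall>\<^sub>F n in sequentially. (LINT x:K|lborel. norm (f n (F x) - h (F x))) \<le> C * (LINT y:F ` K|lborel. norm (f n y - h y))"
      using C(2)[OF set_integral_diff(1)[OF i(1) i(2)]] by (intro always_eventually allI) blast
    show "\<forall>\<^sub>F n in sequentially. 0 \<le> (LINT x:K|lborel. norm (f n (F x) - h (F x)))"
      by (intro always_eventually allI) (auto simp: set_lebesgue_integral_def)
  qed
  then show ?thesis using C(2)[OF i(1)] C(2)[OF i(2)] by (auto simp: L1_lim_def)
qed

text \<open>Injectivity and a nonvanishing Jacobian allow L1 limits to be pulled back from the image
  of \<open>K\<close>; for the C1 approximations the formula is the classical chain rule.\<close>

lemma weak_gradient_compose:
  fixes F :: "real^'n::finite \<Rightarrow> real^'n"
  assumes U: "open U" and V: "open V" and F: "smooth_on U F" "inj_on F U" "\<forall>x\<in>U. det (jacobian F x) \<noteq> 0"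
    and FV: "F ` U \<subseteq> V" and v: "weak_gradient V v w"
  shows "weak_gradient U (\<lambda>x. v (F x)) (\<lambda>x. transpose (jacobian F x) *v w (F x))"
proof (rule weak_gradientI[OF U])
  fix K assume K: "compact K" "K \<subseteq> U"
  have cF: "continuous_on U F" using smooth_on_continuous[OF F(1)] .
  have FK: "compact (F ` K)" "F ` K \<subseteq> V"
    using compact_continuous_image[OF continuous_on_subset[OF cF K(2)] K(1)] K(2) FV by auto
  obtain f g where fg: "\<And>n. C1_on UNIV (f n) (g n)" "L1_lim (F ` K) f v" "L1_lim (F ` K) g w"
    using weak_gradient_approx[OF V v FK] by blast
  \<comment> \<open>In this form each summand is a continuous coefficient times a component of the
    gradient, to which \<open>L1_lim_bilinear\<close> applies.\<close>
  have T: "transpose (jacobian F x) *v z = (\<Sum>a\<in>UNIV. z $ a *\<^sub>R row a (jacobian F x))" for x z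
    by (simp add: vec_eq_iff matrix_vector_mult_def transpose_def row_def mult.commute)
  have rc: "continuous_on U (\<lambda>x. row a (jacobian F x))" for a
  proof -
    have "jacobian F x $ i $ j = frechet_derivative F (at x) (axis j 1) $ i" for x i j
      by (simp add: jacobian_def matrix_def)
    then have "continuous_on U (\<lambda>x. jacobian F x $ i $ j)" for i j
      using smooth_on_continuous[OF smooth_on_nth[OF U smooth_on_frechet[OF F(1)]]] by simp
    then show ?thesis unfolding row_def by (intro continuous_on_vec_lambda)
  qed
  have C: "C1_on U (\<lambda>x. f n (F x)) (\<lambda>x. transpose (jacobian F x) *v g n (F x))" for n
    unfolding C1_on_def
  proof (intro conjI ballI)
    fix x assume x: "x \<in> U"
    have dF: "F differentiable (at x)" using smooth_on_differentiable[OF F(1) x] .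
    have "(f n has_derivative (\<lambda>h. g n (F x) \<bullet> h)) (at (F x))" using fg(1) by (simp add: C1_on_def)
    from diff_chain_at[OF has_derivative_frechet[OF dF] this]
    have "((\<lambda>x. f n (F x)) has_derivative (\<lambda>h. g n (F x) \<bullet> frechet_derivative F (at x) h)) (at x)" by (simp add: o_def)
    moreover have "frechet_derivative F (at x) h = jacobian F x *v h" for h
      unfolding jacobian_def using fun_cong[OF matrix_vector_mul(2)[OF linear_frechet_derivative[OF dF]]] by metis
    moreover have "g n (F x) \<bullet> (jacobian F x *v h) = (transpose (jacobian F x) *v g n (F x)) \<bullet> h" for h
      by (simp add: dot_lmul_matrix[symmetric] transpose_matrix_vector)
    ultimately show "((\<lambda>x. f n (F x)) has_derivative (\<lambda>h. (transpose (jacobian F x) *v g n (F x)) \<bullet> h)) (at x)" by simp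
  next
    have "continuous_on U (\<lambda>x. g n (F x))"
      using fg(1)[of n] by (intro continuous_on_compose2[OF _ cF, of UNIV]) (auto simp: C1_on_def)
    then show "continuous_on U (\<lambda>x. transpose (jacobian F x) *v g n (F x))"
      unfolding T by (intro continuous_intros rc)
  qed
  note cv = L1_lim_change_of_variables[OF U F K]
  have "L1_lim K (\<lambda>n x. \<Sum>a\<in>UNIV. g n (F x) $ a *\<^sub>R row a (jacobian F x)) (\<lambda>x. \<Sum>a\<in>UNIV. w (F x) $ a *\<^sub>R row a (jacobian F x))"
  proof (rule L1_lim_sum[OF _ K(1)])
    fix a :: 'n
    have "bounded_bilinear (\<lambda>(c::real^'n) (z::real^'n). z $ a *\<^sub>R c)"
      by (rule bounded_bilinear.comp[OF bounded_bilinear.flip[OF bounded_bilinear_scaleR] bounded_linear_ident bounded_linear_vec_nth])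
    then show "L1_lim K (\<lambda>n x. g n (F x) $ a *\<^sub>R row a (jacobian F x)) (\<lambda>x. w (F x) $ a *\<^sub>R row a (jacobian F x))"
      by (rule L1_lim_bilinear[OF _ K(1) continuous_on_subset[OF rc K(2)] cv[OF fg(3)]])
  qed simp
  then have "L1_lim K (\<lambda>n x. transpose (jacobian F x) *v g n (F x)) (\<lambda>x. transpose (jacobian F x) *v w (F x))"
    by (simp only: T)
  with C cv[OF fg(2)]
  show "\<exists>f g. (\<forall>n. C1_on U (f n) (g n)) \<and> L1_lim K f (\<lambda>x. v (F x)) \<and> L1_lim K g (\<lambda>x. transpose (jacobian F x) *v w (F x))"
    by (intro exI[of _ "\<lambda>n x. f n (F x)"] exI[of _ "\<lambda>n x. transpose (jacobian F x) *v g n (F x)"]) blast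
qed

lemma weak_gradient_cong:
  assumes S: "open S" "weak_gradient S v w" "\<And>x. x \<in> S \<Longrightarrow> v x = v' x" "\<And>x. x \<in> S \<Longrightarrow> w x = w' x"
  shows "weak_gradient S v' w'"
proof -
  have "set_integrable lborel K f \<longleftrightarrow> set_integrable lborel K f'" if "K \<subseteq> S" "\<And>x. x \<in> S \<Longrightarrow> f x = f' x"
    for K and f f' :: "real^'a \<Rightarrow> 'b::{banach, second_countable_topology}"
  proof -
    have "(\<lambda>x. indicator K x *\<^sub>R f x) = (\<lambda>x. indicator K x *\<^sub>R f' x)"
      by (rule ext) (use that in \<open>auto simp: indicator_def\<close>)
    then show ?thesis by (simp add: set_integrable_def)
  qed
  note I = this
  have L: "locally_L1 S v'" "locally_L1 S w'"
    using S I[of _ v v'] I[of _ w w'] by (auto simp: weak_gradient_def locally_L1_def)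
  have E: "(LINT y:S|lborel. f y * g y) = (LINT y:S|lborel. f' y * g y)" if "\<And>x. x \<in> S \<Longrightarrow> f x = f' x" for f f' g :: "real^'a \<Rightarrow> real"
    unfolding set_lebesgue_integral_def
    by (intro Bochner_Integration.integral_cong refl) (use that in \<open>auto simp: indicator_def\<close>)
  have "weak_parts S v' w'"
    unfolding weak_parts_def
  proof (intro allI impI)
    fix \<phi> and i :: 'a assume "test_function S \<phi>"
    then have "(LINT y:S|lborel. v y * partial_deriv i \<phi> y) = - (LINT y:S|lborel. w y $ i * \<phi> y)"
      using S(2) by (simp add: weak_gradient_def weak_parts_def)
    then show "(LINT y:S|lborel. v' y * partial_deriv i \<phi> y) = - (LINT y:S|lborel. w' y $ i * \<phi> y)"
      using E[of v v' "partial_deriv i \<phi>"] E[of "\<lambda>y. w y $ i" "\<lambda>y. w' y $ i" \<phi>] S(3,4) by simp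
  qed
  then show ?thesis using L by (simp add: weak_gradient_def)
qed

lemma weak_gradient_zero: "weak_gradient S (\<lambda>x. 0) (\<lambda>x. 0)"
  by (simp add: weak_gradient_def locally_L1_def weak_parts_def set_integrable_def set_lebesgue_integral_def)

section \<open>The Riemannian measure\<close>

text \<open>By Lindelof countably many of the open sets have the same union. Making them disjoint
  cuts \<open>E\<close> into countably many Borel pieces, each inside one of the sets, and countable
  additivity does the rest.\<close>

lemma emeasure_eq_open_cover:
  fixes M N :: "'x::second_countable_topology measure"
  assumes M: "sets M = sets borel" and N: "sets N = sets borel"
    and op: "\<And>U. U \<in> \<U> \<Longrightarrow> open U"
    and eq: "\<And>U E. U \<in> \<U> \<Longrightarrow> E \<in> sets borel \<Longrightarrow> E \<subseteq> U \<Longrightarrow> emeasure M E = emeasure N E"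
    and E: "E \<in> sets borel" "E \<subseteq> \<Union>\<U>"
  shows "emeasure M E = emeasure N E"
proof (cases "E = {}")
  case False
  obtain \<V> where \<V>: "\<V> \<subseteq> \<U>" "countable \<V>" "\<Union>\<V> = \<Union>\<U>" using Lindelof[of \<U>] op by metis
  have ne: "\<V> \<noteq> {}" using \<V>(3) E(2) False by (metis Union_empty subset_empty)
  define u where "u = from_nat_into \<V>"
  have u: "u i \<in> \<U>" "(\<Union>i. u i) = \<Union>\<U>" for i
    using subsetD[OF \<V>(1) from_nat_into[OF ne]] range_from_nat_into[OF ne \<V>(2)] \<V>(3) by (auto simp: u_def)
  define D where "D i = E \<inter> disjointed u i" for i
  have ub: "range u \<subseteq> sets borel" using u(1) op by (auto intro: borel_open)
  have Db: "D i \<in> sets borel" for i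
    using sets.range_disjointed_sets[of u borel] ub E(1) by (auto simp: D_def)
  have Du: "D i \<subseteq> u i" for i by (auto simp: D_def disjointed_def)
  have disj: "disjoint_family D" using disjoint_family_disjointed[of u] by (auto simp: D_def disjoint_family_on_def)
  have UN: "(\<Union>i. D i) = E" using E(2) u(2) UN_disjointed_eq[of u] by (auto simp: D_def)
  have "emeasure M E = (\<Sum>i. emeasure M (D i))"
    using suminf_emeasure[of D M, OF _ disj] Db M UN by (simp add: image_subset_iff)
  also have "\<dots> = (\<Sum>i. emeasure N (D i))" using eq[OF u(1) Db Du] by simp
  also have "\<dots> = emeasure N E"
    using suminf_emeasure[of D N, OF _ disj] Db N UN by (simp add: image_subset_iff)
  finally show ?thesis .
qed simp

text \<open>One of the sums is an integral over the counting measure, and integrals of nonnegative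
  functions commute with countable sums.\<close>

lemma suminf_ennreal_swap:
  fixes f :: "nat \<Rightarrow> nat \<Rightarrow> ennreal"
  shows "(\<Sum>i. \<Sum>j. f i j) = (\<Sum>j. \<Sum>i. f i j)"
  using nn_integral_suminf[of "\<lambda>i j. f i j" "count_space UNIV"] by (simp add: nn_integral_count_space_nat)

text \<open>Stated for a map that agrees with the composition near the point, because coordinate
  expressions compose only on overlaps of charts.\<close>

lemma jacobian_chain:
  assumes "f differentiable (at y)" "F differentiable (at (f y))" "open S" "y \<in> S" "\<And>x. x \<in> S \<Longrightarrow> H x = F (f x)"
  shows "jacobian H y = jacobian F (f y) ** jacobian f y"
proof -
  have "((\<lambda>x. F (f x)) has_derivative (\<lambda>h. frechet_derivative F (at (f y)) (frechet_derivative f (at y) h))) (at y)"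
    using diff_chain_at[OF has_derivative_frechet[OF assms(1)] has_derivative_frechet[OF assms(2)]] by (simp add: o_def)
  then have "(H has_derivative (\<lambda>h. frechet_derivative F (at (f y)) (frechet_derivative f (at y) h))) (at y)"
    by (rule has_derivative_transform_within_open[OF _ assms(3,4)]) (use assms(5) in auto)
  then have "frechet_derivative H (at y) = frechet_derivative F (at (f y)) \<circ> frechet_derivative f (at y)"
    by (simp add: frechet_derivative_eqI o_def)
  then show ?thesis
    unfolding jacobian_def
    using matrix_compose[OF linear_frechet_derivative[OF assms(1)] linear_frechet_derivative[OF assms(2)]] by simp
qed

section \<open>Charts of a Riemannian manifold\<close>

locale riemannian =
  fixes A :: "('x::{t2_space, second_countable_topology}, real^'n::finite) atlas" and g :: "('x, 'n) metric"
  assumes manifold: "smooth_manifold A" and metric: "riemannian_metric A g"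
begin

lemma chart_open: "c \<in> A \<Longrightarrow> open (chart_dom c)" "c \<in> A \<Longrightarrow> open (chart_img c)"
  and chart_homeo: "c \<in> A \<Longrightarrow> homeomorphism (chart_dom c) (chart_img c) (chart_map c) (chart_inv c)"
  using manifold by (auto simp: smooth_manifold_def)

lemma chart_inv_map: "c \<in> A \<Longrightarrow> p \<in> chart_dom c \<Longrightarrow> chart_inv c (chart_map c p) = p"
  using chart_homeo unfolding homeomorphism_def by blast

lemma chart_map_inv: "c \<in> A \<Longrightarrow> y \<in> chart_img c \<Longrightarrow> chart_map c (chart_inv c y) = y"
  using chart_homeo unfolding homeomorphism_def by blast

lemma chart_inv_dom: "c \<in> A \<Longrightarrow> y \<in> chart_img c \<Longrightarrow> chart_inv c y \<in> chart_dom c"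
  using chart_homeo unfolding homeomorphism_def by blast

lemma chart_image_open:
  assumes "c \<in> A" "open S" "S \<subseteq> chart_dom c"
  shows "open (chart_map c ` S)"
proof -
  have "openin (top_of_set (chart_img c)) (chart_map c ` S)"
    using homeomorphism_imp_open_map[OF chart_homeo[OF assms(1)]] assms by (simp add: openin_open_eq chart_open)
  then show ?thesis using openin_open_trans chart_open(2)[OF assms(1)] by blast
qed

lemma chart_image_borel: "c \<in> A \<Longrightarrow> E \<in> sets borel \<Longrightarrow> E \<subseteq> chart_dom c \<Longrightarrow> chart_map c ` E \<in> sets borel"
  using homeomorphism_image_borel[OF chart_homeo] chart_open by (meson borel_open)

lemma chart_at: "chart_at A p \<in> A" "p \<in> chart_dom (chart_at A p)"
proof -
  have "\<exists>c. c \<in> A \<and> p \<in> chart_dom c" using manifold unfolding smooth_manifold_def by blast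
  from someI_ex[OF this] show "chart_at A p \<in> A" "p \<in> chart_dom (chart_at A p)" by (auto simp: chart_at_def)
qed

lemma chart_local_metric: assumes "c \<in> A" shows "local_metric (chart_img c) (g c)"
proof
  show "open (chart_img c)" using chart_open assms by blast
  show "smooth_on (chart_img c) (\<lambda>y. g c y $ i $ j)" for i j
    using metric assms unfolding riemannian_metric_def by blast
  fix y assume y: "y \<in> chart_img c"
  have t: "transpose (g c y) = g c y" and pos: "\<forall>v. v \<noteq> 0 \<longrightarrow> 0 < v \<bullet> (g c y *v v)"
    using metric assms y unfolding riemannian_metric_def by blast+
  show "g c y $ i $ j = g c y $ j $ i" for i j
  proof -
    have "transpose (g c y) $ i $ j = g c y $ j $ i" by (simp add: transpose_def)
    then show ?thesis unfolding t .
  qed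
  have "g c y *v v = 0 \<Longrightarrow> v = 0" for v using pos[rule_format, of v] by (cases "v = 0") auto
  then have "invertible (g c y)"
    by (metis invertible_left_inverse matrix_left_invertible_ker)
  then show "det (g c y) \<noteq> 0" by (simp add: invertible_det_nz)
qed

abbreviation "chart_density c y \<equiv> ennreal (sqrt (det (g c y)))"

lemma chart_density_measurable:
  assumes "c \<in> A" shows "chart_density c \<in> borel_measurable (restrict_space borel (chart_img c))"
proof -
  have "continuous_on (chart_img c) (\<lambda>y. sqrt (det (g c y)))"
    using smooth_on_continuous[OF smooth_on_det[OF chart_open(2)[OF assms] local_metric.G_smooth[OF chart_local_metric[OF assms]]]]
    by (intro continuous_intros)
  then show ?thesis
    by (intro measurable_compose[OF borel_measurable_continuous_on_restrict measurable_ennreal])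
qed

text \<open>Countably many chart domains cover the manifold by second countability, so a preimage is
  a countable union of Borel pieces.\<close>

lemma borel_measurable_charts:
  fixes f :: "'x \<Rightarrow> real"
  assumes "\<And>c. c \<in> A \<Longrightarrow> (\<lambda>y. f (chart_inv c y)) \<in> borel_measurable (restrict_space borel (chart_img c))"
  shows "f \<in> borel_measurable borel"
proof -
  have 1: "f \<in> borel_measurable (restrict_space borel (chart_dom c))" if c: "c \<in> A" for c
  proof -
    have "chart_map c \<in> restrict_space borel (chart_dom c) \<rightarrow>\<^sub>M restrict_space borel (chart_img c)"
      using chart_homeo[OF c] unfolding homeomorphism_def
      by (intro measurable_restrict_space2 borel_measurable_continuous_on_restrict) (auto simp: space_restrict_space)
    from measurable_compose[OF this assms[OF c]]
    have "(\<lambda>p. f (chart_inv c (chart_map c p))) \<in> borel_measurable (restrict_space borel (chart_dom c))" .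
    then show ?thesis
      by (rule measurable_cong[THEN iffD1, rotated]) (simp add: space_restrict_space chart_inv_map c)
  qed
  obtain \<V> where \<V>: "\<V> \<subseteq> chart_dom ` A" "countable \<V>" "\<Union>\<V> = \<Union>(chart_dom ` A)"
    using Lindelof[of "chart_dom ` A"] chart_open by (metis imageE)
  have U: "\<Union>(chart_dom ` A) = UNIV" using manifold unfolding smooth_manifold_def by blast
  have "f -` S \<inter> space borel \<in> sets borel" if S: "S \<in> sets borel" for S
  proof -
    have "f -` S \<inter> V \<in> sets borel" if V: "V \<in> \<V>" for V
    proof -
      obtain c where c: "c \<in> A" "V = chart_dom c" using V \<V>(1) by blast
      have "f -` S \<inter> space (restrict_space borel V) \<in> sets (restrict_space borel V)"
        using measurable_sets[OF 1[OF c(1)] S] c(2) by simp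
      then show ?thesis using chart_open(1)[OF c(1)] c(2) by (simp add: space_restrict_space sets_restrict_space_iff)
    qed
    then have "(\<Union>V\<in>\<V>. f -` S \<inter> V) \<in> sets borel" using \<V>(2) by (intro sets.countable_UN') auto
    moreover have "(\<Union>V\<in>\<V>. f -` S \<inter> V) = f -` S" using \<V>(3) U by auto
    ultimately show ?thesis by simp
  qed
  then show ?thesis by (intro measurableI) auto
qed

end

text \<open>\<phi> maps an open part \<open>N\<close> of the first manifold isometrically onto an
  open part of the second. The instances are the identity, which yields independence of charts, the
  translations of the cylinder, and the end of X.\<close>

locale isometry = X: riemannian A g + Y: riemannian C k
  for A :: "('x::{t2_space, second_countable_topology}, real^'n::finite) atlas" and g
    and C :: "('y::{t2_space, second_countable_topology}, real^'n) atlas" and k +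
  fixes N :: "'x set" and \<phi> :: "'x \<Rightarrow> 'y" and \<psi> :: "'y \<Rightarrow> 'x"
  assumes N_open: "open N" and img_open: "open (\<phi> ` N)" and homeo: "homeomorphism N (\<phi> ` N) \<phi> \<psi>"
    and smooth: "smooth_map_open A C N \<phi>"
    and pull_metric: "\<And>p. p \<in> N \<Longrightarrow> pullback_eq_at A g C k \<phi> p"
begin

definition "overlap d c = {p \<in> chart_dom d \<inter> N. \<phi> p \<in> chart_dom c}"
definition "rep d c = chart_map c \<circ> \<phi> \<circ> chart_inv d"

lemma inj: "inj_on \<phi> N"
  using homeo by (metis homeomorphism_apply1 inj_on_inverseI)

lemma cont: "continuous_on N \<phi>" using homeo homeomorphism_cont1 by blast

lemma overlap_open: "d \<in> A \<Longrightarrow> c \<in> C \<Longrightarrow> open (overlap d c)"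
proof -
  assume dc: "d \<in> A" "c \<in> C"
  have "open (N \<inter> \<phi> -` chart_dom c)"
    using continuous_open_preimage[OF cont N_open Y.chart_open(1)[OF dc(2)]] .
  moreover have "overlap d c = chart_dom d \<inter> (N \<inter> \<phi> -` chart_dom c)" by (auto simp: overlap_def)
  ultimately show ?thesis using X.chart_open(1)[OF dc(1)] by auto
qed

lemma overlap_img_open: "d \<in> A \<Longrightarrow> c \<in> C \<Longrightarrow> open (chart_map d ` overlap d c)"
  using X.chart_image_open overlap_open by (simp add: overlap_def)

lemma rep_smooth: "d \<in> A \<Longrightarrow> c \<in> C \<Longrightarrow> smooth_on (chart_map d ` overlap d c) (rep d c)"
  using smooth unfolding smooth_map_open_def overlap_def rep_def by blast

lemma rep_apply: "d \<in> A \<Longrightarrow> p \<in> chart_dom d \<Longrightarrow> rep d c (chart_map d p) = chart_map c (\<phi> p)"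
  by (simp add: rep_def X.chart_inv_map)

lemma rep_local_isometry:
  assumes "d \<in> A" "c \<in> C"
  shows "local_isometry (chart_map d ` overlap d c) (g d) (chart_img c) (k c) (rep d c)"
proof -
  interpret S: local_metric "chart_img d" "g d" using X.chart_local_metric assms by blast
  interpret T: local_metric "chart_img c" "k c" using Y.chart_local_metric assms by blast
  have sub: "chart_map d ` overlap d c \<subseteq> chart_img d" by (auto simp: overlap_def)
  show ?thesis
  proof
    show "open (chart_map d ` overlap d c)" using overlap_img_open assms by blast
    show "smooth_on (chart_map d ` overlap d c) (\<lambda>y. g d y $ i $ j)" for i j
      using smooth_on_subset[OF S.G_smooth sub] .
    show "g d y $ i $ j = g d y $ j $ i" if "y \<in> chart_map d ` overlap d c" for y i j
      using S.G_sym sub that by blast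
    show "det (g d y) \<noteq> 0" if "y \<in> chart_map d ` overlap d c" for y
      using S.G_det sub that by blast
    show "rep d c ` chart_map d ` overlap d c \<subseteq> chart_img c"
      using rep_apply[OF assms(1), where c = c] by (auto simp: overlap_def)
    show "smooth_on (chart_map d ` overlap d c) (rep d c)" using rep_smooth assms by blast
    fix y assume "y \<in> chart_map d ` overlap d c"
    then obtain p where p: "y = chart_map d p" "p \<in> chart_dom d" "p \<in> N" "\<phi> p \<in> chart_dom c" by (auto simp: overlap_def)
    then show "g d y = transpose (jacobian (rep d c) y) ** k c (rep d c y) ** jacobian (rep d c) y"
      using pull_metric[OF p(3)] assms rep_apply[OF assms(1) p(2), of c]
      unfolding pullback_eq_at_def rep_def Let_def by simp
  qed
qed

lemma rep_inj: "d \<in> A \<Longrightarrow> c \<in> C \<Longrightarrow> inj_on (rep d c) (chart_map d ` overlap d c)"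
proof (rule inj_onI)
  fix x y assume dc: "d \<in> A" "c \<in> C" and xy: "x \<in> chart_map d ` overlap d c" "y \<in> chart_map d ` overlap d c" "rep d c x = rep d c y"
  then obtain p q where pq: "x = chart_map d p" "y = chart_map d q" "p \<in> overlap d c" "q \<in> overlap d c" by blast
  then have "chart_map c (\<phi> p) = chart_map c (\<phi> q)" using rep_apply[OF dc(1), where c = c] xy(3) by (simp add: overlap_def)
  then have "\<phi> p = \<phi> q" using Y.chart_inv_map[OF dc(2)] pq by (metis (mono_tags, lifting) mem_Collect_eq overlap_def)
  then show "x = y" using inj pq by (auto simp: overlap_def inj_on_def)
qed

text \<open>Taking determinants in the transformation law of the metric, the square root of the Gram
  determinant picks up the absolute Jacobian determinant, exactly the factor in the change of
  variables formula.\<close>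

lemma chart_measure_eq:
  assumes d: "d \<in> A" and c: "c \<in> C" and E: "E \<in> sets borel" "E \<subseteq> overlap d c"
  shows "(\<integral>\<^sup>+y\<in>chart_map c ` \<phi> ` E. ennreal (sqrt (det (k c y))) \<partial>lborel) = (\<integral>\<^sup>+y\<in>chart_map d ` E. ennreal (sqrt (det (g d y))) \<partial>lborel)"
proof -
  let ?U = "chart_map d ` overlap d c" and ?F = "rep d c"
  interpret L: local_isometry ?U "g d" "chart_img c" "k c" ?F by (rule rep_local_isometry[OF d c])
  let ?E = "chart_map d ` E"
  have EU: "?E \<subseteq> ?U" using E by blast
  have FE: "?F ` ?E = chart_map c ` \<phi> ` E"
    unfolding image_image using rep_apply[OF d, where c = c] E(2) by (intro image_cong refl) (auto simp: overlap_def)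
  have cd: "continuous_on ?U (\<lambda>x. det (jacobian ?F x))"
    by (rule smooth_on_continuous[OF smooth_on_det[OF L.S.V]])
       (simp add: L.jacobian_nth smooth_on_nth[OF L.S.V L.DF_smooth])
  have \<phi>E: "\<phi> ` E \<in> sets borel"
    using homeomorphism_image_borel[OF homeo _ _ E(1)] N_open img_open E(2) by (auto simp: overlap_def)
  then have FEb: "?F ` ?E \<in> sets borel" unfolding FE using Y.chart_image_borel[OF c] E(2) by (auto simp: overlap_def)
  let ?f = "\<lambda>y. ennreal (sqrt (det (k c y))) * indicator (?F ` ?E) y"
  have fm: "?f \<in> borel_measurable (restrict_space borel (?F ` ?U))"
  proof -
    have "?F ` ?U \<subseteq> chart_img c" by (rule L.FU)
    then have "(\<lambda>y. ennreal (sqrt (det (k c y)))) \<in> borel_measurable (restrict_space borel (?F ` ?U))"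
      using measurable_restrict_mono[OF Y.chart_density_measurable[OF c]] by blast
    moreover have "indicator (?F ` ?E) \<in> borel_measurable (restrict_space borel (?F ` ?U))"
      using FEb by (intro measurable_restrict_space1) simp
    ultimately show ?thesis by (rule borel_measurable_times_ennreal)
  qed
  have "(\<integral>\<^sup>+y\<in>chart_map c ` \<phi> ` E. ennreal (sqrt (det (k c y))) \<partial>lborel) = (\<integral>\<^sup>+y\<in>?F ` ?U. ?f y \<partial>lborel)"
    unfolding FE[symmetric] using EU by (intro nn_integral_cong) (auto simp: indicator_def)
  also have "\<dots> = (\<integral>\<^sup>+x\<in>?U. ennreal \<bar>det (jacobian ?F x)\<bar> * ?f (?F x) \<partial>lborel)"
    by (rule nn_integral_change_of_variables[OF L.S.V smooth_on_differentiable[OF L.F_smooth] cd rep_inj[OF d c] fm])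
  also have "\<dots> = (\<integral>\<^sup>+y\<in>?E. ennreal (sqrt (det (g d y))) \<partial>lborel)"
  proof (intro nn_integral_cong)
    fix x
    have s: "ennreal \<bar>det (jacobian ?F x)\<bar> * ennreal (sqrt (det (k c (?F x)))) = ennreal (sqrt (det (g d x)))" if "x \<in> ?U"
    proof -
      have "det (g d x) = (det (jacobian ?F x))\<^sup>2 * det (k c (?F x))"
        using L.pull[OF that] by (simp add: det_mul power2_eq_square mult_ac)
      then have "sqrt (det (g d x)) = \<bar>det (jacobian ?F x)\<bar> * sqrt (det (k c (?F x)))" by (simp add: real_sqrt_mult)
      then show ?thesis by (simp add: ennreal_mult')
    qed
    have i: "?F x \<in> ?F ` ?E \<longleftrightarrow> x \<in> ?E" if "x \<in> ?U" using inj_on_image_mem_iff[OF rep_inj[OF d c] that EU] .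
    show "ennreal \<bar>det (jacobian ?F x)\<bar> * ?f (?F x) * indicator ?U x = ennreal (sqrt (det (g d x))) * indicator ?E x"
    proof (cases "x \<in> ?U")
      case True then show ?thesis using s[OF True] i[OF True] by (simp add: indicator_def)
    next
      case False then have "x \<notin> ?E" using EU by blast
      then show ?thesis using False by simp
    qed
  qed
  finally show ?thesis .
qed

lemma scalar_curvature_chart:
  "d \<in> A \<Longrightarrow> c \<in> C \<Longrightarrow> p \<in> overlap d c \<Longrightarrow>
    local_scalar_curvature (g d) (chart_map d p) = local_scalar_curvature (k c) (chart_map c (\<phi> p))"
  using local_isometry.scalar_curvature_transform[OF rep_local_isometry[of d c], of "chart_map d p"] rep_apply[of d p c]
  by (auto simp: overlap_def)

text \<open>The covector is pulled back by the transposed Jacobian, and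
  \<open>matrix_inv_pull\<close> turns the inverse metric of the source into that of the
  target.\<close>

lemma norm2_chart:
  assumes "d \<in> A" "c \<in> C" "p \<in> overlap d c"
    and "\<eta> = transpose (jacobian (rep d c) (chart_map d p)) *v \<omega>"
  shows "\<eta> \<bullet> (matrix_inv (g d (chart_map d p)) *v \<eta>) = \<omega> \<bullet> (matrix_inv (k c (chart_map c (\<phi> p))) *v \<omega>)"
proof -
  interpret L: local_isometry "chart_map d ` overlap d c" "g d" "chart_img c" "k c" "rep d c"
    by (rule rep_local_isometry[OF assms(1,2)])
  let ?J = "jacobian (rep d c) (chart_map d p)" and ?G = "matrix_inv (g d (chart_map d p))"
  have "\<eta> \<bullet> (?G *v \<eta>) = \<omega> \<bullet> (?J *v (?G *v (transpose ?J *v \<omega>)))"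
    unfolding assms(4) by (simp add: dot_lmul_matrix)
  also have "?J *v (?G *v (transpose ?J *v \<omega>)) = (?J ** ?G ** transpose ?J) *v \<omega>"
    by (simp only: matrix_vector_mul_assoc matrix_mul_assoc)
  also have "?J ** ?G ** transpose ?J = matrix_inv (k c (chart_map c (\<phi> p)))"
    using L.matrix_inv_pull[of "chart_map d p"] assms(3) rep_apply[OF assms(1), of p c] by (auto simp: overlap_def)
  finally show ?thesis .
qed

end

section \<open>Independence of charts and existence of the volume measure\<close>

context riemannian
begin

text \<open>Transition maps are the coordinate expressions of the identity, so everything proved
  about isometries specialises to independence of the chosen charts.\<close>

lemma identity_isometry: "isometry A g A g UNIV (\<lambda>p. p) (\<lambda>p. p)"
proof
  show "homeomorphism UNIV ((\<lambda>p. p) ` UNIV) (\<lambda>p. p) (\<lambda>p. p :: 'x)" by (simp add: homeomorphism_def)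
  have e: "chart_map d \<circ> (\<lambda>p. p) \<circ> chart_inv c = chart_map d \<circ> chart_inv c" for c d :: "('x, real^'n) chart" by auto
  have "{p \<in> chart_dom c \<inter> UNIV. p \<in> chart_dom d} = chart_dom c \<inter> chart_dom d" for c d :: "('x, real^'n) chart" by auto
  then show "smooth_map_open A A UNIV (\<lambda>p. p)"
    using manifold unfolding smooth_map_open_def smooth_manifold_def e by auto
  show "pullback_eq_at A g A g (\<lambda>p. p) p" for p
    using metric unfolding pullback_eq_at_def riemannian_metric_def Let_def e by (metis IntI)
qed auto

sublocale Id: isometry A g A g UNIV "\<lambda>p. p" "\<lambda>p. p"
  by (rule identity_isometry)

lemma transition_rep: "Id.rep d c = chart_map c \<circ> chart_inv d"
  by (auto simp: Id.rep_def)

lemma scalar_curvature_eq: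
  "c \<in> A \<Longrightarrow> p \<in> chart_dom c \<Longrightarrow> scalar_curvature A g p = local_scalar_curvature (g c) (chart_map c p)"
  using Id.scalar_curvature_chart[of "chart_at A p" c p] chart_at[of p]
  by (simp add: scalar_curvature_def Let_def Id.overlap_def)

lemma norm2_oneform_eq:
  assumes "oneform A \<omega>" "c \<in> A" "p \<in> chart_dom c"
  shows "norm2_oneform A g \<omega> p = \<omega> c (chart_map c p) \<bullet> (matrix_inv (g c (chart_map c p)) *v \<omega> c (chart_map c p))"
proof -
  let ?d = "chart_at A p"
  note d = chart_at[of p]
  have o: "p \<in> Id.overlap ?d c" using d assms by (simp add: Id.overlap_def)
  have "\<omega> ?d (chart_map ?d p) = transpose (jacobian (Id.rep ?d c) (chart_map ?d p)) *v \<omega> c (chart_map c p)"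
    using assms d unfolding transition_rep oneform_def by blast
  from Id.norm2_chart[OF d(1) assms(2) o this] show ?thesis
    unfolding norm2_oneform_def Let_def .
qed

lemma scalar_curvature_continuous: "continuous_on UNIV (scalar_curvature A g)"
proof (rule continuous_at_imp_continuous_on, intro ballI)
  fix p
  let ?c = "chart_at A p"
  note c = chart_at[of p]
  have "continuous_on (chart_dom ?c) (\<lambda>p. local_scalar_curvature (g ?c) (chart_map ?c p))"
    using chart_homeo[OF c(1)] unfolding homeomorphism_def
    by (intro continuous_on_compose2[OF smooth_on_continuous[OF local_metric.local_scalar_curvature_smooth[OF chart_local_metric[OF c(1)]]]]) auto
  then have "continuous_on (chart_dom ?c) (scalar_curvature A g)"
    by (rule continuous_on_eq) (simp add: scalar_curvature_eq[OF c(1)])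
  then show "isCont (scalar_curvature A g) p"
    using continuous_on_eq_continuous_at[OF chart_open(1)[OF c(1)]] c(2) by blast
qed

text \<open>Choose countably many charts covering the manifold, cut it into disjoint Borel pieces
  each inside one chart, measure each piece in its own chart and add up. That the result is right in
  every chart is \<open>chart_measure_eq\<close> for the identity.\<close>

lemma riemannian_measure_exists:
  "\<exists>\<mu>. sets \<mu> = sets borel \<and> (\<forall>c\<in>A. \<forall>E\<in>sets borel. E \<subseteq> chart_dom c \<longrightarrow>
     emeasure \<mu> E = (\<integral>\<^sup>+y\<in>chart_map c ` E. ennreal (sqrt (det (g c y))) \<partial>lborel))"
proof -
  define m where "m c E = (\<integral>\<^sup>+y\<in>chart_map c ` E. ennreal (sqrt (det (g c y))) \<partial>lborel)" for c E
  have m_sum: "m c (\<Union>i. E i) = (\<Sum>i. m c (E i))"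
    if c: "c \<in> A" and E: "\<And>i. E i \<in> sets borel" "\<And>i. E i \<subseteq> chart_dom c" "disjoint_family E" for c and E :: "nat \<Rightarrow> 'x set"
  proof -
    let ?d = "\<lambda>y. ennreal (sqrt (det (g c y))) * indicator (chart_img c) y"
    have dm: "?d \<in> borel_measurable lborel"
      using chart_density_measurable[OF c] chart_open(2)[OF c]
      by (subst (asm) borel_measurable_restrict_space_iff_ennreal) auto
    have md: "m c S = emeasure (density lborel ?d) (chart_map c ` S)" if "S \<in> sets borel" "S \<subseteq> chart_dom c" for S
    proof -
      have sub: "chart_map c ` S \<subseteq> chart_img c" using that(2) by blast
      have "chart_map c ` S \<in> sets lborel" using chart_image_borel[OF c that] by simp
      from emeasure_density[OF dm this] show ?thesis
        unfolding m_def using subsetD[OF sub] by (auto intro!: nn_integral_cong split: split_indicator)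
    qed
    have inj: "inj_on (chart_map c) (chart_dom c)" by (metis chart_inv_map[OF c] inj_on_inverseI)
    have "disjoint_family (\<lambda>i. chart_map c ` E i)"
      using E(2,3) inj unfolding disjoint_family_on_def by (metis image_empty inj_on_image_Int)
    then have "(\<Sum>i. emeasure (density lborel ?d) (chart_map c ` E i)) = emeasure (density lborel ?d) (\<Union>i. chart_map c ` E i)"
      using chart_image_borel[OF c E(1,2)] by (intro suminf_emeasure) auto
    moreover have "m c (\<Union>i. E i) = emeasure (density lborel ?d) (\<Union>i. chart_map c ` E i)"
      using md[of "\<Union>i. E i"] E by (simp add: image_UN UN_least)
    ultimately show ?thesis using md E by simp
  qed
  obtain \<V> where \<V>: "\<V> \<subseteq> chart_dom ` A" "countable \<V>" "\<Union>\<V> = \<Union>(chart_dom ` A)"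
    using Lindelof[of "chart_dom ` A"] chart_open by (metis imageE)
  have U: "\<Union>(chart_dom ` A) = UNIV" using manifold unfolding smooth_manifold_def by blast
  then have ne: "\<V> \<noteq> {}" using \<V>(3) by auto
  define V where "V = from_nat_into \<V>"
  have "\<forall>i. \<exists>c\<in>A. V i = chart_dom c" using \<V>(1) from_nat_into[OF ne] unfolding V_def by blast
  then obtain C where C: "\<And>i. C i \<in> A" "\<And>i. V i = chart_dom (C i)" by metis
  have VU: "(\<Union>i. V i) = UNIV" using range_from_nat_into[OF ne \<V>(2)] \<V>(3) U unfolding V_def by auto
  let ?D = "disjointed V"
  have Vb: "range V \<subseteq> sets borel" using chart_open(1)[OF C(1)] by (auto simp: C(2) intro: borel_open)
  have Db: "?D i \<in> sets borel" for i using sets.range_disjointed_sets[OF Vb] by auto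
  have Dc: "?D i \<subseteq> chart_dom (C i)" for i using C(2) disjointed_subset by metis
  define \<mu> where "\<mu> E = (\<Sum>i. m (C i) (E \<inter> ?D i))" for E
  have "emeasure (measure_of UNIV (sets borel) \<mu>) E = \<mu> E" if "E \<in> sets borel" for E
  proof (rule emeasure_measure_of[OF refl])
    show "positive (sets (measure_of UNIV (sets borel) \<mu>)) \<mu>" by (simp add: positive_def \<mu>_def m_def)
    show "countably_additive (sets (measure_of UNIV (sets borel) \<mu>)) \<mu>"
    proof (rule countably_additiveI)
      fix E :: "nat \<Rightarrow> 'x set"
      assume E: "range E \<subseteq> sets (measure_of UNIV (sets borel) \<mu>)" "disjoint_family E"
      then have Eb: "E i \<in> sets borel" for i using sets.sigma_sets_eq[of borel] by (auto simp: sets_measure_of_conv)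
      have "(\<Sum>j. \<mu> (E j)) = (\<Sum>i. \<Sum>j. m (C i) (E j \<inter> ?D i))"
        unfolding \<mu>_def by (rule suminf_ennreal_swap)
      also have "\<dots> = (\<Sum>i. m (C i) (\<Union>j. E j \<inter> ?D i))"
      proof (intro suminf_cong m_sum[symmetric] C)
        show "E j \<inter> ?D i \<in> sets borel" for i j using Eb Db by auto
        show "E j \<inter> ?D i \<subseteq> chart_dom (C i)" for i j using Dc by auto
        show "disjoint_family (\<lambda>j. E j \<inter> ?D i)" for i using E(2) by (auto simp: disjoint_family_on_def)
      qed
      finally show "(\<Sum>j. \<mu> (E j)) = \<mu> (\<Union>j. E j)" by (simp add: \<mu>_def)
    qed
    show "E \<in> sets (measure_of UNIV (sets borel) \<mu>)"
      using that sets.sigma_sets_eq[of borel] by (simp add: sets_measure_of_conv)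
  qed auto
  moreover have "\<mu> E = m c E" if c: "c \<in> A" and E: "E \<in> sets borel" "E \<subseteq> chart_dom c" for c E
  proof -
    have "m (C i) (E \<inter> ?D i) = m c (E \<inter> ?D i)" for i
      using Id.chart_measure_eq[OF c C(1), of "E \<inter> ?D i" i] E Db Dc by (auto simp: m_def Id.overlap_def subset_eq)
    then have "\<mu> E = (\<Sum>i. m c (E \<inter> ?D i))" by (simp add: \<mu>_def)
    also have "\<dots> = m c (\<Union>i. E \<inter> ?D i)"
      using E Db disjoint_family_subset[OF disjoint_family_disjointed[of V], of "\<lambda>i. E \<inter> ?D i"]
      by (intro m_sum[OF c, symmetric]) auto
    also have "(\<Union>i. E \<inter> ?D i) = E" using UN_disjointed_eq[of V] VU by auto
    finally show ?thesis .
  qed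
  ultimately show ?thesis
    using sets.sigma_sets_eq[of "borel :: 'x measure"]
    by (intro exI[of _ "measure_of UNIV (sets borel) \<mu>"]) (simp add: sets_measure_of_conv m_def)
qed

text \<open>The definite description is justified by existence and uniqueness: two such measures
  agree on Borel subsets of chart domains, and these domains form an open cover.\<close>

lemma riemannian_measure:
  "sets (riemannian_measure A g) = sets borel"
  "c \<in> A \<Longrightarrow> E \<in> sets borel \<Longrightarrow> E \<subseteq> chart_dom c \<Longrightarrow>
     emeasure (riemannian_measure A g) E = (\<integral>\<^sup>+y\<in>chart_map c ` E. ennreal (sqrt (det (g c y))) \<partial>lborel)"
proof -
  let ?P = "\<lambda>\<mu>. sets \<mu> = sets borel \<and> (\<forall>c\<in>A. \<forall>E\<in>sets borel. E \<subseteq> chart_dom c \<longrightarrow>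
     emeasure \<mu> E = (\<integral>\<^sup>+y\<in>chart_map c ` E. ennreal (sqrt (det (g c y))) \<partial>lborel))"
  obtain \<mu> where \<mu>: "?P \<mu>" using riemannian_measure_exists by blast
  have "?P (riemannian_measure A g)"
    unfolding riemannian_measure_def
  proof (rule theI[of ?P, OF \<mu>])
    fix \<nu> assume \<nu>: "?P \<nu>"
    show "\<nu> = \<mu>"
    proof (rule measure_eqI)
      fix E assume E: "E \<in> sets \<nu>"
      show "emeasure \<nu> E = emeasure \<mu> E"
      proof (rule emeasure_eq_open_cover[where \<U> = "chart_dom ` A"])
        show "emeasure \<nu> F = emeasure \<mu> F" if "U \<in> chart_dom ` A" "F \<in> sets borel" "F \<subseteq> U" for U F
          using that \<mu> \<nu> by (metis (no_types, lifting) imageE)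
        show "E \<subseteq> \<Union>(chart_dom ` A)" using manifold unfolding smooth_manifold_def by blast
      qed (use \<mu> \<nu> E chart_open in auto)
    qed (use \<mu> \<nu> in auto)
  qed
  then show "sets (riemannian_measure A g) = sets borel"
    "c \<in> A \<Longrightarrow> E \<in> sets borel \<Longrightarrow> E \<subseteq> chart_dom c \<Longrightarrow>
     emeasure (riemannian_measure A g) E = (\<integral>\<^sup>+y\<in>chart_map c ` E. ennreal (sqrt (det (g c y))) \<partial>lborel)"
    by blast+
qed

end

section \<open>Transport of Sobolev functions along isometries\<close>

context riemannian
begin

text \<open>With \<open>v\<close> the inverse matrix applied to \<open>w\<close>, the value is the
  metric evaluated on \<open>v\<close>, which is positive unless \<open>v\<close> vanishes.\<close>

lemma metric_inverse_nonneg: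
  assumes c: "c \<in> A" and y: "y \<in> chart_img c"
  shows "0 \<le> w \<bullet> (matrix_inv (g c y) *v w)"
proof -
  interpret L: local_metric "chart_img c" "g c" using chart_local_metric c by blast
  define v where "v = matrix_inv (g c y) *v w"
  have "g c y *v v = w"
    unfolding v_def using matrix_inv_right(1)[OF L.G_det[OF y]] by (simp add: matrix_vector_mul_assoc)
  moreover have "v \<noteq> 0 \<longrightarrow> 0 < v \<bullet> (g c y *v v)" using metric c y unfolding riemannian_metric_def by blast
  ultimately have "0 \<le> v \<bullet> w" by (cases "v = 0") auto
  then show ?thesis unfolding v_def by (simp add: inner_commute)
qed

lemma norm2_oneform_nonneg: "norm2_oneform A g \<omega> p \<ge> 0"
  using metric_inverse_nonneg[of "chart_at A p"] chart_at[of p] unfolding norm2_oneform_def Let_def by blast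

text \<open>Measurability of the components of \<omega> is contained in their local integrability: a
  chart image is a countable union of compact sets, on each of which they are measurable.\<close>

lemma norm2_oneform_measurable:
  assumes "weak_differential A u \<omega>"
  shows "norm2_oneform A g \<omega> \<in> borel_measurable borel"
proof (rule borel_measurable_charts)
  fix c assume c: "c \<in> A"
  interpret L: local_metric "chart_img c" "g c" using chart_local_metric c by blast
  have of: "oneform A \<omega>" and wg: "locally_L1 (chart_img c) (\<omega> c)"
    using assms c by (auto simp: weak_differential_iff weak_gradient_def)
  obtain K :: "nat \<Rightarrow> (real^'n) set" where K: "\<And>n. compact (K n)" "\<And>n. K n \<subseteq> chart_img c" "(\<Union>n. K n) = chart_img c"
    using open_Union_compact_subsets[OF L.V] by metis
  have m: "\<omega> c \<in> borel_measurable (restrict_space borel (chart_img c))"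
  proof (rule measurableI)
    fix S :: "(real^'n) set" assume S: "S \<in> sets borel"
    have "\<omega> c -` S \<inter> K n \<in> sets borel" for n
    proof -
      have Kb: "K n \<in> sets borel" using compact_imp_closed[OF K(1)] borel_closed by blast
      have "set_borel_measurable lborel (K n) (\<omega> c)"
        using wg K(1,2) by (intro set_integrable_borel_measurable) (auto simp: locally_L1_def)
      then have "(\<lambda>x. indicator (K n) x *\<^sub>R \<omega> c x) \<in> borel_measurable borel" by (simp add: set_borel_measurable_def)
      then have "(\<lambda>x. indicator (K n) x *\<^sub>R \<omega> c x) -` S \<inter> K n \<in> sets borel"
        using sets.Int[OF measurable_sets[OF _ S] Kb] by (simp only: space_borel Int_UNIV_right)
      moreover have "(\<lambda>x. indicator (K n) x *\<^sub>R \<omega> c x) -` S \<inter> K n = \<omega> c -` S \<inter> K n" by auto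
      ultimately show ?thesis by simp
    qed
    then have "(\<Union>n. \<omega> c -` S \<inter> K n) \<in> sets borel" by blast
    moreover have "(\<Union>n. \<omega> c -` S \<inter> K n) = \<omega> c -` S \<inter> chart_img c" using K(3) by blast
    ultimately show "\<omega> c -` S \<inter> space (restrict_space borel (chart_img c)) \<in> sets (restrict_space borel (chart_img c))"
      using L.V by (simp add: space_restrict_space sets_restrict_space_iff)
  qed simp
  have mn: "(\<lambda>y. \<omega> c y $ i) \<in> borel_measurable (restrict_space borel (chart_img c))" for i
    unfolding cart_eq_inner_axis using m by measurable
  have mi: "(\<lambda>y. matrix_inv (g c y) $ i $ j) \<in> borel_measurable (restrict_space borel (chart_img c))" for i j
    by (intro borel_measurable_continuous_on_restrict smooth_on_continuous[OF smooth_on_matrix_inv[OF L.V L.G_smooth L.G_det]])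
  have "(\<lambda>y. \<omega> c y \<bullet> (matrix_inv (g c y) *v \<omega> c y)) \<in> borel_measurable (restrict_space borel (chart_img c))"
    unfolding inner_vec_def matrix_vector_mult_def using mn mi by (simp add: borel_measurable_sum)
  then show "(\<lambda>y. norm2_oneform A g \<omega> (chart_inv c y)) \<in> borel_measurable (restrict_space borel (chart_img c))"
    by (rule measurable_cong[THEN iffD1, rotated])
       (simp add: space_restrict_space norm2_oneform_eq[OF of c] chart_inv_dom c chart_map_inv)
qed

end

definition transport :: "'x set \<Rightarrow> ('x \<Rightarrow> 'y) \<Rightarrow> ('y \<Rightarrow> real) \<Rightarrow> 'x \<Rightarrow> real" where
  "transport N \<phi> f p = (if p \<in> N then f (\<phi> p) else 0)"

text \<open>The pull-back extended by zero. At each point some chart of the target is picked; by the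
  transformation law of one-forms the choice does not matter, see
  \<open>transport_form_eq\<close>.\<close>

definition transport_form :: "('y, real^'n::finite) atlas \<Rightarrow> 'x set \<Rightarrow> ('x \<Rightarrow> 'y) \<Rightarrow> ('y, 'n) oneform \<Rightarrow> ('x, 'n) oneform" where
  "transport_form C N \<phi> \<omega> d y = (let p = chart_inv d y; c = chart_at C (\<phi> p) in
     if p \<in> N then transpose (jacobian (chart_map c \<circ> \<phi> \<circ> chart_inv d) y) *v \<omega> c (chart_map c (\<phi> p)) else 0)"

context isometry
begin

lemma transport_form_eq:
  assumes of: "oneform C \<omega>" and d: "d \<in> A" and c: "c \<in> C" and p: "p \<in> overlap d c"
  shows "transport_form C N \<phi> \<omega> d (chart_map d p) = transpose (jacobian (rep d c) (chart_map d p)) *v \<omega> c (chart_map c (\<phi> p))"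
proof -
  let ?c = "chart_at C (\<phi> p)" and ?y = "chart_map d p"
  have c': "?c \<in> C" "\<phi> p \<in> chart_dom ?c" using Y.chart_at by blast+
  have p': "p \<in> chart_dom d" "p \<in> N" "\<phi> p \<in> chart_dom c" using p by (auto simp: overlap_def)
  let ?T = "chart_map c \<circ> chart_inv ?c"
  have F: "rep d c'' differentiable at ?y" if "c'' \<in> C" "\<phi> p \<in> chart_dom c''" for c''
    using smooth_on_differentiable[OF rep_smooth[OF d that(1)]] that p' by (auto simp: overlap_def)
  have T: "?T differentiable at (rep d ?c ?y)"
  proof -
    have "smooth_on (chart_map ?c ` (chart_dom ?c \<inter> chart_dom c)) ?T"
      using Y.manifold c' c unfolding smooth_manifold_def by blast
    then show ?thesis using smooth_on_differentiable rep_apply[OF d p'(1), of ?c] c' p' by auto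
  qed
  have "jacobian (rep d c) ?y = jacobian ?T (rep d ?c ?y) ** jacobian (rep d ?c) ?y"
  proof (rule jacobian_chain[OF F[OF c'] T])
    show "open (chart_map d ` (overlap d c \<inter> overlap d ?c))"
      using X.chart_image_open[OF d] overlap_open[OF d c] overlap_open[OF d c'(1)] by (auto simp: overlap_def)
    show "?y \<in> chart_map d ` (overlap d c \<inter> overlap d ?c)" using p' c' by (auto simp: overlap_def)
    show "rep d c x = ?T (rep d ?c x)" if "x \<in> chart_map d ` (overlap d c \<inter> overlap d ?c)" for x
    proof -
      obtain q where q: "x = chart_map d q" "q \<in> chart_dom d" "\<phi> q \<in> chart_dom ?c" using \<open>x \<in> _\<close> by (auto simp: overlap_def)
      then show ?thesis
        using rep_apply[OF d q(2), of c] rep_apply[OF d q(2), of ?c] Y.chart_inv_map[OF c'(1) q(3)] by simp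
    qed
  qed
  moreover have "\<omega> ?c (chart_map ?c (\<phi> p)) = transpose (jacobian ?T (chart_map ?c (\<phi> p))) *v \<omega> c (chart_map c (\<phi> p))"
    using of c c' p'(3) unfolding oneform_def by blast
  ultimately have "transpose (jacobian (rep d ?c) ?y) *v \<omega> ?c (chart_map ?c (\<phi> p)) = transpose (jacobian (rep d c) ?y) *v \<omega> c (chart_map c (\<phi> p))"
    using rep_apply[OF d p'(1), of ?c] by (simp add: matrix_transpose_mul matrix_vector_mul_assoc del: transpose_matrix_vector)
  then show ?thesis
    using p' X.chart_inv_map[OF d p'(1)] unfolding transport_form_def Let_def rep_def by simp
qed

lemma transport_form_outside: "d \<in> A \<Longrightarrow> p \<in> chart_dom d \<Longrightarrow> p \<notin> N \<Longrightarrow> transport_form C N \<phi> \<omega> d (chart_map d p) = 0"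
  by (simp add: transport_form_def X.chart_inv_map)

lemma oneform_transport:
  assumes of: "oneform C \<omega>" shows "oneform A (transport_form C N \<phi> \<omega>)"
  unfolding oneform_def
proof (intro ballI)
  fix d e p assume d: "d \<in> A" and e: "e \<in> A" and p: "p \<in> chart_dom d \<inter> chart_dom e"
  let ?T = "chart_map e \<circ> chart_inv d" and ?y = "chart_map d p"
  show "transport_form C N \<phi> \<omega> d ?y = transpose (jacobian ?T ?y) *v transport_form C N \<phi> \<omega> e (chart_map e p)"
  proof (cases "p \<in> N")
    case True
    let ?c = "chart_at C (\<phi> p)"
    have c: "?c \<in> C" "\<phi> p \<in> chart_dom ?c" using Y.chart_at by blast+
    have o: "p \<in> overlap d ?c" "p \<in> overlap e ?c" using True p c by (auto simp: overlap_def)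
    have T: "smooth_on (chart_map d ` (chart_dom d \<inter> chart_dom e)) ?T"
      using X.manifold d e unfolding smooth_manifold_def by blast
    have Ty: "?T ?y = chart_map e p" using X.chart_inv_map[OF d] p by simp
    have "jacobian (rep d ?c) ?y = jacobian (rep e ?c) (?T ?y) ** jacobian ?T ?y"
    proof (rule jacobian_chain)
      show "?T differentiable at ?y" using smooth_on_differentiable[OF T] p by blast
      show "rep e ?c differentiable at (?T ?y)"
        unfolding Ty using smooth_on_differentiable[OF rep_smooth[OF e c(1)]] o by blast
      show "open (chart_map d ` (overlap d ?c \<inter> overlap e ?c))"
        using X.chart_image_open[OF d] overlap_open[OF d c(1)] overlap_open[OF e c(1)] by (auto simp: overlap_def)
      show "?y \<in> chart_map d ` (overlap d ?c \<inter> overlap e ?c)" using o by blast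
      show "rep d ?c x = rep e ?c (?T x)" if "x \<in> chart_map d ` (overlap d ?c \<inter> overlap e ?c)" for x
      proof -
        obtain q where q: "x = chart_map d q" "q \<in> chart_dom d" "q \<in> chart_dom e" using \<open>x \<in> _\<close> by (auto simp: overlap_def)
        then show ?thesis
          using rep_apply[OF d q(2), of ?c] rep_apply[OF e q(3), of ?c] X.chart_inv_map[OF d q(2)] by simp
      qed
    qed
    then show ?thesis
      unfolding transport_form_eq[OF of d c(1) o(1)] transport_form_eq[OF of e c(1) o(2)] Ty
      by (simp add: matrix_transpose_mul matrix_vector_mul_assoc del: transpose_matrix_vector)
  next
    case False
    then show ?thesis using transport_form_outside[OF d] transport_form_outside[OF e] p by simp
  qed
qed

lemma norm2_transport:
  assumes of: "oneform C \<omega>"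
  shows "norm2_oneform A g (transport_form C N \<phi> \<omega>) = transport N \<phi> (norm2_oneform C k \<omega>)"
proof
  fix p
  let ?d = "chart_at A p" and ?c = "chart_at C (\<phi> p)"
  note d = X.chart_at[of p] and c = Y.chart_at[of "\<phi> p"]
  show "norm2_oneform A g (transport_form C N \<phi> \<omega>) p = transport N \<phi> (norm2_oneform C k \<omega>) p"
  proof (cases "p \<in> N")
    case True
    then have o: "p \<in> overlap ?d ?c" using d c by (simp add: overlap_def)
    show ?thesis
      using norm2_chart[OF d(1) c(1) o transport_form_eq[OF of d(1) c(1) o]] True
      unfolding norm2_oneform_def Let_def transport_def by simp
  next
    case False
    then show ?thesis using transport_form_outside[OF d False] by (simp add: norm2_oneform_def Let_def transport_def)
  qed
qed

lemma scalar_curvature_isometry: "p \<in> N \<Longrightarrow> scalar_curvature A g p = scalar_curvature C k (\<phi> p)"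
  using scalar_curvature_chart[OF X.chart_at(1) Y.chart_at(1), of p] X.chart_at(2)[of p] Y.chart_at(2)[of "\<phi> p"]
  by (simp add: overlap_def scalar_curvature_def Let_def)

abbreviation "\<sigma> \<equiv> riemannian_measure A g"
abbreviation "\<tau> \<equiv> riemannian_measure C k"

lemma sets_measures [simp, measurable_cong]: "sets \<sigma> = sets borel" "sets \<tau> = sets borel"
  using X.riemannian_measure(1) Y.riemannian_measure(1) by auto

lemma space_measures [simp]: "space \<sigma> = UNIV" "space \<tau> = UNIV"
  using sets_eq_imp_space_eq[OF sets_measures(1)] sets_eq_imp_space_eq[OF sets_measures(2)] by auto

text \<open>Both measures are compared on the side of \<open>N\<close>: the target measure is moved
  there by \<psi>, and the two agree on subsets of each overlap of charts by
  \<open>chart_measure_eq\<close>. The overlaps form an open cover of \<open>N\<close>.\<close>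

lemma restrict_distr:
  "restrict_space \<tau> (\<phi> ` N) = distr (restrict_space \<sigma> N) (restrict_space borel (\<phi> ` N)) \<phi>"
proof (rule measure_eqI)
  show s: "sets (restrict_space \<tau> (\<phi> ` N)) = sets (distr (restrict_space \<sigma> N) (restrict_space borel (\<phi> ` N)) \<phi>)"
    by (simp add: sets_restrict_space)
  fix S assume "S \<in> sets (restrict_space \<tau> (\<phi> ` N))"
  then have S: "S \<in> sets borel" "S \<subseteq> \<phi> ` N" using img_open by (auto simp: sets_restrict_space_iff)
  have \<phi>m: "\<phi> \<in> restrict_space \<sigma> N \<rightarrow>\<^sub>M restrict_space borel (\<phi> ` N)"
  proof -
    have "\<phi> \<in> restrict_space borel N \<rightarrow>\<^sub>M restrict_space borel (\<phi> ` N)"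
      by (intro measurable_restrict_space2 borel_measurable_continuous_on_restrict cont) (auto simp: space_restrict_space)
    then show ?thesis by (simp cong: measurable_cong_sets add: sets_restrict_space_cong[OF sets_measures(1)])
  qed
  let ?M = "distr (restrict_space \<tau> (\<phi> ` N)) borel \<psi>"
  let ?R = "density \<sigma> (indicator N)"
  have \<psi>m: "\<psi> \<in> restrict_space \<tau> (\<phi> ` N) \<rightarrow>\<^sub>M borel"
  proof -
    have "\<psi> \<in> borel_measurable (restrict_space borel (\<phi> ` N))"
      using homeo by (intro borel_measurable_continuous_on_restrict) (simp add: homeomorphism_def)
    then show ?thesis by (simp cong: measurable_cong_sets add: sets_restrict_space_cong[OF sets_measures(2)])
  qed
  have \<psi>: "\<psi> -` E \<inter> \<phi> ` N = \<phi> ` E" if "E \<subseteq> N" for E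
    using homeo that unfolding homeomorphism_def by force
  have eM: "emeasure ?M E = emeasure \<tau> (\<phi> ` E)" if "E \<in> sets borel" "E \<subseteq> N" for E
    using that \<psi>m img_open by (simp add: emeasure_distr space_restrict_space \<psi> emeasure_restrict_space image_mono)
  have eR: "emeasure ?R E = emeasure \<sigma> E" if "E \<in> sets borel" "E \<subseteq> N" for E
  proof -
    have "emeasure ?R E = emeasure \<sigma> (N \<inter> E)"
      using that borel_open[OF N_open]
      by (subst emeasure_density) (auto simp flip: indicator_inter_arith intro!: borel_measurable_indicator)
    then show ?thesis using that(2) by (simp add: Int_absorb1)
  qed
  define E where "E = \<phi> -` S \<inter> N"
  have Eb: "E \<in> sets borel" "E \<subseteq> N"
  proof -
    have "\<phi> -` S \<inter> space (restrict_space \<sigma> N) \<in> sets (restrict_space \<sigma> N)"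
      using \<phi>m by (rule measurable_sets) (use S img_open in \<open>simp add: sets_restrict_space_iff\<close>)
    then show "E \<in> sets borel" "E \<subseteq> N" using N_open by (auto simp: E_def space_restrict_space sets_restrict_space_iff)
  qed
  have \<phi>E: "\<phi> ` E = S" using S(2) by (auto simp: E_def)
  have "emeasure ?M E = emeasure ?R E"
  proof (rule emeasure_eq_open_cover[where \<U> = "{overlap d c |d c. d \<in> A \<and> c \<in> C}"])
    fix U F assume "U \<in> {overlap d c |d c. d \<in> A \<and> c \<in> C}" and F: "F \<in> sets borel" "F \<subseteq> U"
    then obtain d c where dc: "d \<in> A" "c \<in> C" "U = overlap d c" by blast
    have FN: "F \<subseteq> N" "F \<subseteq> chart_dom d" "\<phi> ` F \<subseteq> chart_dom c" using F dc by (auto simp: overlap_def)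
    have \<phi>F: "\<phi> ` F \<in> sets borel" using homeomorphism_image_borel[OF homeo _ _ F(1) FN(1)] N_open img_open by auto
    show "emeasure ?M F = emeasure ?R F"
      unfolding eM[OF F(1) FN(1)] eR[OF F(1) FN(1)] X.riemannian_measure(2)[OF dc(1) F(1) FN(2)]
        Y.riemannian_measure(2)[OF dc(2) \<phi>F FN(3)]
      using chart_measure_eq[OF dc(1,2) F(1)] F dc by simp
  next
    show "E \<subseteq> \<Union>{overlap d c |d c. d \<in> A \<and> c \<in> C}"
    proof
      fix p assume "p \<in> E"
      then have "p \<in> overlap (chart_at A p) (chart_at C (\<phi> p))"
        using X.chart_at[of p] Y.chart_at[of "\<phi> p"] Eb by (auto simp: overlap_def)
      then show "p \<in> \<Union>{overlap d c |d c. d \<in> A \<and> c \<in> C}" using X.chart_at(1) Y.chart_at(1) by blast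
    qed
  qed (use Eb overlap_open in auto)
  then have "emeasure \<tau> S = emeasure \<sigma> E" using eM[OF Eb] eR[OF Eb] \<phi>E by simp
  moreover have "emeasure (restrict_space \<tau> (\<phi> ` N)) S = emeasure \<tau> S"
    using S img_open by (simp add: emeasure_restrict_space)
  moreover have "emeasure (distr (restrict_space \<sigma> N) (restrict_space borel (\<phi> ` N)) \<phi>) S = emeasure \<sigma> E"
    using \<phi>m S Eb N_open img_open
    by (subst emeasure_distr) (auto simp: sets_restrict_space_iff space_restrict_space emeasure_restrict_space E_def)
  ultimately show "emeasure (restrict_space \<tau> (\<phi> ` N)) S = emeasure (distr (restrict_space \<sigma> N) (restrict_space borel (\<phi> ` N)) \<phi>) S"
    by simp
qed

lemma transport_integral:
  fixes f :: "'y \<Rightarrow> real"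
  assumes f: "f \<in> borel_measurable borel" and supp: "\<And>q. q \<notin> \<phi> ` N \<Longrightarrow> f q = 0"
  shows "transport N \<phi> f \<in> borel_measurable borel" "integrable \<sigma> (transport N \<phi> f) \<longleftrightarrow> integrable \<tau> f"
    "(\<integral>p. transport N \<phi> f p \<partial>\<sigma>) = (\<integral>q. f q \<partial>\<tau>)"
proof -
  have \<phi>b: "\<phi> \<in> borel_measurable (restrict_space borel N)" by (intro borel_measurable_continuous_on_restrict cont)
  have e: "transport N \<phi> f = (\<lambda>p. indicator N p *\<^sub>R f (\<phi> p))" by (auto simp: transport_def)
  show "transport N \<phi> f \<in> borel_measurable borel"
    unfolding e using measurable_compose[OF \<phi>b f] N_open by (subst (asm) borel_measurable_restrict_space_iff) auto
  have \<phi>m: "\<phi> \<in> restrict_space \<sigma> N \<rightarrow>\<^sub>M restrict_space borel (\<phi> ` N)"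
  proof -
    have "\<phi> \<in> restrict_space borel N \<rightarrow>\<^sub>M restrict_space borel (\<phi> ` N)"
      by (intro measurable_restrict_space2 \<phi>b) (auto simp: space_restrict_space)
    then show ?thesis by (simp cong: measurable_cong_sets add: sets_restrict_space_cong[OF sets_measures(1)])
  qed
  have fm: "f \<in> borel_measurable (restrict_space borel (\<phi> ` N))" using f by (rule measurable_restrict_space1)
  have f2: "f = (\<lambda>q. indicator (\<phi> ` N) q *\<^sub>R f q)"
    by (rule ext) (use supp in \<open>auto simp: indicator_def\<close>)
  have "integrable \<sigma> (transport N \<phi> f) \<longleftrightarrow> integrable (restrict_space \<sigma> N) (\<lambda>p. f (\<phi> p))"
    unfolding e using N_open by (subst integrable_restrict_space) auto
  also have "\<dots> \<longleftrightarrow> integrable (restrict_space \<tau> (\<phi> ` N)) f"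
    unfolding restrict_distr by (rule integrable_distr_eq[OF \<phi>m fm, symmetric])
  also have "\<dots> \<longleftrightarrow> integrable \<tau> (\<lambda>q. indicator (\<phi> ` N) q *\<^sub>R f q)"
    using img_open by (subst integrable_restrict_space) auto
  finally show "integrable \<sigma> (transport N \<phi> f) \<longleftrightarrow> integrable \<tau> f" using f2 by simp
  have "(\<integral>p. transport N \<phi> f p \<partial>\<sigma>) = (\<integral>p. f (\<phi> p) \<partial>(restrict_space \<sigma> N))"
    unfolding e using N_open by (subst integral_restrict_space) auto
  also have "\<dots> = (\<integral>q. f q \<partial>(restrict_space \<tau> (\<phi> ` N)))"
    unfolding restrict_distr by (rule integral_distr[OF \<phi>m fm, symmetric])
  also have "\<dots> = (\<integral>q. indicator (\<phi> ` N) q *\<^sub>R f q \<partial>\<tau>)"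
    using img_open by (subst integral_restrict_space) auto
  finally show "(\<integral>p. transport N \<phi> f p \<partial>\<sigma>) = (\<integral>q. f q \<partial>\<tau>)" using f2 by simp
qed

text \<open>Extension by zero preserves weak differentiability because the support lies in a closed
  set \<open>T\<close> inside \<open>N\<close>: near a point of \<open>N\<close> the function is a
  pull-back in charts, and near a point outside \<open>N\<close> it vanishes identically, as the
  complement of \<open>T\<close> is open. Locality of weak gradients joins the two cases.\<close>

lemma transport_sobolev:
  assumes s: "sobolev_L12 C k u \<omega>"
    and T: "closed T" "T \<subseteq> N" "\<And>q. q \<notin> \<phi> ` T \<Longrightarrow> u q = 0"
      "\<And>c q. c \<in> C \<Longrightarrow> q \<in> chart_dom c \<Longrightarrow> q \<notin> \<phi> ` T \<Longrightarrow> \<omega> c (chart_map c q) = 0"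
  shows "sobolev_L12 A g (transport N \<phi> u) (transport_form C N \<phi> \<omega>)"
    "yamabe_quotient A g (transport N \<phi> u) (transport_form C N \<phi> \<omega>) = yamabe_quotient C k u \<omega>"
    "(\<integral>p. \<bar>transport N \<phi> u p\<bar> powr r \<partial>\<sigma>) = (\<integral>q. \<bar>u q\<bar> powr r \<partial>\<tau>)"
proof -
  have um: "u \<in> borel_measurable borel" and wd: "weak_differential C u \<omega>" and
    u2: "integrable \<tau> (\<lambda>q. (u q)\<^sup>2)" and w2: "integrable \<tau> (norm2_oneform C k \<omega>)"
    using s by (auto simp: sobolev_L12_def)
  have of: "oneform C \<omega>" and wg: "\<And>c. c \<in> C \<Longrightarrow> weak_gradient (chart_img c) (\<lambda>y. u (chart_inv c y)) (\<omega> c)"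
    using wd by (auto simp: weak_differential_iff)
  have nm: "norm2_oneform C k \<omega> \<in> borel_measurable borel" using Y.norm2_oneform_measurable[OF wd] .
  have sub: "\<phi> ` T \<subseteq> \<phi> ` N" using T(2) by blast
  have u0: "u q = 0" if "q \<notin> \<phi> ` N" for q using T(3) sub that by blast
  have n0: "norm2_oneform C k \<omega> q = 0" if "q \<notin> \<phi> ` N" for q
  proof -
    have "\<omega> (chart_at C q) (chart_map (chart_at C q) q) = 0" using T(4)[OF Y.chart_at, of q] sub that by blast
    then show ?thesis by (simp add: norm2_oneform_def Let_def)
  qed
  have pT: "\<phi> p \<notin> \<phi> ` T" if "p \<in> N" "p \<notin> T" for p using that inj T(2) by (auto simp: inj_on_def)
  have wA: "weak_differential A (transport N \<phi> u) (transport_form C N \<phi> \<omega>)"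
    unfolding weak_differential_iff
  proof (intro conjI ballI)
    show "oneform A (transport_form C N \<phi> \<omega>)" by (rule oneform_transport[OF of])
    fix d assume d: "d \<in> A"
    show "weak_gradient (chart_img d) (\<lambda>y. transport N \<phi> u (chart_inv d y)) (transport_form C N \<phi> \<omega> d)"
    proof (rule weak_gradient_local[OF X.chart_open(2)[OF d]])
      fix y assume "y \<in> chart_img d"
      then obtain p where p: "p \<in> chart_dom d" "y = chart_map d p" by blast
      show "\<exists>M. open M \<and> y \<in> M \<and> M \<subseteq> chart_img d \<and>
        weak_gradient M (\<lambda>y. transport N \<phi> u (chart_inv d y)) (transport_form C N \<phi> \<omega> d)"
      proof (cases "p \<in> N")
        case True
        let ?c = "chart_at C (\<phi> p)"
        have c: "?c \<in> C" "\<phi> p \<in> chart_dom ?c" using Y.chart_at by blast+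
        let ?M = "chart_map d ` overlap d ?c"
        interpret L: local_isometry ?M "g d" "chart_img ?c" "k ?c" "rep d ?c" by (rule rep_local_isometry[OF d c(1)])
        have "weak_gradient ?M (\<lambda>x. u (chart_inv ?c (rep d ?c x))) (\<lambda>x. transpose (jacobian (rep d ?c) x) *v \<omega> ?c (rep d ?c x))"
          using L.det_jacobian
          by (intro weak_gradient_compose[OF L.S.V L.T.V L.F_smooth rep_inj[OF d c(1)] _ L.FU wg[OF c(1)]]) blast
        then have "weak_gradient ?M (\<lambda>y. transport N \<phi> u (chart_inv d y)) (transport_form C N \<phi> \<omega> d)"
        proof (rule weak_gradient_cong[OF L.S.V])
          fix x assume "x \<in> ?M"
          then obtain q where q: "x = chart_map d q" "q \<in> overlap d ?c" by blast
          then have q': "q \<in> chart_dom d" "q \<in> N" "\<phi> q \<in> chart_dom ?c" by (auto simp: overlap_def)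
          have r: "rep d ?c x = chart_map ?c (\<phi> q)" using rep_apply[OF d q'(1), of ?c] q(1) by simp
          show "u (chart_inv ?c (rep d ?c x)) = transport N \<phi> u (chart_inv d x)"
            using q q' r X.chart_inv_map[OF d q'(1)] Y.chart_inv_map[OF c(1) q'(3)] by (simp add: transport_def)
          show "transpose (jacobian (rep d ?c) x) *v \<omega> ?c (rep d ?c x) = transport_form C N \<phi> \<omega> d x"
            unfolding q(1) r[unfolded q(1)] transport_form_eq[OF of d c(1) q(2)] ..
        qed
        then show ?thesis using L.S.V p True c by (intro exI[of _ ?M]) (auto simp: overlap_def)
      next
        case False
        \<comment> \<open>This neighbourhood of a point outside \<open>N\<close> avoids
          \<open>T\<close> but may still meet \<open>N\<close>; there the transported data vanish
          because \<phi> is injective and so sends points off \<open>T\<close> to points off the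
          image of \<open>T\<close>.\<close>
        let ?M = "chart_map d ` (chart_dom d - T)"
        have o: "open ?M" using X.chart_image_open[OF d, of "chart_dom d - T"] X.chart_open(1)[OF d] T(1) by (simp add: open_Diff)
        have "weak_gradient ?M (\<lambda>y. transport N \<phi> u (chart_inv d y)) (transport_form C N \<phi> \<omega> d)"
        proof (rule weak_gradient_cong[OF o weak_gradient_zero])
          fix x assume "x \<in> ?M"
          then obtain q where q: "x = chart_map d q" "q \<in> chart_dom d" "q \<notin> T" by blast
          show "0 = transport N \<phi> u (chart_inv d x)"
            using q X.chart_inv_map[OF d q(2)] T(3) pT by (simp add: transport_def)
          show "0 = transport_form C N \<phi> \<omega> d x"
          proof (cases "q \<in> N")
            case True
            let ?c = "chart_at C (\<phi> q)"
            have c: "?c \<in> C" "\<phi> q \<in> chart_dom ?c" using Y.chart_at by blast+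
            have "q \<in> overlap d ?c" using True q c by (simp add: overlap_def)
            from transport_form_eq[OF of d c(1) this] show ?thesis
              using T(4)[OF c pT[OF True q(3)]] q(1) by simp
          next
            case False then show ?thesis using transport_form_outside[OF d q(2)] q(1) by simp
          qed
        qed
        then show ?thesis using o p False T(2) by (intro exI[of _ ?M]) auto
      qed
    qed
  qed
  have t2: "(\<lambda>p. (transport N \<phi> u p)\<^sup>2) = transport N \<phi> (\<lambda>q. (u q)\<^sup>2)" by (auto simp: transport_def)
  have tr: "(\<lambda>p. \<bar>transport N \<phi> u p\<bar> powr r) = transport N \<phi> (\<lambda>q. \<bar>u q\<bar> powr r)" for r by (auto simp: transport_def)
  have i2: "integrable \<sigma> (\<lambda>p. (transport N \<phi> u p)\<^sup>2)"
    unfolding t2 using transport_integral(2)[of "\<lambda>q. (u q)\<^sup>2"] um u0 u2 by simp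
  have in2: "integrable \<sigma> (norm2_oneform A g (transport_form C N \<phi> \<omega>))"
    unfolding norm2_transport[OF of] using transport_integral(2)[OF nm n0] w2 by simp
  show "sobolev_L12 A g (transport N \<phi> u) (transport_form C N \<phi> \<omega>)"
    unfolding sobolev_L12_def using wA i2 in2 transport_integral(1)[OF um u0] by blast
  show P: "(\<integral>p. \<bar>transport N \<phi> u p\<bar> powr r \<partial>\<sigma>) = (\<integral>q. \<bar>u q\<bar> powr r \<partial>\<tau>)" for r
    unfolding tr by (rule transport_integral(3)) (use um u0 in auto)
  have Rm: "scalar_curvature C k \<in> borel_measurable borel"
    by (rule borel_measurable_continuous_onI[OF Y.scalar_curvature_continuous])
  have I: "(\<integral>p. a * norm2_oneform A g (transport_form C N \<phi> \<omega>) p + scalar_curvature A g p * (transport N \<phi> u p)\<^sup>2 \<partial>\<sigma>)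
     = (\<integral>q. a * norm2_oneform C k \<omega> q + scalar_curvature C k q * (u q)\<^sup>2 \<partial>\<tau>)" for a
  proof -
    have "(\<lambda>p. a * norm2_oneform A g (transport_form C N \<phi> \<omega>) p + scalar_curvature A g p * (transport N \<phi> u p)\<^sup>2)
      = transport N \<phi> (\<lambda>q. a * norm2_oneform C k \<omega> q + scalar_curvature C k q * (u q)\<^sup>2)"
      by (auto simp: norm2_transport[OF of] transport_def scalar_curvature_isometry)
    moreover have "(\<lambda>q. a * norm2_oneform C k \<omega> q + scalar_curvature C k q * (u q)\<^sup>2) \<in> borel_measurable borel"
      using nm Rm um by measurable
    ultimately show ?thesis using transport_integral(3) u0 n0 by simp
  qed
  show "yamabe_quotient A g (transport N \<phi> u) (transport_form C N \<phi> \<omega>) = yamabe_quotient C k u \<omega>"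
    unfolding yamabe_quotient_def Let_def P I ..
qed

end

section \<open>The cylinder\<close>

lemma sum_option: "(\<Sum>i\<in>UNIV. f i) = f None + (\<Sum>a\<in>UNIV. f (Some a))"
  for f :: "'a::finite option \<Rightarrow> 'b::comm_monoid_add"
  by (simp add: UNIV_option_conv sum.reindex)

definition cyl_tail :: "real^'m::finite option \<Rightarrow> real^'m" where
  "cyl_tail y = (\<chi> k. y $ Some k)"

definition cyl_lift :: "real^'m::finite \<Rightarrow> real \<Rightarrow> real^'m option" where
  "cyl_lift x t = (\<chi> i. case i of None \<Rightarrow> t | Some j \<Rightarrow> x $ j)"

lemma cyl_lift_nth [simp]: "cyl_lift x t $ None = t" "cyl_lift x t $ Some j = x $ j" "cyl_tail y $ j = y $ Some j"
  by (simp_all add: cyl_lift_def cyl_tail_def)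

lemma cyl_vec_eq_iff: "x = y \<longleftrightarrow> x $ None = y $ None \<and> (\<forall>j. x $ Some j = y $ Some j)" for x y :: "real^'m::finite option"
  unfolding vec_eq_iff by (metis option.exhaust)

lemma cyl_tail_lift [simp]: "cyl_tail (cyl_lift x t) = x" "cyl_lift (cyl_tail y) (y $ None) = y"
  by (subst vec_eq_iff, simp) (simp add: cyl_vec_eq_iff)

lemma bounded_linear_cyl_tail: "bounded_linear cyl_tail"
  by (intro linear_conv_bounded_linear[THEN iffD1]) (auto simp: linear_iff vec_eq_iff)

lemma bounded_linear_cyl_lift: "bounded_linear (\<lambda>x. cyl_lift x 0)"
  by (intro linear_conv_bounded_linear[THEN iffD1]) (auto simp: linear_iff cyl_vec_eq_iff)

lemma cyl_lift_split: "cyl_lift x t = cyl_lift x 0 + t *\<^sub>R axis None 1"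
  by (auto simp: cyl_vec_eq_iff axis_def)

lemma continuous_on_cyl_tail: "continuous_on S f \<Longrightarrow> continuous_on S (\<lambda>x. cyl_tail (f x))"
  using bounded_linear.continuous_on[OF bounded_linear_cyl_tail] .

lemma continuous_on_cyl_lift:
  "continuous_on S f \<Longrightarrow> continuous_on S t \<Longrightarrow> continuous_on S (\<lambda>x. cyl_lift (f x) (t x))"
proof -
  assume ft: "continuous_on S f" "continuous_on S t"
  have "continuous_on S (\<lambda>x. cyl_lift (f x) 0 + t x *\<^sub>R axis None 1)"
    by (intro continuous_intros bounded_linear.continuous_on[OF bounded_linear_cyl_lift] ft)
  then show ?thesis by (rule continuous_on_eq) (rule cyl_lift_split[symmetric])
qed

text \<open>The block diagonal matrix of \<open>M\<close> and 1. The product metric and the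
  Jacobians of cylinder transitions both have this shape, so their transformation laws reduce to
  those on Z.\<close>

definition blk :: "real^'m::finite^'m \<Rightarrow> real^'m option^'m option" where
  "blk M = (\<chi> i j. case (i, j) of (Some a, Some b) \<Rightarrow> M $ a $ b | (None, None) \<Rightarrow> 1 | _ \<Rightarrow> 0)"

lemma blk_nth [simp]: "blk M $ None $ None = 1" "blk M $ None $ Some b = 0" "blk M $ Some a $ None = 0"
  "blk M $ Some a $ Some b = M $ a $ b"
  by (simp_all add: blk_def)

lemma blk_eqI:
  fixes X Y :: "real^'m::finite option^'m option"
  assumes "X $ None $ None = Y $ None $ None" "\<And>b. X $ None $ Some b = Y $ None $ Some b"
    "\<And>b. X $ Some b $ None = Y $ Some b $ None" "\<And>a b. X $ Some a $ Some b = Y $ Some a $ Some b"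
  shows "X = Y"
proof -
  have "X $ i $ j = Y $ i $ j" for i j using assms by (cases i; cases j) auto
  then show ?thesis by (simp add: vec_eq_iff)
qed

lemma blk_mult: "blk A ** blk B = blk (A ** B)"
  by (rule blk_eqI) (simp_all add: matrix_matrix_mult_def sum_option)

lemma blk_transpose: "transpose (blk A) = blk (transpose A)"
  by (rule blk_eqI) (simp_all add: transpose_def)

lemma cylinder_chart_eq: "cylinder_chart c = (chart_dom c \<times> UNIV, \<lambda>(z, t). cyl_lift (chart_map c z) t)"
  by (simp add: cylinder_chart_def cyl_lift_def)

text \<open>The chart map on its whole type, including points outside the domain, can be read off
  from the slice t = 0; hence \<open>inv cylinder_chart\<close> in the product metric really
  recovers the chart.\<close>

lemma inj_cylinder_chart: "inj cylinder_chart"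
proof (rule injI)
  fix c d :: "('z, real^'m::finite) chart"
  assume eq: "cylinder_chart c = cylinder_chart d"
  have "chart_dom c \<times> (UNIV::real set) = chart_dom d \<times> UNIV" using arg_cong[OF eq, of fst] by (simp add: cylinder_chart_eq)
  then have 1: "chart_dom c = chart_dom d" by (metis UNIV_not_empty fst_image_times)
  have "(\<lambda>(z, t). cyl_lift (chart_map c z) t) = (\<lambda>(z, t). cyl_lift (chart_map d z) t)"
    using arg_cong[OF eq, of snd] by (simp add: cylinder_chart_eq)
  then have "cyl_lift (chart_map c z) 0 = cyl_lift (chart_map d z) 0" for z
    by (metis (mono_tags, lifting) case_prod_conv)
  then have "chart_map c z = chart_map d z" for z by (metis cyl_tail_lift(1))
  then have "chart_map c = chart_map d" by auto
  then show "c = d" using 1 by (simp add: prod_eq_iff)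
qed

lemma cylinder_metric_eq: "cylinder_metric h (cylinder_chart c) y = blk (h c (cyl_tail y))"
  unfolding cylinder_metric_def blk_def cyl_tail_def inv_f_f[OF inj_cylinder_chart] by simp

section \<open>The product manifold, its translations and its curvature\<close>

locale cylinder = riemannian B h
  for B :: "('z::{t2_space, second_countable_topology}, real^'m::finite) atlas" and h
begin

abbreviation "M \<equiv> cylinder_atlas B"
abbreviation "k \<equiv> cylinder_metric h"

lemma cyl_dom [simp]: "chart_dom (cylinder_chart c) = chart_dom c \<times> UNIV"
  and cyl_map: "chart_map (cylinder_chart c) (z, t) = cyl_lift (chart_map c z) t"
  by (simp_all add: cylinder_chart_eq)

lemma cyl_img_sub: "S \<subseteq> chart_dom c \<Longrightarrow> chart_map (cylinder_chart c) ` (S \<times> UNIV) = cyl_tail -` (chart_map c ` S)"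
proof
  show "chart_map (cylinder_chart c) ` (S \<times> UNIV) \<subseteq> cyl_tail -` (chart_map c ` S)"
    by (auto simp: cyl_map)
  show "cyl_tail -` (chart_map c ` S) \<subseteq> chart_map (cylinder_chart c) ` (S \<times> UNIV)"
  proof
    fix y assume "y \<in> cyl_tail -` (chart_map c ` S)"
    then obtain z where z: "z \<in> S" "cyl_tail y = chart_map c z" by auto
    then have "y = chart_map (cylinder_chart c) (z, y $ None)" by (metis cyl_map cyl_tail_lift(2))
    then show "y \<in> chart_map (cylinder_chart c) ` (S \<times> UNIV)" using z(1) by blast
  qed
qed

lemma cyl_img: "chart_map (cylinder_chart c) ` (chart_dom c \<times> UNIV) = cyl_tail -` (chart_img c)"
  by (rule cyl_img_sub) simp

lemma cyl_inv:
  assumes "c \<in> B" "cyl_tail y \<in> chart_img c"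
  shows "chart_inv (cylinder_chart c) y = (chart_inv c (cyl_tail y), y $ None)"
  unfolding chart_inv_def[of "cylinder_chart c"] cyl_dom
proof (rule inv_into_f_eq)
  show "inj_on (chart_map (cylinder_chart c)) (chart_dom c \<times> UNIV)"
  proof (rule inj_onI)
    fix p q assume "p \<in> chart_dom c \<times> (UNIV::real set)" "q \<in> chart_dom c \<times> (UNIV::real set)"
      "chart_map (cylinder_chart c) p = chart_map (cylinder_chart c) q"
    then show "p = q"
      by (cases p; cases q) (metis chart_inv_map[OF assms(1)] cyl_lift_nth(1) cyl_map cyl_tail_lift(1) mem_Sigma_iff)
  qed
  show "(chart_inv c (cyl_tail y), y $ None) \<in> chart_dom c \<times> UNIV" using chart_inv_dom[OF assms] by simp
  show "chart_map (cylinder_chart c) (chart_inv c (cyl_tail y), y $ None) = y"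
    by (simp add: cyl_map chart_map_inv[OF assms])
qed

lemma open_tail: "open S \<Longrightarrow> open (cyl_tail -` S)"
  by (rule open_vimage) (auto intro: continuous_on_cyl_tail)

definition "shift s = (\<lambda>(z, t). (z, t + s))" for s :: real

text \<open>Including the translation by \<open>s\<close> treats chart transitions, where
  \<open>s = 0\<close>, and the coordinate expressions of translations together. The Jacobian does
  not see the translation.\<close>

lemma cyl_transition:
  fixes s :: real
  assumes c: "c \<in> B" and d: "d \<in> B"
  defines "S \<equiv> chart_map (cylinder_chart c) ` (chart_dom (cylinder_chart c) \<inter> chart_dom (cylinder_chart d))"
  defines "F \<equiv> chart_map (cylinder_chart d) \<circ> shift s \<circ> chart_inv (cylinder_chart c)"
  shows "open S" "smooth_on S F" "y \<in> S \<Longrightarrow> jacobian F y = blk (jacobian (chart_map d \<circ> chart_inv c) (cyl_tail y))"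
proof -
  let ?T = "chart_map d \<circ> chart_inv c" and ?S0 = "chart_map c ` (chart_dom c \<inter> chart_dom d)"
  have "chart_dom (cylinder_chart c) \<inter> chart_dom (cylinder_chart d) = (chart_dom c \<inter> chart_dom d) \<times> (UNIV::real set)" by auto
  then have S: "S = cyl_tail -` ?S0" unfolding S_def using cyl_img_sub[of "chart_dom c \<inter> chart_dom d" c] by simp
  have oS0: "open ?S0" using chart_image_open[OF c] chart_open[OF c] chart_open[OF d] by auto
  show oS: "open S" unfolding S by (rule open_tail[OF oS0])
  \<comment> \<open>The transition of Z between a linear projection and a linear embedding, plus an
    affine term, so that the rules for linear pre- and postcomposition apply; \<open>+ 0\<close> is
    the offset in \<open>smooth_on_pre\<close>.\<close>
  let ?G = "\<lambda>y. cyl_lift (?T (cyl_tail y + 0)) 0 + ((y $ None) *\<^sub>R axis None 1 + s *\<^sub>R axis None 1)"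
  have FG: "?G y = F y" if "y \<in> S" for y
  proof -
    have y: "cyl_tail y \<in> chart_img c" using that S by auto
    have "F y = cyl_lift (?T (cyl_tail y)) (y $ None + s)"
      unfolding F_def o_def cyl_inv[OF c y] shift_def by (simp add: cyl_map)
    then show ?thesis by (subst (asm) cyl_lift_split) (simp add: scaleR_add_left)
  qed
  have T: "smooth_on ?S0 ?T" using manifold c d unfolding smooth_manifold_def by blast
  have G: "smooth_on S ?G"
  proof (intro smooth_on_add[OF oS] smooth_on_const)
    show "smooth_on S (\<lambda>y. cyl_lift (?T (cyl_tail y + 0)) 0)"
      by (rule smooth_on_post[OF oS bounded_linear_cyl_lift], rule smooth_on_pre[OF oS bounded_linear_cyl_tail _ T])
         (auto simp: S)
    show "smooth_on S (\<lambda>y. (y $ None) *\<^sub>R axis None 1)"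
      by (intro smooth_on_linear bounded_linear_scaleR_const bounded_linear_vec_nth)
  qed
  show "smooth_on S F" by (rule smooth_on_cong[OF oS _ G]) (rule FG)
  assume yS: "y \<in> S"
  then have ty: "cyl_tail y \<in> ?S0" using S by auto
  have dT: "?T differentiable (at (cyl_tail y))" using smooth_on_differentiable[OF T ty] .
  have G': "(?G has_derivative (\<lambda>v. cyl_lift (frechet_derivative ?T (at (cyl_tail y)) (cyl_tail v)) 0 + v $ None *\<^sub>R axis None 1)) (at y)"
  proof -
    have 1: "((\<lambda>y. ?T (cyl_tail y)) has_derivative (\<lambda>v. frechet_derivative ?T (at (cyl_tail y)) (cyl_tail v))) (at y)"
      using diff_chain_at[OF bounded_linear_imp_has_derivative[OF bounded_linear_cyl_tail] has_derivative_frechet[OF dT]]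
      by (simp add: o_def)
    have 2: "((\<lambda>y. (y $ None) *\<^sub>R axis None 1 + s *\<^sub>R axis None 1) has_derivative (\<lambda>v. v $ None *\<^sub>R axis None (1::real) + 0)) (at y)"
      by (intro has_derivative_add has_derivative_const bounded_linear_imp_has_derivative bounded_linear_scaleR_const bounded_linear_vec_nth)
    show ?thesis
      using has_derivative_add[OF bounded_linear.has_derivative[OF bounded_linear_cyl_lift 1] 2] by simp
  qed
  have "(F has_derivative (\<lambda>v. cyl_lift (frechet_derivative ?T (at (cyl_tail y)) (cyl_tail v)) 0 + v $ None *\<^sub>R axis None 1)) (at y)"
    by (rule has_derivative_transform_within_open[OF G' oS yS]) (rule FG)
  then have fd: "frechet_derivative F (at y) = (\<lambda>v. cyl_lift (frechet_derivative ?T (at (cyl_tail y)) (cyl_tail v)) 0 + v $ None *\<^sub>R axis None 1)"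
    by (rule frechet_derivative_eqI)
  have t: "cyl_tail (axis None 1) = 0" "cyl_tail (axis (Some j) 1) = axis j 1" for j :: 'm
    by (auto simp: vec_eq_iff axis_def)
  have z: "frechet_derivative ?T (at (cyl_tail y)) 0 = 0"
    using linear_0[OF linear_frechet_derivative[OF dT]] .
  show "jacobian F y = blk (jacobian ?T (cyl_tail y))"
    by (rule blk_eqI) (simp_all add: jacobian_def matrix_def fd t z, simp_all add: axis_def)
qed

lemma cyl_manifold: "smooth_manifold M"
  unfolding smooth_manifold_def
proof (intro conjI ballI)
  have "(\<Union>c\<in>B. chart_dom c) = UNIV" using manifold by (simp add: smooth_manifold_def)
  then show "(\<Union>C\<in>M. chart_dom C) = UNIV" by (auto simp: cylinder_atlas_def)
next
  fix C assume "C \<in> M"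
  then obtain c where c: "c \<in> B" "C = cylinder_chart c" by (auto simp: cylinder_atlas_def)
  show "open (chart_dom C)" using chart_open[OF c(1)] by (simp add: c(2) open_Times)
  show "open (chart_img C)" unfolding c(2) cyl_dom cyl_img using open_tail chart_open[OF c(1)] by blast
  show "homeomorphism (chart_dom C) (chart_img C) (chart_map C) (chart_inv C)"
    unfolding c(2) cyl_dom cyl_img
  proof (rule homeomorphismI)
    have h: "continuous_on (chart_dom c) (chart_map c)" "continuous_on (chart_img c) (chart_inv c)"
      using chart_homeo[OF c(1)] by (auto simp: homeomorphism_def)
    have "continuous_on (chart_dom c \<times> UNIV) (\<lambda>p::'z \<times> real. cyl_lift (chart_map c (fst p)) (snd p))"
      by (intro continuous_on_cyl_lift continuous_on_compose2[OF h(1)] continuous_intros) auto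
    then show "continuous_on (chart_dom c \<times> UNIV) (chart_map (cylinder_chart c))"
      by (simp add: cylinder_chart_eq case_prod_unfold)
    have "continuous_on (cyl_tail -` chart_img c) (\<lambda>y. (chart_inv c (cyl_tail y), y $ None))"
      by (intro continuous_on_Pair continuous_on_compose2[OF h(2)] continuous_on_cyl_tail continuous_intros) auto
    then show "continuous_on (cyl_tail -` chart_img c) (chart_inv (cylinder_chart c))"
      by (rule continuous_on_eq) (simp add: cyl_inv[OF c(1)])
    show "chart_map (cylinder_chart c) ` (chart_dom c \<times> UNIV) \<subseteq> cyl_tail -` chart_img c"
      by (auto simp: cyl_map)
    show "chart_inv (cylinder_chart c) ` (cyl_tail -` chart_img c) \<subseteq> chart_dom c \<times> UNIV"
      by (auto simp: cyl_inv[OF c(1)] chart_inv_dom[OF c(1)])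
    show "chart_inv (cylinder_chart c) (chart_map (cylinder_chart c) p) = p" if "p \<in> chart_dom c \<times> UNIV" for p
      using that by (cases p) (auto simp: cyl_map cyl_inv[OF c(1)] chart_inv_map[OF c(1)])
    show "chart_map (cylinder_chart c) (chart_inv (cylinder_chart c) y) = y" if "y \<in> cyl_tail -` chart_img c" for y
      using that by (simp add: cyl_inv[OF c(1)] cyl_map chart_map_inv[OF c(1)])
  qed
next
  fix C D assume "C \<in> M" "D \<in> M"
  then obtain c d where cd: "c \<in> B" "C = cylinder_chart c" "d \<in> B" "D = cylinder_chart d" by (auto simp: cylinder_atlas_def)
  have "shift 0 = (id :: 'z \<times> real \<Rightarrow> _)" by (auto simp: shift_def)
  then show "smooth_on (chart_map C ` (chart_dom C \<inter> chart_dom D)) (chart_map D \<circ> chart_inv C)"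
    using cyl_transition(2)[OF cd(1,3), of 0] by (simp add: cd)
qed

text \<open>By the block shape of metric and Jacobian the identity reduces to the transformation law
  of \<open>h\<close>. For \<open>s = 0\<close> it is the transformation law of the product metric;
  in general it says that translations are isometries.\<close>

lemma cyl_pullback:
  fixes s :: real
  assumes c: "c \<in> B" and d: "d \<in> B" and p: "p \<in> chart_dom c" "p \<in> chart_dom d"
  defines "F \<equiv> chart_map (cylinder_chart d) \<circ> shift s \<circ> chart_inv (cylinder_chart c)"
  shows "k (cylinder_chart c) (chart_map (cylinder_chart c) (p, t)) =
    transpose (jacobian F (chart_map (cylinder_chart c) (p, t))) ** k (cylinder_chart d) (chart_map (cylinder_chart d) (p, t + s))
      ** jacobian F (chart_map (cylinder_chart c) (p, t))"
proof -
  let ?J = "jacobian (chart_map d \<circ> chart_inv c) (chart_map c p)"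
  have "chart_map (cylinder_chart c) (p, t) \<in> chart_map (cylinder_chart c) ` (chart_dom (cylinder_chart c) \<inter> chart_dom (cylinder_chart d))"
    using p by (intro imageI) simp
  from cyl_transition(3)[OF c d this, of s] have J: "jacobian F (chart_map (cylinder_chart c) (p, t)) = blk ?J"
    by (simp add: F_def cyl_map)
  have "h c (chart_map c p) = transpose ?J ** h d (chart_map d p) ** ?J"
    using metric c d p unfolding riemannian_metric_def Let_def by blast
  then show ?thesis unfolding J cylinder_metric_eq blk_transpose blk_mult by (simp add: cyl_map)
qed

lemma cyl_metric: "riemannian_metric M k"
  unfolding riemannian_metric_def Let_def
proof (intro conjI ballI allI impI)
  fix C and i j :: "'m option" assume "C \<in> M"
  then obtain c where c: "c \<in> B" "C = cylinder_chart c" by (auto simp: cylinder_atlas_def)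
  interpret L: local_metric "chart_img c" "h c" using chart_local_metric[OF c(1)] .
  have o: "open (cyl_tail -` chart_img c)" by (rule open_tail[OF L.V])
  have sm: "smooth_on (cyl_tail -` chart_img c) (\<lambda>y. h c (cyl_tail y + 0) $ a $ b)" for a b
    by (rule smooth_on_pre[OF o bounded_linear_cyl_tail _ L.G_smooth]) auto
  show "smooth_on (chart_img C) (\<lambda>y. k C y $ i $ j)"
    unfolding c(2) cyl_dom cyl_img cylinder_metric_eq
    using sm by (cases i; cases j) (auto simp: smooth_on_const)
next
  fix C y assume "C \<in> M" and y: "y \<in> chart_img C"
  then obtain c where c: "c \<in> B" "C = cylinder_chart c" by (auto simp: cylinder_atlas_def)
  have ty: "cyl_tail y \<in> chart_img c" using y unfolding c(2) cyl_dom cyl_img by auto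
  have t: "transpose (h c (cyl_tail y)) = h c (cyl_tail y)" and pos: "\<forall>v. v \<noteq> 0 \<longrightarrow> 0 < v \<bullet> (h c (cyl_tail y) *v v)"
    using metric c ty unfolding riemannian_metric_def by blast+
  show "transpose (k C y) = k C y" unfolding c(2) cylinder_metric_eq blk_transpose t ..
  fix v :: "real^'m option" assume v: "v \<noteq> 0"
  have "v \<bullet> (k C y *v v) = (v $ None)\<^sup>2 + cyl_tail v \<bullet> (h c (cyl_tail y) *v cyl_tail v)"
    unfolding c(2) cylinder_metric_eq
    by (simp add: inner_vec_def matrix_vector_mult_def sum_option power2_eq_square)
  moreover have "0 < \<dots>"
  proof (cases "cyl_tail v = 0")
    case True
    then have "v $ Some j = 0" for j by (metis cyl_lift_nth(3) zero_index)
    then have "v $ None \<noteq> 0" using v by (auto simp: cyl_vec_eq_iff)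
    then show ?thesis using True by simp
  next
    case False then show ?thesis using pos by (simp add: add_nonneg_pos)
  qed
  ultimately show "0 < v \<bullet> (k C y *v v)" by simp
next
  fix C D p assume "C \<in> M" "D \<in> M" and p: "p \<in> chart_dom C \<inter> chart_dom D"
  then obtain c d where cd: "c \<in> B" "C = cylinder_chart c" "d \<in> B" "D = cylinder_chart d" by (auto simp: cylinder_atlas_def)
  obtain z t where zt: "p = (z, t)" by (cases p)
  have s: "shift 0 = (id :: 'z \<times> real \<Rightarrow> _)" by (auto simp: shift_def)
  show "k C (chart_map C p) = transpose (jacobian (chart_map D \<circ> chart_inv C) (chart_map C p)) ** k D (chart_map D p) **
    jacobian (chart_map D \<circ> chart_inv C) (chart_map C p)"
    using cyl_pullback[OF cd(1,3), where s = 0 and p = z and t = t] p by (simp add: cd zt s)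
qed

sublocale Cyl: riemannian M k
  by unfold_locales (rule cyl_manifold, rule cyl_metric)

lemma shift_isometry: "isometry M k M k UNIV (shift s) (shift (- s))"
proof
  have sf: "shift r = (\<lambda>p :: 'z \<times> real. (fst p, snd p + r))" for r by (auto simp: shift_def)
  have cs: "continuous_on UNIV (shift r :: 'z \<times> real \<Rightarrow> _)" for r
    unfolding sf by (intro continuous_intros)
  have r: "range (shift s :: 'z \<times> real \<Rightarrow> _) = UNIV"
  proof -
    have "p = shift s (shift (- s) p)" for p :: "'z \<times> real" by (cases p) (simp add: shift_def)
    then show ?thesis by (metis surjI)
  qed
  show "open (range (shift s :: 'z \<times> real \<Rightarrow> _))" unfolding r by simp
  show "homeomorphism UNIV (range (shift s :: 'z \<times> real \<Rightarrow> _)) (shift s) (shift (- s))"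
    unfolding r by (rule homeomorphismI) (auto simp: sf intro!: continuous_intros)
  show "smooth_map_open M M UNIV (shift s)"
    unfolding smooth_map_open_def
  proof (intro conjI ballI cs)
    fix C D assume "C \<in> M" "D \<in> M"
    then obtain c d where cd: "c \<in> B" "C = cylinder_chart c" "d \<in> B" "D = cylinder_chart d" by (auto simp: cylinder_atlas_def)
    have "{p \<in> chart_dom C \<inter> UNIV. shift s p \<in> chart_dom D} = chart_dom C \<inter> chart_dom D"
      by (auto simp: cd shift_def)
    then show "smooth_on (chart_map C ` {p \<in> chart_dom C \<inter> UNIV. shift s p \<in> chart_dom D}) (chart_map D \<circ> shift s \<circ> chart_inv C)"
      using cyl_transition(2)[OF cd(1,3)] by (simp add: cd)
  qed
  show "pullback_eq_at M k M k (shift s) p" for p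
    unfolding pullback_eq_at_def Let_def
  proof (intro ballI impI)
    fix C D assume "C \<in> M" "D \<in> M" and p: "p \<in> chart_dom C \<and> shift s p \<in> chart_dom D"
    then obtain c d where cd: "c \<in> B" "C = cylinder_chart c" "d \<in> B" "D = cylinder_chart d" by (auto simp: cylinder_atlas_def)
    obtain z t where zt: "p = (z, t)" by (cases p)
    show "transpose (jacobian (chart_map D \<circ> shift s \<circ> chart_inv C) (chart_map C p)) ** k D (chart_map D (shift s p)) **
       jacobian (chart_map D \<circ> shift s \<circ> chart_inv C) (chart_map C p) = k C (chart_map C p)"
      using cyl_pullback[OF cd(1,3), where s = s and p = z and t = t] p by (simp add: cd zt shift_def[of s])
  qed
qed simp

text \<open>Translations are isometries, so the curvature is determined by its continuous
  restriction to the compact slice t = 0.\<close>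

lemma cyl_curvature_bounded:
  assumes "compact (UNIV :: 'z set)"
  obtains K where "K \<ge> 0" "\<And>p. \<bar>scalar_curvature M k p\<bar> \<le> K"
proof -
  have "continuous_on UNIV (\<lambda>z. scalar_curvature M k (z, 0))"
    by (rule continuous_on_compose2[OF Cyl.scalar_curvature_continuous]) (auto intro!: continuous_intros)
  then have "compact (range (\<lambda>z. scalar_curvature M k (z, 0)))" using assms by (rule compact_continuous_image)
  then obtain K where K: "\<And>z. \<bar>scalar_curvature M k (z, 0)\<bar> \<le> K"
    using compact_imp_bounded bounded_iff by (metis rangeI real_norm_def)
  have "\<bar>scalar_curvature M k p\<bar> \<le> K" for p
  proof -
    obtain z t where p: "p = (z, t)" by (cases p)
    interpret I: isometry M k M k UNIV "shift (- t)" "shift (- (- t))" by (rule shift_isometry)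
    show ?thesis using I.scalar_curvature_isometry[of p] K[of z] by (simp add: p shift_def)
  qed
  then show ?thesis using that[of "max K 0"] by (metis max.cobounded2 max.coboundedI1)
qed

end

section \<open>The end as an isometric copy of a half cylinder\<close>

context riemannian
begin

text \<open>On an open set the local extensions \<open>F\<close> in \<open>smooth_map\<close> agree
  with \<open>f\<close> near each point, so smoothness in charts passes from \<open>F\<close> to
  \<open>f\<close>; neighbourhoods are shrunk until \<open>F\<close> lands in the target
  chart.\<close>

lemma smooth_map_openI:
  assumes f: "smooth_map A B S f" and P: "open P" "P \<subseteq> S" and B: "\<And>d. d \<in> B \<Longrightarrow> open (chart_dom d)"
  shows "smooth_map_open A B P f"
proof -
  have loc: "\<exists>N F. open N \<and> p \<in> N \<and> smooth_map_open A B N F \<and> (\<forall>q\<in>N \<inter> P. F q = f q)" if p: "p \<in> P" for p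
  proof -
    have "p \<in> S" using p P(2) by blast
    from f[unfolded smooth_map_def, rule_format, OF this] show ?thesis using P(2) by blast
  qed
  have cont: "continuous_on P f"
  proof (rule continuous_at_imp_continuous_on, intro ballI)
    fix p assume p: "p \<in> P"
    obtain N F where N: "open N" "p \<in> N" "smooth_map_open A B N F" "\<forall>q\<in>N \<inter> P. F q = f q" using loc[OF p] by blast
    have "continuous_on (N \<inter> P) F" using N(3) by (auto simp: smooth_map_open_def intro: continuous_on_subset)
    then have "continuous_on (N \<inter> P) f" by (rule continuous_on_eq) (use N(4) in auto)
    then show "isCont f p" using continuous_on_eq_continuous_at[of "N \<inter> P" f] N P p by auto
  qed
  moreover have "smooth_on (chart_map c ` {p \<in> chart_dom c \<inter> P. f p \<in> chart_dom d}) (chart_map d \<circ> f \<circ> chart_inv c)"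
    if c: "c \<in> A" and d: "d \<in> B" for c d
  proof (rule smooth_on_local)
    fix y assume "y \<in> chart_map c ` {p \<in> chart_dom c \<inter> P. f p \<in> chart_dom d}"
    then obtain p where p: "y = chart_map c p" "p \<in> chart_dom c" "p \<in> P" "f p \<in> chart_dom d" by blast
    obtain N F where N: "open N" "p \<in> N" "smooth_map_open A B N F" "\<forall>q\<in>N \<inter> P. F q = f q" using loc[OF p(3)] by blast
    let ?O = "{q \<in> chart_dom c \<inter> (N \<inter> P). F q \<in> chart_dom d}"
    have "continuous_on (chart_dom c \<inter> (N \<inter> P)) F" using N(3) by (auto simp: smooth_map_open_def intro: continuous_on_subset)
    moreover have "open (chart_dom c \<inter> (N \<inter> P))" using chart_open(1)[OF c] N P by blast
    ultimately have "open ((chart_dom c \<inter> (N \<inter> P)) \<inter> F -` chart_dom d)" using continuous_open_preimage B[OF d] by blast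
    moreover have "(chart_dom c \<inter> (N \<inter> P)) \<inter> F -` chart_dom d = ?O" by auto
    ultimately have "open ?O" by simp
    then have o: "open (chart_map c ` ?O)" by (intro chart_image_open[OF c]) auto
    have "smooth_on (chart_map c ` {q \<in> chart_dom c \<inter> N. F q \<in> chart_dom d}) (chart_map d \<circ> F \<circ> chart_inv c)"
      using N(3) c d unfolding smooth_map_open_def by blast
    then have s: "smooth_on (chart_map c ` ?O) (chart_map d \<circ> F \<circ> chart_inv c)" by (rule smooth_on_subset) blast
    have "smooth_on (chart_map c ` ?O) (chart_map d \<circ> f \<circ> chart_inv c)"
    proof (rule smooth_on_cong[OF o _ s])
      fix z assume "z \<in> chart_map c ` ?O"
      then obtain q where q: "z = chart_map c q" "q \<in> chart_dom c" "q \<in> N \<inter> P" by blast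
      show "(chart_map d \<circ> F \<circ> chart_inv c) z = (chart_map d \<circ> f \<circ> chart_inv c) z"
        using N(4) q chart_inv_map[OF c q(2)] by simp
    qed
    moreover have "y \<in> chart_map c ` ?O" using p N by auto
    ultimately show "\<exists>T. open T \<and> y \<in> T \<and> smooth_on T (chart_map d \<circ> f \<circ> chart_inv c)" using o by blast
  qed
  ultimately show ?thesis unfolding smooth_map_open_def by blast
qed

end

text \<open>The hypothesis pulls the metric of X back along \<Psi>, whereas transport of functions
  to X calls for the inverse map. On the open part t > 1 the Jacobians of \<Psi> and of its inverse
  are inverse matrices, so the pull-back identity can be inverted.\<close>

lemma end_isometry:
  fixes A :: "('x::{t2_space, second_countable_topology}, real^('m::finite option)) atlas"
    and B :: "('z::{t2_space, second_countable_topology}, real^'m) atlas"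
  assumes X: "riemannian A g" and Z: "riemannian B h"
    and \<Psi>: "diffeo (cylinder_atlas B) A (UNIV \<times> {0..}) (- W) \<Psi>"
    and pb: "\<forall>p\<in>UNIV \<times> {1..}. pullback_eq_at (cylinder_atlas B) (cylinder_metric h) A g \<Psi> p"
  obtains N \<phi> where "isometry A g (cylinder_atlas B) (cylinder_metric h) N \<phi> \<Psi>" "\<phi> ` N = UNIV \<times> {1<..}"
proof -
  interpret X: riemannian A g by fact
  interpret cylinder B h unfolding cylinder_def by fact
  \<comment> \<open>The strict inequality makes the set open; the intersection with the full product
    only fixes the types.\<close>
  define P where "P = (UNIV :: 'z set) \<times> {1<..} \<inter> (UNIV :: ('z \<times> real) set)"
  have P: "P = UNIV \<times> {1<..}" "open P" "P \<subseteq> UNIV \<times> {0..}" by (auto simp: P_def open_Times)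
  define \<phi> where "\<phi> = inv_into (UNIV \<times> {0..}) \<Psi>"
  have bij: "bij_betw \<Psi> (UNIV \<times> {0..}) (- W)" and s1: "smooth_map M A (UNIV \<times> {0..}) \<Psi>" and s2: "smooth_map A M (- W) \<phi>"
    using \<Psi> by (auto simp: diffeo_def \<phi>_def)
  have inj: "inj_on \<Psi> P" using bij P(3) by (auto simp: bij_betw_def intro: inj_on_subset)
  have \<phi>\<Psi>: "\<phi> (\<Psi> q) = q" if "q \<in> P" for q
    unfolding \<phi>_def using bij P(3) that by (intro inv_into_f_f) (auto simp: bij_betw_def)
  have \<Psi>s: "smooth_map_open M A P \<Psi>" by (rule Cyl.smooth_map_openI[OF s1 P(2,3) X.chart_open(1)])
  have \<Psi>c: "continuous_on P \<Psi>" using \<Psi>s by (simp add: smooth_map_open_def)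
  define N where "N = \<Psi> ` P"
  have NW: "N \<subseteq> - W" using bij P(3) by (auto simp: N_def bij_betw_def)
  \<comment> \<open>\<open>diffeo\<close> gives a bijection onto the complement of \<open>W\<close>,
    so openness of the image in X is derived in charts from invariance of domain.\<close>
  have N: "open N"
  proof (subst open_subopen, intro ballI)
    fix x assume "x \<in> N"
    then obtain q where q: "q \<in> P" "x = \<Psi> q" by (auto simp: N_def)
    let ?c = "chart_at M q" and ?d = "chart_at A x"
    note c = Cyl.chart_at[of q] and d = X.chart_at[of x]
    let ?O = "(chart_dom ?c \<inter> P) \<inter> \<Psi> -` chart_dom ?d"
    have O: "open ?O"
      using continuous_open_preimage[OF continuous_on_subset[OF \<Psi>c] _ X.chart_open(1)[OF d(1)], of "chart_dom ?c \<inter> P"]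
        Cyl.chart_open(1)[OF c(1)] P(2) by auto
    have V: "open (chart_map ?c ` ?O)" by (rule Cyl.chart_image_open[OF c(1) O]) auto
    let ?F = "chart_map ?d \<circ> \<Psi> \<circ> chart_inv ?c"
    have O_eq: "{p \<in> chart_dom ?c \<inter> P. \<Psi> p \<in> chart_dom ?d} = ?O" by auto
    have "smooth_on (chart_map ?c ` {p \<in> chart_dom ?c \<inter> P. \<Psi> p \<in> chart_dom ?d}) ?F"
      using \<Psi>s c(1) d(1) unfolding smooth_map_open_def by blast
    then have "smooth_on (chart_map ?c ` ?O) ?F" unfolding O_eq .
    then have Fc: "continuous_on (chart_map ?c ` ?O) ?F" by (rule smooth_on_continuous)
    have Fq: "?F (chart_map ?c r) = chart_map ?d (\<Psi> r)" if "r \<in> ?O" for r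
      using Cyl.chart_inv_map[OF c(1)] that by simp
    have "inj_on ?F (chart_map ?c ` ?O)"
    proof (rule inj_onI)
      fix a b assume "a \<in> chart_map ?c ` ?O" "b \<in> chart_map ?c ` ?O" and e: "?F a = ?F b"
      then obtain r r' where r: "r \<in> ?O" "r' \<in> ?O" "a = chart_map ?c r" "b = chart_map ?c r'" by blast
      have "chart_map ?d (\<Psi> r) = chart_map ?d (\<Psi> r')" using e Fq r by metis
      then have "\<Psi> r = \<Psi> r'" using X.chart_inv_map[OF d(1)] r by (metis IntD2 vimageD)
      then show "a = b" using inj r by (metis IntD1 IntD2 inj_onD)
    qed
    then have "open (?F ` chart_map ?c ` ?O)" using invariance_of_domain[OF Fc V] by blast
    moreover have "?F ` chart_map ?c ` ?O = chart_map ?d ` \<Psi> ` ?O"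
      unfolding image_image[of ?F] image_image[of "chart_map ?d"] using Fq by (rule image_cong[OF refl])
    ultimately have o: "open (chart_map ?d ` \<Psi> ` ?O)" by simp
    have hd: "homeomorphism (chart_img ?d) (chart_dom ?d) (chart_inv ?d) (chart_map ?d)"
      using X.chart_homeo[OF d(1)] homeomorphism_symD by blast
    have "openin (top_of_set (chart_dom ?d)) (chart_inv ?d ` chart_map ?d ` \<Psi> ` ?O)"
      by (rule homeomorphism_imp_open_map[OF hd]) (use o X.chart_open(2)[OF d(1)] in \<open>auto simp: openin_open_eq\<close>)
    then have "open (chart_inv ?d ` chart_map ?d ` \<Psi> ` ?O)"
      using openin_open_trans X.chart_open(1)[OF d(1)] by blast
    moreover have "chart_inv ?d ` chart_map ?d ` \<Psi> ` ?O = \<Psi> ` ?O"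
      unfolding image_image using X.chart_inv_map[OF d(1)] by (intro image_cong) auto
    ultimately have "open (\<Psi> ` ?O)" by simp
    moreover have "x \<in> \<Psi> ` ?O" using q c d by auto
    moreover have "\<Psi> ` ?O \<subseteq> N" by (auto simp: N_def)
    ultimately show "\<exists>T. open T \<and> x \<in> T \<and> T \<subseteq> N" by blast
  qed
  have \<phi>s: "smooth_map_open A M N \<phi>" by (rule X.smooth_map_openI[OF s2 N NW Cyl.chart_open(1)])
  have \<phi>N: "\<phi> ` N = P" unfolding N_def image_image using \<phi>\<Psi> by simp
  have iso: "isometry A g M k N \<phi> \<Psi>"
  proof
    show "open N" by fact
    show "open (\<phi> ` N)" unfolding \<phi>N by (rule P(2))
    show "homeomorphism N (\<phi> ` N) \<phi> \<Psi>"
      unfolding \<phi>N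
      by (rule homeomorphismI) (use \<Psi>c \<phi>s \<phi>\<Psi> \<phi>N in \<open>auto simp: smooth_map_open_def N_def\<close>)
    show "smooth_map_open A M N \<phi>" by fact
    fix p assume p: "p \<in> N"
    then obtain q where q: "q \<in> P" "p = \<Psi> q" by (auto simp: N_def)
    have \<phi>p: "\<phi> p = q" using q \<phi>\<Psi> by simp
    show "pullback_eq_at A g M k \<phi> p"
      unfolding pullback_eq_at_def Let_def
    proof (intro ballI impI)
      fix d c assume d: "d \<in> A" and c: "c \<in> M" and dom: "p \<in> chart_dom d \<and> \<phi> p \<in> chart_dom c"
      let ?J = "jacobian (chart_map c \<circ> \<phi> \<circ> chart_inv d) (chart_map d p)"
      let ?J' = "jacobian (chart_map d \<circ> \<Psi> \<circ> chart_inv c) (chart_map c q)"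
      have qc: "q \<in> chart_dom c" and pd: "p \<in> chart_dom d" using dom \<phi>p by auto
      let ?O = "{r \<in> chart_dom c \<inter> P. \<Psi> r \<in> chart_dom d}"
      have "?O = (chart_dom c \<inter> P) \<inter> \<Psi> -` chart_dom d" by auto
      then have O: "open ?O"
        using continuous_open_preimage[OF continuous_on_subset[OF \<Psi>c] _ X.chart_open(1)[OF d], of "chart_dom c \<inter> P"]
          Cyl.chart_open(1)[OF c] P(2) by auto
      have V: "open (chart_map c ` ?O)" by (rule Cyl.chart_image_open[OF c O]) auto
      have qO: "chart_map c q \<in> chart_map c ` ?O" using qc pd q by auto
      have Fq: "(chart_map d \<circ> \<Psi> \<circ> chart_inv c) (chart_map c r) = chart_map d (\<Psi> r)" if "r \<in> ?O" for r
        using Cyl.chart_inv_map[OF c] that by simp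
      have dF: "(chart_map d \<circ> \<Psi> \<circ> chart_inv c) differentiable at (chart_map c q)"
        using smooth_on_differentiable[OF _ qO] \<Psi>s c d unfolding smooth_map_open_def by blast
      have "chart_map d p \<in> chart_map d ` {r \<in> chart_dom d \<inter> N. \<phi> r \<in> chart_dom c}" using dom p by auto
      then have dG: "(chart_map c \<circ> \<phi> \<circ> chart_inv d) differentiable at (chart_map d p)"
        using smooth_on_differentiable \<phi>s c d unfolding smooth_map_open_def by blast
      have qp: "(chart_map d \<circ> \<Psi> \<circ> chart_inv c) (chart_map c q) = chart_map d p"
        using Cyl.chart_inv_map[OF c qc] q(2) by simp
      \<comment> \<open>Chain rule for \<phi> after \<Psi>, which is the identity near
        \<open>q\<close>. A one-sided inverse of a square matrix is two-sided, and this gives the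
        product in the other order.\<close>
      have "jacobian (\<lambda>x. x) (chart_map c q) = ?J ** ?J'"
      proof (rule jacobian_chain[OF dF _ V qO, unfolded qp, OF dG])
        fix x assume "x \<in> chart_map c ` ?O"
        then obtain r where r: "r \<in> ?O" "x = chart_map c r" by blast
        then show "x = (chart_map c \<circ> \<phi> \<circ> chart_inv d) ((chart_map d \<circ> \<Psi> \<circ> chart_inv c) x)"
          using Fq[OF r(1)] X.chart_inv_map[OF d] \<phi>\<Psi> by simp
      qed
      moreover have "jacobian (\<lambda>x. x) y = mat 1" for y :: "real^'m option"
        unfolding jacobian_def frechet_derivative_eqI[OF has_derivative_ident] by (simp add: matrix_id_mat_1[unfolded id_def])
      ultimately have JJ: "?J ** ?J' = mat 1" by simp
      then have JJ': "?J' ** ?J = mat 1" by (rule matrix_left_right_inverse[THEN iffD1])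
      have "q \<in> UNIV \<times> {1..}" using q(1) P(1) by auto
      then have pbq: "transpose ?J' ** g d (chart_map d p) ** ?J' = k c (chart_map c q)"
        using pb c d qc pd q(2) unfolding pullback_eq_at_def Let_def by blast
      have "transpose ?J ** k c (chart_map c q) ** ?J = transpose (?J' ** ?J) ** g d (chart_map d p) ** (?J' ** ?J)"
        unfolding pbq[symmetric] by (simp add: matrix_transpose_mul matrix_mul_assoc)
      then show "transpose ?J ** k c (chart_map c (\<phi> p)) ** ?J = g d (chart_map d p)"
        unfolding JJ' \<phi>p by (simp add: transpose_mat)
    qed
  qed
  show ?thesis using that[OF iso] \<phi>N P(1) by simp
qed

section \<open>Cutting off and truncating\<close>

text \<open>Squaring removes the corner of the positive part at 0, which is what makes the cutoff
  C1.\<close>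

lemma max_square_derivative: "((\<lambda>s::real. (max 0 s)\<^sup>2) has_real_derivative 2 * max 0 s) (at s)"
proof -
  consider "s > 0" | "s < 0" | "s = 0" by linarith
  then show ?thesis
  proof cases
    case 1
    have "((\<lambda>s. s\<^sup>2) has_real_derivative 2 * max 0 s) (at s)" using 1 by (auto intro!: derivative_eq_intros)
    then show ?thesis by (rule has_field_derivative_transform_within_open[where S = "{0<..}"]) (use 1 in auto)
  next
    case 2
    have "((\<lambda>s. 0) has_real_derivative 2 * max 0 s) (at s)" using 2 by simp
    then show ?thesis by (rule has_field_derivative_transform_within_open[where S = "{..<0}"]) (use 2 in auto)
  next
    case 3
    have "((\<lambda>h::real. ((max 0 h)\<^sup>2 - (max 0 0)\<^sup>2) / (h - 0)) \<longlongrightarrow> 0) (at 0)"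
    proof (rule Lim_null_comparison)
      show "\<forall>\<^sub>F h in at 0. norm (((max 0 h)\<^sup>2 - (max 0 0)\<^sup>2) / (h - 0)) \<le> \<bar>h\<bar>" for h :: real
        by (rule always_eventually) (auto simp: max_def power2_eq_square)
      show "((\<lambda>h::real. \<bar>h\<bar>) \<longlongrightarrow> 0) (at 0)" by (rule tendsto_rabs_zero) (rule tendsto_ident_at)
    qed
    then show ?thesis using 3 by (simp add: has_field_derivative_iff)
  qed
qed

text \<open>A C1 bump on [-T, T]; a continuous first derivative is the regularity asked by
  \<open>weak_gradient_mult\<close>. The explicit formula lets support, limits and a bound uniform
  in \<open>T\<close> be read off.\<close>

definition cutoff :: "real \<Rightarrow> real \<Rightarrow> real" where "cutoff T t = (max 0 (1 - (t / T)\<^sup>2))\<^sup>2"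
definition cutoff' :: "real \<Rightarrow> real \<Rightarrow> real" where "cutoff' T t = 2 * max 0 (1 - (t / T)\<^sup>2) * (- 2 * t / T\<^sup>2)"

lemma cutoff_derivative: "T > 0 \<Longrightarrow> (cutoff T has_real_derivative cutoff' T t) (at t)"
proof -
  assume T: "T > 0"
  have "((\<lambda>t. 1 - (t / T)\<^sup>2) has_real_derivative (- 2 * t / T\<^sup>2)) (at t)"
    using T by (auto intro!: derivative_eq_intros simp: power2_eq_square field_simps)
  from DERIV_chain2[OF max_square_derivative this] show ?thesis by (simp add: cutoff_def[abs_def] cutoff'_def)
qed

lemma cutoff_continuous: "T > 0 \<Longrightarrow> continuous_on S (cutoff T)" "T > 0 \<Longrightarrow> continuous_on S (cutoff' T)"
  unfolding cutoff_def[abs_def] cutoff'_def[abs_def] by (intro continuous_intros; simp)+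

lemma cutoff_bounds: "0 \<le> cutoff T t" "cutoff T t \<le> 1"
proof -
  have "max 0 (1 - (t / T)\<^sup>2) \<le> 1" by simp
  then show "cutoff T t \<le> 1" unfolding cutoff_def by (intro power_le_one) auto
qed (simp add: cutoff_def)

lemma cutoff_outside: "T > 0 \<Longrightarrow> \<bar>t\<bar> \<ge> T \<Longrightarrow> cutoff T t = 0 \<and> cutoff' T t = 0"
proof -
  assume "T > 0" "\<bar>t\<bar> \<ge> T"
  then have "1 \<le> \<bar>t / T\<bar>" by (simp add: abs_divide)
  then have "1 \<le> (t / T)\<^sup>2" by (metis one_le_power power2_abs)
  then have "max 0 (1 - (t / T)\<^sup>2) = 0" by simp
  then show ?thesis by (simp add: cutoff_def cutoff'_def)
qed

text \<open>The bound is uniform in \<open>T\<close>, as dominated convergence demands: on the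
  support the positive part is at most 1 and the inner derivative at most 2 in absolute
  value.\<close>

lemma cutoff'_bound: assumes "T \<ge> 1" shows "\<bar>cutoff' T t\<bar> \<le> 4"
proof (cases "\<bar>t\<bar> \<ge> T")
  case True then show ?thesis using cutoff_outside[of T t] assms by simp
next
  case False
  have a: "\<bar>max 0 (1 - (t / T)\<^sup>2)\<bar> \<le> 1" by simp
  have "T * 1 \<le> T * T" by (rule mult_left_mono) (use assms in auto)
  then have "\<bar>t\<bar> \<le> T\<^sup>2" unfolding power2_eq_square using False by linarith
  then have "\<bar>t\<bar> / T\<^sup>2 \<le> 1" using assms by simp
  then have b: "\<bar>- 2 * t / T\<^sup>2\<bar> \<le> 2" by (simp add: abs_mult abs_divide)
  have "\<bar>cutoff' T t\<bar> = 2 * (\<bar>max 0 (1 - (t / T)\<^sup>2)\<bar> * \<bar>- 2 * t / T\<^sup>2\<bar>)" by (simp only: cutoff'_def abs_mult mult.assoc abs_numeral)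
  also have "\<dots> \<le> 2 * (1 * 2)" using a b by (intro mult_left_mono mult_mono) auto
  finally show ?thesis by simp
qed

lemma cutoff_tendsto: "(\<lambda>n. cutoff (real (Suc n)) t) \<longlonglongrightarrow> 1" "(\<lambda>n. cutoff' (real (Suc n)) t) \<longlonglongrightarrow> 0"
proof -
  have i: "(\<lambda>n. inverse (real (Suc n))) \<longlonglongrightarrow> 0" by (rule LIMSEQ_inverse_real_of_nat)
  have "(\<lambda>n. (max 0 (1 - (t * inverse (real (Suc n)))\<^sup>2))\<^sup>2) \<longlonglongrightarrow> (max 0 (1 - (t * 0)\<^sup>2))\<^sup>2"
    by (intro tendsto_intros i)
  then show "(\<lambda>n. cutoff (real (Suc n)) t) \<longlonglongrightarrow> 1" by (simp add: cutoff_def divide_inverse)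
  have "(\<lambda>n. 2 * max 0 (1 - (t * inverse (real (Suc n)))\<^sup>2) * (- 2 * t * (inverse (real (Suc n)))\<^sup>2)) \<longlonglongrightarrow>
      2 * max 0 (1 - (t * 0)\<^sup>2) * (- 2 * t * 0\<^sup>2)"
    by (intro tendsto_intros i)
  then show "(\<lambda>n. cutoff' (real (Suc n)) t) \<longlonglongrightarrow> 0" by (simp add: cutoff'_def divide_inverse power_inverse)
qed

text \<open>A smooth substitute for truncation: for fixed positive \<open>a\<close> it is bounded
  with slope at most 1 in absolute value, and it tends to the identity as \<open>a\<close> tends to
  0.\<close>

definition trunc :: "real \<Rightarrow> real \<Rightarrow> real" where "trunc a s = s / (1 + a * s\<^sup>2)"
definition trunc' :: "real \<Rightarrow> real \<Rightarrow> real" where "trunc' a s = (1 - a * s\<^sup>2) / (1 + a * s\<^sup>2)\<^sup>2"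

lemma trunc_denom: "a > 0 \<Longrightarrow> 1 + a * s\<^sup>2 \<ge> (1::real)" by simp

lemma trunc_derivative: "a > 0 \<Longrightarrow> (trunc a has_real_derivative trunc' a s) (at s)"
proof -
  assume a: "a > 0"
  then have n: "1 + a * s\<^sup>2 \<noteq> 0" using trunc_denom[of a s] by linarith
  have "((\<lambda>s. s / (1 + a * s\<^sup>2)) has_real_derivative (1 * (1 + a * s\<^sup>2) - s * (a * (2 * s))) / ((1 + a * s\<^sup>2) * (1 + a * s\<^sup>2))) (at s)"
    using n by (auto intro!: derivative_eq_intros)
  moreover have "(1 * (1 + a * s\<^sup>2) - s * (a * (2 * s))) / ((1 + a * s\<^sup>2) * (1 + a * s\<^sup>2)) = trunc' a s"
    by (simp add: trunc'_def power2_eq_square algebra_simps)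
  ultimately show ?thesis by (simp add: trunc_def[abs_def])
qed

lemma trunc'_continuous: "a > 0 \<Longrightarrow> continuous_on UNIV (trunc' a)"
  unfolding trunc'_def[abs_def]
proof -
  assume a: "a > 0"
  have "1 + a * s\<^sup>2 \<noteq> 0" for s using trunc_denom[OF a, of s] by linarith
  then show "continuous_on UNIV (\<lambda>s. (1 - a * s\<^sup>2) / (1 + a * s\<^sup>2)\<^sup>2)" by (intro continuous_intros) auto
qed

lemma trunc_bounds:
  assumes a: "a > 0"
  shows "\<bar>trunc' a s\<bar> \<le> 1" "\<bar>trunc a s\<bar> \<le> \<bar>s\<bar>" "\<bar>trunc a s\<bar> \<le> 1 + 1 / a" "trunc a 0 = 0"
proof -
  let ?d = "1 + a * s\<^sup>2"
  have d: "?d \<ge> 1" using trunc_denom[OF a] .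
  have "\<bar>1 - a * s\<^sup>2\<bar> \<le> ?d" using a by (simp add: abs_le_iff)
  also have "\<dots> \<le> ?d\<^sup>2" using d by (simp add: power2_eq_square)
  finally show "\<bar>trunc' a s\<bar> \<le> 1" using d by (simp add: trunc'_def abs_divide)
  show "\<bar>trunc a s\<bar> \<le> \<bar>s\<bar>"
    using d mult_left_mono[of 1 ?d "\<bar>s\<bar>"] by (simp add: trunc_def abs_divide pos_divide_le_eq)
  \<comment> \<open>A crude estimate, comparing |s| with 1 when |s| is at most 1 and with s^2
    otherwise; all that matters is a finite bound for each \<open>a\<close>.\<close>
  have "\<bar>s\<bar> \<le> (1 + 1 / a) * ?d"
  proof (cases "\<bar>s\<bar> \<le> 1")
    case True
    have "1 \<le> 1 + 1 / a" using a by simp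
    then have s1: "\<bar>s\<bar> \<le> 1 + 1 / a" using True by linarith
    have "\<bar>s\<bar> * 1 \<le> (1 + 1 / a) * ?d" by (rule mult_mono[OF s1 d]) (use a in auto)
    then show ?thesis by simp
  next
    case False
    then have "\<bar>s\<bar> \<le> s\<^sup>2" using mult_left_mono[of 1 "\<bar>s\<bar>" "\<bar>s\<bar>"] by (simp add: power2_eq_square)
    also have "s\<^sup>2 = (1 / a) * (a * s\<^sup>2)" using a by simp
    also have "\<dots> \<le> (1 + 1 / a) * ?d" by (rule mult_mono) (use a in auto)
    finally show ?thesis .
  qed
  then show "\<bar>trunc a s\<bar> \<le> 1 + 1 / a" using d by (simp add: trunc_def abs_divide pos_divide_le_eq)
qed (simp add: trunc_def)

lemma trunc_tendsto: "(\<lambda>n. trunc (inverse (real (Suc n))) s) \<longlonglongrightarrow> s"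
proof -
  have "(\<lambda>n. s / (1 + inverse (real (Suc n)) * s\<^sup>2)) \<longlonglongrightarrow> s / (1 + 0 * s\<^sup>2)"
    by (intro tendsto_intros LIMSEQ_inverse_real_of_nat) simp
  then show ?thesis by (simp add: trunc_def)
qed

section \<open>Truncated and cut-off Sobolev functions\<close>

context riemannian
begin

text \<open>The chain rule multiplies \<omega> by a factor of absolute value at most 1, so neither
  the function nor its energy density grows.\<close>

lemma sobolev_truncate:
  assumes s: "sobolev_L12 A g u \<omega>" and a: "a > 0"
  defines "u' \<equiv> \<lambda>p. trunc a (u p)" and "\<omega>' \<equiv> \<lambda>c y. trunc' a (u (chart_inv c y)) *\<^sub>R \<omega> c y"
  shows "sobolev_L12 A g u' \<omega>'" "\<And>p. norm2_oneform A g \<omega>' p \<le> norm2_oneform A g \<omega> p"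
proof -
  let ?\<sigma> = "riemannian_measure A g"
  have sets: "sets ?\<sigma> = sets borel" using riemannian_measure(1) .
  have um: "u \<in> borel_measurable borel" and wd: "weak_differential A u \<omega>" and
    u2: "integrable ?\<sigma> (\<lambda>p. (u p)\<^sup>2)" and w2: "integrable ?\<sigma> (norm2_oneform A g \<omega>)"
    using s by (auto simp: sobolev_L12_def)
  have of: "oneform A \<omega>" and wg: "\<And>c. c \<in> A \<Longrightarrow> weak_gradient (chart_img c) (\<lambda>y. u (chart_inv c y)) (\<omega> c)"
    using wd by (auto simp: weak_differential_iff)
  have of': "oneform A \<omega>'"
    unfolding oneform_def
  proof (intro ballI)
    fix c d p assume c: "c \<in> A" and d: "d \<in> A" and p: "p \<in> chart_dom c \<inter> chart_dom d"
    have "\<omega> c (chart_map c p) = transpose (jacobian (chart_map d \<circ> chart_inv c) (chart_map c p)) *v \<omega> d (chart_map d p)"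
      using of c d p unfolding oneform_def by blast
    then show "\<omega>' c (chart_map c p) = transpose (jacobian (chart_map d \<circ> chart_inv c) (chart_map c p)) *v \<omega>' d (chart_map d p)"
      using p chart_inv_map[OF c] chart_inv_map[OF d]
      by (simp add: \<omega>'_def linear_cmul[OF matrix_vector_mul_linear] del: transpose_matrix_vector)
  qed
  have wd': "weak_differential A u' \<omega>'"
    unfolding weak_differential_iff u'_def \<omega>'_def
  proof (intro conjI ballI)
    show "oneform A (\<lambda>c y. trunc' a (u (chart_inv c y)) *\<^sub>R \<omega> c y)" using of' by (simp add: \<omega>'_def)
    show "weak_gradient (chart_img c) (\<lambda>y. trunc a (u (chart_inv c y))) (\<lambda>y. trunc' a (u (chart_inv c y)) *\<^sub>R \<omega> c y)" if c: "c \<in> A" for c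
      by (rule weak_gradient_chain[OF chart_open(2)[OF c] wg[OF c] trunc_derivative[OF a] trunc'_continuous[OF a] trunc_bounds(1)[OF a] trunc_bounds(4)[OF a]])
  qed
  show n: "norm2_oneform A g \<omega>' p \<le> norm2_oneform A g \<omega> p" for p
  proof -
    let ?c = "chart_at A p"
    note c = chart_at[of p]
    have "norm2_oneform A g \<omega>' p = (trunc' a (u p))\<^sup>2 * norm2_oneform A g \<omega> p"
      using chart_inv_map[OF c]
      by (simp add: norm2_oneform_def Let_def \<omega>'_def linear_cmul[OF matrix_vector_mul_linear] power2_eq_square)
    also have "\<dots> \<le> 1 * norm2_oneform A g \<omega> p"
      using trunc_bounds(1)[OF a, of "u p"] norm2_oneform_nonneg by (intro mult_right_mono) (auto simp: abs_square_le_1)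
    finally show ?thesis by simp
  qed
  have um': "u' \<in> borel_measurable borel"
  proof -
    have "continuous_on UNIV (trunc a)" using trunc_derivative[OF a] DERIV_isCont continuous_at_imp_continuous_on by blast
    then show ?thesis unfolding u'_def using measurable_compose[OF um borel_measurable_continuous_onI] by blast
  qed
  have "integrable ?\<sigma> (\<lambda>p. (u' p)\<^sup>2)"
  proof (rule Bochner_Integration.integrable_bound[OF u2])
    show "(\<lambda>p. (u' p)\<^sup>2) \<in> borel_measurable ?\<sigma>" using um' sets by (simp cong: measurable_cong_sets)
    show "AE p in ?\<sigma>. norm ((u' p)\<^sup>2) \<le> norm ((u p)\<^sup>2)"
      using trunc_bounds(2)[OF a] by (intro AE_I2) (simp add: u'_def abs_le_square_iff)
  qed
  moreover have "integrable ?\<sigma> (norm2_oneform A g \<omega>')"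
  proof (rule Bochner_Integration.integrable_bound[OF w2])
    show "norm2_oneform A g \<omega>' \<in> borel_measurable ?\<sigma>" using norm2_oneform_measurable[OF wd'] sets by (simp cong: measurable_cong_sets)
    show "AE p in ?\<sigma>. norm (norm2_oneform A g \<omega>' p) \<le> norm (norm2_oneform A g \<omega> p)"
      using n norm2_oneform_nonneg norm2_oneform_nonneg by (intro AE_I2) simp
  qed
  ultimately show "sobolev_L12 A g u' \<omega>'" unfolding sobolev_L12_def using um' wd' by blast
qed

end

context cylinder
begin

abbreviation "\<mu> \<equiv> riemannian_measure M k"

lemma cyl_sets [simp, measurable_cong]: "sets \<mu> = sets borel"
  by (rule Cyl.riemannian_measure(1))

text \<open>Product rule for the cutoff times \<open>u\<close>: the cutoff depends on t only, and
  the covector dt has components \<open>axis None 1\<close> in every cylinder chart.\<close>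

definition cut_form ::
    "real \<Rightarrow> ('z \<times> real \<Rightarrow> real) \<Rightarrow> ('z \<times> real, 'm option) oneform \<Rightarrow> ('z \<times> real, 'm option) oneform" where
  "cut_form T u \<omega> C y = cutoff T (y $ None) *\<^sub>R \<omega> C y + (u (chart_inv C y) * cutoff' T (y $ None)) *\<^sub>R axis None 1"

lemma cyl_chart_snd:
  assumes "C \<in> M" shows "chart_map C p $ None = snd p" "y \<in> chart_img C \<Longrightarrow> snd (chart_inv C y) = y $ None"
proof -
  obtain c where c: "c \<in> B" "C = cylinder_chart c" using assms by (auto simp: cylinder_atlas_def)
  show *: "chart_map C p $ None = snd p" for p using c by (cases p) (simp add: cyl_map)
  show "snd (chart_inv C y) = y $ None" if "y \<in> chart_img C"
    using *[of "chart_inv C y"] Cyl.chart_map_inv[OF assms that] by simp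
qed

lemma blk_axis_None: "blk X *v axis None 1 = axis None 1"
  by (subst cyl_vec_eq_iff) (simp add: matrix_vector_mult_basis column_def, simp add: axis_def)

text \<open>The Jacobian is a block matrix with entry 1 in the t direction, so dt has the same
  components in all charts. By this \<open>cut_form\<close> obeys the transformation law of
  one-forms.\<close>

lemma cyl_jacobian_axis:
  assumes "C \<in> M" "D \<in> M" "p \<in> chart_dom C \<inter> chart_dom D"
  shows "transpose (jacobian (chart_map D \<circ> chart_inv C) (chart_map C p)) *v axis None 1 = axis None 1"
proof -
  obtain c d where cd: "c \<in> B" "C = cylinder_chart c" "d \<in> B" "D = cylinder_chart d"
    using assms by (auto simp: cylinder_atlas_def)
  have s: "shift 0 = (id :: 'z \<times> real \<Rightarrow> _)" by (auto simp: shift_def)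
  have "chart_map C p \<in> chart_map (cylinder_chart c) ` (chart_dom (cylinder_chart c) \<inter> chart_dom (cylinder_chart d))"
    using assms(3) cd by blast
  from cyl_transition(3)[OF cd(1,3) this, of 0] show ?thesis
    unfolding s cd(2,4) by (simp add: blk_transpose blk_axis_None del: transpose_matrix_vector)
qed

text \<open>The covector dt has norm 1 for the product metric, so expanding the square leaves a
  cross term whose coefficient \<open>b\<close> depends neither on \<open>T\<close> nor on
  \<open>u\<close>; this yields pointwise limits as \<open>T\<close> grows. For the inequality the
  cross term is bounded by using that the quadratic form stays nonnegative when the sign of dt is
  reversed.\<close>

lemma cut_norm2:
  assumes of: "oneform M \<omega>"
  shows "\<exists>b. \<forall>T u. norm2_oneform M k (cut_form T u \<omega>) p
     = (cutoff T (snd p))\<^sup>2 * norm2_oneform M k \<omega> p + cutoff T (snd p) * (u p * cutoff' T (snd p)) * b + (u p * cutoff' T (snd p))\<^sup>2"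
    "norm2_oneform M k (cut_form T u \<omega>) p \<le> 2 * (cutoff T (snd p))\<^sup>2 * norm2_oneform M k \<omega> p + 2 * (u p * cutoff' T (snd p))\<^sup>2"
proof -
  let ?C = "chart_at M p"
  note C = Cyl.chart_at[of p]
  obtain c where c: "c \<in> B" "?C = cylinder_chart c" using C(1) by (auto simp: cylinder_atlas_def)
  let ?y = "chart_map ?C p" and ?e = "axis None 1 :: real^'m option"
  let ?Q = "matrix_inv (k ?C ?y)" and ?w = "\<omega> ?C (chart_map ?C p)"
  have y: "?y \<in> chart_img ?C" using C by blast
  interpret L: local_metric "chart_img ?C" "k ?C" using Cyl.chart_local_metric C by blast
  have "k ?C ?y *v ?e = ?e" unfolding c(2) cylinder_metric_eq by (rule blk_axis_None)
  then have "?Q *v ?e = ?Q *v (k ?C ?y *v ?e)" by simp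
  also have "\<dots> = ?e" using matrix_inv_right(2)[OF L.G_det[OF y]] by (simp add: matrix_vector_mul_assoc)
  finally have Qe: "?Q *v ?e = ?e" .
  have ee: "?e \<bullet> ?e = 1" by (simp add: inner_axis)
  let ?b = "?w \<bullet> ?e + ?e \<bullet> (?Q *v ?w)"
  have n0: "norm2_oneform M k \<omega> p = ?w \<bullet> (?Q *v ?w)" by (simp add: norm2_oneform_def Let_def)
  have ex: "(r *\<^sub>R ?w + s *\<^sub>R ?e) \<bullet> (?Q *v (r *\<^sub>R ?w + s *\<^sub>R ?e)) = r\<^sup>2 * (?w \<bullet> (?Q *v ?w)) + r * s * ?b + s\<^sup>2" for r s
    by (simp add: matrix_vector_right_distrib linear_cmul[OF matrix_vector_mul_linear] Qe inner_add_left inner_add_right ee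
        power2_eq_square algebra_simps)
  have cf: "cut_form T u \<omega> ?C ?y = cutoff T (snd p) *\<^sub>R ?w + (u p * cutoff' T (snd p)) *\<^sub>R ?e" for T u
    using Cyl.chart_inv_map[OF C] cyl_chart_snd(1)[OF C(1)] by (simp add: cut_form_def)
  have eq: "norm2_oneform M k (cut_form T u \<omega>) p
     = (cutoff T (snd p))\<^sup>2 * norm2_oneform M k \<omega> p + cutoff T (snd p) * (u p * cutoff' T (snd p)) * ?b + (u p * cutoff' T (snd p))\<^sup>2" for T u
    unfolding norm2_oneform_def[of M k "cut_form T u \<omega>"] Let_def cf ex n0 ..
  then show "\<exists>b. \<forall>T u. norm2_oneform M k (cut_form T u \<omega>) p
     = (cutoff T (snd p))\<^sup>2 * norm2_oneform M k \<omega> p + cutoff T (snd p) * (u p * cutoff' T (snd p)) * b + (u p * cutoff' T (snd p))\<^sup>2"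
    by blast
  let ?r = "cutoff T (snd p)" and ?s = "u p * cutoff' T (snd p)"
  have "0 \<le> (?r *\<^sub>R ?w + (- ?s) *\<^sub>R ?e) \<bullet> (?Q *v (?r *\<^sub>R ?w + (- ?s) *\<^sub>R ?e))"
    by (rule Cyl.metric_inverse_nonneg[OF C(1) y])
  then have "?r * ?s * ?b \<le> ?r\<^sup>2 * norm2_oneform M k \<omega> p + ?s\<^sup>2" unfolding ex n0 by simp
  then show "norm2_oneform M k (cut_form T u \<omega>) p \<le> 2 * (cutoff T (snd p))\<^sup>2 * norm2_oneform M k \<omega> p + 2 * (u p * cutoff' T (snd p))\<^sup>2"
    unfolding eq by linarith
qed

lemma sobolev_cut:
  assumes s: "sobolev_L12 M k u \<omega>" and T: "T \<ge> 1"
  defines "u' \<equiv> \<lambda>p. cutoff T (snd p) * u p"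
  shows "sobolev_L12 M k u' (cut_form T u \<omega>)"
    "norm2_oneform M k (cut_form T u \<omega>) p \<le> 2 * norm2_oneform M k \<omega> p + 32 * (u p)\<^sup>2"
    "0 \<le> norm2_oneform M k (cut_form T u \<omega>) p"
proof -
  have um: "u \<in> borel_measurable borel" and wd: "weak_differential M u \<omega>" and
    u2: "integrable \<mu> (\<lambda>p. (u p)\<^sup>2)" and w2: "integrable \<mu> (norm2_oneform M k \<omega>)"
    using s by (auto simp: sobolev_L12_def)
  have of: "oneform M \<omega>" and wg: "\<And>c. c \<in> M \<Longrightarrow> weak_gradient (chart_img c) (\<lambda>y. u (chart_inv c y)) (\<omega> c)"
    using wd by (auto simp: weak_differential_iff)
  have T0: "T > 0" using T by simp
  have of': "oneform M (cut_form T u \<omega>)"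
    unfolding oneform_def
  proof (intro ballI)
    fix C D p assume C: "C \<in> M" and D: "D \<in> M" and p: "p \<in> chart_dom C \<inter> chart_dom D"
    have "\<omega> C (chart_map C p) = transpose (jacobian (chart_map D \<circ> chart_inv C) (chart_map C p)) *v \<omega> D (chart_map D p)"
      using of C D p unfolding oneform_def by blast
    then show "cut_form T u \<omega> C (chart_map C p) = transpose (jacobian (chart_map D \<circ> chart_inv C) (chart_map C p)) *v cut_form T u \<omega> D (chart_map D p)"
      using p Cyl.chart_inv_map[OF C] Cyl.chart_inv_map[OF D] cyl_chart_snd(1)[OF C] cyl_chart_snd(1)[OF D] cyl_jacobian_axis[OF C D p]
      by (simp add: cut_form_def matrix_vector_right_distrib linear_cmul[OF matrix_vector_mul_linear] del: transpose_matrix_vector)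
  qed
  have wd': "weak_differential M u' (cut_form T u \<omega>)"
    unfolding weak_differential_iff
  proof (intro conjI ballI of')
    fix C assume C: "C \<in> M"
    have C1: "C1_on (chart_img C) (\<lambda>y. cutoff T (y $ None)) (\<lambda>y. cutoff' T (y $ None) *\<^sub>R axis None 1)"
      unfolding C1_on_def
    proof (intro conjI ballI)
      fix y :: "real^'m option"
      from diff_chain_at[OF bounded_linear_imp_has_derivative[OF bounded_linear_vec_nth] cutoff_derivative[OF T0, of "y $ None", unfolded has_field_derivative_def]]
      show "((\<lambda>y. cutoff T (y $ None)) has_derivative (\<lambda>h. (cutoff' T (y $ None) *\<^sub>R axis None 1) \<bullet> h)) (at y)"
        by (simp add: o_def inner_axis inner_commute[of "axis None 1"])
    next
      show "continuous_on (chart_img C) (\<lambda>y. cutoff' T (y $ None) *\<^sub>R axis None (1::real))"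
        by (intro continuous_intros continuous_on_compose2[OF cutoff_continuous(2)[OF T0, of UNIV]]) auto
    qed
    show "weak_gradient (chart_img C) (\<lambda>y. u' (chart_inv C y)) (cut_form T u \<omega> C)"
    proof (rule weak_gradient_cong[OF Cyl.chart_open(2)[OF C] weak_gradient_mult[OF Cyl.chart_open(2)[OF C] wg[OF C] C1]])
      fix y assume "y \<in> chart_img C"
      then show "cutoff T (y $ None) * u (chart_inv C y) = u' (chart_inv C y)"
        using cyl_chart_snd(2)[OF C] by (simp add: u'_def)
      show "cutoff T (y $ None) *\<^sub>R \<omega> C y + u (chart_inv C y) *\<^sub>R (cutoff' T (y $ None) *\<^sub>R axis None 1) = cut_form T u \<omega> C y"
        by (simp add: cut_form_def)
    qed
  qed
  have n0: "0 \<le> norm2_oneform M k (cut_form T u \<omega>) p" for p using Cyl.norm2_oneform_nonneg .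
  then show "0 \<le> norm2_oneform M k (cut_form T u \<omega>) p" .
  have n: "norm2_oneform M k (cut_form T u \<omega>) p \<le> 2 * norm2_oneform M k \<omega> p + 32 * (u p)\<^sup>2" for p
  proof -
    have "(cutoff T (snd p))\<^sup>2 \<le> 1" using cutoff_bounds[of T "snd p"] by (simp add: power_le_one)
    then have 1: "2 * (cutoff T (snd p))\<^sup>2 * norm2_oneform M k \<omega> p \<le> 2 * norm2_oneform M k \<omega> p"
      using Cyl.norm2_oneform_nonneg[of \<omega> p] mult_right_mono[of "2 * (cutoff T (snd p))\<^sup>2" 2 "norm2_oneform M k \<omega> p"] by simp
    \<comment> \<open>The coefficient 32 in the bound is twice the square of the bound 4 for
      \<open>cutoff'\<close>.\<close>
    have "(cutoff' T (snd p))\<^sup>2 \<le> 4\<^sup>2" using power_mono[OF cutoff'_bound[OF T, of "snd p"], of 2] by simp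
    then have "(u p * cutoff' T (snd p))\<^sup>2 \<le> (u p)\<^sup>2 * 16" by (simp add: power_mult_distrib mult_left_mono)
    then show ?thesis using cut_norm2(2)[OF of, of T u p] 1 by linarith
  qed
  then show "norm2_oneform M k (cut_form T u \<omega>) p \<le> 2 * norm2_oneform M k \<omega> p + 32 * (u p)\<^sup>2" .
  have um': "u' \<in> borel_measurable borel"
  proof -
    have "continuous_on UNIV (\<lambda>p :: 'z \<times> real. cutoff T (snd p))"
      by (intro continuous_on_compose2[OF cutoff_continuous(1)[OF T0, of UNIV]] continuous_intros) auto
    then have "(\<lambda>p :: 'z \<times> real. cutoff T (snd p)) \<in> borel_measurable borel" by (rule borel_measurable_continuous_onI)
    then show ?thesis unfolding u'_def using um by measurable
  qed
  have "integrable \<mu> (\<lambda>p. (u' p)\<^sup>2)"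
  proof (rule Bochner_Integration.integrable_bound[OF u2])
    show "(\<lambda>p. (u' p)\<^sup>2) \<in> borel_measurable \<mu>" using um' by simp
    show "AE p in \<mu>. norm ((u' p)\<^sup>2) \<le> norm ((u p)\<^sup>2)"
    proof (intro AE_I2)
      fix p
      have "\<bar>u' p\<bar> \<le> \<bar>u p\<bar>" using cutoff_bounds[of T "snd p"] by (simp add: u'_def abs_mult mult_left_le_one_le)
      then show "norm ((u' p)\<^sup>2) \<le> norm ((u p)\<^sup>2)" by (simp add: abs_le_square_iff)
    qed
  qed
  moreover have "integrable \<mu> (norm2_oneform M k (cut_form T u \<omega>))"
  proof (rule Bochner_Integration.integrable_bound)
    show "integrable \<mu> (\<lambda>p. 2 * norm2_oneform M k \<omega> p + 32 * (u p)\<^sup>2)" using u2 w2 by simp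
    show "norm2_oneform M k (cut_form T u \<omega>) \<in> borel_measurable \<mu>" using Cyl.norm2_oneform_measurable[OF wd'] by simp
    show "AE p in \<mu>. norm (norm2_oneform M k (cut_form T u \<omega>) p) \<le> norm (2 * norm2_oneform M k \<omega> p + 32 * (u p)\<^sup>2)"
    proof (intro AE_I2)
      fix p
      show "norm (norm2_oneform M k (cut_form T u \<omega>) p) \<le> norm (2 * norm2_oneform M k \<omega> p + 32 * (u p)\<^sup>2)"
        using n[of p] n0[of p] by simp
    qed
  qed
  ultimately show "sobolev_L12 M k u' (cut_form T u \<omega>)" unfolding sobolev_L12_def using um' wd' by blast
qed

end

section \<open>Comparison of the Yamabe constants\<close>

lemma (in isometry) transport_form_zero:
  assumes "d \<in> A" "p \<in> chart_dom d" "\<And>c. c \<in> C \<Longrightarrow> \<phi> p \<in> chart_dom c \<Longrightarrow> \<omega> c (chart_map c (\<phi> p)) = 0"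
  shows "transport_form C N \<phi> \<omega> d (chart_map d p) = 0"
  using assms(3)[OF Y.chart_at] by (simp add: transport_form_def Let_def X.chart_inv_map[OF assms(1,2)])

text \<open>A positive integral of a power of \<open>u\<close> certifies that \<open>u\<close> does
  not vanish almost everywhere, so the pair is admissible in the infimum.\<close>

lemma yamabe_cyl_le:
  assumes "sobolev_L12 A g u \<omega>" "(\<integral>p. \<bar>u p\<bar> powr r \<partial>riemannian_measure A g) > 0"
  shows "yamabe_cyl A g \<le> ereal (yamabe_quotient A g u \<omega>)"
proof -
  have "\<not> (AE p in riemannian_measure A g. u p = 0)"
  proof
    assume "AE p in riemannian_measure A g. u p = 0"
    then have "AE p in riemannian_measure A g. \<bar>u p\<bar> powr r = 0" by (rule AE_mp) simp
    then have "(\<integral>p. \<bar>u p\<bar> powr r \<partial>riemannian_measure A g) = 0" by (rule integral_eq_zero_AE)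
    then show False using assms(2) by simp
  qed
  then show ?thesis unfolding yamabe_cyl_def using assms(1) by (intro Inf_lower) blast
qed

text \<open>Two transports are composed: a translation that moves the support into t > 1, and the
  isometry of the end. Compactness of Z makes the set containing the support compact, so its image
  is closed in X as extension by zero demands.\<close>

lemma yamabe_le_compactly_supported:
  fixes A :: "('x::{t2_space, second_countable_topology}, real^('m::finite option)) atlas"
    and B :: "('z::{t2_space, second_countable_topology}, real^'m) atlas"
  assumes X: "riemannian A g" and Z: "cylinder B h" and cZ: "compact (UNIV :: 'z set)"
    and E: "isometry A g (cylinder_atlas B) (cylinder_metric h) N \<phi> \<Psi>" "\<phi> ` N = UNIV \<times> {1<..}"
    and u: "sobolev_L12 (cylinder_atlas B) (cylinder_metric h) u \<omega>"
    and supp: "\<And>z t. \<bar>t\<bar> \<ge> T \<Longrightarrow> u (z, t) = 0"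
      "\<And>C p. C \<in> cylinder_atlas B \<Longrightarrow> p \<in> chart_dom C \<Longrightarrow> \<bar>snd p\<bar> \<ge> T \<Longrightarrow> \<omega> C (chart_map C p) = 0"
    and pos: "(\<integral>p. \<bar>u p\<bar> powr r \<partial>riemannian_measure (cylinder_atlas B) (cylinder_metric h)) > 0"
  shows "yamabe_cyl A g \<le> ereal (yamabe_quotient (cylinder_atlas B) (cylinder_metric h) u \<omega>)"
proof -
  interpret cylinder B h by fact
  \<comment> \<open>The support moves from [-|T|, |T|] to [2, 2|T| + 2], which lies in t > 1. The
    absolute value keeps the interval nonempty for every real \<open>T\<close>.\<close>
  let ?s = "\<bar>T\<bar> + 2"
  interpret S: isometry M k M k UNIV "shift (- ?s)" "shift (- (- ?s))" by (rule shift_isometry)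
  interpret E: isometry A g M k N \<phi> \<Psi> by (rule E(1))
  define u1 where "u1 = transport UNIV (shift (- ?s)) u"
  define \<omega>1 where "\<omega>1 = transport_form M UNIV (shift (- ?s)) \<omega>"
  have surj: "q \<in> range (shift (- ?s))" for q :: "'z \<times> real"
    by (cases q) (auto simp: shift_def image_iff intro!: exI[of _ "fst q"] exI[of _ "snd q + ?s"])
  \<comment> \<open>The translation is onto, so the closed set in \<open>transport_sobolev\<close>
    can be the whole cylinder.\<close>
  have 1: "sobolev_L12 M k u1 \<omega>1" "yamabe_quotient M k u1 \<omega>1 = yamabe_quotient M k u \<omega>"
    "(\<integral>p. \<bar>u1 p\<bar> powr r \<partial>\<mu>) = (\<integral>p. \<bar>u p\<bar> powr r \<partial>\<mu>)"
    using S.transport_sobolev[OF u, of UNIV] surj unfolding u1_def \<omega>1_def by auto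
  define K where "K = \<Psi> ` (UNIV \<times> {?s - \<bar>T\<bar>..?s + \<bar>T\<bar>})"
  have sub: "UNIV \<times> {?s - \<bar>T\<bar>..?s + \<bar>T\<bar>} \<subseteq> \<phi> ` N" unfolding E(2) by auto
  have \<Psi>c: "continuous_on (\<phi> ` N) \<Psi>" and \<phi>\<Psi>: "\<And>q. q \<in> \<phi> ` N \<Longrightarrow> \<phi> (\<Psi> q) = q \<and> \<Psi> q \<in> N"
    using E.homeo unfolding homeomorphism_def by auto
  have Kc: "closed K"
    unfolding K_def
    by (intro compact_imp_closed compact_continuous_image continuous_on_subset[OF \<Psi>c sub] compact_Times cZ compact_Icc)
  have KN: "K \<subseteq> N" unfolding K_def using \<phi>\<Psi> sub by blast
  have \<phi>K: "\<phi> ` K = UNIV \<times> {?s - \<bar>T\<bar>..?s + \<bar>T\<bar>}"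
  proof -
    have "\<phi> (\<Psi> q) = q" if "q \<in> UNIV \<times> {?s - \<bar>T\<bar>..?s + \<bar>T\<bar>}" for q using \<phi>\<Psi> sub that by blast
    then show ?thesis unfolding K_def image_image by (simp only: image_ident cong: image_cong)
  qed
  have out: "\<bar>snd (shift (- ?s) q)\<bar> \<ge> T" if "q \<notin> \<phi> ` K" for q :: "'z \<times> real"
  proof -
    obtain z t where q: "q = (z, t)" by (cases q)
    show ?thesis using that unfolding \<phi>K by (auto simp: q shift_def)
  qed
  have u10: "u1 q = 0" if "q \<notin> \<phi> ` K" for q
    using supp(1)[of "snd (shift (- ?s) q)" "fst (shift (- ?s) q)"] out[OF that] by (simp add: u1_def transport_def)
  have \<omega>10: "\<omega>1 C (chart_map C q) = 0" if "C \<in> M" "q \<in> chart_dom C" "q \<notin> \<phi> ` K" for C q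
    unfolding \<omega>1_def by (rule S.transport_form_zero[OF that(1,2)]) (rule supp(2)[OF _ _ out[OF that(3)]])
  note t = E.transport_sobolev[OF 1(1) Kc KN u10 \<omega>10]
  have "yamabe_cyl A g \<le> ereal (yamabe_quotient A g (transport N \<phi> u1) (transport_form M N \<phi> \<omega>1))"
    by (rule yamabe_cyl_le[where r = r]) (use t 1(3) pos in auto)
  then show ?thesis using t(2) 1(2) by simp
qed

section \<open>Removing the cutoff\<close>

context cylinder
begin

lemma cyl_numerator_integrable:
  assumes s: "sobolev_L12 M k u \<omega>" and K: "\<And>p. \<bar>scalar_curvature M k p\<bar> \<le> K"
  shows "integrable \<mu> (\<lambda>p. scalar_curvature M k p * (u p)\<^sup>2)"
proof (rule Bochner_Integration.integrable_bound)
  have [measurable]: "u \<in> borel_measurable borel" and i: "integrable \<mu> (\<lambda>p. (u p)\<^sup>2)" using s by (auto simp: sobolev_L12_def)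
  show "integrable \<mu> (\<lambda>p. K * (u p)\<^sup>2)" using i by simp
  have [measurable]: "scalar_curvature M k \<in> borel_measurable borel"
    by (rule borel_measurable_continuous_onI[OF Cyl.scalar_curvature_continuous])
  show "(\<lambda>p. scalar_curvature M k p * (u p)\<^sup>2) \<in> borel_measurable \<mu>" by simp
  show "AE p in \<mu>. norm (scalar_curvature M k p * (u p)\<^sup>2) \<le> norm (K * (u p)\<^sup>2)"
  proof (intro AE_I2)
    fix p
    have "\<bar>scalar_curvature M k p\<bar> * (u p)\<^sup>2 \<le> \<bar>K\<bar> * (u p)\<^sup>2"
      using K[of p] by (intro mult_right_mono) auto
    then show "norm (scalar_curvature M k p * (u p)\<^sup>2) \<le> norm (K * (u p)\<^sup>2)" by (simp add: abs_mult)
  qed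
qed

text \<open>Dominated convergence in numerator and denominator: the cutoffs are at most 1, their
  derivatives are uniformly bounded and tend to 0, and the scalar curvature is bounded. The limiting
  denominator is positive, so the quotients converge as well.\<close>

lemma quotient_cutoff_tendsto:
  assumes cZ: "compact (UNIV :: 'z set)" and n: "3 \<le> CARD('m option)"
    and u: "sobolev_L12 M k u \<omega>"
  defines "r \<equiv> 2 * real CARD('m option) / (real CARD('m option) - 2)"
  defines "un \<equiv> \<lambda>i p. cutoff (real (Suc i)) (snd p) * u p" and "\<omega>n \<equiv> \<lambda>i. cut_form (real (Suc i)) u \<omega>"
  assumes ir: "integrable \<mu> (\<lambda>p. \<bar>u p\<bar> powr r)" and pos: "(\<integral>p. \<bar>u p\<bar> powr r \<partial>\<mu>) > 0"
  shows "(\<lambda>i. \<integral>p. \<bar>un i p\<bar> powr r \<partial>\<mu>) \<longlonglongrightarrow> (\<integral>p. \<bar>u p\<bar> powr r \<partial>\<mu>)"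
    "(\<lambda>i. yamabe_quotient M k (un i) (\<omega>n i)) \<longlonglongrightarrow> yamabe_quotient M k u \<omega>"
proof -
  let ?n = "real CARD('m option)"
  have n2: "?n - 2 > 0" "?n \<ge> 3" using n by auto
  define \<alpha> where "\<alpha> = 4 * (?n - 1) / (?n - 2)"
  have \<alpha>: "\<alpha> \<ge> 0" using n2 by (simp add: \<alpha>_def)
  have r0: "r > 0" using n2 by (simp add: r_def)
  obtain K where K: "K \<ge> 0" "\<And>p. \<bar>scalar_curvature M k p\<bar> \<le> K" using cyl_curvature_bounded[OF cZ] by blast
  have [measurable]: "u \<in> borel_measurable borel" and u2: "integrable \<mu> (\<lambda>p. (u p)\<^sup>2)"
    and w2: "integrable \<mu> (norm2_oneform M k \<omega>)" and wd: "weak_differential M u \<omega>" using u by (auto simp: sobolev_L12_def)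
  have of: "oneform M \<omega>" using wd by (simp add: weak_differential_iff)
  have [measurable]: "norm2_oneform M k \<omega> \<in> borel_measurable borel" using Cyl.norm2_oneform_measurable[OF wd] .
  have sn: "sobolev_L12 M k (un i) (\<omega>n i)" for i
    unfolding un_def \<omega>n_def by (rule sobolev_cut[OF u]) simp
  have [measurable]: "un i \<in> borel_measurable borel" for i using sn[of i] by (auto simp: sobolev_L12_def)
  have [measurable]: "norm2_oneform M k (\<omega>n i) \<in> borel_measurable borel" for i
    using Cyl.norm2_oneform_measurable sn[of i] by (auto simp: sobolev_L12_def)
  have [measurable]: "scalar_curvature M k \<in> borel_measurable borel"
    by (rule borel_measurable_continuous_onI[OF Cyl.scalar_curvature_continuous])
  have ub: "\<bar>un i p\<bar> \<le> \<bar>u p\<bar>" for i p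
    using cutoff_bounds[of "real (Suc i)" "snd p"] by (simp add: un_def abs_mult mult_left_le_one_le)
  have ul: "(\<lambda>i. un i p) \<longlonglongrightarrow> u p" for p
    using tendsto_mult_right[OF cutoff_tendsto(1)[of "snd p"], of "u p"] by (simp add: un_def)
  have nl: "(\<lambda>i. norm2_oneform M k (\<omega>n i) p) \<longlonglongrightarrow> norm2_oneform M k \<omega> p" for p
  proof -
    obtain b where b: "\<And>T u. norm2_oneform M k (cut_form T u \<omega>) p = (cutoff T (snd p))\<^sup>2 * norm2_oneform M k \<omega> p
       + cutoff T (snd p) * (u p * cutoff' T (snd p)) * b + (u p * cutoff' T (snd p))\<^sup>2"
      using cut_norm2(1)[OF of, of p] by blast
    have "(\<lambda>i. norm2_oneform M k (\<omega>n i) p) \<longlonglongrightarrow> 1\<^sup>2 * norm2_oneform M k \<omega> p + 1 * (u p * 0) * b + (u p * 0)\<^sup>2"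
      unfolding \<omega>n_def b by (intro tendsto_intros cutoff_tendsto)
    then show ?thesis by simp
  qed
  show D: "(\<lambda>i. \<integral>p. \<bar>un i p\<bar> powr r \<partial>\<mu>) \<longlonglongrightarrow> (\<integral>p. \<bar>u p\<bar> powr r \<partial>\<mu>)"
  proof (rule integral_dominated_convergence[OF _ _ ir])
    show "AE p in \<mu>. (\<lambda>i. \<bar>un i p\<bar> powr r) \<longlonglongrightarrow> \<bar>u p\<bar> powr r"
      using r0 ul by (intro AE_I2 tendsto_powr' tendsto_rabs tendsto_const) auto
    show "AE p in \<mu>. norm (\<bar>un i p\<bar> powr r) \<le> \<bar>u p\<bar> powr r" for i
      using ub r0 by (intro AE_I2) (simp add: powr_mono2)
  qed simp_all
  have N: "(\<lambda>i. \<integral>p. \<alpha> * norm2_oneform M k (\<omega>n i) p + scalar_curvature M k p * (un i p)\<^sup>2 \<partial>\<mu>) \<longlonglongrightarrow>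
     (\<integral>p. \<alpha> * norm2_oneform M k \<omega> p + scalar_curvature M k p * (u p)\<^sup>2 \<partial>\<mu>)"
  \<comment> \<open>The energy densities are bounded uniformly in the cutoff by
    \<open>sobolev_cut\<close>, and the curvature by \<open>K\<close>.\<close>
  proof (rule integral_dominated_convergence[where w = "\<lambda>p. \<alpha> * (2 * norm2_oneform M k \<omega> p + 32 * (u p)\<^sup>2) + K * (u p)\<^sup>2"])
    show "integrable \<mu> (\<lambda>p. \<alpha> * (2 * norm2_oneform M k \<omega> p + 32 * (u p)\<^sup>2) + K * (u p)\<^sup>2)"
      using u2 w2 by simp
    show "AE p in \<mu>. (\<lambda>i. \<alpha> * norm2_oneform M k (\<omega>n i) p + scalar_curvature M k p * (un i p)\<^sup>2) \<longlonglongrightarrow>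
        \<alpha> * norm2_oneform M k \<omega> p + scalar_curvature M k p * (u p)\<^sup>2"
      by (intro AE_I2 tendsto_intros nl ul)
    show "AE p in \<mu>. norm (\<alpha> * norm2_oneform M k (\<omega>n i) p + scalar_curvature M k p * (un i p)\<^sup>2)
        \<le> \<alpha> * (2 * norm2_oneform M k \<omega> p + 32 * (u p)\<^sup>2) + K * (u p)\<^sup>2" for i
    proof (intro AE_I2)
      fix p
      have a: "0 \<le> norm2_oneform M k (\<omega>n i) p" "norm2_oneform M k (\<omega>n i) p \<le> 2 * norm2_oneform M k \<omega> p + 32 * (u p)\<^sup>2"
        unfolding \<omega>n_def by (rule sobolev_cut[OF u], simp)+
      have b: "\<bar>scalar_curvature M k p * (un i p)\<^sup>2\<bar> \<le> K * (u p)\<^sup>2"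
        unfolding abs_mult using K ub[of i p] by (intro mult_mono) (auto simp: abs_le_square_iff)
      have "\<alpha> * norm2_oneform M k (\<omega>n i) p \<le> \<alpha> * (2 * norm2_oneform M k \<omega> p + 32 * (u p)\<^sup>2)"
        using a(2) \<alpha> by (rule mult_left_mono)
      moreover have "0 \<le> \<alpha> * norm2_oneform M k (\<omega>n i) p" using a(1) \<alpha> by simp
      ultimately show "norm (\<alpha> * norm2_oneform M k (\<omega>n i) p + scalar_curvature M k p * (un i p)\<^sup>2)
        \<le> \<alpha> * (2 * norm2_oneform M k \<omega> p + 32 * (u p)\<^sup>2) + K * (u p)\<^sup>2"
        using b unfolding real_norm_def by linarith
    qed
  qed simp_all
  have "(\<lambda>i. (\<integral>p. \<bar>un i p\<bar> powr r \<partial>\<mu>) powr ((?n - 2) / ?n)) \<longlonglongrightarrow> (\<integral>p. \<bar>u p\<bar> powr r \<partial>\<mu>) powr ((?n - 2) / ?n)"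
    using pos by (intro tendsto_powr D tendsto_const) auto
  then show "(\<lambda>i. yamabe_quotient M k (un i) (\<omega>n i)) \<longlonglongrightarrow> yamabe_quotient M k u \<omega>"
    unfolding yamabe_quotient_def Let_def r_def[symmetric] \<alpha>_def[symmetric]
    using pos by (intro tendsto_divide N) auto
qed

end

text \<open>The cut-off competitors have support bounded in t, so their quotients bound
  \<open>yamabe_cyl A g\<close> from above, and so does the limit of these quotients.\<close>

lemma yamabe_le_integrable:
  fixes A :: "('x::{t2_space, second_countable_topology}, real^('m::finite option)) atlas"
    and B :: "('z::{t2_space, second_countable_topology}, real^'m) atlas"
  assumes X: "riemannian A g" and Z: "cylinder B h" and cZ: "compact (UNIV :: 'z set)"
    and n: "3 \<le> CARD('m option)"
    and E: "isometry A g (cylinder_atlas B) (cylinder_metric h) N \<phi> \<Psi>" "\<phi> ` N = UNIV \<times> {1<..}"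
    and u: "sobolev_L12 (cylinder_atlas B) (cylinder_metric h) u \<omega>"
  defines "r \<equiv> 2 * real CARD('m option) / (real CARD('m option) - 2)"
  assumes ir: "integrable (riemannian_measure (cylinder_atlas B) (cylinder_metric h)) (\<lambda>p. \<bar>u p\<bar> powr r)"
    and pos: "(\<integral>p. \<bar>u p\<bar> powr r \<partial>riemannian_measure (cylinder_atlas B) (cylinder_metric h)) > 0"
  shows "yamabe_cyl A g \<le> ereal (yamabe_quotient (cylinder_atlas B) (cylinder_metric h) u \<omega>)"
proof -
  interpret cylinder B h by fact
  let ?un = "\<lambda>i p. cutoff (real (Suc i)) (snd p) * u p" and ?\<omega>n = "\<lambda>i. cut_form (real (Suc i)) u \<omega>"
  note lim = quotient_cutoff_tendsto[OF cZ n u, folded r_def, OF ir pos]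
  have "\<forall>\<^sub>F i in sequentially. yamabe_cyl A g \<le> ereal (yamabe_quotient M k (?un i) (?\<omega>n i))"
    \<comment> \<open>A function cut off too early may vanish; for large \<open>i\<close> its
      denominator is positive because the limit is, which makes it admissible.\<close>
    using order_tendstoD(1)[OF lim(1) pos]
  proof eventually_elim
    case (elim i)
    show ?case
    proof (rule yamabe_le_compactly_supported[OF X Z cZ E, where T = "real (Suc i)" and r = r])
      show "sobolev_L12 M k (?un i) (?\<omega>n i)" by (rule sobolev_cut[OF u]) simp
      show "cutoff (real (Suc i)) (snd (z, t)) * u (z, t) = 0" if "real (Suc i) \<le> \<bar>t\<bar>" for z t
        using cutoff_outside[OF _ that] by simp
      show "?\<omega>n i C (chart_map C p) = 0" if "C \<in> M" "p \<in> chart_dom C" "real (Suc i) \<le> \<bar>snd p\<bar>" for C p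
        using cutoff_outside[OF _ that(3)] cyl_chart_snd(1)[OF that(1), of p] by (simp add: cut_form_def)
    qed (rule elim)
  qed
  moreover have "(\<lambda>i. ereal (yamabe_quotient M k (?un i) (?\<omega>n i))) \<longlonglongrightarrow> ereal (yamabe_quotient M k u \<omega>)"
    by (rule tendsto_ereal[OF lim(2)])
  ultimately show ?thesis by (intro tendsto_lowerbound) auto
qed

text \<open>If the denominator diverges, the quotient takes the junk value \<open>0\<close>; truncations of \<open>u\<close> have
  bounded energy and denominators tending to infinity. This replaces the Sobolev embedding.\<close>

lemma yamabe_nonpos_not_integrable:
  fixes A :: "('x::{t2_space, second_countable_topology}, real^('m::finite option)) atlas"
    and B :: "('z::{t2_space, second_countable_topology}, real^'m) atlas"
  assumes X: "riemannian A g" and Z: "cylinder B h" and cZ: "compact (UNIV :: 'z set)"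
    and n: "3 \<le> CARD('m option)"
    and E: "isometry A g (cylinder_atlas B) (cylinder_metric h) N \<phi> \<Psi>" "\<phi> ` N = UNIV \<times> {1<..}"
    and u: "sobolev_L12 (cylinder_atlas B) (cylinder_metric h) u \<omega>"
  defines "r \<equiv> 2 * real CARD('m option) / (real CARD('m option) - 2)"
  assumes nir: "\<not> integrable (riemannian_measure (cylinder_atlas B) (cylinder_metric h)) (\<lambda>p. \<bar>u p\<bar> powr r)"
  shows "yamabe_cyl A g \<le> 0"
proof -
  interpret cylinder B h by fact
  let ?n = "real CARD('m option)"
  have n2: "?n - 2 > 0" "?n \<ge> 3" using n by auto
  define \<alpha> where "\<alpha> = 4 * (?n - 1) / (?n - 2)"
  define \<theta> where "\<theta> = (?n - 2) / ?n"
  have \<alpha>: "\<alpha> \<ge> 0" and \<theta>: "\<theta> > 0" using n2 by (simp_all add: \<alpha>_def \<theta>_def)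
  have r2: "r - 2 > 0" using n2 by (simp add: r_def field_simps)
  obtain K where K: "K \<ge> 0" "\<And>p. \<bar>scalar_curvature M k p\<bar> \<le> K" using cyl_curvature_bounded[OF cZ] by blast
  have [measurable]: "u \<in> borel_measurable borel" and u2: "integrable \<mu> (\<lambda>p. (u p)\<^sup>2)"
    and w2: "integrable \<mu> (norm2_oneform M k \<omega>)" and wd: "weak_differential M u \<omega>" using u by (auto simp: sobolev_L12_def)
  have of: "oneform M \<omega>" using wd by (simp add: weak_differential_iff)
  \<comment> \<open>Truncation parameters tending to 0, so that \<open>v i\<close> tends to
    \<open>u\<close> pointwise.\<close>
  define a where "a i = inverse (real (Suc i))" for i
  have a: "a i > 0" for i by (simp add: a_def)
  define v where "v i p = trunc (a i) (u p)" for i p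
  define \<eta> where "\<eta> i = (\<lambda>C y. trunc' (a i) (u (chart_inv C y)) *\<^sub>R \<omega> C y)" for i
  have sv: "sobolev_L12 M k (v i) (\<eta> i)" and nv: "norm2_oneform M k (\<eta> i) p \<le> norm2_oneform M k \<omega> p" for i p
    using Cyl.sobolev_truncate[OF u a, of i] unfolding v_def[abs_def] \<eta>_def by auto
  have [measurable]: "v i \<in> borel_measurable borel" for i using sv[of i] by (auto simp: sobolev_L12_def)
  have vb: "\<bar>v i p\<bar> \<le> \<bar>u p\<bar>" "\<bar>v i p\<bar> \<le> 1 + 1 / a i" for i p unfolding v_def using trunc_bounds[OF a] by auto
  have iv: "integrable \<mu> (\<lambda>p. \<bar>v i p\<bar> powr r)" for i
  proof (rule Bochner_Integration.integrable_bound)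
    show "integrable \<mu> (\<lambda>p. (1 + 1 / a i) powr (r - 2) * (u p)\<^sup>2)" using u2 by simp
    show "AE p in \<mu>. norm (\<bar>v i p\<bar> powr r) \<le> norm ((1 + 1 / a i) powr (r - 2) * (u p)\<^sup>2)"
    proof (intro AE_I2)
      fix p
      \<comment> \<open>Two of the \<open>r\<close> powers are kept for square integrability; the
        remaining \<open>r - 2\<close> are absorbed by the bound on \<open>trunc\<close>, which is
        finite for each \<open>i\<close>.\<close>
      have "\<bar>v i p\<bar> powr r = \<bar>v i p\<bar> powr (r - 2) * (v i p)\<^sup>2"
      proof (cases "v i p = 0")
        case False
        then have "\<bar>v i p\<bar> powr r = \<bar>v i p\<bar> powr (r - 2) * \<bar>v i p\<bar> powr 2" using powr_add[of "\<bar>v i p\<bar>" "r - 2" 2] by simp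
        moreover have "\<bar>v i p\<bar> powr 2 = \<bar>v i p\<bar>\<^sup>2" using False by (intro powr_numeral) simp
        ultimately show ?thesis by simp
      qed simp
      also have "\<dots> \<le> (1 + 1 / a i) powr (r - 2) * (u p)\<^sup>2"
        using vb[of i p] r2 by (intro mult_mono powr_mono2) (auto simp: abs_le_square_iff)
      finally show "norm (\<bar>v i p\<bar> powr r) \<le> norm ((1 + 1 / a i) powr (r - 2) * (u p)\<^sup>2)" by simp
    qed
  qed simp
  define D where "D i = (\<integral>p. \<bar>v i p\<bar> powr r \<partial>\<mu>)" for i
  \<comment> \<open>Fatou: if the denominators stayed bounded along the sequence, the power
    \<open>r\<close> of the absolute value of \<open>u\<close> would be integrable.\<close>
  have unbounded: "\<exists>i. D i > b" if b: "b > 0" for b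
  proof (rule ccontr)
    assume "\<not> (\<exists>i. D i > b)"
    then have Db: "D i \<le> b" for i by (simp add: not_less)
    have "(\<integral>\<^sup>+p. ennreal (\<bar>u p\<bar> powr r) \<partial>\<mu>) = (\<integral>\<^sup>+p. liminf (\<lambda>i. ennreal (\<bar>v i p\<bar> powr r)) \<partial>\<mu>)"
    proof (intro nn_integral_cong)
      fix p
      have "(\<lambda>i. ennreal (\<bar>v i p\<bar> powr r)) \<longlonglongrightarrow> ennreal (\<bar>u p\<bar> powr r)"
        unfolding v_def a_def using r2 by (intro tendsto_ennrealI tendsto_powr' tendsto_rabs trunc_tendsto tendsto_const) auto
      then show "ennreal (\<bar>u p\<bar> powr r) = liminf (\<lambda>i. ennreal (\<bar>v i p\<bar> powr r))"
        by (rule lim_imp_Liminf[OF sequentially_bot, symmetric])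
    qed
    also have "\<dots> \<le> liminf (\<lambda>i. \<integral>\<^sup>+p. ennreal (\<bar>v i p\<bar> powr r) \<partial>\<mu>)" by (rule nn_integral_liminf) simp
    also have "\<dots> \<le> liminf (\<lambda>i. ennreal b)"
    proof (rule Liminf_mono, rule always_eventually, rule allI)
      fix i
      have "(\<integral>\<^sup>+p. ennreal (\<bar>v i p\<bar> powr r) \<partial>\<mu>) = ennreal (D i)"
        unfolding D_def by (rule nn_integral_eq_integral[OF iv]) simp
      then show "(\<integral>\<^sup>+p. ennreal (\<bar>v i p\<bar> powr r) \<partial>\<mu>) \<le> ennreal b" using Db by (simp add: ennreal_leI)
    qed
    also have "\<dots> = ennreal b" by (simp add: Liminf_const)
    finally have "(\<integral>\<^sup>+p. ennreal (\<bar>u p\<bar> powr r) \<partial>\<mu>) < \<infinity>" by (auto intro: le_less_trans)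
    then have "integrable \<mu> (\<lambda>p. \<bar>u p\<bar> powr r)" by (intro integrableI_bounded) auto
    then show False using nir by simp
  qed
  \<comment> \<open>A bound for all numerators at once, since truncation increases neither the
    absolute value of \<open>u\<close> nor the energy density.\<close>
  define E where "E = (\<integral>p. \<alpha> * norm2_oneform M k \<omega> p + K * (u p)\<^sup>2 \<partial>\<mu>)"
  have Ei: "integrable \<mu> (\<lambda>p. \<alpha> * norm2_oneform M k \<omega> p + K * (u p)\<^sup>2)" using u2 w2 by simp
  have E0: "E \<ge> 0"
    unfolding E_def using \<alpha> K(1) Cyl.norm2_oneform_nonneg by (intro integral_nonneg_AE AE_I2) simp
  have num: "(\<integral>p. \<alpha> * norm2_oneform M k (\<eta> i) p + scalar_curvature M k p * (v i p)\<^sup>2 \<partial>\<mu>) \<le> E" for i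
    unfolding E_def
  proof (rule integral_mono[OF _ Ei])
    have "integrable \<mu> (norm2_oneform M k (\<eta> i))" using sv[of i] by (auto simp: sobolev_L12_def)
    then show "integrable \<mu> (\<lambda>p. \<alpha> * norm2_oneform M k (\<eta> i) p + scalar_curvature M k p * (v i p)\<^sup>2)"
      using cyl_numerator_integrable[OF sv K(2)] by simp
    fix p
    have "scalar_curvature M k p * (v i p)\<^sup>2 \<le> K * (u p)\<^sup>2"
    proof -
      have "scalar_curvature M k p * (v i p)\<^sup>2 \<le> K * (v i p)\<^sup>2" using K(2)[of p] by (intro mult_right_mono) auto
      also have "\<dots> \<le> K * (u p)\<^sup>2" using vb(1)[of i p] K(1) by (intro mult_left_mono) (auto simp: abs_le_square_iff)
      finally show ?thesis .
    qed
    moreover have "\<alpha> * norm2_oneform M k (\<eta> i) p \<le> \<alpha> * norm2_oneform M k \<omega> p" using nv \<alpha> by (rule mult_left_mono)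
    ultimately show "\<alpha> * norm2_oneform M k (\<eta> i) p + scalar_curvature M k p * (v i p)\<^sup>2 \<le> \<alpha> * norm2_oneform M k \<omega> p + K * (u p)\<^sup>2"
      by linarith
  qed
  show ?thesis
  proof (rule ereal_le_epsilon2)
    fix e :: real assume e: "e > 0"
    \<comment> \<open>Chosen so that an integral above \<open>b\<close>, raised to the power
      \<theta>, is at least (E + 1) / e and makes the quotient at most \<open>e\<close>. The summand
      1 keeps \<open>b\<close> positive when \<open>E = 0\<close>.\<close>
    define b where "b = ((E + 1) / e) powr (1 / \<theta>)"
    have Ee: "(E + 1) / e > 0" using E0 e by simp
    then have b: "b > 0" using E0 e by (simp add: b_def)
    then obtain i where i: "D i > b" using unbounded by blast
    have D0: "D i > 0" using i b by simp
    have bt: "b powr \<theta> = (E + 1) / e" using \<theta> E0 e by (simp add: b_def powr_powr)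
    have "b powr \<theta> \<le> D i powr \<theta>" using i b \<theta> by (intro powr_mono2) auto
    then have D\<theta>: "(E + 1) / e \<le> D i powr \<theta>" by (simp add: bt)
    have "yamabe_quotient M k (v i) (\<eta> i) = (\<integral>p. \<alpha> * norm2_oneform M k (\<eta> i) p + scalar_curvature M k p * (v i p)\<^sup>2 \<partial>\<mu>) / D i powr \<theta>"
      by (simp add: yamabe_quotient_def Let_def \<alpha>_def \<theta>_def D_def r_def)
    also have "\<dots> \<le> E / D i powr \<theta>" by (rule divide_right_mono[OF num]) simp
    also have "\<dots> \<le> e"
    proof -
      have "E \<le> e * ((E + 1) / e)" using e by simp
      also have "\<dots> \<le> e * D i powr \<theta>" using D\<theta> e by (intro mult_left_mono) auto
      finally show ?thesis using D0 by (simp add: pos_divide_le_eq)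
    qed
    finally have q: "yamabe_quotient M k (v i) (\<eta> i) \<le> e" .
    have "yamabe_cyl A g \<le> ereal (yamabe_quotient M k (v i) (\<eta> i))"
      by (rule yamabe_le_integrable[OF X Z cZ n \<open>isometry A g M k N \<phi> \<Psi>\<close> \<open>\<phi> ` N = UNIV \<times> {1<..}\<close> sv, folded r_def, OF iv])
         (use D0 in \<open>simp add: D_def\<close>)
    also have "\<dots> \<le> 0 + ereal e" using q by simp
    finally show "yamabe_cyl A g \<le> 0 + ereal e" .
  qed
qed

theorem proposition2p11:
  fixes A :: "('x::{t2_space, second_countable_topology}, real^('m::finite option)) atlas"
    and W :: "'x set"
    and B :: "('z::{t2_space, second_countable_topology}, real^'m) atlas"
    and h :: "('z, 'm) metric"
  assumes "3 \<le> CARD('m option)"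
    and "open_manifold_with_tame_ends A W B"
    and "riemannian_metric B h"
  shows "(\<forall>g. cylindrical_metric A W B g h \<longrightarrow>
            yamabe_cyl A g \<le> yamabe_cyl (cylinder_atlas B) (cylinder_metric h)) \<and>
         yamabe_hcyl A W B h \<le> yamabe_cyl (cylinder_atlas B) (cylinder_metric h)"
proof -
  have mA: "smooth_manifold A" and mB: "smooth_manifold B" and cZ: "compact (UNIV :: 'z set)"
    using assms(2) by (auto simp: open_manifold_with_tame_ends_def)
  have Z: "riemannian B h" by unfold_locales (fact mB, fact assms(3))
  then have Zc: "cylinder B h" by (simp add: cylinder_def)
  interpret cylinder B h by fact
  have main: "yamabe_cyl A g \<le> yamabe_cyl M k" if g: "cylindrical_metric A W B g h" for g
  proof -
    have X: "riemannian A g" by unfold_locales (use mA g in \<open>auto simp: cylindrical_metric_def\<close>)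
    obtain \<Psi> where \<Psi>: "diffeo M A (UNIV \<times> {0..}) (- W) \<Psi>" "\<forall>p\<in>UNIV \<times> {1..}. pullback_eq_at M k A g \<Psi> p"
      using g unfolding cylindrical_metric_def by blast
    obtain N \<phi> where E: "isometry A g M k N \<phi> \<Psi>" "\<phi> ` N = UNIV \<times> {1<..}"
      using end_isometry[OF X Z \<Psi>] by blast
    let ?r = "2 * real CARD('m option) / (real CARD('m option) - 2)"
    show ?thesis
      unfolding yamabe_cyl_def[of M k]
    proof (rule Inf_greatest)
      fix q assume "q \<in> {ereal (yamabe_quotient M k u \<omega>) |u \<omega>. sobolev_L12 M k u \<omega> \<and> \<not> (AE p in \<mu>. u p = 0)}"
      then obtain u \<omega> where q: "q = ereal (yamabe_quotient M k u \<omega>)" and u: "sobolev_L12 M k u \<omega>"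
        and nz: "\<not> (AE p in \<mu>. u p = 0)" by blast
      show "yamabe_cyl A g \<le> q"
      \<comment> \<open>A competitor whose denominator diverges is still admissible in the infimum,
        with quotient 0; for it the claim is that \<open>yamabe_cyl A g\<close> is at most
        0.\<close>
      proof (cases "integrable \<mu> (\<lambda>p. \<bar>u p\<bar> powr ?r)")
        case True
        have "(\<integral>p. \<bar>u p\<bar> powr ?r \<partial>\<mu>) \<noteq> 0"
          using nz integral_nonneg_eq_0_iff_AE[OF True] by simp
        moreover have "(\<integral>p. \<bar>u p\<bar> powr ?r \<partial>\<mu>) \<ge> 0" by (intro integral_nonneg_AE AE_I2) simp
        ultimately have "(\<integral>p. \<bar>u p\<bar> powr ?r \<partial>\<mu>) > 0" by (metis less_le)
        then show ?thesis unfolding q by (rule yamabe_le_integrable[OF X Zc cZ assms(1) E u True])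
      next
        case False
        then have "yamabe_quotient M k u \<omega> = 0"
          by (simp add: yamabe_quotient_def Let_def not_integrable_integral_eq)
        then show ?thesis unfolding q using yamabe_nonpos_not_integrable[OF X Zc cZ assms(1) E u False] by (simp add: zero_ereal_def)
      qed
    qed
  qed
  \<comment> \<open>The bound just shown is the same for all \<open>g\<close>, so it passes to the
    supremum.\<close>
  then have "yamabe_hcyl A W B h \<le> yamabe_cyl M k"
    unfolding yamabe_hcyl_def by (intro Sup_least) auto
  then show ?thesis using main by blast
qed

end
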